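(* Let $S$ be a Damek-Ricci space. Let $\psi_1$ and $\psi_2$ be continuous real-valued functions on $[0,\infty)$ that are $C^\infty$ away from the origin. Suppose the dispersive equations with phase functions $\psi_1,\psi_2$ are of comparable oscillation, that is, there exist $\Lambda>0$ and $C>0$ such that $|\psi_1(\lambda)-\psi_2(\lambda)|\le C$ for all $\lambda>\Lambda$. Then they are locally transferrable, that is, for every $\beta_0>0$ and every $p\in[1,\infty]$, and for $(i,j)=(1,2)$ as well as $(i,j)=(2,1)$: if for all $R>0$ and all $\beta>\beta_0$ there is a constant $C_{R,\beta}>0$ such that $$\|S^*_{\psi_i}f\|_{L^p(B_R)}\le C_{R,\beta}\|f\|_{H^\beta(S)}\quad\text{for all }f\in\mathscr{S}^2(S)_o,$$ then for all $R>0$ and all $\beta>\beta_0$ there is a constant $C'_{R,\beta}>0$ such that $$\|S^*_{\psi_j}f\|_{L^p(B_R)}\le C'_{R,\beta}\|f\|_{H^\beta(S)}\quad\text{for all }f\in\mathscr{S}^2(S)_o.$$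
   Context: Damek-Ricci spaces. Let $\mathfrak n=\mathfrak v\oplus\mathfrak z$ be an $H$-type Lie algebra: a two-step real nilpotent Lie algebra with inner product, center $\mathfrak z$, $\mathfrak v=\mathfrak z^\perp$, such that for each $Z\in\mathfrak z$ the map $J_Z:\mathfrak v\to\mathfrak v$, $\langle J_ZX,Y\rangle=\langle[X,Y],Z\rangle$, satisfies $J_Z^2=-|Z|^2 I$. Let $N=\exp\mathfrak n$ be the connected, simply connected group, with elements $(X,Z)$. $A=\mathbb{R}^+$ acts on $N$ by $(X,Z)\mapsto(\sqrt a X,aZ)$ and $S=NA$ is the semidirect product, with product $(X,Z,a)(X',Z',a')=(X+\sqrt aX',\,Z+aZ'+\frac{\sqrt a}{2}[X,X'],\,aa')$. $S$ carries the left-invariant Riemannian metric induced by $\langle(X,Z,l),(X',Z',l')\rangle=\langle X,X'\rangle+\langle Z,Z'\rangle+ll'$ on its Lie algebra $\mathfrak v\oplus\mathfrak z\oplus\mathbb{R}$. (Real hyperbolic spaces of dimension $\ge2$ occur as the degenerate case $\mathfrak v=0$.) Write $m_{\mathfrak v}=\dim\mathfrak v$, $m_{\mathfrak z}=\dim\mathfrak z$, $n=m_{\mathfrak v}+m_{\mathfrak z}+1$, $Q=\frac{m_{\mathfrak v}}2+m_{\mathfrak z}$. $\Delta$ is the Laplace-Beltrami operator; $d$ the distance, $e$ the identity, $B_R=\{x:d(e,x)<R\}$. A function is radial if it depends only on $s=d(e,x)$; we then write $f(s)$. $S$ has left Haar (Riemannian) measure $dx$, used for $L^p(B_R)$, normalized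 so that for radial $f$, $\int_Sf\,dx=\int_0^\infty f(s)A(s)\,ds$ with $A(s)=2^{m_{\mathfrak v}+m_{\mathfrak z}}(\sinh\frac s2)^{m_{\mathfrak v}+m_{\mathfrak z}}(\cosh\frac s2)^{m_{\mathfrak z}}$. Spherical analysis. $\varphi_\lambda$ is the radial function with $\Delta\varphi_\lambda=-(\lambda^2+\frac{Q^2}4)\varphi_\lambda$, $\varphi_\lambda(e)=1$; $\widehat f(\lambda)=\int_Sf\varphi_\lambda\,dx$ for radial $f$; and ${\bf c}(\lambda)=\frac{2^{Q-2i\lambda}\Gamma(2i\lambda)}{\Gamma(\frac{Q+2i\lambda}2)}\cdot\frac{\Gamma(\frac n2)}{\Gamma(\frac{m_{\mathfrak v}+4i\lambda+2}4)}$. $\mathscr{S}^2(S)_o$ is the space of smooth radial $f$ with $|(\frac d{ds})^Mf(s)|\lesssim(1+s)^{-N}e^{-\frac Q2s}$ for all integers $M,N\ge0$. For $\beta\ge0$ and radial $f$, $\|f\|_{H^\beta(S)}=\left(\int_0^\infty(\lambda^2+\frac{Q^2}4)^\beta|\widehat f(\lambda)|^2|{\bf c}(\lambda)|^{-2}d\lambda\right)^{1/2}$. Maximal function. For a phase function $\psi$ and $f\in\mathscr{S}^2(S)_o$, $S_{\psi,t}f(x)=\int_0^\infty\varphi_\lambda(x)e^{it\psi(\lambda)}\widehat f(\lambda)|{\bf c}(\lambda)|^{-2}d\lambda$ and $S^*_\psi f(x)=\sup_{0<t<1}|S_{\psi,t}f(x)|$. *)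

theory Defs
  imports
    "HOL-Analysis.Analysis"
    "HOL-Probability.Essential_Supremum"
    "HOL-Combinatorics.Permutations"
begin

section \<open>Smooth functions on open subsets of a Euclidean space\<close>

primrec Ck_on :: "nat \<Rightarrow> 'a::euclidean_space set \<Rightarrow> ('a \<Rightarrow> 'b::real_normed_vector) \<Rightarrow> bool" where
  "Ck_on 0 M f \<longleftrightarrow> continuous_on M f"
| "Ck_on (Suc k) M f \<longleftrightarrow>
     (\<forall>x\<in>M. f differentiable (at x)) \<and> (\<forall>v. Ck_on k M (\<lambda>x. frechet_derivative f (at x) v))"

definition smooth_on :: "'a::euclidean_space set \<Rightarrow> ('a \<Rightarrow> 'b::real_normed_vector) \<Rightarrow> bool" where
  "smooth_on M f \<longleftrightarrow> (\<forall>k. Ck_on k M f)"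


section \<open>Riemannian geometry of an open subset of a Euclidean space\<close>

text \<open>A metric is a function \<open>g\<close> with \<open>g x v w\<close> the inner product of the tangent vectors
  \<open>v\<close> and \<open>w\<close> at \<open>x\<close>. Its matrix is taken in the orthonormal basis \<open>Basis\<close> of the chart.\<close>

type_synonym 'a riem_metric = "'a \<Rightarrow> 'a \<Rightarrow> 'a \<Rightarrow> real"

definition gram_det :: "'a::euclidean_space riem_metric \<Rightarrow> 'a \<Rightarrow> real" where
  "gram_det g x = (\<Sum>p | p permutes (Basis::'a set). of_int (sign p) * (\<Prod>b\<in>Basis. g x b (p b)))"

text \<open>The entries \<open>g\<^sup>i\<^sup>j\<close> of the inverse matrix (set to 0 off the basis, so that the description
  is definite).\<close>

definition cometric :: "'a::euclidean_space riem_metric \<Rightarrow> 'a riem_metric" where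
  "cometric g x = (THE h. (\<forall>i\<in>Basis. \<forall>j\<in>Basis. (\<Sum>k\<in>Basis. g x i k * h k j) = (if i = j then 1 else 0))
                        \<and> (\<forall>i j. i \<notin> Basis \<or> j \<notin> Basis \<longrightarrow> h i j = 0))"

definition laplace_beltrami ::
  "'a::euclidean_space riem_metric \<Rightarrow> ('a \<Rightarrow> complex) \<Rightarrow> 'a \<Rightarrow> complex" where
  "laplace_beltrami g f x =
     (1 / sqrt (gram_det g x)) *\<^sub>R
       (\<Sum>i\<in>Basis. frechet_derivative
          (\<lambda>y. sqrt (gram_det g y) *\<^sub>R
                 (\<Sum>j\<in>Basis. cometric g y i j *\<^sub>R frechet_derivative f (at y) j)) (at x) i)"

text \<open>Lengths are extended nonnegative reals because a \<open>valid_path\<close> is only required to be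
  \<open>C\<^sup>1\<close> off a finite set of parameters and may have infinite length; on such a path a real-valued
  integral of the speed would be 0.\<close>

definition curve_length :: "'a::euclidean_space riem_metric \<Rightarrow> (real \<Rightarrow> 'a) \<Rightarrow> ennreal" where
  "curve_length g \<gamma> = (\<integral>\<^sup>+t\<in>{0..1}. ennreal
     (sqrt (g (\<gamma> t) (vector_derivative \<gamma> (at t)) (vector_derivative \<gamma> (at t)))) \<partial>lborel)"

definition riem_dist :: "'a::euclidean_space set \<Rightarrow> 'a riem_metric \<Rightarrow> 'a \<Rightarrow> 'a \<Rightarrow> real" where
  "riem_dist M g x y = enn2real (Inf {curve_length g \<gamma> | \<gamma>.
     valid_path \<gamma> \<and> path_image \<gamma> \<subseteq> M \<and> pathstart \<gamma> = x \<and> pathfinish \<gamma> = y})"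

text \<open>Extended by the null measure to the complement of \<open>M\<close>.\<close>

definition riem_volume :: "'a::euclidean_space set \<Rightarrow> 'a riem_metric \<Rightarrow> 'a measure" where
  "riem_volume M g = density lborel (\<lambda>x. ennreal (indicator M x * sqrt (gram_det g x)))"


section \<open>H-type Lie algebras\<close>

text \<open>The inner product is the one of the type \<open>'n\<close>; the Lie bracket is \<open>br\<close>.\<close>

definition lie_bracket :: "('n::euclidean_space \<Rightarrow> 'n \<Rightarrow> 'n) \<Rightarrow> bool" where
  "lie_bracket br \<longleftrightarrow> bilinear br \<and> (\<forall>X. br X X = 0) \<and>
     (\<forall>X Y W. br X (br Y W) + br Y (br W X) + br W (br X Y) = 0)"

definition center :: "('n::euclidean_space \<Rightarrow> 'n \<Rightarrow> 'n) \<Rightarrow> 'n set" where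
  "center br = {Z. \<forall>X. br Z X = 0}"

definition vspace :: "('n::euclidean_space \<Rightarrow> 'n \<Rightarrow> 'n) \<Rightarrow> 'n set" where
  "vspace br = (center br)\<^sup>\<bottom>"

definition J_map :: "('n::euclidean_space \<Rightarrow> 'n \<Rightarrow> 'n) \<Rightarrow> 'n \<Rightarrow> 'n \<Rightarrow> 'n" where
  "J_map br Z X = (THE W. W \<in> vspace br \<and> (\<forall>Y\<in>vspace br. inner W Y = inner (br X Y) Z))"

text \<open>The bracket may vanish identically; then the center is everything, \<open>vspace br = {0}\<close>, and
  the associated space is a real hyperbolic space.\<close>

definition H_type :: "('n::euclidean_space \<Rightarrow> 'n \<Rightarrow> 'n) \<Rightarrow> bool" where
  "H_type br \<longleftrightarrow> lie_bracket br \<and> (\<forall>X Y W. br (br X Y) W = 0) \<and>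
     (\<forall>Z\<in>center br. \<forall>X\<in>vspace br. J_map br Z (J_map br Z X) = - ((norm Z)\<^sup>2 *\<^sub>R X))"

definition mv :: "('n::euclidean_space \<Rightarrow> 'n \<Rightarrow> 'n) \<Rightarrow> nat" where
  "mv br = dim (vspace br)"

definition mz :: "('n::euclidean_space \<Rightarrow> 'n \<Rightarrow> 'n) \<Rightarrow> nat" where
  "mz br = dim (center br)"

definition dimS :: "('n::euclidean_space \<Rightarrow> 'n \<Rightarrow> 'n) \<Rightarrow> nat" where
  "dimS br = mv br + mz br + 1"

definition hdim :: "('n::euclidean_space \<Rightarrow> 'n \<Rightarrow> 'n) \<Rightarrow> real" where
  "hdim br = real (mv br) / 2 + real (mz br)"

definition zpart :: "('n::euclidean_space \<Rightarrow> 'n \<Rightarrow> 'n) \<Rightarrow> 'n \<Rightarrow> 'n" where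
  "zpart br U = (THE Z. Z \<in> center br \<and> U - Z \<in> vspace br)"

definition vpart :: "('n::euclidean_space \<Rightarrow> 'n \<Rightarrow> 'n) \<Rightarrow> 'n \<Rightarrow> 'n" where
  "vpart br U = U - zpart br U"


section \<open>Damek-Ricci spaces\<close>

text \<open>The point \<open>(X, Z, a)\<close> of \<open>S = NA\<close> is represented by the pair \<open>(X + Z, a)\<close>, so \<open>S\<close> is an open
  subset of the Euclidean space \<open>'n \<times> real\<close>, whose inner product is that of the Lie algebra of \<open>S\<close>.\<close>

definition DR :: "('n::euclidean_space \<times> real) set" where
  "DR = UNIV \<times> {0<..}"

definition DR_one :: "'n::euclidean_space \<times> real" where
  "DR_one = (0, 1)"

definition DR_mult ::
  "('n::euclidean_space \<Rightarrow> 'n \<Rightarrow> 'n) \<Rightarrow> 'n \<times> real \<Rightarrow> 'n \<times> real \<Rightarrow> 'n \<times> real" where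
  "DR_mult br x y = (case x of (U, a) \<Rightarrow> case y of (U', a') \<Rightarrow>
     (let X = vpart br U; Z = zpart br U; X' = vpart br U'; Z' = zpart br U' in
       ((X + sqrt a *\<^sub>R X') + (Z + a *\<^sub>R Z' + (sqrt a / 2) *\<^sub>R br X X'), a * a')))"

text \<open>The differential at the identity of the left translation by \<open>x\<close>, and the left-invariant
  metric.\<close>

definition DR_dL :: "('n::euclidean_space \<Rightarrow> 'n \<Rightarrow> 'n) \<Rightarrow> 'n \<times> real \<Rightarrow> 'n \<times> real \<Rightarrow> 'n \<times> real" where
  "DR_dL br x = frechet_derivative (DR_mult br x) (at DR_one)"

definition DR_metric :: "('n::euclidean_space \<Rightarrow> 'n \<Rightarrow> 'n) \<Rightarrow> ('n \<times> real) riem_metric" where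
  "DR_metric br x v w = inner (inv (DR_dL br x) v) (inv (DR_dL br x) w)"

definition DR_laplacian ::
  "('n::euclidean_space \<Rightarrow> 'n \<Rightarrow> 'n) \<Rightarrow> ('n \<times> real \<Rightarrow> complex) \<Rightarrow> 'n \<times> real \<Rightarrow> complex" where
  "DR_laplacian br = laplace_beltrami (DR_metric br)"

definition DR_dist :: "('n::euclidean_space \<Rightarrow> 'n \<Rightarrow> 'n) \<Rightarrow> 'n \<times> real \<Rightarrow> 'n \<times> real \<Rightarrow> real" where
  "DR_dist br = riem_dist DR (DR_metric br)"

definition DR_ball :: "('n::euclidean_space \<Rightarrow> 'n \<Rightarrow> 'n) \<Rightarrow> real \<Rightarrow> ('n \<times> real) set" where
  "DR_ball br R = {x \<in> DR. DR_dist br DR_one x < R}"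

definition DR_weight :: "('n::euclidean_space \<Rightarrow> 'n \<Rightarrow> 'n) \<Rightarrow> real \<Rightarrow> real" where
  "DR_weight br s = 2 ^ (mv br + mz br) * sinh (s / 2) ^ (mv br + mz br) * cosh (s / 2) ^ mz br"

text \<open>The Riemannian volume, multiplied by the positive constant for which integration of a radial
  function is integration of its profile against \<open>DR_weight\<close>.\<close>

definition DR_const :: "('n::euclidean_space \<Rightarrow> 'n \<Rightarrow> 'n) \<Rightarrow> real" where
  "DR_const br = (THE \<kappa>. 0 < \<kappa> \<and> (\<forall>F::real \<Rightarrow> ennreal. F \<in> borel_measurable borel \<longrightarrow>
     ennreal \<kappa> * (\<integral>\<^sup>+x\<in>DR. F (DR_dist br DR_one x) \<partial>riem_volume DR (DR_metric br)) =
     (\<integral>\<^sup>+s\<in>{0..}. F s * ennreal (DR_weight br s) \<partial>lborel)))"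

definition DR_measure :: "('n::euclidean_space \<Rightarrow> 'n \<Rightarrow> 'n) \<Rightarrow> ('n \<times> real) measure" where
  "DR_measure br = scale_measure (ennreal (DR_const br)) (riem_volume DR (DR_metric br))"


section \<open>Spherical analysis\<close>

definition radial :: "('n::euclidean_space \<Rightarrow> 'n \<Rightarrow> 'n) \<Rightarrow> ('n \<times> real \<Rightarrow> complex) \<Rightarrow> bool" where
  "radial br f \<longleftrightarrow>
     (\<forall>x\<in>DR. \<forall>y\<in>DR. DR_dist br DR_one x = DR_dist br DR_one y \<longrightarrow> f x = f y)"

definition profile :: "('n::euclidean_space \<Rightarrow> 'n \<Rightarrow> 'n) \<Rightarrow> ('n \<times> real \<Rightarrow> complex) \<Rightarrow> real \<Rightarrow> complex" where
  "profile br f s = f (SOME x. x \<in> DR \<and> DR_dist br DR_one x = s)"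

text \<open>The conditions determine the function on \<open>DR\<close>; its values elsewhere are never used.\<close>

definition spherical_function ::
  "('n::euclidean_space \<Rightarrow> 'n \<Rightarrow> 'n) \<Rightarrow> real \<Rightarrow> 'n \<times> real \<Rightarrow> complex" where
  "spherical_function br lam = (SOME \<phi>. smooth_on DR \<phi> \<and> radial br \<phi> \<and>
     (\<forall>x\<in>DR. DR_laplacian br \<phi> x = - complex_of_real (lam\<^sup>2 + (hdim br)\<^sup>2 / 4) * \<phi> x) \<and>
     \<phi> DR_one = 1)"

definition spherical_transform ::
  "('n::euclidean_space \<Rightarrow> 'n \<Rightarrow> 'n) \<Rightarrow> ('n \<times> real \<Rightarrow> complex) \<Rightarrow> real \<Rightarrow> complex" where
  "spherical_transform br f lam = (LINT x:DR|DR_measure br. f x * spherical_function br lam x)"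

definition c_function :: "('n::euclidean_space \<Rightarrow> 'n \<Rightarrow> 'n) \<Rightarrow> real \<Rightarrow> complex" where
  "c_function br lam =
     (2 powr (of_real (hdim br) - 2 * \<i> * of_real lam) * Gamma (2 * \<i> * of_real lam)
        / Gamma ((of_real (hdim br) + 2 * \<i> * of_real lam) / 2)) *
     (Gamma (of_nat (dimS br) / 2) / Gamma ((of_nat (mv br) + 4 * \<i> * of_real lam + 2) / 4))"

text \<open>\<open>|c(\<lambda>)|\<^sup>-\<^sup>2\<close>; at \<open>\<lambda> = 0\<close>, a pole of \<open>c\<close>, this is \<open>1 / 0 = 0\<close>, the correct limit.\<close>

definition plancherel_density :: "('n::euclidean_space \<Rightarrow> 'n \<Rightarrow> 'n) \<Rightarrow> real \<Rightarrow> real" where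
  "plancherel_density br lam = 1 / (cmod (c_function br lam))\<^sup>2"

text \<open>The derivatives are those of a function on \<open>[0,\<infinity>)\<close>, one-sided at the origin.\<close>

definition schwartz2 :: "('n::euclidean_space \<Rightarrow> 'n \<Rightarrow> 'n) \<Rightarrow> ('n \<times> real \<Rightarrow> complex) set" where
  "schwartz2 br = {f. smooth_on DR f \<and> radial br f \<and>
     (\<forall>M N. \<exists>K. \<forall>s\<ge>0.
        cmod (((\<lambda>h s. vector_derivative h (at s within {0..})) ^^ M) (profile br f) s)
          \<le> K * inverse ((1 + s) ^ N) * exp (- (hdim br / 2) * s))}"


section \<open>Norms\<close>

definition ennreal_powr :: "ennreal \<Rightarrow> real \<Rightarrow> ennreal" where
  "ennreal_powr u r = (if u = \<infinity> then \<infinity> else ennreal (enn2real u powr r))"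

text \<open>Only used for \<open>1 \<le> p \<le> \<infinity>\<close>.\<close>

definition Lp_norm :: "ennreal \<Rightarrow> 'a measure \<Rightarrow> ('a \<Rightarrow> ennreal) \<Rightarrow> ennreal" where
  "Lp_norm p M F = (if p = \<infinity> then esssup M F
     else ennreal_powr (\<integral>\<^sup>+x. ennreal_powr (F x) (enn2real p) \<partial>M) (1 / enn2real p))"

definition sobolev_norm ::
  "('n::euclidean_space \<Rightarrow> 'n \<Rightarrow> 'n) \<Rightarrow> real \<Rightarrow> ('n \<times> real \<Rightarrow> complex) \<Rightarrow> ennreal" where
  "sobolev_norm br \<beta> f = ennreal_powr
     (\<integral>\<^sup>+lam\<in>{0..}. ennreal ((lam\<^sup>2 + (hdim br)\<^sup>2 / 4) powr \<beta> *
        (cmod (spherical_transform br f lam))\<^sup>2 * plancherel_density br lam) \<partial>lborel) (1 / 2)"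


section \<open>Maximal functions and transference\<close>

definition dispersive ::
  "('n::euclidean_space \<Rightarrow> 'n \<Rightarrow> 'n) \<Rightarrow> (real \<Rightarrow> real) \<Rightarrow> real \<Rightarrow> ('n \<times> real \<Rightarrow> complex) \<Rightarrow>
    'n \<times> real \<Rightarrow> complex" where
  "dispersive br \<psi> t f x = (LINT lam:{0..}|lborel.
     spherical_function br lam x * exp (\<i> * of_real (t * \<psi> lam)) * spherical_transform br f lam *
     of_real (plancherel_density br lam))"

definition maximal_function ::
  "('n::euclidean_space \<Rightarrow> 'n \<Rightarrow> 'n) \<Rightarrow> (real \<Rightarrow> real) \<Rightarrow> ('n \<times> real \<Rightarrow> complex) \<Rightarrow>
    'n \<times> real \<Rightarrow> ennreal" where
  "maximal_function br \<psi> f x = (SUP t\<in>{0<..<1}. ennreal (cmod (dispersive br \<psi> t f x)))"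

definition phase_function :: "(real \<Rightarrow> real) \<Rightarrow> bool" where
  "phase_function \<psi> \<longleftrightarrow> continuous_on {0..} \<psi> \<and> smooth_on {0<..} \<psi>"

definition comparable_oscillation :: "(real \<Rightarrow> real) \<Rightarrow> (real \<Rightarrow> real) \<Rightarrow> bool" where
  "comparable_oscillation \<psi>1 \<psi>2 \<longleftrightarrow> (\<exists>\<Lambda>>0. \<exists>C>0. \<forall>lam>\<Lambda>. \<bar>\<psi>1 lam - \<psi>2 lam\<bar> \<le> C)"

definition local_maximal_bound ::
  "('n::euclidean_space \<Rightarrow> 'n \<Rightarrow> 'n) \<Rightarrow> (real \<Rightarrow> real) \<Rightarrow> real \<Rightarrow> ennreal \<Rightarrow> bool" where
  "local_maximal_bound br \<psi> \<beta>\<^sub>0 p \<longleftrightarrow> (\<forall>R>0. \<forall>\<beta>>\<beta>\<^sub>0. \<exists>C>0. \<forall>f\<in>schwartz2 br.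
     Lp_norm p (restrict_space (DR_measure br) (DR_ball br R)) (maximal_function br \<psi> f)
       \<le> ennreal C * sobolev_norm br \<beta> f)"

definition locally_transferrable ::
  "('n::euclidean_space \<Rightarrow> 'n \<Rightarrow> 'n) \<Rightarrow> (real \<Rightarrow> real) \<Rightarrow> (real \<Rightarrow> real) \<Rightarrow> bool" where
  "locally_transferrable br \<psi>1 \<psi>2 \<longleftrightarrow> (\<forall>\<beta>\<^sub>0>0. \<forall>p\<ge>1.
     (local_maximal_bound br \<psi>1 \<beta>\<^sub>0 p \<longrightarrow> local_maximal_bound br \<psi>2 \<beta>\<^sub>0 p) \<and>
     (local_maximal_bound br \<psi>2 \<beta>\<^sub>0 p \<longrightarrow> local_maximal_bound br \<psi>1 \<beta>\<^sub>0 p))"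

end

theory Submission
 imports
  Defs
  "HOL-Real_Asymp.Real_Asymp"
  "HOL-Probability.Characteristic_Functions"
begin

text \<open>
Suppose that \<open>\<psi>2 = \<psi>1 + \<Delta>\<close> with \<open>|\<Delta>| <= C\<close> for frequencies beyond \<open>\<Lambda>\<close>. There
\<open>exp (i t \<psi>2)\<close> is the sum over \<open>k\<close> of \<open>(i t C)\<^sup>k / k!\<close> times \<open>exp (i t \<psi>1) (\<Delta>/C)\<^sup>k\<close>. For \<open>t < 1\<close> the
solution with phase \<open>\<psi>2\<close> is therefore dominated by maximal functions for \<open>\<psi>1\<close> with weights of sum at
most \<open>exp C\<close>, applied to data with transforms \<open>(\<Delta>/C)\<^sup>k\<close> times that of \<open>f\<close>; these multipliers are bounded
by 1, so they do not increase Sobolev norms. Frequencies below \<open>\<Lambda>\<close> contribute at most the integral of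
the transform over \<open>[0,\<Lambda>]\<close>, which the Cauchy-Schwarz inequality bounds by the Sobolev norm, and
constants lie in \<open>L\<^sup>p\<close> of a ball.

The hypothesis on \<open>\<psi>1\<close> concerns Schwartz functions, and \<open>(\<Delta>/C)\<^sup>k\<close> need not preserve the Schwartz class:
\<open>\<Delta>\<close> is only continuous at 0 and its derivatives are not controlled. It is therefore replaced by a
polynomial in the resolvent \<open>1 / (\<lambda>\<^sup>2 + Q\<^sup>2/4)\<close>, with an error that is small both in the \<open>L\<^sup>1\<close> norm that
controls maximal functions pointwise and in the Sobolev norm (\<open>multiplier_approx\<close>, by Weierstrass).
Such polynomials do preserve the Schwartz class, because the inverse Laplacian is a composition of two
quadratures with explicit decay (\<open>rapid_inverse_laplacian\<close>), and they act on transforms by Green's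
identity (\<open>tr_laplacian\<close>).

The rest makes radial analysis explicit. The function \<open>vv\<close>, equal to \<open>sinh\<^sup>2 (s/2)\<close> at distance \<open>s\<close>, has a
gradient with \<open>|\<nabla> vv|\<^sup>2 = vv (1 + vv)\<close> (\<open>eikonal\<close>); this and explicit geodesics give the distance
(\<open>DR_dist_eq\<close>), the radial Laplacian (\<open>laplacian_radial\<close>) and, by the divergence theorem, integration in
polar coordinates (\<open>distr_vol\<close>). Spherical functions are power series in the eigenvalue
(\<open>spherical_function_eq\<close>), with decay from an energy estimate (\<open>ph_decay\<close>), and the Plancherel density
grows at most polynomially (\<open>plancherel_bound\<close>).
\<close>

section \<open>H-type algebras\<close>

locale htype =
 fixes br :: "'n::euclidean_space => 'n => 'n"
 assumes H: "H_type br"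
begin

lemma bilinear_br: "bilinear br"
 using H by (simp add: H_type_def lie_bracket_def)

lemma bounded_bilinear_br: "bounded_bilinear br"
 using bilinear_br bilinear_conv_bounded_bilinear by blast

lemma br_self [simp]: "br X X = 0"
 using H by (simp add: H_type_def lie_bracket_def)

lemma br_br [simp]: "br (br X Y) W = 0"
 using H by (simp add: H_type_def)

lemmas br_simps =
 bilinear_ladd[OF bilinear_br] bilinear_radd[OF bilinear_br]
 bilinear_lmul[OF bilinear_br] bilinear_rmul[OF bilinear_br]
 bilinear_lsub[OF bilinear_br] bilinear_rsub[OF bilinear_br]
 bilinear_lneg[OF bilinear_br] bilinear_rneg[OF bilinear_br]
 bilinear_lzero[OF bilinear_br] bilinear_rzero[OF bilinear_br]

lemma br_skew: "br X Y = - br Y X"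
proof -
 have "br (X + Y) (X + Y) = 0" by simp
 then have "br X Y + br Y X = 0"
  unfolding br_simps by (simp add: add.commute)
 then show ?thesis by (simp add: eq_neg_iff_add_eq_0)
qed

lemma subspace_center: "subspace (center br)"
 unfolding subspace_def center_def by (simp add: br_simps)

lemma subspace_vspace: "subspace (vspace br)"
 unfolding vspace_def by (rule subspace_orthogonal_comp)

lemma br_center [simp]: "br X Y \<in> center br"
 by (simp add: center_def)

lemma center_left: "Z \<in> center br ==> br Z X = 0"
 by (simp add: center_def)

lemma center_right: "Z \<in> center br ==> br X Z = 0"
 using br_skew[of X Z] by (simp add: center_def)

lemma vspace_orth: "X \<in> vspace br ==> Z \<in> center br ==> inner X Z = 0"
 by (auto simp: vspace_def orthogonal_comp_def orthogonal_def inner_commute[of X Z])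

lemma center_vspace_0: "Z \<in> center br ==> Z \<in> vspace br ==> Z = 0"
 using vspace_orth[of Z Z] by simp

lemma ex1_zpart: "\<exists>!Z. Z \<in> center br \<and> U - Z \<in> vspace br"
proof -
 obtain y z where y: "y \<in> span (center br)" and z: "!!w. w \<in> span (center br) ==> orthogonal z w"
  and U: "U = y + z"
  using orthogonal_subspace_decomp_exists[of "center br" U] by blast
 have sc: "span (center br) = center br" using subspace_center by (simp add: span_eq_iff)
 show ?thesis
 proof (rule ex1I[of _ y])
  show "y \<in> center br \<and> U - y \<in> vspace br"
   using y z U sc by (auto simp: vspace_def orthogonal_comp_def orthogonal_commute)
 next
  fix Z assume Z: "Z \<in> center br \<and> U - Z \<in> vspace br"
  have "U - y \<in> vspace br"
   using y z U sc by (auto simp: vspace_def orthogonal_comp_def orthogonal_commute)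
  then have "(U - y) - (U - Z) \<in> vspace br" using Z subspace_vspace subspace_diff by blast
  then have "Z - y \<in> vspace br" by simp
  moreover have "Z - y \<in> center br" using Z y sc subspace_center subspace_diff by blast
  ultimately show "Z = y" using center_vspace_0[of "Z - y"] by simp
 qed
qed

lemma zpart_props: "zpart br U \<in> center br" "U - zpart br U \<in> vspace br"
 using theI'[OF ex1_zpart[of U]] by (auto simp: zpart_def)

lemma zpart_eqI: "Z \<in> center br ==> U - Z \<in> vspace br ==> zpart br U = Z"
 using ex1_zpart[of U] zpart_props[of U] by blast

abbreviation vp :: "'n => 'n" where "vp \<equiv> vpart br"
abbreviation zp :: "'n => 'n" where "zp \<equiv> zpart br"

lemma zp_center [simp]: "zp U \<in> center br" by (rule zpart_props)
lemma vp_vspace [simp]: "vp U \<in> vspace br" unfolding vpart_def by (rule zpart_props)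
lemma vp_zp: "vp U + zp U = U" by (simp add: vpart_def)

lemma zp_add: "zp (U + W) = zp U + zp W"
proof (rule zpart_eqI)
 show "zp U + zp W \<in> center br" using subspace_center subspace_add zp_center by blast
 have "vp U + vp W \<in> vspace br" using subspace_vspace subspace_add vp_vspace by blast
 then show "U + W - (zp U + zp W) \<in> vspace br" by (simp add: vpart_def algebra_simps)
qed

lemma zp_scale: "zp (c *\<^sub>R U) = c *\<^sub>R zp U"
proof (rule zpart_eqI)
 show "c *\<^sub>R zp U \<in> center br" using subspace_center subspace_scale zp_center by blast
 have "c *\<^sub>R vp U \<in> vspace br" using subspace_vspace subspace_scale vp_vspace by blast
 then show "c *\<^sub>R U - c *\<^sub>R zp U \<in> vspace br" by (simp add: vpart_def algebra_simps)
qed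

lemma linear_zp: "linear zp" by (rule linearI) (simp_all add: zp_add zp_scale)

lemma linear_vp: "linear vp"
 by (rule linearI) (simp_all add: vpart_def zp_add zp_scale algebra_simps)

lemmas vp_simps = linear_add[OF linear_vp] linear_scale[OF linear_vp] linear_diff[OF linear_vp]
 linear_neg[OF linear_vp] linear_0[OF linear_vp]
lemmas zp_simps = linear_add[OF linear_zp] linear_scale[OF linear_zp] linear_diff[OF linear_zp]
 linear_neg[OF linear_zp] linear_0[OF linear_zp]

lemma bounded_linear_vp: "bounded_linear vp" using linear_vp linear_conv_bounded_linear by blast
lemma bounded_linear_zp: "bounded_linear zp" using linear_zp linear_conv_bounded_linear by blast

lemma zp_of_center: "Z \<in> center br ==> zp Z = Z"
 by (rule zpart_eqI) (simp_all add: subspace_vspace subspace_0)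
lemma zp_of_vspace: "X \<in> vspace br ==> zp X = 0"
 by (rule zpart_eqI) (simp_all add: subspace_center subspace_0)
lemma vp_of_center: "Z \<in> center br ==> vp Z = 0"
 by (simp add: vpart_def zp_of_center)
lemma vp_of_vspace: "X \<in> vspace br ==> vp X = X"
 by (simp add: vpart_def zp_of_vspace)

lemma vz_idem [simp]: "zp (zp U) = zp U" "vp (vp U) = vp U" "zp (vp U) = 0" "vp (zp U) = 0"
 "zp (br U W) = br U W" "vp (br U W) = 0"
 by (simp_all add: zp_of_center vp_of_center zp_of_vspace vp_of_vspace)

lemma inner_vz [simp]: "inner (vp U) (zp W) = 0" "inner (zp W) (vp U) = 0"
 "inner (vp U) (br X Y) = 0" "inner (br X Y) (vp U) = 0"
 by (simp_all add: vspace_orth inner_commute[of "zp W"] inner_commute[of "br X Y"])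

lemma inner_vp: "inner (vp U) W = inner (vp U) (vp W)" "inner W (vp U) = inner (vp W) (vp U)"
 "inner (zp U) W = inner (zp U) (zp W)" "inner W (zp U) = inner (zp W) (zp U)"
 using vp_zp[of W] by (metis inner_add_right inner_add_left inner_vz add.left_neutral add.right_neutral)+

lemma inner_vp_sym: "inner (vp U) W = inner U (vp W)" "inner (zp U) W = inner U (zp W)"
 using inner_vp by metis+

lemma br_vp: "br (vp U) W = br U W" "br W (vp U) = br W U"
 by (simp_all add: vpart_def br_simps center_left center_right)

lemma br_zp [simp]: "br (zp U) W = 0" "br W (zp U) = 0"
 by (simp_all add: center_left center_right)

lemma br_brr [simp]: "br X (br Y W) = 0" by (simp add: center_right)

text \<open>The map \<open>J_Z\<close>, extended to all \<open>Z\<close> and \<open>X\<close> so that it is bilinear.\<close>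

definition jj :: "'n => 'n => 'n" where
 "jj Z X = (\<Sum>b\<in>Basis. inner (br X b) Z *\<^sub>R b)"

lemma inner_jj: "inner (jj Z X) Y = inner (br X Y) Z"
proof -
 have "inner (br X Y) Z = inner (br X (\<Sum>b\<in>Basis. inner Y b *\<^sub>R b)) Z"
  by (simp add: euclidean_representation)
 also have "br X (\<Sum>b\<in>Basis. inner Y b *\<^sub>R b) = (\<Sum>b\<in>Basis. inner Y b *\<^sub>R br X b)"
  using bilinear_br by (simp add: bilinear_def linear_sum linear_scale)
 also have "inner ... Z = inner (jj Z X) Y"
  by (simp add: jj_def inner_sum_left inner_commute[of Y] mult.commute)
 finally show ?thesis by simp
qed

lemma jj_eqI: "(!!Y. inner W Y = inner (br X Y) Z) ==> jj Z X = W"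
 by (metis inner_jj vector_eq_rdot)

lemma bilinear_jj: "bilinear jj"
 unfolding bilinear_def
 by (intro conjI allI linearI jj_eqI)
   (simp_all add: inner_add_left inner_jj inner_add_right br_simps)

lemmas jj_simps =
 bilinear_ladd[OF bilinear_jj] bilinear_radd[OF bilinear_jj]
 bilinear_lmul[OF bilinear_jj] bilinear_rmul[OF bilinear_jj]
 bilinear_lsub[OF bilinear_jj] bilinear_rsub[OF bilinear_jj]
 bilinear_lneg[OF bilinear_jj] bilinear_rneg[OF bilinear_jj]
 bilinear_lzero[OF bilinear_jj] bilinear_rzero[OF bilinear_jj]

lemma bounded_bilinear_jj: "bounded_bilinear jj"
 using bilinear_jj bilinear_conv_bounded_bilinear by blast

lemma jj_vspace [simp]: "jj Z X \<in> vspace br"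
 unfolding vspace_def orthogonal_comp_def orthogonal_def
 by (auto simp: inner_commute[of _ "jj Z X"] inner_jj center_right)

lemma J_map_eq: "J_map br Z X = jj Z X"
 unfolding J_map_def
proof (rule the_equality)
 show "jj Z X \<in> vspace br \<and> (\<forall>Y\<in>vspace br. inner (jj Z X) Y = inner (br X Y) Z)"
  by (simp add: inner_jj)
next
 fix W assume W: "W \<in> vspace br \<and> (\<forall>Y\<in>vspace br. inner W Y = inner (br X Y) Z)"
 have "W - jj Z X \<in> vspace br" using W subspace_vspace subspace_diff jj_vspace by blast
 then have "inner (W - jj Z X) (W - jj Z X) = 0"
  using W inner_jj by (simp add: inner_diff_left)
 then show "W = jj Z X" by simp
qed

lemma jj_jj: "Z \<in> center br ==> X \<in> vspace br ==> jj Z (jj Z X) = - ((norm Z)\<^sup>2 *\<^sub>R X)"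
 using H unfolding H_type_def J_map_eq by blast

lemma jj_vz [simp]: "vp (jj Z X) = jj Z X" "zp (jj Z X) = 0"
 by (simp_all add: vp_of_vspace zp_of_vspace)

lemma inner_jj_skew: "inner (jj Z X) Y = - inner X (jj Z Y)"
 by (metis br_skew inner_commute inner_jj inner_minus_left)

lemma inner_jj_self [simp]: "inner (jj Z X) X = 0" "inner X (jj Z X) = 0"
 by (simp_all add: inner_jj inner_commute[of X])

lemma inner_jj_jj: "Z \<in> center br ==> X \<in> vspace br ==>
  inner (jj Z X) (jj Z X) = (norm Z)\<^sup>2 * (norm X)\<^sup>2"
 by (subst inner_jj_skew) (simp add: jj_jj power2_norm_eq_inner)

text \<open>The H-type condition in the form in which it enters the computation of \<open>TT\<close>, the gradient of the radial coordinate: obtained from \<open>inner_jj_jj\<close> by polarisation in \<open>Z\<close>.\<close>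

lemma br_jj: assumes Z: "Z \<in> center br" and X: "X \<in> vspace br"
 shows "br X (jj Z X) = (norm X)\<^sup>2 *\<^sub>R Z"
proof -
 have "inner (br X (jj Z X) - (norm X)\<^sup>2 *\<^sub>R Z) Z' = 0" if Z': "Z' \<in> center br" for Z'
 proof -
  have s: "Z + Z' \<in> center br" using Z Z' subspace_center subspace_add by blast
  have "inner (jj (Z + Z') X) (jj (Z + Z') X) = (norm (Z+Z'))\<^sup>2 * (norm X)\<^sup>2"
   by (rule inner_jj_jj[OF s X])
  then have "2 * inner (jj Z' X) (jj Z X) = 2 * inner Z Z' * (norm X)\<^sup>2"
   using inner_jj_jj[OF Z X] inner_jj_jj[OF Z' X]
   by (simp add: jj_simps inner_add_left inner_add_right power2_norm_eq_inner algebra_simps inner_commute)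
  then show ?thesis using inner_jj[of Z' X "jj Z X"]
   by (simp add: inner_diff_left inner_commute[of Z Z'] inner_commute[of "jj Z' X"] mult.commute)
 qed
 moreover have "br X (jj Z X) - (norm X)\<^sup>2 *\<^sub>R Z \<in> center br"
  using Z subspace_center by (simp add: subspace_diff subspace_scale)
 ultimately show ?thesis by (metis eq_iff_diff_eq_0 inner_eq_zero_iff)
qed

lemma DIM_eq: "mv br + mz br = DIM('n)"
proof -
 have "dim {x + y |x y. x \<in> center br \<and> y \<in> vspace br} + dim (center br \<inter> vspace br) = dim (center br) + dim (vspace br)"
  by (rule dim_sums_Int[OF subspace_center subspace_vspace])
 moreover have "{x + y |x y. x \<in> center br \<and> y \<in> vspace br} = UNIV"
  by (auto, metis zp_center vp_vspace vp_zp add.commute)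
 moreover have "center br \<inter> vspace br = {0}"
  using center_vspace_0 subspace_0[OF subspace_center] subspace_0[OF subspace_vspace] by blast
 ultimately show ?thesis by (simp add: mv_def mz_def)
qed

lemma mz_pos: "mz br > 0"
proof (rule ccontr)
 assume "\<not> mz br > 0"
 then have 0: "center br \<subseteq> {0}" unfolding mz_def by simp
 have "br X Y = 0" for X Y using 0 br_center[of X Y] by blast
 then have "center br = UNIV" by (auto simp: center_def)
 then show False using 0 by (metis DIM_positive UNIV_I insertE empty_iff subset_iff nonempty_Basis nonzero_Basis ex_in_conv)
qed

lemma hdim_ge: "hdim br >= 1" using mz_pos by (simp add: hdim_def)

abbreviation Q :: real where "Q \<equiv> hdim br"

end

section \<open>Determinants in an orthonormal basis\<close>

text \<open>Determinants of matrices are indexed by a finite type, whereas the Gram determinant of the metric is a sum over permutations of the set \<open>Basis\<close>. This type turns that set into an index type.\<close>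

typedef (overloaded) 'a bidx = "Basis :: 'a::euclidean_space set"
 morphisms bvec Bidx
 using nonempty_Basis by blast

lemma inj_bvec: "inj bvec" by (simp add: bvec_inject inj_def)

lemma range_bvec: "range (bvec :: 'a bidx => 'a) = (Basis :: 'a::euclidean_space set)"
 using type_definition.Rep_range[OF type_definition_bidx] .

lemma bij_bvec: "bij_betw bvec UNIV (Basis :: 'a::euclidean_space set)"
 using inj_bvec range_bvec by (simp add: bij_betw_def)

instance bidx :: (euclidean_space) finite
proof
 have "finite (range (bvec :: 'a bidx => 'a))" by (simp add: range_bvec)
 then show "finite (UNIV :: 'a bidx set)" using finite_imageD inj_bvec by blast
qed

lemma bvec_Basis [simp]: "bvec i \<in> Basis" by (rule bvec)

lemma inner_bvec: "inner (bvec i) (bvec j) = (if i = j then 1 else 0)"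
 by (simp add: inner_Basis bvec_inject)

lemma sum_bvec: "(\<Sum>i\<in>UNIV. f (bvec i)) = (\<Sum>b\<in>(Basis::'a::euclidean_space set). f b)"
 using sum.reindex_bij_betw[OF bij_bvec] .

lemma prod_bvec: "(\<Prod>i\<in>UNIV. f (bvec i)) = (\<Prod>b\<in>(Basis::'a::euclidean_space set). f b)"
 using prod.reindex_bij_betw[OF bij_bvec] .

lemma leibniz_det:
 fixes A :: "'a::euclidean_space => 'a => real"
 shows "(\<Sum>p | p permutes (Basis::'a set). of_int (sign p) * (\<Prod>b\<in>Basis. A b (p b)))
  = det (\<chi> i j. A (bvec i) (bvec j))"
proof -
 let ?m = "map_permutation UNIV (bvec :: 'a bidx => 'a)"
 have bij: "bij_betw ?m {p. p permutes UNIV} {p. p permutes (Basis :: 'a set)}"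
 proof (rule bij_betw_byWitness[where f' = "map_permutation Basis (inv_into UNIV bvec)"])
  have ib: "bij_betw (inv_into UNIV bvec) (Basis :: 'a set) UNIV"
   by (rule bij_betw_inv_into[OF bij_bvec])
  show "\<forall>p\<in>{p. p permutes UNIV}. map_permutation Basis (inv_into UNIV bvec) (?m p) = p"
   by (auto intro!: map_permutation_compose_inv[OF bij_bvec] simp: inj_bvec)
  show "\<forall>p\<in>{p. p permutes Basis}. ?m (map_permutation Basis (inv_into UNIV bvec) p) = p"
   by (auto intro!: map_permutation_compose_inv[OF ib] simp: bij_betw_inv_into_right[OF bij_bvec])
  show "?m ` {p. p permutes UNIV} \<subseteq> {p. p permutes Basis}"
   by (auto intro!: map_permutation_permutes bij_bvec)
  show "map_permutation Basis (inv_into UNIV bvec) ` {p. p permutes (Basis :: 'a set)} \<subseteq> {p. p permutes UNIV}"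
   by (auto intro!: map_permutation_permutes ib)
 qed
 have "(\<Sum>p | p permutes (Basis::'a set). of_int (sign p) * (\<Prod>b\<in>Basis. A b (p b)))
   = (\<Sum>p | p permutes UNIV. of_int (sign (?m p)) * (\<Prod>b\<in>Basis. A b (?m p b)))"
  by (rule sum.reindex_bij_betw[OF bij, symmetric])
 also have "... = (\<Sum>p | p permutes UNIV. of_int (sign p) * (\<Prod>i\<in>UNIV. A (bvec i) (bvec (p i))))"
 proof (rule sum.cong[OF refl])
  fix p :: "'a bidx => 'a bidx" assume "p \<in> {p. p permutes UNIV}"
  then have p: "p permutes UNIV" by simp
  have "sign (?m p) = sign p"
   by (rule sign_map_permutation) (use p inj_bvec in auto)
  moreover have "(\<Prod>b\<in>Basis. A b (?m p b)) = (\<Prod>i\<in>UNIV. A (bvec i) (bvec (p i)))"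
   by (subst prod_bvec[symmetric]) (simp add: map_permutation_apply[OF inj_bvec])
  ultimately show "of_int (sign (?m p)) * (\<Prod>b\<in>Basis. A b (?m p b))
   = of_int (sign p) * (\<Prod>i\<in>UNIV. A (bvec i) (bvec (p i)))" by simp
 qed
 finally show ?thesis by (simp add: det_def)
qed

definition mt :: "('a::euclidean_space => 'a) => real ^ 'a bidx ^ 'a bidx" where
 "mt M = (\<chi> i j. inner (M (bvec j)) (bvec i))"

definition detL :: "('a::euclidean_space => 'a) => real" where "detL M = det (mt M)"

lemma mt_comp: assumes "linear M" shows "mt (M \<circ> N) = mt M ** mt N"
proof -
 have "inner (M (N (bvec j))) (bvec i) = (\<Sum>k\<in>UNIV. inner (M (bvec k)) (bvec i) * inner (N (bvec j)) (bvec k))" for i j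
 proof -
  have "M (N (bvec j)) = M (\<Sum>b\<in>Basis. inner (N (bvec j)) b *\<^sub>R b)"
   by (simp add: euclidean_representation)
  also have "... = (\<Sum>b\<in>Basis. inner (N (bvec j)) b *\<^sub>R M b)"
   using assms by (simp add: linear_sum linear_scale)
  finally have "inner (M (N (bvec j))) (bvec i) = (\<Sum>b\<in>Basis. inner (N (bvec j)) b * inner (M b) (bvec i))"
   by (simp add: inner_sum_left)
  also have "... = (\<Sum>k\<in>UNIV. inner (N (bvec j)) (bvec k) * inner (M (bvec k)) (bvec i))"
   by (rule sum_bvec[symmetric])
  finally show ?thesis by (simp add: mult.commute)
 qed
 then show ?thesis by (simp add: mt_def matrix_matrix_mult_def)
qed

lemma mt_id: "mt (%x. x) = mat 1"
 by (simp add: mt_def mat_def vec_eq_iff inner_bvec)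

lemma detL_comp: "linear M ==> detL (M \<circ> N) = detL M * detL N"
 by (simp add: detL_def mt_comp det_mul)

lemma detL_id: "detL (%x. x) = 1" by (simp add: detL_def mt_id det_I)

lemma det_gram:
 fixes M :: "'a::euclidean_space => 'a"
 shows "det (\<chi> i j. inner (M (bvec i)) (M (bvec j))) = (detL M)\<^sup>2"
proof -
 have "(\<chi> i j. inner (M (bvec i)) (M (bvec j))) = transpose (mt M) ** mt M"
  by (simp add: mt_def matrix_matrix_mult_def transpose_def vec_eq_iff
    sum_bvec[where f = "%b. inner (M (bvec _)) b * inner (M (bvec _)) b"] euclidean_inner[symmetric])
 then show ?thesis by (simp add: detL_def det_mul det_transpose power2_eq_square)
qed

lemma detL_diagonalizable:
 fixes M :: "'a::euclidean_space => 'a"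
 assumes M: "linear M" and E: "!!x y. x \<in> E ==> y \<in> E ==> inner x y = (if x = y then 1 else 0)"
  and fin: "finite E" and card: "card E = DIM('a)" and ev: "!!e. e \<in> E ==> M e = d e *\<^sub>R e"
 shows "detL M = (\<Prod>e\<in>E. d e)"
proof -
 have "card E = card (UNIV :: 'a bidx set)"
  using card bij_betw_same_card[of bvec "UNIV :: 'a bidx set" Basis] bij_bvec by metis
 then obtain f where f: "bij_betw f (UNIV :: 'a bidx set) E"
  using fin by (metis finite_same_card_bij finite)
 define Q where "Q x = (\<Sum>i\<in>UNIV. inner x (bvec i) *\<^sub>R f i)" for x :: 'a
 have lQ: "linear Q" unfolding Q_def
  by (rule linearI) (simp_all add: inner_add_left scaleR_add_left sum.distrib scaleR_sum_right)
 have fE: "f i \<in> E" for i using f by (auto simp: bij_betw_def)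
 have fi: "inner (f i) (f j) = (if i = j then 1 else 0)" for i j
  using E[OF fE fE] f by (auto simp: bij_betw_def inj_def)
 have Qb: "Q (bvec j) = f j" for j
  unfolding Q_def by (simp add: inner_bvec if_distrib[of "%c. c *\<^sub>R _"] cong: if_cong)
 define D where "D x = (\<Sum>i\<in>UNIV. (d (f i) * inner x (bvec i)) *\<^sub>R bvec i)" for x :: 'a
 have Db: "D (bvec j) = d (f j) *\<^sub>R bvec j" for j
  unfolding D_def by (simp add: inner_bvec if_distrib[of "%c. c *\<^sub>R _"] if_distrib[of "%c. _ * c"] cong: if_cong)
 have "mt (M \<circ> Q) = mt (Q \<circ> D)"
  unfolding mt_def by (simp add: Qb Db linear_scale[OF lQ] ev[OF fE])
 then have "detL M * detL Q = detL Q * detL D"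
  using detL_comp[OF M, of Q] detL_comp[OF lQ, of D] by (simp add: detL_def)
 moreover have "(detL Q)\<^sup>2 = 1"
  unfolding det_gram[symmetric] Qb fi
  using det_I[where 'n = "'a bidx"] by (simp add: mat_def)
 moreover have "detL D = (\<Prod>e\<in>E. d e)"
 proof -
  have "detL D = (\<Prod>i\<in>UNIV. mt D $ i $ i)"
   unfolding detL_def by (rule det_diagonal) (simp add: mt_def Db inner_bvec)
  also have "... = (\<Prod>i\<in>UNIV. d (f i))" by (simp add: mt_def Db inner_bvec)
  finally show ?thesis using prod.reindex_bij_betw[OF f] by simp
 qed
 ultimately show ?thesis by (metis mult.commute mult_cancel_left power2_eq_square zero_neq_one mult_zero_left)
qed

section \<open>The left-invariant metric\<close>

lemma linear_basis_sum:
 fixes L :: "'a::euclidean_space => 'b::real_vector"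
 assumes "linear L"
 shows "(\<Sum>k\<in>Basis. inner u k *\<^sub>R L k) = L u"
proof -
 have "L u = L (\<Sum>k\<in>Basis. inner u k *\<^sub>R k)" by (simp add: euclidean_representation)
 also have "... = (\<Sum>k\<in>Basis. inner u k *\<^sub>R L k)" using assms by (simp add: linear_sum linear_scale)
 finally show ?thesis ..
qed

lemma linear_basis_sum_real:
 fixes L :: "'a::euclidean_space => real"
 assumes "linear L"
 shows "(\<Sum>k\<in>Basis. inner u k * L k) = L u" "(\<Sum>k\<in>Basis. L k * inner u k) = L u"
 using linear_basis_sum[OF assms, of u] by (simp_all add: mult.commute)

context htype
begin

definition dL :: "'n \<times> real => 'n \<times> real => 'n \<times> real" where
 "dL x w = (sqrt (snd x) *\<^sub>R vp (fst w) + snd x *\<^sub>R zp (fst w) + (sqrt (snd x) / 2) *\<^sub>R br (fst x) (fst w), snd x * snd w)"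

definition minv :: "'n \<times> real => 'n \<times> real => 'n \<times> real" where
 "minv x w = ((1 / sqrt (snd x)) *\<^sub>R vp (fst w) + (1 / snd x) *\<^sub>R (zp (fst w) - (1/2) *\<^sub>R br (fst x) (fst w)), snd w / snd x)"

abbreviation met :: "'n \<times> real => 'n \<times> real => 'n \<times> real => real" where
 "met \<equiv> DR_metric br"

lemma linear_dL: "linear (dL x)"
 unfolding dL_def
 by (rule linearI) (auto simp: vp_simps zp_simps br_simps algebra_simps)

lemma linear_minv: "linear (minv x)"
 unfolding minv_def
 by (rule linearI) (auto simp: vp_simps zp_simps br_simps algebra_simps add_divide_distrib)

lemma DR_mult_eq: "DR_mult br x y = (fst x, 0) + dL x y"
proof -
 have "vp U + sqrt a *\<^sub>R vp U' + (zp U + a *\<^sub>R zp U' + (sqrt a / 2) *\<^sub>R br (vp U) (vp U'))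
   = U + (sqrt a *\<^sub>R vp U' + a *\<^sub>R zp U' + (sqrt a / 2) *\<^sub>R br U U')" for U U' a
  using vp_zp[of U] by (simp add: br_vp)
 then show ?thesis
  by (simp add: DR_mult_def dL_def Let_def split: prod.splits)
qed

lemma DR_dL_eq: "DR_dL br x = dL x"
proof -
 have "bounded_linear (dL x)" using linear_dL linear_conv_bounded_linear by blast
 then have "(dL x has_derivative dL x) (at DR_one)"
  by (rule bounded_linear_imp_has_derivative)
 then have "((%y. (fst x, 0) + dL x y) has_derivative dL x) (at DR_one)"
  by (auto intro!: derivative_eq_intros)
 then show ?thesis unfolding DR_dL_def DR_mult_eq[abs_def]
  using frechet_derivative_at by metis
qed

lemma minv_dL: "snd x > 0 ==> minv x (dL x w) = w"
proof (rule prod_eqI)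
 assume a: "snd x > 0"
 have s: "sqrt (snd x) \<noteq> 0" using a by simp
 have "vp (fst (dL x w)) = sqrt (snd x) *\<^sub>R vp (fst w)"
  "zp (fst (dL x w)) = snd x *\<^sub>R zp (fst w) + (sqrt (snd x) / 2) *\<^sub>R br (fst x) (fst w)"
  "br (fst x) (fst (dL x w)) = sqrt (snd x) *\<^sub>R br (fst x) (fst w)"
  by (simp_all add: dL_def vp_simps zp_simps br_simps br_vp)
 then show "fst (minv x (dL x w)) = fst w"
  using a s by (simp add: minv_def algebra_simps vp_zp)
 show "snd (minv x (dL x w)) = snd w" using a by (simp add: minv_def dL_def)
qed

lemma dL_minv: "snd x > 0 ==> dL x (minv x w) = w"
proof (rule prod_eqI)
 assume a: "snd x > 0"
 have s: "sqrt (snd x) \<noteq> 0" using a by simp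
 have "vp (fst (minv x w)) = (1 / sqrt (snd x)) *\<^sub>R vp (fst w)"
  "zp (fst (minv x w)) = (1 / snd x) *\<^sub>R (zp (fst w) - (1/2) *\<^sub>R br (fst x) (fst w))"
  "br (fst x) (fst (minv x w)) = (1 / sqrt (snd x)) *\<^sub>R br (fst x) (fst w)"
  by (simp_all add: minv_def vp_simps zp_simps br_simps br_vp)
 then have "sqrt (snd x) *\<^sub>R vp (fst (minv x w)) = vp (fst w)"
  "snd x *\<^sub>R zp (fst (minv x w)) = zp (fst w) - (1/2) *\<^sub>R br (fst x) (fst w)"
  "(sqrt (snd x) / 2) *\<^sub>R br (fst x) (fst (minv x w)) = (1/2) *\<^sub>R br (fst x) (fst w)"
  using a s by simp_all
 then have "fst (dL x (minv x w)) = vp (fst w) + (zp (fst w) - (1/2) *\<^sub>R br (fst x) (fst w)) + (1/2) *\<^sub>R br (fst x) (fst w)"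
  by (simp only: dL_def fst_conv)
 then show "fst (dL x (minv x w)) = fst w"
  by (simp add: vp_zp)
 show "snd (dL x (minv x w)) = snd w" using a by (simp add: minv_def dL_def)
qed

lemma met_eq: "snd x > 0 ==> met x v w = inner (minv x v) (minv x w)"
proof -
 assume a: "snd x > 0"
 have "inv (DR_dL br x) = minv x"
  unfolding DR_dL_eq by (rule inv_equality) (simp_all add: minv_dL[OF a] dL_minv[OF a])
 then show ?thesis by (simp add: DR_metric_def)
qed

lemma met_dL: "snd x > 0 ==> met x v (dL x w) = inner (minv x v) w"
 by (simp add: met_eq minv_dL)

definition cmet :: "'n \<times> real => 'n \<times> real => 'n \<times> real => real" where
 "cmet x i j = (if i \<in> Basis \<and> j \<in> Basis then \<Sum>e\<in>Basis. inner (dL x e) i * inner (dL x e) j else 0)"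

lemma linear_met: "snd x > 0 ==> linear (met x v)" "snd x > 0 ==> linear (%v. met x v w)"
 using linear_minv[of x] by (intro linearI; simp add: met_eq linear_add linear_scale inner_add_right inner_add_left)+

lemma sum_cmet:
 assumes a: "snd x > 0" and i: "i \<in> Basis"
 shows "(\<Sum>j\<in>Basis. cmet x i j * met x T j) = inner T i"
proof -
 have "(\<Sum>j\<in>Basis. cmet x i j * met x T j)
   = (\<Sum>j\<in>Basis. \<Sum>e\<in>Basis. inner (dL x e) i * (inner (dL x e) j * met x T j))"
  using i by (simp add: cmet_def sum_distrib_right mult.assoc)
 also have "... = (\<Sum>e\<in>Basis. inner (dL x e) i * (\<Sum>j\<in>Basis. inner (dL x e) j * met x T j))"
  by (subst sum.swap) (simp add: sum_distrib_left)
 also have "... = (\<Sum>e\<in>Basis. inner (dL x e) i * inner (minv x T) e)"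
  using linear_basis_sum_real(1)[OF linear_met(1)[OF a]] by (simp add: met_dL[OF a])
 also have "... = inner (dL x (minv x T)) i"
  by (rule linear_basis_sum_real(2)) (use linear_dL[of x] in \<open>intro linearI; simp add: linear_add linear_scale inner_add_left\<close>)
 finally show ?thesis by (simp add: dL_minv[OF a])
qed

lemma cometric_eq:
 assumes a: "snd x > 0"
 shows "cometric met x = cmet x"
 unfolding cometric_def
proof (rule the_equality)
 have sym: "met x v w = met x w v" "cmet x v w = cmet x w v" for v w
  by (simp_all add: met_eq[OF a] inner_commute cmet_def mult.commute)
 have main: "(\<Sum>k\<in>Basis. met x i k * cmet x k j) = (if i = j then 1 else 0)" if "i \<in> Basis" "j \<in> Basis" for i j
 proof -
  have "(\<Sum>k\<in>Basis. met x i k * cmet x k j) = (\<Sum>k\<in>Basis. cmet x j k * met x i k)"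
   by (simp add: sym(2)[of _ j] mult.commute)
  then show ?thesis using sum_cmet[OF a that(2), of i] that by (simp add: inner_Basis)
 qed
 then show "(\<forall>i\<in>Basis. \<forall>j\<in>Basis. (\<Sum>k\<in>Basis. met x i k * cmet x k j) = (if i = j then 1 else 0))
   \<and> (\<forall>i j. i \<notin> Basis \<or> j \<notin> Basis \<longrightarrow> cmet x i j = 0)"
  by (auto simp: cmet_def)
 fix h assume h: "(\<forall>i\<in>Basis. \<forall>j\<in>Basis. (\<Sum>k\<in>Basis. met x i k * h k j) = (if i = j then 1 else 0))
   \<and> (\<forall>i j. i \<notin> Basis \<or> j \<notin> Basis \<longrightarrow> h i j = 0)"
 show "h = cmet x"
 proof (intro ext)
  fix k j
  show "h k j = cmet x k j"
  proof (cases "k \<in> Basis \<and> j \<in> Basis")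
   case False
   then have "h k j = 0" using h by blast
   then show ?thesis using False by (auto simp: cmet_def)
  next
   case True
   define D where "D = (\<Sum>k\<in>Basis. (h k j - cmet x k j) *\<^sub>R k)"
   have 0: "met x i D = 0" if "i \<in> Basis" for i
   proof -
    have "met x i D = (\<Sum>k\<in>Basis. (h k j - cmet x k j) * met x i k)"
     unfolding D_def using linear_met(1)[OF a] by (simp add: linear_sum linear_scale)
    also have "... = (\<Sum>k\<in>Basis. met x i k * h k j) - (\<Sum>k\<in>Basis. met x i k * cmet x k j)"
     by (simp add: algebra_simps sum_subtractf)
    also have "... = 0" using h main that True by simp
    finally show ?thesis .
   qed
   have "met x D D = (\<Sum>k\<in>Basis. inner D k * met x k D)"
    using linear_basis_sum_real(1)[OF linear_met(2)[OF a], of D D] by simp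
   then have "inner (minv x D) (minv x D) = 0" using 0 by (simp add: met_eq[OF a])
   then have "minv x D = 0" by simp
   then have "D = 0" using dL_minv[OF a, of D] linear_0[OF linear_dL] by metis
   then have "inner D k = 0" by simp
   moreover have "inner D k = h k j - cmet x k j"
    unfolding D_def using True by (simp add: inner_sum_left inner_Basis if_distrib cong: if_cong)
   ultimately show ?thesis by simp
  qed
 qed
qed

text \<open>The Riemannian density in the chart, see \<open>sqrt_gram_det\<close>.\<close>

definition hh :: "real => real" where "hh a = a powr (- (Q + 1))"

text \<open>The reflection \<open>S\<close> with eigenvalue \<open>-1\<close> on \<open>vspace br\<close> conjugates this map into its inverse, so the square of its determinant is 1.\<close>

lemma detL_unipotent: "(detL (%w::'n\<times>real. (fst w - (1/2) *\<^sub>R br U (fst w), snd w)))\<^sup>2 = 1" (is "(detL ?N)\<^sup>2 = 1")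
proof -
 define S where "S = (%w::'n\<times>real. (zp (fst w) - vp (fst w), snd w))"
 have lS: "linear S" unfolding S_def
  by (rule linearI) (auto simp: vp_simps zp_simps algebra_simps)
 have lN: "linear ?N" by (rule linearI) (auto simp: br_simps algebra_simps)
 have "S (S w) = w" for w by (simp add: S_def vp_simps zp_simps add.commute vp_zp prod_eq_iff)
 then have SS: "S \<circ> S = (%w. w)" by (intro ext) (simp only: o_apply)
 have "S (?N (S (?N w))) = w" for w
 proof -
  have 1: "S (?N w) = (zp (fst w) - (1/2) *\<^sub>R br U (fst w) - vp (fst w), snd w)"
   by (simp add: S_def vp_simps zp_simps)
  have 2: "?N (S (?N w)) = (zp (fst w) - vp (fst w), snd w)"
   unfolding 1 by (simp add: br_simps br_vp)
  show ?thesis unfolding 2 by (simp add: S_def vp_simps zp_simps prod_eq_iff add.commute vp_zp)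
 qed
 then have "S \<circ> (?N \<circ> (S \<circ> ?N)) = (%w. w)" by (intro ext) (simp only: o_apply)
 then have "detL (S \<circ> (?N \<circ> (S \<circ> ?N))) = 1" by (simp only: detL_id)
 then have "detL S * (detL ?N * (detL S * detL ?N)) = 1"
  by (simp only: detL_comp[OF lS] detL_comp[OF lN])
 moreover have "detL (S \<circ> S) = 1" by (simp only: SS detL_id)
 then have "detL S * detL S = 1" by (simp only: detL_comp[OF lS])
 moreover have "detL S * (detL ?N * (detL S * detL ?N)) = (detL S * detL S) * (detL ?N)\<^sup>2"
  by (simp add: power2_eq_square)
 ultimately show ?thesis by simp
qed

lemma detL_dilation:
 "detL (%w. ((c1::real) *\<^sub>R vp (fst w) + c2 *\<^sub>R zp (fst w), c2 * snd w)) = c1 ^ mv br * c2 ^ (mz br + 1)"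
proof -
 let ?D = "%w::'n\<times>real. (c1 *\<^sub>R vp (fst w) + c2 *\<^sub>R zp (fst w), c2 * snd w)"
 obtain Bv where Bv: "Bv \<subseteq> vspace br" "pairwise orthogonal Bv" "!!x. x \<in> Bv ==> norm x = 1"
  "independent Bv" "card Bv = mv br"
  using orthonormal_basis_subspace[OF subspace_vspace] unfolding mv_def by metis
 obtain Bz where Bz: "Bz \<subseteq> center br" "pairwise orthogonal Bz" "!!x. x \<in> Bz ==> norm x = 1"
  "independent Bz" "card Bz = mz br"
  using orthonormal_basis_subspace[OF subspace_center] unfolding mz_def by metis
 define Ev Ez where "Ev = (%x. (x, 0::real)) ` Bv" and "Ez = insert (0,1) ((%x. (x, 0::real)) ` Bz)"
 have fin: "finite Bv" "finite Bz" using Bv(4) Bz(4) independent_bound by blast+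
 have fE: "finite Ev" "finite Ez" using fin by (auto simp: Ev_def Ez_def)
 have "inj_on (%x. (x, 0::real)) A" for A :: "'n set" by (auto simp: inj_on_def)
 then have cv: "card Ev = mv br" and cz: "card Ez = mz br + 1"
  unfolding Ev_def Ez_def using fin Bv(5) Bz(5) by (auto simp: card_image card_insert_if)
 have disj: "Ev \<inter> Ez = {}"
 proof -
  have "x \<notin> Bz" if "x \<in> Bv" for x
   using that Bv(1,3) Bz(1) center_vspace_0[of x] by fastforce
  then show ?thesis by (auto simp: Ev_def Ez_def)
 qed
 have on: "inner x y = (if x = y then 1 else 0)" if "x \<in> Ev \<union> Ez" "y \<in> Ev \<union> Ez" for x y
 proof -
  have v: "inner x y = (if x = y then 1 else 0)" if "x \<in> Bv" "y \<in> Bv" for x y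
   using Bv(2) Bv(3)[OF that(1)] that by (auto simp: pairwise_def orthogonal_def norm_eq_1)
  have z: "inner x y = (if x = y then 1 else 0)" if "x \<in> Bz" "y \<in> Bz" for x y
   using Bz(2) Bz(3)[OF that(1)] that by (auto simp: pairwise_def orthogonal_def norm_eq_1)
  have vz: "inner x y = 0" "inner y x = 0" if "x \<in> Bv" "y \<in> Bz" for x y
   using vspace_orth[of x y] that Bv(1) Bz(1) by (auto simp: inner_commute)
  have n0: "x \<noteq> y" if "x \<in> Bv" "y \<in> Bz" for x y
   using vz(1)[OF that] v[of x x] that by auto
  have cx: "(\<exists>x'. x' \<in> Bv \<and> x = (x', 0)) \<or> (\<exists>x'. x' \<in> Bz \<and> x = (x', 0)) \<or> x = (0, 1)"
   using that(1) unfolding Ev_def Ez_def by blast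
  have cy: "(\<exists>y'. y' \<in> Bv \<and> y = (y', 0)) \<or> (\<exists>y'. y' \<in> Bz \<and> y = (y', 0)) \<or> y = (0, 1)"
   using that(2) unfolding Ev_def Ez_def by blast
  from cx show ?thesis
  proof (elim disjE exE conjE)
   fix x' assume x: "x' \<in> Bv" "x = (x', 0)"
   show ?thesis using cy
    by (elim disjE exE conjE) (use x v[OF x(1)] vz(1)[OF x(1)] n0[OF x(1)] in simp_all)
  next
   fix x' assume x: "x' \<in> Bz" "x = (x', 0)"
   show ?thesis using cy
    by (elim disjE exE conjE) (use x z[OF x(1)] vz(2)[OF _ x(1)] n0[OF _ x(1)] in auto)
  next
   assume x: "x = (0, 1)"
   show ?thesis using cy by (elim disjE exE conjE) (use x in simp_all)
  qed
 qed
 let ?d = "%e. if e \<in> Ev then c1 else c2"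
 have "detL ?D = (\<Prod>e\<in>Ev \<union> Ez. ?d e)"
 proof (rule detL_diagonalizable)
  show "linear ?D" by (rule linearI) (auto simp: vp_simps zp_simps algebra_simps)
  show "card (Ev \<union> Ez) = DIM('n \<times> real)"
   using card_Un_disjoint[OF fE disj] cv cz DIM_eq by simp
  show "finite (Ev \<union> Ez)" using fE by simp
  fix e assume e: "e \<in> Ev \<union> Ez"
  show "?D e = ?d e *\<^sub>R e"
  proof (cases "e \<in> Ev")
   case True then show ?thesis using Bv(1) by (auto simp: Ev_def vp_of_vspace zp_of_vspace)
  next
   case False then have "e \<in> Ez" using e by simp
   then show ?thesis using False Bz(1) by (auto simp: Ez_def vp_of_center zp_of_center vp_simps zp_simps)
  qed
 qed (use on in auto)
 also have "... = (\<Prod>e\<in>Ev. ?d e) * (\<Prod>e\<in>Ez. ?d e)" by (rule prod.union_disjoint[OF fE disj])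
 also have "(\<Prod>e\<in>Ev. ?d e) = c1 ^ mv br" by (simp add: cv)
 also have "(\<Prod>e\<in>Ez. ?d e) = (\<Prod>e\<in>Ez. c2)" using disj by (intro prod.cong) auto
 also have "... = c2 ^ (mz br + 1)" by (simp add: cz)
 finally show ?thesis .
qed

lemma sqrt_gram_det: assumes a: "snd x > 0" shows "sqrt (gram_det met x) = hh (snd x)"
proof -
 let ?N = "%w::'n\<times>real. (fst w - (1/2) *\<^sub>R br (fst x) (fst w), snd w)"
 let ?D = "%w::'n\<times>real. ((1 / sqrt (snd x)) *\<^sub>R vp (fst w) + (1 / snd x) *\<^sub>R zp (fst w), (1 / snd x) * snd w)"
 have lD: "linear ?D" by (rule linearI) (simp_all add: vp_simps zp_simps scaleR_add_right add_divide_distrib)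
 have e: "minv x = ?D \<circ> ?N" by (rule ext) (simp add: minv_def o_def vp_simps zp_simps)
 have d: "detL (minv x) = detL ?D * detL ?N" unfolding e by (rule detL_comp[OF lD])
 have "gram_det met x = det (\<chi> i j. met x (bvec i) (bvec j))"
  unfolding gram_det_def by (rule leibniz_det)
 also have "... = (detL (minv x))\<^sup>2" by (simp add: met_eq[OF a] det_gram)
 also have "... = (detL ?D)\<^sup>2" by (simp add: d power_mult_distrib detL_unipotent)
 finally have "sqrt (gram_det met x) = \<bar>detL ?D\<bar>" by simp
 also have "... = (1 / sqrt (snd x)) ^ mv br * (1 / snd x) ^ (mz br + 1)"
 proof -
  have "detL ?D = (1 / sqrt (snd x)) ^ mv br * (1 / snd x) ^ (mz br + 1)" by (rule detL_dilation)
  moreover have "(1 / sqrt (snd x)) ^ mv br * (1 / snd x) ^ (mz br + 1) >= 0"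
   using a by (intro mult_nonneg_nonneg zero_le_power) auto
  ultimately show ?thesis by (simp only: abs_of_nonneg)
 qed
 also have "... = hh (snd x)"
 proof -
  have s: "sqrt (snd x) ^ mv br = snd x powr (real (mv br) / 2)"
   using a by (simp add: powr_half_sqrt[symmetric] powr_powr flip: powr_realpow)
  have "snd x ^ (mz br + 1) = snd x powr (real (mz br) + 1)"
   using a powr_realpow[OF a, of "mz br + 1"] by (simp add: add.commute)
  with s have "sqrt (snd x) ^ mv br * snd x ^ (mz br + 1) = snd x powr (Q + 1)"
   by (simp add: hdim_def powr_add[symmetric] add.assoc)
  then have "inverse (sqrt (snd x) ^ mv br * snd x ^ (mz br + 1)) = hh (snd x)"
   by (simp only: hh_def powr_minus)
  then show ?thesis by (simp add: divide_inverse power_inverse)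
 qed
 finally show ?thesis .
qed

end

section \<open>The radial coordinate and its gradient\<close>

text \<open>The divergence of the gradient field below is a trace in \<open>Basis\<close>, which need not respect the splitting into center and complement; this is what evaluates it.\<close>

lemma trace_projection:
 fixes P :: "'a::euclidean_space => 'a"
 assumes S: "subspace S" and PS: "!!u. P u \<in> S" and PI: "!!u. u \<in> S ==> P u = u"
  and sa: "!!u w. inner (P u) w = inner u (P w)"
 shows "(\<Sum>b\<in>Basis. inner (P b) b) = real (dim S)"
proof -
 obtain B where B: "B \<subseteq> S" "pairwise orthogonal B" "!!x. x \<in> B ==> norm x = 1"
  "independent B" "card B = dim S" "span B = S"
  using orthonormal_basis_subspace[OF S] by metis
 have fin: "finite B" using B(4) independent_bound by blast
 have on: "inner x y = (if x = y then 1 else 0)" if "x \<in> B" "y \<in> B" for x y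
  using B(2) B(3)[OF that(1)] that by (auto simp: pairwise_def orthogonal_def norm_eq_1)
 have P: "P u = (\<Sum>e\<in>B. inner u e *\<^sub>R e)" for u
 proof -
  define d where "d = P u - (\<Sum>e\<in>B. inner u e *\<^sub>R e)"
  have dS: "d \<in> span B" unfolding d_def B(6)
   using S PS B(1) by (intro subspace_diff subspace_sum subspace_scale) auto
  have "inner d e = 0" if "e \<in> B" for e
  proof -
   have "inner (P u) e = inner u e" using sa PI that B(1) by auto
   moreover have "(\<Sum>e'\<in>B. inner u e' * inner e' e) = (\<Sum>e'\<in>B. if e' = e then inner u e else 0)"
    using on that by (intro sum.cong) auto
   ultimately show ?thesis unfolding d_def
    using that fin by (simp add: inner_diff_left inner_sum_left)
  qed
  then have "orthogonal d d" using orthogonal_to_span[OF dS, of d] by (simp add: orthogonal_def)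
  then show ?thesis unfolding d_def by (simp add: orthogonal_self)
 qed
 have "(\<Sum>b\<in>Basis. inner (P b) b) = (\<Sum>b\<in>Basis. \<Sum>e\<in>B. inner e b * inner e b)"
  unfolding P by (simp add: inner_sum_left) (simp add: inner_commute)
 also have "... = (\<Sum>e\<in>B. inner e e)"
  by (subst sum.swap) (simp add: euclidean_inner[symmetric])
 also have "... = (\<Sum>e\<in>B. 1)" using on by (intro sum.cong) auto
 finally show ?thesis using B(5) by simp
qed

lemma sum_Basis_prod:
 fixes f :: "'a::euclidean_space \<times> 'b::euclidean_space => 'c::comm_monoid_add"
 shows "(\<Sum>b\<in>Basis. f b) = (\<Sum>b\<in>Basis. f (b, 0)) + (\<Sum>b\<in>Basis. f (0, b))"
proof -
 have d: "(%u. (u, 0::'b)) ` (Basis::'a set) \<inter> (%v. (0::'a, v)) ` (Basis::'b set) = {}"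
  using nonzero_Basis by fastforce
 have "inj_on (%u. (u, 0::'b)) (Basis::'a set)" "inj_on (%v. (0::'a, v)) (Basis::'b set)"
  by (auto simp: inj_on_def)
 then show ?thesis
  by (simp add: Basis_prod_def sum.union_disjoint[OF _ _ d] sum.reindex o_def)
qed

context htype
begin

lemma inner_vp_flip: "inner (vp a) b = inner (vp b) a" by (metis inner_commute inner_vp_sym(1))
lemma inner_zp_flip: "inner (zp a) b = inner (zp b) a" by (metis inner_commute inner_vp_sym(2))
lemma inner_br_zp: "inner (br X Y) (zp W) = inner (br X Y) W" by (metis inner_vp_sym(2) vz_idem(5))

lemmas has_derivative_vp [derivative_intros] = bounded_linear.has_derivative[OF bounded_linear_vp]
lemmas has_derivative_zp [derivative_intros] = bounded_linear.has_derivative[OF bounded_linear_zp]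
lemmas has_derivative_jj [derivative_intros] = bounded_bilinear.FDERIV[OF bounded_bilinear_jj]
lemmas continuous_on_vp [continuous_intros] = bounded_linear.continuous_on[OF bounded_linear_vp]
lemmas continuous_on_zp [continuous_intros] = bounded_linear.continuous_on[OF bounded_linear_zp]
lemmas continuous_on_jj [continuous_intros] = bounded_bilinear.continuous_on[OF bounded_bilinear_jj]
lemmas continuous_on_br [continuous_intros] = bounded_bilinear.continuous_on[OF bounded_bilinear_br]

text \<open>The radial coordinate \<open>vv\<close> will turn out to be \<open>sinh\<^sup>2 (s/2)\<close> for the distance \<open>s\<close> from the identity, and \<open>TT\<close> is its Riemannian gradient. Unlike \<open>s\<close>, the coordinate \<open>vv\<close> is a smooth function on the whole space.\<close>

definition BB :: "'n \<times> real => real" where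
 "BB x = 1 + snd x + inner (vp (fst x)) (vp (fst x)) / 4"
definition NN :: "'n \<times> real => real" where
 "NN x = (BB x)\<^sup>2 + inner (zp (fst x)) (zp (fst x))"
definition vv :: "'n \<times> real => real" where
 "vv x = NN x / (4 * snd x) - 1"
definition TT :: "'n \<times> real => 'n \<times> real" where
 "TT x = ((1/4) *\<^sub>R (BB x *\<^sub>R vp (fst x) + jj (zp (fst x)) (vp (fst x))) + ((BB x - 1) / 2) *\<^sub>R zp (fst x),
      (2 * snd x * BB x - NN x) / 4)"
definition dBB :: "'n \<times> real => 'n \<times> real => real" where
 "dBB x w = snd w + inner (vp (fst x)) (fst w) / 2"
definition dNN :: "'n \<times> real => 'n \<times> real => real" where
 "dNN x w = 2 * BB x * dBB x w + 2 * inner (zp (fst x)) (fst w)"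
definition dvv :: "'n \<times> real => 'n \<times> real => real" where
 "dvv x w = dNN x w / (4 * snd x) - NN x * snd w / (4 * (snd x)\<^sup>2)"
definition dTT :: "'n \<times> real => 'n \<times> real => 'n \<times> real" where
 "dTT x w = ((1/4) *\<^sub>R (dBB x w *\<^sub>R vp (fst x) + BB x *\<^sub>R vp (fst w)
        + jj (zp (fst w)) (vp (fst x)) + jj (zp (fst x)) (vp (fst w)))
       + (dBB x w / 2) *\<^sub>R zp (fst x) + ((BB x - 1) / 2) *\<^sub>R zp (fst w),
      (2 * snd w * BB x + 2 * snd x * dBB x w - dNN x w) / 4)"

lemma BB_deriv: "(BB has_derivative dBB x) (at x within S)"
 unfolding BB_def[abs_def] dBB_def[abs_def]
 by (auto intro!: derivative_eq_intros ext simp: inner_vp_flip inner_vp(1)[symmetric])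

lemma NN_deriv: "(NN has_derivative dNN x) (at x within S)"
 unfolding NN_def[abs_def] dNN_def[abs_def]
 by (auto intro!: derivative_eq_intros BB_deriv ext simp: inner_zp_flip inner_vp(3)[symmetric])

lemma vv_deriv: "snd x > 0 ==> (vv has_derivative dvv x) (at x within S)"
 unfolding vv_def[abs_def] dvv_def[abs_def]
 by (auto intro!: derivative_eq_intros NN_deriv ext simp: field_simps power2_eq_square)

lemma TT_deriv: "(TT has_derivative dTT x) (at x within S)"
 unfolding TT_def[abs_def] dTT_def[abs_def]
 by (auto intro!: derivative_eq_intros BB_deriv NN_deriv ext simp: algebra_simps add_divide_distrib diff_divide_distrib scaleR_add_right)

lemma minv_TT:
 assumes a: "snd x > 0"
 shows "minv x (TT x) = ((1 / (4 * sqrt (snd x))) *\<^sub>R (BB x *\<^sub>R vp (fst x) + jj (zp (fst x)) (vp (fst x)))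
   + (1/2) *\<^sub>R zp (fst x), (2 * snd x * BB x - NN x) / (4 * snd x))"
proof (rule prod_eqI)
 let ?V = "vp (fst x)" and ?Z = "zp (fst x)"
 have v: "vp (fst (TT x)) = (1/4) *\<^sub>R (BB x *\<^sub>R ?V + jj ?Z ?V)"
  by (simp add: TT_def vp_simps)
 have z: "zp (fst (TT x)) = ((BB x - 1) / 2) *\<^sub>R ?Z"
  by (simp add: TT_def zp_simps)
 have "br (fst x) (fst (TT x)) = br ?V (vp (fst (TT x)))" by (simp add: br_vp)
 also have "... = ((norm ?V)\<^sup>2 / 4) *\<^sub>R ?Z" using br_jj[of ?Z ?V] unfolding v by (simp add: br_simps)
 finally have b: "br (fst x) (fst (TT x)) = ((norm ?V)\<^sup>2 / 4) *\<^sub>R ?Z" .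
 have c: "(BB x - 1) / 2 - (norm ?V)\<^sup>2 / 8 = snd x / 2"
  by (simp add: BB_def power2_norm_eq_inner field_simps)
 have "zp (fst (TT x)) - (1/2) *\<^sub>R br (fst x) (fst (TT x)) = ((BB x - 1) / 2 - (norm ?V)\<^sup>2 / 8) *\<^sub>R ?Z"
  unfolding z b by (simp add: scaleR_diff_left)
 then have zz: "zp (fst (TT x)) - (1/2) *\<^sub>R br (fst x) (fst (TT x)) = (snd x / 2) *\<^sub>R ?Z"
  unfolding c .
 show "fst (minv x (TT x)) = fst ((1 / (4 * sqrt (snd x))) *\<^sub>R (BB x *\<^sub>R ?V + jj ?Z ?V) + (1/2) *\<^sub>R ?Z, (2 * snd x * BB x - NN x) / (4 * snd x))"
  using a unfolding minv_def fst_conv zz v by simp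
 show "snd (minv x (TT x)) = snd ((1 / (4 * sqrt (snd x))) *\<^sub>R (BB x *\<^sub>R ?V + jj ?Z ?V) + (1/2) *\<^sub>R ?Z, (2 * snd x * BB x - NN x) / (4 * snd x))"
  by (simp add: minv_def TT_def)
qed

lemma met_TT: assumes a: "snd x > 0" shows "met x (TT x) w = dvv x w"
proof -
 let ?V = "vp (fst x)" and ?Z = "zp (fst x)" and ?W = "fst w"
 have s: "sqrt (snd x) * sqrt (snd x) = snd x" "sqrt (snd x) \<noteq> 0" using a by auto
 have i1: "inner ?V (vp ?W) = inner ?V ?W" by (rule inner_vp(1)[symmetric])
 have i2: "inner (jj ?Z ?V) (vp ?W) = inner (br ?V ?W) ?Z" by (simp add: inner_jj br_vp)
 have i3: "inner ?Z (zp ?W) = inner ?Z ?W" by (rule inner_vp(3)[symmetric])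
 have i4: "inner ?Z (br (fst x) ?W) = inner (br ?V ?W) ?Z" by (simp add: br_vp inner_commute)
 have 0: "inner ?V (zp ?W) = 0" "inner ?V (br (fst x) ?W) = 0" "inner ?Z (vp ?W) = 0"
   "inner (jj ?Z ?V) (zp ?W) = 0" "inner (jj ?Z ?V) (br (fst x) ?W) = 0"
  by (simp_all add: inner_jj)
 have "met x (TT x) w = inner (minv x (TT x)) (minv x w)" by (rule met_eq[OF a])
 also have "... = (1 / (4 * sqrt (snd x))) * (1 / sqrt (snd x)) * (BB x * inner ?V ?W + inner (br ?V ?W) ?Z)
   + (1/2) * (1 / snd x) * (inner ?Z ?W - (1/2) * inner (br ?V ?W) ?Z)
   + (2 * snd x * BB x - NN x) / (4 * snd x) * (snd w / snd x)"
  unfolding minv_TT[OF a] unfolding minv_def[of x w] inner_prod_def fst_conv snd_conv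
  by (simp add: inner_add_left inner_add_right inner_diff_right 0 i1 i2 i3 i4)
    (simp add: algebra_simps add_divide_distrib diff_divide_distrib)
 also have "(1 / (4 * sqrt (snd x))) * (1 / sqrt (snd x)) = 1 / (4 * snd x)" using s by simp
 finally show ?thesis
  using a by (simp add: dvv_def dNN_def dBB_def field_simps power2_eq_square)
qed

text \<open>This identity and the divergence of \<open>TT\<close> (lemma \<open>div_hT\<close>) are functions of \<open>vv\<close> alone. This is why the Laplacian of a radial function is radial.\<close>

lemma eikonal: assumes a: "snd x > 0" shows "met x (TT x) (TT x) = vv x * (1 + vv x)"
proof -
 let ?V = "vp (fst x)" and ?Z = "zp (fst x)"
 have s: "sqrt (snd x) * sqrt (snd x) = snd x" using a by auto
 have 0: "inner (BB x *\<^sub>R ?V + jj ?Z ?V) ?Z = 0" by (simp add: inner_add_left inner_jj)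
 have j: "inner (BB x *\<^sub>R ?V + jj ?Z ?V) (BB x *\<^sub>R ?V + jj ?Z ?V) = NN x * inner ?V ?V"
  using inner_jj_jj[OF zp_center vp_vspace, of "fst x" "fst x", unfolded power2_norm_eq_inner]
  by (simp add: inner_add_left inner_add_right NN_def power2_eq_square algebra_simps)
 have q: "inner (c *\<^sub>R P + d *\<^sub>R Z) (c *\<^sub>R P + d *\<^sub>R Z) = c * c * inner P P + 2 * c * d * inner P Z + d * d * inner Z Z"
  for c d :: real and P Z :: 'n
  by (simp add: inner_add_left inner_add_right inner_commute[of Z P] algebra_simps)
 have "met x (TT x) (TT x) = inner (minv x (TT x)) (minv x (TT x))" by (rule met_eq[OF a])
 also have "... = (1 / (4 * sqrt (snd x))) * (1 / (4 * sqrt (snd x))) * (NN x * inner ?V ?V) + inner ?Z ?Z / 4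
   + ((2 * snd x * BB x - NN x) / (4 * snd x))\<^sup>2"
  unfolding minv_TT[OF a] inner_prod_def fst_conv snd_conv q 0 j by (simp add: power2_eq_square)
 also have "(1 / (4 * sqrt (snd x))) * (1 / (4 * sqrt (snd x))) = 1 / (16 * snd x)" using s by (simp add: field_simps)
 also have "inner ?V ?V = 4 * (BB x - 1 - snd x)" by (simp add: BB_def)
 also have "inner ?Z ?Z = NN x - (BB x)\<^sup>2" by (simp add: NN_def)
 also have "1 / (16 * snd x) * (NN x * (4 * (BB x - 1 - snd x))) + (NN x - (BB x)\<^sup>2) / 4 + ((2 * snd x * BB x - NN x) / (4 * snd x))\<^sup>2
   = vv x * (1 + vv x)"
  using a by (simp add: vv_def field_simps power2_eq_square)
 finally show ?thesis .
qed

lemma dvv_TT: "snd x > 0 ==> dvv x (TT x) = vv x * (1 + vv x)"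
 using met_TT[of x "TT x"] eikonal by simp

lemma met_nonneg: "snd x > 0 ==> met x w w >= 0" by (simp add: met_eq)

lemma vv_nonneg: assumes a: "snd x > 0" shows "vv x >= 0"
proof -
 have "(1 + snd x)\<^sup>2 <= (BB x)\<^sup>2" using a by (intro power_mono) (auto simp: BB_def)
 moreover have "4 * snd x <= (1 + snd x)\<^sup>2"
  using zero_le_power2[of "1 - snd x"] by (simp add: power2_eq_square algebra_simps)
 moreover have "inner (zp (fst x)) (zp (fst x)) >= 0" by simp
 ultimately have "4 * snd x <= NN x" unfolding NN_def by linarith
 then show ?thesis using a by (simp add: vv_def)
qed

lemma vv_eq_0: assumes a: "snd x > 0" shows "vv x = 0 \<longleftrightarrow> x = (0, 1)"
proof
 assume "vv x = 0"
 then have N: "NN x = 4 * snd x" using a by (simp add: vv_def field_simps)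
 have B: "BB x >= 1 + snd x" by (simp add: BB_def)
 have 1: "(1 + snd x)\<^sup>2 <= (BB x)\<^sup>2" using a B by (intro power_mono) auto
 have z: "inner (zp (fst x)) (zp (fst x)) >= 0" by simp
 have e: "(1 - snd x)\<^sup>2 = (1 + snd x)\<^sup>2 - 4 * snd x" by (simp add: power2_eq_square algebra_simps)
 have "(1 - snd x)\<^sup>2 <= 0" using N 1 z e unfolding NN_def by linarith
 then have s: "snd x = 1" by simp
 have z0: "inner (zp (fst x)) (zp (fst x)) = 0"
 proof -
  have "(1 + snd x)\<^sup>2 = 4" "NN x = 4" using s N by simp_all
  then show ?thesis using 1 z unfolding NN_def by linarith
 qed
 have "(BB x)\<^sup>2 = 2\<^sup>2" using N z0 s unfolding NN_def by simp
 then have "BB x = 2" by (rule power2_eq_imp_eq) (use B s in auto)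
 then have "inner (vp (fst x)) (vp (fst x)) = 0" using s by (simp add: BB_def)
 then have "vp (fst x) = 0" "zp (fst x) = 0" using z0 by simp_all
 then have "fst x = 0" using vp_zp[of "fst x"] by simp
 then show "x = (0, 1)" using s by (simp add: prod_eq_iff)
next
 assume "x = (0, 1)" then show "vv x = 0" by (simp add: vv_def NN_def BB_def vp_simps zp_simps)
qed

lemma dvv_bound: assumes a: "snd x > 0"
 shows "\<bar>dvv x w\<bar> <= sqrt (vv x * (1 + vv x)) * sqrt (met x w w)"
proof -
 have "\<bar>dvv x w\<bar> = \<bar>inner (minv x (TT x)) (minv x w)\<bar>" using met_TT[OF a] met_eq[OF a] by metis
 also have "... <= norm (minv x (TT x)) * norm (minv x w)" by (rule Cauchy_Schwarz_ineq2)
 also have "... = sqrt (met x (TT x) (TT x)) * sqrt (met x w w)"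
  by (simp add: met_eq[OF a] norm_eq_sqrt_inner)
 finally show ?thesis by (simp add: eikonal[OF a])
qed

lemma trace_vp: "(\<Sum>b\<in>Basis. inner (vp b) b) = real (mv br)"
 unfolding mv_def by (rule trace_projection[OF subspace_vspace]) (simp_all add: vp_of_vspace inner_vp_sym)
lemma trace_zp: "(\<Sum>b\<in>Basis. inner (zp b) b) = real (mz br)"
 unfolding mz_def by (rule trace_projection[OF subspace_center]) (simp_all add: zp_of_center inner_vp_sym)

lemma trace_ad: "(\<Sum>b\<in>Basis. inner (br V b) b) = 0"
proof -
 have l: "linear (br V)" using bilinear_br by (simp add: bilinear_def)
 have "(\<Sum>b\<in>Basis. inner (br V b) b) = (\<Sum>b\<in>Basis. inner (br V (vp b)) b)" by (simp add: br_vp)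
 also have "... = (\<Sum>b\<in>Basis. \<Sum>c\<in>Basis. inner (vp b) c * inner (br V c) b)"
  by (intro sum.cong refl, subst linear_basis_sum[OF l, symmetric]) (simp add: inner_sum_left)
 also have "... = (\<Sum>c\<in>Basis. \<Sum>b\<in>Basis. inner (vp c) b * inner (br V c) b)"
  by (subst sum.swap) (simp add: inner_vp_flip)
 also have "... = (\<Sum>c\<in>Basis. inner (vp c) (br V c))" by (simp add: euclidean_inner[symmetric])
 finally show ?thesis by simp
qed

lemma trace_dTT: assumes a: "snd x > 0"
 shows "(\<Sum>b\<in>Basis. inner (dTT x b) b) = BB x * mv br / 4 + inner (vp (fst x)) (vp (fst x)) / 8 + (BB x - 1) / 2 * mz br + snd x / 2"
proof -
 let ?V = "vp (fst x)" and ?Z = "zp (fst x)"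
 have "(\<Sum>b\<in>Basis. inner (dTT x b) b) = (\<Sum>b\<in>Basis. inner (fst (dTT x (b, 0))) b) + snd (dTT x (0, 1))"
  by (simp add: sum_Basis_prod inner_prod_def)
 also have "(\<Sum>b\<in>Basis. inner (fst (dTT x (b, 0))) b)
   = (\<Sum>b\<in>Basis. inner ?V b * inner ?V b / 8 + BB x / 4 * inner (vp b) b + inner (br ?V b) b / 4
     + inner ?V b * inner ?Z b / 4 + (BB x - 1) / 2 * inner (zp b) b)"
 proof (rule sum.cong[OF refl])
  fix b :: 'n
  have 1: "inner (jj (zp b) ?V) b = inner (br ?V b) b"
   by (simp add: inner_jj inner_br_zp)
  have 2: "inner (jj ?Z (vp b)) b = 0"
   by (metis inner_jj br_vp(1) br_self inner_zero_left)
  show "inner (fst (dTT x (b, 0))) b = inner ?V b * inner ?V b / 8 + BB x / 4 * inner (vp b) b + inner (br ?V b) b / 4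
     + inner ?V b * inner ?Z b / 4 + (BB x - 1) / 2 * inner (zp b) b"
   by (simp add: dTT_def dBB_def inner_add_left 1 2 algebra_simps)
 qed
 also have "... = inner ?V ?V / 8 + BB x / 4 * mv br + inner ?V ?Z / 4 + (BB x - 1) / 2 * mz br"
  by (simp add: sum.distrib sum_divide_distrib[symmetric] sum_distrib_left[symmetric] trace_vp trace_zp trace_ad
    euclidean_inner[symmetric])
 also have "snd (dTT x (0, 1)) = snd x / 2" by (simp add: dTT_def dBB_def dNN_def algebra_simps)
 finally show ?thesis by simp
qed

lemma hh_deriv: "a > 0 ==> (hh has_real_derivative (- (Q + 1) * hh a / a)) (at a within S)"
 unfolding hh_def[abs_def]
proof (rule DERIV_cong[OF DERIV_subset[OF has_real_derivative_powr subset_UNIV]])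
 assume a: "a > 0"
 show "- (Q + 1) * a powr (- (Q + 1) - 1) = - (Q + 1) * a powr (- (Q + 1)) / a"
  by (simp only: powr_diff[of a "- (Q + 1)" 1] powr_one[OF less_imp_le[OF a]] times_divide_eq_right)
qed

lemma hh_pos: "a > 0 ==> hh a > 0" by (simp add: hh_def)

definition dhT :: "'n \<times> real => 'n \<times> real => 'n \<times> real" where
 "dhT x w = hh (snd x) *\<^sub>R dTT x w + (- (Q + 1) * hh (snd x) / snd x * snd w) *\<^sub>R TT x"

lemma hT_deriv: assumes a: "snd x > 0" shows "((%y. hh (snd y) *\<^sub>R TT y) has_derivative dhT x) (at x within S)"
proof -
 have h: "((%y. hh (snd y)) has_derivative (%w. - (Q + 1) * hh (snd x) / snd x * snd w)) (at x within S)"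
  using has_derivative_compose[OF bounded_linear_imp_has_derivative[OF bounded_linear_snd]
    hh_deriv[OF a, of UNIV, unfolded has_field_derivative_def], of S]
  by (simp add: mult.commute)
 show ?thesis unfolding dhT_def[abs_def]
  by (rule has_derivative_scaleR[OF h TT_deriv])
qed

definition nS :: real where "nS = real (dimS br)"

lemma div_hT: assumes a: "snd x > 0"
 shows "(\<Sum>b\<in>Basis. inner (dhT x b) b) = hh (snd x) * ((Q + 1) * vv x + nS / 2)"
proof -
 have "(\<Sum>b\<in>Basis. inner (dhT x b) b) = hh (snd x) * (\<Sum>b\<in>Basis. inner (dTT x b) b)
   + (- (Q + 1) * hh (snd x) / snd x) * (\<Sum>b\<in>Basis. snd b * inner (TT x) b)"
  by (simp add: dhT_def inner_add_left sum.distrib sum_distrib_left mult.assoc)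
 also have "(\<Sum>b\<in>Basis. snd b * inner (TT x) b) = snd (TT x)"
  by (simp add: sum_Basis_prod inner_prod_def)
 also have "snd (TT x) = (2 * snd x * BB x - NN x) / 4" by (simp add: TT_def)
 also note trace_dTT[OF a]
 also have "inner (vp (fst x)) (vp (fst x)) = 4 * (BB x - 1 - snd x)" by (simp add: BB_def)
 finally show ?thesis
  using a by (simp add: vv_def hdim_def nS_def dimS_def field_simps)
qed

end

section \<open>The distance from the identity\<close>

context htype
begin

definition rr :: "'n \<times> real => real" where "rr x = 2 * arsinh (sqrt (vv x))"

lemma DR_iff: "x \<in> DR \<longleftrightarrow> snd x > 0" by (cases x) (auto simp: DR_def)

lemma continuous_on_vv: "continuous_on DR vv"
 by (rule has_derivative_continuous_on[OF vv_deriv]) (simp add: DR_iff)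

text \<open>Along a curve \<open>|d vv| <= sqrt (vv (1 + vv)) |d\<gamma>|\<close>, and \<open>2 arsinh (sqrt v)\<close> has derivative \<open>1 / sqrt (v (1 + v))\<close>. It is singular at 0, so the estimate is integrated only after the last visit of the curve to \<open>vv = 0\<close>.\<close>

lemma curve_lower:
 assumes vp: "valid_path \<gamma>" and im: "path_image \<gamma> \<subseteq> DR" and s: "pathstart \<gamma> = (0,1)" and f: "pathfinish \<gamma> = x"
 shows "ennreal (rr x) <= curve_length met \<gamma>"
proof (cases "vv x = 0")
 case True then show ?thesis by (simp add: rr_def)
next
 case vx: False
 have cont: "continuous_on {0..1} \<gamma>" using vp valid_path_def piecewise_C1_differentiable_on_def by blast
 obtain S where S: "finite S" "\<gamma> C1_differentiable_on {0..1} - S"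
  using vp unfolding valid_path_def piecewise_C1_differentiable_on_def by blast
 obtain D where D: "!!t. t \<in> {0..1} - S ==> (\<gamma> has_vector_derivative D t) (at t)"
  and Dc: "continuous_on ({0..1} - S) D"
  using S(2) unfolding C1_differentiable_on_def by blast
 have DR: "\<gamma> t \<in> DR" if "t \<in> {0..1}" for t using im that by (auto simp: path_image_def)
 then have pos: "snd (\<gamma> t) > 0" if "t \<in> {0..1}" for t using that by (simp add: DR_iff)
 have wc: "continuous_on {0..1} (%t. vv (\<gamma> t))"
  by (rule continuous_on_compose2[OF continuous_on_vv cont]) (use DR in auto)
 define Zs where "Zs = {t \<in> {0..1}. vv (\<gamma> t) = 0}"
 have cz: "closed Zs" unfolding Zs_def
  using continuous_closed_preimage[OF wc closed_atLeastAtMost closed_singleton, of 0]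
  by (simp add: vimage_def Int_def)
 have z0: "0 \<in> Zs" using s vv_eq_0[of "(0,1)"] by (simp add: Zs_def pathstart_def)
 have Zsub: "Zs \<subseteq> {0..1}" by (auto simp: Zs_def)
 have bdd: "bdd_above Zs" by (rule bdd_above_mono[OF bdd_above_Icc Zsub])
 define t0 where "t0 = Sup Zs"
 have "t0 \<in> Zs" unfolding t0_def using closed_contains_Sup[OF _ bdd cz] z0 by blast
 then have t0: "0 <= t0" "t0 <= 1" "vv (\<gamma> t0) = 0" by (auto simp: Zs_def)
 have wpos: "vv (\<gamma> t) > 0" if "t0 < t" "t <= 1" for t
 proof -
  have "t \<notin> Zs" using that cSup_upper[OF _ bdd, of t] unfolding t0_def by auto
  then show ?thesis using that t0(1) vv_nonneg[OF pos, of t] by (auto simp: Zs_def)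
 qed
 define g where "g t = rr (\<gamma> t)" for t
 define sp where "sp t = sqrt (met (\<gamma> t) (D t) (D t))" for t
 define g' where "g' t = (if t \<in> {t0<..<1} - S then dvv (\<gamma> t) (D t) / sqrt (vv (\<gamma> t) * (1 + vv (\<gamma> t))) else 0)" for t
 have gc: "continuous_on {t0..1} g"
  unfolding g_def rr_def
  by (intro continuous_intros continuous_on_subset[OF wc]) (use t0 in auto)
 have gd: "(g has_vector_derivative g' t) (at t)" if t: "t \<in> {t0<..<1} - S" for t
 proof -
  have t01: "t \<in> {0..1} - S" using t t0 by auto
  have w: "vv (\<gamma> t) > 0" using wpos t by auto
  have "((%t. vv (\<gamma> t)) has_derivative (%h. dvv (\<gamma> t) (h *\<^sub>R D t))) (at t)"
   using has_derivative_compose[OF D[OF t01, unfolded has_vector_derivative_def] vv_deriv[OF pos, of t UNIV]] t01 by auto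
  moreover have "dvv (\<gamma> t) (h *\<^sub>R D t) = dvv (\<gamma> t) (D t) * h" for h
  proof -
   have "linear (dvv (\<gamma> t))" using vv_deriv[OF pos, of t UNIV] t01 has_derivative_linear by blast
   then show ?thesis by (simp add: linear_scale)
  qed
  ultimately have wd: "((%t. vv (\<gamma> t)) has_real_derivative dvv (\<gamma> t) (D t)) (at t)"
   by (simp add: has_field_derivative_def)
  have "(g has_real_derivative 2 * (1 / sqrt ((sqrt (vv (\<gamma> t)))\<^sup>2 + 1) * (dvv (\<gamma> t) (D t) * (inverse (sqrt (vv (\<gamma> t))) / 2)))) (at t)"
   unfolding g_def rr_def
   by (rule DERIV_cmult, rule DERIV_chain2[OF arsinh_real_has_field_derivative, THEN DERIV_cong],
     rule DERIV_chain2[OF DERIV_real_sqrt[OF w] wd]) (simp add: mult_ac)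
  moreover have "2 * (1 / sqrt ((sqrt (vv (\<gamma> t)))\<^sup>2 + 1) * (dvv (\<gamma> t) (D t) * (inverse (sqrt (vv (\<gamma> t))) / 2))) = g' t"
  proof -
   have "sqrt (vv (\<gamma> t) * (1 + vv (\<gamma> t))) = sqrt (vv (\<gamma> t)) * sqrt (vv (\<gamma> t) + 1)"
    by (simp add: real_sqrt_mult add.commute)
   moreover have "sqrt (vv (\<gamma> t)) > 0" "sqrt (vv (\<gamma> t) + 1) > 0" "(sqrt (vv (\<gamma> t)))\<^sup>2 = vv (\<gamma> t)" using w by auto
   ultimately show ?thesis using t by (simp add: g'_def field_simps)
  qed
  ultimately show ?thesis by (simp add: has_real_derivative_iff_has_vector_derivative)
 qed
 have int: "(g' has_integral g 1 - g t0) {t0..1}"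
  by (rule fundamental_theorem_of_calculus_interior_strong[OF S(1) t0(2)]) (use gd gc in auto)
 have g1: "g 1 - g t0 = rr x" using f t0(3) by (simp add: g_def pathfinish_def rr_def)
 define F where "F t = indicator ({0..1} - S) t * sp t" for t
 have minvc: "continuous_on ({0..1} - S) (%t. minv (\<gamma> t) (D t))"
  unfolding minv_def
  by (intro continuous_intros Dc continuous_on_subset[OF cont]) (use pos in force)+
 have spc: "continuous_on ({0..1} - S) sp"
 proof (rule continuous_on_eq)
  show "continuous_on ({0..1} - S) (%t. sqrt (inner (minv (\<gamma> t) (D t)) (minv (\<gamma> t) (D t))))"
   by (intro continuous_intros minvc)
 qed (use pos in \<open>auto simp: sp_def met_eq\<close>)
 have Fm: "F \<in> borel_measurable borel"
  unfolding F_def using borel_measurable_continuous_on_indicator[OF _ spc] S(1)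
  by (simp add: finite_imp_closed borel_closed)
 have sp0: "sp t >= 0" if "t \<in> {0..1}" for t using met_nonneg[OF pos[OF that]] by (simp add: sp_def)
 have F0: "F t >= 0" for t using sp0 by (auto simp: F_def indicator_def)
 have le: "(\<integral>\<^sup>+t. ennreal (F t) \<partial>lborel) <= curve_length met \<gamma>"
  unfolding curve_length_def
 proof (rule nn_integral_mono)
  fix t
  show "ennreal (F t) <= ennreal (sqrt (met (\<gamma> t) (vector_derivative \<gamma> (at t)) (vector_derivative \<gamma> (at t)))) * indicator {0..1} t"
   using D[of t] vector_derivative_at[of \<gamma> "D t" t] by (auto simp: F_def sp_def indicator_def)
 qed
 show ?thesis
 proof (cases "(\<integral>\<^sup>+t. ennreal (F t) \<partial>lborel) = \<infinity>")
  case True then show ?thesis using le by (simp add: top_unique)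
 next
  case False
  then have I: "integrable lborel F"
   using Fm F0 by (intro integrableI_nonneg) (auto simp: less_top)
  have "(F has_integral integral\<^sup>L lborel F) UNIV" by (rule has_integral_integral_lborel[OF I])
  then have Fi: "F integrable_on UNIV" "integral UNIV F = integral\<^sup>L lborel F" by auto
  have Fi2: "F integrable_on {t0..1}" by (rule integrable_on_subinterval[OF Fi(1)]) simp
  have "rr x <= integral {t0..1} F"
  proof (rule has_integral_le[OF int[unfolded g1] integrable_integral[OF Fi2]])
   fix t assume t: "t \<in> {t0..1}"
   show "g' t <= F t"
   proof (cases "t \<in> {t0<..<1} - S")
    case False
    then have "g' t = 0" by (simp only: g'_def if_False)
    then show ?thesis using F0 by simp
   next
    case True
    then have w: "vv (\<gamma> t) > 0" and p: "snd (\<gamma> t) > 0" using wpos pos t0 by auto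
    have "dvv (\<gamma> t) (D t) <= sqrt (vv (\<gamma> t) * (1 + vv (\<gamma> t))) * sp t"
     using dvv_bound[OF p, of "D t"] by (simp add: sp_def)
    then have "g' t <= sp t" using True w by (simp add: g'_def divide_le_eq mult.commute)
    then show ?thesis using True t0 by (simp add: F_def)
   qed
  qed
  also have "... <= integral UNIV F" by (rule integral_subset_le[OF _ Fi2 Fi(1)]) (use F0 in auto)
  also have "... = integral\<^sup>L lborel F" by (rule Fi(2))
  finally have "ennreal (rr x) <= ennreal (integral\<^sup>L lborel F)" by (rule ennreal_leI)
  also have "... = (\<integral>\<^sup>+t. ennreal (F t) \<partial>lborel)"
   by (rule nn_integral_eq_integral[OF I, symmetric]) (use F0 in auto)
  also note le
  finally show ?thesis .
 qed
qed

end

text \<open>The speed of the curves \<open>geo\<close> below is \<open>2 sqrt th / q\<close>.\<close>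

lemma geo_identity:
 fixes t z x2 r :: real
 assumes "th = x2 + z + t\<^sup>2" "c = (1 - t * r)\<^sup>2 + z * r\<^sup>2" "q = 1 - th * r\<^sup>2" "c' = 2 * z * r - 2 * t * (1 - t * r)"
 shows "4 * x2 * q * c + 4 * z * q\<^sup>2 + (2 * th * r * c + q * c')\<^sup>2 = 4 * th * c\<^sup>2"
 unfolding assms by (simp add: power2_eq_square algebra_simps)

context htype
begin

context
 fixes X Z :: 'n and t x2 z th :: real
 assumes X: "X \<in> vspace br" and Z: "Z \<in> center br"
  and x2: "x2 = inner X X" and z: "z = inner Z Z" and th: "th = x2 + z + t\<^sup>2" and th1: "th < 1"
begin

text \<open>Radial geodesics are images of the rays of a ball under a Cayley transform: \<open>(X, Z, t)\<close> is the end point of the ray and \<open>th < 1\<close> its squared length. The primed functions are derivatives.\<close>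

definition chi :: "real => real" where "chi r = (1 - t * r)\<^sup>2 + z * r\<^sup>2"
definition qq :: "real => real" where "qq r = 1 - th * r\<^sup>2"
definition gP :: "real => real" where "gP r = 2 * r * (1 - t * r) / chi r"
definition gR :: "real => real" where "gR r = 2 * r\<^sup>2 / chi r"
definition gS :: "real => real" where "gS r = 2 * r / chi r"
definition ga :: "real => real" where "ga r = qq r / chi r"
definition chi' :: "real => real" where "chi' r = 2 * z * r - 2 * t * (1 - t * r)"
definition gP' :: "real => real" where "gP' r = 2 * ((1 - t * r)\<^sup>2 - z * r\<^sup>2) / (chi r)\<^sup>2"
definition gR' :: "real => real" where "gR' r = 4 * r * (1 - t * r) / (chi r)\<^sup>2"
definition gS' :: "real => real" where "gS' r = 2 * (1 - (t\<^sup>2 + z) * r\<^sup>2) / (chi r)\<^sup>2"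
definition ga' :: "real => real" where "ga' r = - (2 * th * r * chi r + qq r * chi' r) / (chi r)\<^sup>2"
definition geo :: "real => 'n \<times> real" where
 "geo r = (gP r *\<^sub>R X + gR r *\<^sub>R jj Z X + gS r *\<^sub>R Z, ga r)"
definition geo' :: "real => 'n \<times> real" where
 "geo' r = (gP' r *\<^sub>R X + gR' r *\<^sub>R jj Z X + gS' r *\<^sub>R Z, ga' r)"

lemma th0: "0 <= th" using th x2 z by simp

lemma chi_pos: assumes "0 <= r" "r <= 1" shows "chi r > 0"
proof -
 have "t\<^sup>2 <= th" using th x2 z by simp
 then have "t\<^sup>2 < 1\<^sup>2" using th1 by simp
 then have "\<bar>t\<bar> < 1" by (simp add: abs_square_less_1)
 moreover have "\<bar>t * r\<bar> <= \<bar>t\<bar> * 1" unfolding abs_mult using assms by (intro mult_left_mono) auto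
 ultimately have "1 - t * r > 0" by linarith
 then have "(1 - t * r)\<^sup>2 > 0" by simp
 moreover have "z * r\<^sup>2 >= 0" using z by simp
 ultimately show ?thesis unfolding chi_def by linarith
qed

lemma qq_pos: assumes "0 <= r" "r <= 1" shows "qq r > 0"
proof -
 have "r\<^sup>2 <= 1" using assms by (simp add: power_le_one)
 then have "th * r\<^sup>2 <= th * 1" using th0 by (intro mult_left_mono) auto
 then show ?thesis using th1 by (simp add: qq_def)
qed

lemma chi_deriv: "(chi has_real_derivative chi' r) (at r)"
 unfolding chi_def[abs_def] chi'_def by (auto intro!: derivative_eq_intros simp: algebra_simps)

lemma g_derivs:
 assumes c: "chi r \<noteq> 0"
 shows "(gP has_real_derivative gP' r) (at r)" "(gR has_real_derivative gR' r) (at r)"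
  "(gS has_real_derivative gS' r) (at r)" "(ga has_real_derivative ga' r) (at r)"
proof -
 show "(gP has_real_derivative gP' r) (at r)"
 proof -
  have "(gP has_real_derivative ((2 * (1 - t * r) - 2 * r * t) * chi r - 2 * r * (1 - t * r) * chi' r) / (chi r * chi r)) (at r)"
   unfolding gP_def[abs_def] by (rule DERIV_divide[OF _ chi_deriv c]) (auto intro!: derivative_eq_intros simp: algebra_simps)
  moreover have "(2 * (1 - t * r) - 2 * r * t) * chi r - 2 * r * (1 - t * r) * chi' r = 2 * ((1 - t * r)\<^sup>2 - z * r\<^sup>2)"
   by (simp add: chi_def chi'_def power2_eq_square algebra_simps)
  ultimately show ?thesis by (simp add: gP'_def power2_eq_square)
 qed
 show "(gR has_real_derivative gR' r) (at r)"
 proof -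
  have "(gR has_real_derivative ((4 * r) * chi r - 2 * r\<^sup>2 * chi' r) / (chi r * chi r)) (at r)"
   unfolding gR_def[abs_def] by (rule DERIV_divide[OF _ chi_deriv c]) (auto intro!: derivative_eq_intros simp: algebra_simps)
  moreover have "(4 * r) * chi r - 2 * r\<^sup>2 * chi' r = 4 * r * (1 - t * r)"
   by (simp add: chi_def chi'_def power2_eq_square algebra_simps)
  ultimately show ?thesis by (simp add: gR'_def power2_eq_square)
 qed
 show "(gS has_real_derivative gS' r) (at r)"
 proof -
  have "(gS has_real_derivative (2 * chi r - 2 * r * chi' r) / (chi r * chi r)) (at r)"
   unfolding gS_def[abs_def] by (rule DERIV_divide[OF _ chi_deriv c]) (auto intro!: derivative_eq_intros simp: algebra_simps)
  moreover have "2 * chi r - 2 * r * chi' r = 2 * (1 - (t\<^sup>2 + z) * r\<^sup>2)"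
   by (simp add: chi_def chi'_def power2_eq_square algebra_simps)
  ultimately show ?thesis by (simp add: gS'_def power2_eq_square)
 qed
 show "(ga has_real_derivative ga' r) (at r)"
 proof -
  have "(ga has_real_derivative ((- 2 * th * r) * chi r - qq r * chi' r) / (chi r * chi r)) (at r)"
   unfolding ga_def[abs_def] by (rule DERIV_divide[OF _ chi_deriv c]) (auto intro!: derivative_eq_intros simp: qq_def[abs_def] algebra_simps)
  moreover have "(- 2 * th * r) * chi r - qq r * chi' r = - (2 * th * r * chi r + qq r * chi' r)" by simp
  ultimately show ?thesis by (simp only: ga'_def power2_eq_square)
 qed
qed

lemma geo_deriv: assumes "0 <= r" "r <= 1" shows "(geo has_vector_derivative geo' r) (at r)"
proof -
 note d = g_derivs[OF less_imp_neq[OF chi_pos[OF assms], symmetric]]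
 have sc: "((%r. f r *\<^sub>R v) has_vector_derivative f' *\<^sub>R v) (at r)" if "(f has_real_derivative f') (at r)" for f f' and v :: 'n
  using has_vector_derivative_scaleR[OF that has_vector_derivative_const[of v]] by simp
 show ?thesis unfolding geo_def[abs_def] geo'_def
  by (intro has_vector_derivative_Pair has_vector_derivative_add sc d d(4)[unfolded has_real_derivative_iff_has_vector_derivative])
qed

lemma geo_speed: assumes r: "0 <= r" "r <= 1" shows "met (geo r) (geo' r) (geo' r) = 4 * th / (qq r)\<^sup>2"
proof -
 have c: "chi r > 0" and q: "qq r > 0" using chi_pos qq_pos r by auto
 have a: "snd (geo r) > 0" using c q by (simp add: geo_def ga_def)
 let ?J = "jj Z X"
 have vU: "vp (fst (geo r)) = gP r *\<^sub>R X + gR r *\<^sub>R ?J"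
  and vU': "vp (fst (geo' r)) = gP' r *\<^sub>R X + gR' r *\<^sub>R ?J" and zU': "zp (fst (geo' r)) = gS' r *\<^sub>R Z"
  using X Z by (simp_all add: geo_def geo'_def vp_simps zp_simps vp_of_vspace vp_of_center zp_of_vspace zp_of_center)
 have XJ: "br X ?J = x2 *\<^sub>R Z" "br ?J X = - (x2 *\<^sub>R Z)"
  using br_jj[OF Z X] br_skew[of ?J X] by (simp_all add: x2 power2_norm_eq_inner)
 have "br (fst (geo r)) (fst (geo' r)) = br (vp (fst (geo r))) (vp (fst (geo' r)))" by (simp add: br_vp)
 also have "... = ((gP r * gR' r - gR r * gP' r) * x2) *\<^sub>R Z"
  unfolding vU vU' by (simp add: br_simps XJ algebra_simps)
 finally have b: "br (fst (geo r)) (fst (geo' r)) = ((gP r * gR' r - gR r * gP' r) * x2) *\<^sub>R Z" .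
 have e2: "gP r * gR' r - gR r * gP' r = 4 * r\<^sup>2 / (chi r)\<^sup>2"
 proof -
  have "gP r * gR' r - gR r * gP' r = (8 * r\<^sup>2 * (1 - t * r)\<^sup>2 - 4 * r\<^sup>2 * ((1 - t * r)\<^sup>2 - z * r\<^sup>2)) / (chi r * (chi r)\<^sup>2)"
   unfolding gP_def gR_def gP'_def gR'_def times_divide_times_eq diff_divide_distrib[symmetric]
   by (rule arg_cong2[where f = "(/)"]) (simp_all add: power2_eq_square algebra_simps)
  also have "8 * r\<^sup>2 * (1 - t * r)\<^sup>2 - 4 * r\<^sup>2 * ((1 - t * r)\<^sup>2 - z * r\<^sup>2) = 4 * r\<^sup>2 * chi r"
   unfolding chi_def by (simp add: power2_eq_square algebra_simps)
  finally show ?thesis using c by simp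
 qed
 have e3: "gS' r - (1/2) * ((gP r * gR' r - gR r * gP' r) * x2) = 2 * qq r / (chi r)\<^sup>2"
  unfolding e2 gS'_def qq_def unfolding th using c by (simp add: divide_simps) (simp add: algebra_simps)
 have e1: "(gP' r)\<^sup>2 + (gR' r)\<^sup>2 * z = 4 / (chi r)\<^sup>2"
 proof -
  have "(gP' r)\<^sup>2 + (gR' r)\<^sup>2 * z = 4 * (((1 - t * r)\<^sup>2 - z * r\<^sup>2)\<^sup>2 + 4 * z * r\<^sup>2 * (1 - t * r)\<^sup>2) / ((chi r)\<^sup>2)\<^sup>2"
   unfolding gP'_def gR'_def by (simp add: power_divide add_divide_distrib[symmetric] power_mult_distrib) (simp add: power2_eq_square algebra_simps)
  also have "((1 - t * r)\<^sup>2 - z * r\<^sup>2)\<^sup>2 + 4 * z * r\<^sup>2 * (1 - t * r)\<^sup>2 = (chi r)\<^sup>2"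
   unfolding chi_def power2_sum power2_diff by (simp add: algebra_simps)
  finally show ?thesis using c by (simp add: power2_eq_square)
 qed
 have m: "minv (geo r) (geo' r) = ((1 / sqrt (ga r)) *\<^sub>R (gP' r *\<^sub>R X + gR' r *\<^sub>R ?J) + (1 / ga r * (2 * qq r / (chi r)\<^sup>2)) *\<^sub>R Z, ga' r / ga r)"
 proof -
  have "zp (fst (geo' r)) - (1/2) *\<^sub>R br (fst (geo r)) (fst (geo' r)) = (2 * qq r / (chi r)\<^sup>2) *\<^sub>R Z"
   unfolding zU' b e3[symmetric] by (simp add: scaleR_diff_left)
  then show ?thesis unfolding minv_def vU' by (simp add: geo_def geo'_def)
 qed
 have w: "inner (gP' r *\<^sub>R X + gR' r *\<^sub>R ?J) (gP' r *\<^sub>R X + gR' r *\<^sub>R ?J) = 4 / (chi r)\<^sup>2 * x2"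
  unfolding e1[symmetric]
  using inner_jj_jj[OF Z X, unfolded power2_norm_eq_inner]
  by (simp add: inner_add_left inner_add_right x2 z power2_eq_square algebra_simps)
 have wz: "inner (gP' r *\<^sub>R X + gR' r *\<^sub>R ?J) Z = 0"
  using Z X by (simp add: inner_add_left vspace_orth)
 have q1: "inner (c1 *\<^sub>R P + d *\<^sub>R Z) (c1 *\<^sub>R P + d *\<^sub>R Z) = c1\<^sup>2 * inner P P + 2 * c1 * d * inner P Z + d\<^sup>2 * inner Z Z"
  for c1 d :: real and P Z :: 'n
  by (simp add: inner_add_left inner_add_right inner_commute[of Z P] power2_eq_square algebra_simps)
 have ga0: "ga r > 0" using c q by (simp add: ga_def)
 have "met (geo r) (geo' r) (geo' r) = (1 / sqrt (ga r))\<^sup>2 * (4 / (chi r)\<^sup>2 * x2)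
   + (1 / ga r * (2 * qq r / (chi r)\<^sup>2))\<^sup>2 * z + (ga' r / ga r)\<^sup>2"
  unfolding met_eq[OF a] m inner_prod_def fst_conv snd_conv
   q1[of "1 / sqrt (ga r)" "gP' r *\<^sub>R X + gR' r *\<^sub>R ?J" "1 / ga r * (2 * qq r / (chi r)\<^sup>2)" Z] w wz z[symmetric] by (simp add: power2_eq_square)
 also have "(1 / sqrt (ga r))\<^sup>2 = chi r / qq r" using ga0 by (simp add: power_divide ga_def)
 also have "1 / ga r * (2 * qq r / (chi r)\<^sup>2) = 2 / chi r" using c q by (simp add: ga_def power2_eq_square)
 also have "ga' r / ga r = - (2 * th * r * chi r + qq r * chi' r) / (chi r * qq r)"
  using c q by (simp add: ga_def ga'_def power2_eq_square)
 also have "chi r / qq r * (4 / (chi r)\<^sup>2 * x2) + (2 / chi r)\<^sup>2 * z + (- (2 * th * r * chi r + qq r * chi' r) / (chi r * qq r))\<^sup>2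
  = (4 * x2 * qq r * chi r + 4 * z * (qq r)\<^sup>2 + (2 * th * r * chi r + qq r * chi' r)\<^sup>2) / (chi r * qq r)\<^sup>2"
 proof -
  have "chi r / qq r * (4 / (chi r)\<^sup>2 * x2) = 4 * x2 * qq r * chi r / (chi r * qq r)\<^sup>2"
   "(2 / chi r)\<^sup>2 * z = 4 * z * (qq r)\<^sup>2 / (chi r * qq r)\<^sup>2"
   using c q by (simp_all add: power2_eq_square)
  then show ?thesis by (simp only: add_divide_distrib power_divide power2_minus)
 qed
 also have "... = 4 * th * (chi r)\<^sup>2 / (chi r * qq r)\<^sup>2"
  using geo_identity[OF th chi_def qq_def chi'_def] by simp
 finally show ?thesis using c by (simp add: power_mult_distrib)
qed

lemma geo_valid: "valid_path geo"
proof -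
 have cc: "continuous_on {0..1} chi"
  using chi_deriv by (intro DERIV_continuous_on) (auto intro: has_field_derivative_at_within)
 have c: "chi r \<noteq> 0" if "r \<in> {0..1}" for r using chi_pos[of r] that by auto
 have "continuous_on {0..1} geo'"
  unfolding geo'_def[abs_def] gP'_def[abs_def] gR'_def[abs_def] gS'_def[abs_def] ga'_def[abs_def] qq_def[abs_def] chi'_def[abs_def]
  by (intro continuous_intros cc) (use c in auto)
 then have "geo C1_differentiable_on {0..1}"
  unfolding C1_differentiable_on_def using geo_deriv by fastforce
 then show ?thesis unfolding valid_path_def by (rule C1_differentiable_imp_piecewise)
qed

lemma geo_length: "curve_length met geo = ennreal (ln ((1 + sqrt th) / (1 - sqrt th)))"
proof -
 define s where "s = sqrt th"
 have s: "s\<^sup>2 = th" "0 <= s" "s < 1" using th0 th1 by (auto simp: s_def)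
 have sr: "s * r < 1" "s * r >= 0" if "0 <= r" "r <= 1" for r
  using that s mult_mono[of s s r 1] by auto
 have "curve_length met geo = (\<integral>\<^sup>+r. ennreal (2 * s / qq r) * indicator {0..1} r \<partial>lborel)"
  unfolding curve_length_def
 proof (rule nn_integral_cong)
  fix r :: real
  show "ennreal (sqrt (met (geo r) (vector_derivative geo (at r)) (vector_derivative geo (at r)))) * indicator {0..1} r
    = ennreal (2 * s / qq r) * indicator {0..1} r"
  proof (cases "r \<in> {0..1}")
   case True
   then have r: "0 <= r" "r <= 1" by auto
   have "sqrt (4 * th / (qq r)\<^sup>2) = 2 * s / qq r"
    using qq_pos[OF r] by (simp add: real_sqrt_divide real_sqrt_mult s_def)
   then show ?thesis
    using vector_derivative_at[OF geo_deriv[OF r]] geo_speed[OF r] by simp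
  qed simp
 qed
 also have "... = ennreal ((ln (1 + s * 1) - ln (1 - s * 1)) - (ln (1 + s * 0) - ln (1 - s * 0)))"
 proof (rule nn_integral_FTC_Icc[where F = "%r. ln (1 + s * r) - ln (1 - s * r)"])
  show "(%r. 2 * s / qq r) \<in> borel_measurable borel" unfolding qq_def[abs_def] by measurable
  fix r :: real assume "r \<in> {0..1}"
  then have r: "0 <= r" "r <= 1" by auto
  have q: "qq r = (1 + s * r) * (1 - s * r)" unfolding qq_def unfolding s(1)[symmetric] by (simp add: power2_eq_square algebra_simps)
  have "((%r. ln (1 + s * r) - ln (1 - s * r)) has_real_derivative (s / (1 + s * r) + s / (1 - s * r))) (at r)"
   using sr[OF r] by (auto intro!: derivative_eq_intros)
  moreover have "s / (1 + s * r) + s / (1 - s * r) = 2 * s / qq r"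
   unfolding q using sr[OF r] by (simp add: divide_simps) (simp add: algebra_simps)
  ultimately show "((%r. ln (1 + s * r) - ln (1 - s * r)) has_real_derivative 2 * s / qq r) (at r)" by metis
  show "0 <= 2 * s / qq r" using s qq_pos[OF r] by simp
 qed simp
 also have "(ln (1 + s * 1) - ln (1 - s * 1)) - (ln (1 + s * 0) - ln (1 - s * 0)) = ln ((1 + s) / (1 - s))"
  using s by (simp add: ln_div)
 finally show ?thesis by (simp add: s_def)
qed

lemma geo_image: "path_image geo \<subseteq> DR"
 using chi_pos qq_pos by (auto simp: path_image_def DR_iff geo_def ga_def)

lemma geo_start: "pathstart geo = (0, 1)"
 by (simp add: pathstart_def geo_def gP_def gR_def gS_def ga_def qq_def chi_def)

end

text \<open>The end point of the ray is the inverse Cayley transform of \<open>x\<close>; the length of its image is then \<open>2 artanh (sqrt th)\<close>, which equals \<open>rr x\<close>.\<close>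

lemma curve_upper:
 assumes x: "x \<in> DR"
 shows "\<exists>\<gamma>. valid_path \<gamma> \<and> path_image \<gamma> \<subseteq> DR \<and> pathstart \<gamma> = (0,1) \<and> pathfinish \<gamma> = x \<and> curve_length met \<gamma> = ennreal (rr x)"
proof -
 have a: "snd x > 0" using x by (simp add: DR_iff)
 let ?V = "vp (fst x)" and ?Zt = "zp (fst x)" and ?B = "BB x" and ?N = "NN x"
 define v2 where "v2 = inner ?V ?V"
 define z2 where "z2 = inner ?Zt ?Zt"
 have B: "?B = 1 + snd x + v2 / 4" and N: "?N = ?B\<^sup>2 + z2" by (simp_all add: BB_def NN_def v2_def z2_def)
 have v20: "v2 >= 0" and z20: "z2 >= 0" by (simp_all add: v2_def z2_def)
 have B0: "?B > 0" using a v20 unfolding B by simp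
 have N0: "?N > 0" unfolding N using B0 z20 by (simp add: add_pos_nonneg)
 define t where "t = ((?B - 1)\<^sup>2 + z2 - 1) / ?N"
 define Z where "Z = (2 / ?N) *\<^sub>R ?Zt"
 define X where "X = (1 / ?N) *\<^sub>R (?B *\<^sub>R ?V - jj ?Zt ?V)"
 define x2 where "x2 = inner X X"
 define z where "z = inner Z Z"
 define th where "th = x2 + z + t\<^sup>2"
 have Xv: "X \<in> vspace br" unfolding X_def
  using subspace_vspace by (intro subspace_scale subspace_diff) auto
 have Zc: "Z \<in> center br" unfolding Z_def using subspace_center by (intro subspace_scale) auto
 have zz: "z = 4 * z2 / ?N\<^sup>2" by (simp add: z_def Z_def z2_def power2_eq_square)
 have "inner (?B *\<^sub>R ?V - jj ?Zt ?V) (?B *\<^sub>R ?V - jj ?Zt ?V) = ?N * v2"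
  using inner_jj_jj[OF zp_center vp_vspace, of "fst x" "fst x", unfolded power2_norm_eq_inner]
  unfolding N by (simp add: inner_diff_left inner_diff_right v2_def z2_def power2_eq_square algebra_simps)
 then have xx: "x2 = v2 / ?N" using N0 by (simp add: x2_def X_def)
 have t1: "1 - t = 2 * ?B / ?N"
 proof -
  have "?N - ((?B - 1)\<^sup>2 + z2 - 1) = 2 * ?B" unfolding N by (simp add: power2_eq_square algebra_simps)
  then show ?thesis unfolding t_def using N0 by (simp add: field_simps)
 qed
 have thv: "th = 1 - 4 * snd x / ?N"
 proof -
  have "th * ?N\<^sup>2 = v2 * ?N + 4 * z2 + ((?B - 1)\<^sup>2 + z2 - 1)\<^sup>2"
   unfolding th_def xx zz t_def using N0 by (simp add: power_divide field_simps power2_eq_square)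
  also have "v2 = 4 * (?B - 1 - snd x)" unfolding B by simp
  also have "4 * (?B - 1 - snd x) * ?N + 4 * z2 + ((?B - 1)\<^sup>2 + z2 - 1)\<^sup>2 = ?N\<^sup>2 - 4 * snd x * ?N"
   unfolding N by (simp add: power2_eq_square algebra_simps)
  also have "... = (1 - 4 * snd x / ?N) * ?N\<^sup>2" using N0 by (simp add: left_diff_distrib power2_eq_square)
  finally show ?thesis using N0 by simp
 qed
 have th1: "th < 1" unfolding thv using a N0 by simp
 note G = Xv Zc x2_def z_def th_def th1
 have ch: "chi t z 1 = 4 / ?N"
 proof -
  have "chi t z 1 = (4 * ?B\<^sup>2 + 4 * z2) / ?N\<^sup>2"
   unfolding chi_def[OF G] mult_1_right unfolding t1 zz by (simp add: power_divide power_mult_distrib add_divide_distrib)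
  also have "4 * ?B\<^sup>2 + 4 * z2 = 4 * ?N" unfolding N by simp
  finally show ?thesis using N0 by (simp add: power2_eq_square)
 qed
 have fin: "pathfinish (geo X Z t z th) = x"
 proof (rule prod_eqI)
  have p: "gP t z 1 = ?B" unfolding gP_def[OF G] ch mult_1_right t1 using N0 by simp
  have r: "gR t z 1 = ?N / 2" unfolding gR_def[OF G] ch using N0 by simp
  have s: "gS t z 1 = ?N / 2" unfolding gS_def[OF G] ch using N0 by simp
  have jZX: "jj Z X = (2 / (?N * ?N)) *\<^sub>R (?B *\<^sub>R jj ?Zt ?V + z2 *\<^sub>R ?V)"
   unfolding Z_def X_def using jj_jj[OF zp_center vp_vspace, of "fst x" "fst x", unfolded power2_norm_eq_inner]
   by (simp add: jj_simps z2_def algebra_simps)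
  have "gP t z 1 *\<^sub>R X + gR t z 1 *\<^sub>R jj Z X = (1 / ?N) *\<^sub>R ((?B\<^sup>2 + z2) *\<^sub>R ?V)"
   unfolding p r jZX using N0 by (simp add: X_def algebra_simps power2_eq_square)
  also have "... = ?V" unfolding N[symmetric] using N0 by simp
  finally have "fst (pathfinish (geo X Z t z th)) = ?V + gS t z 1 *\<^sub>R Z"
   by (simp add: pathfinish_def geo_def[OF G])
  also have "gS t z 1 *\<^sub>R Z = ?Zt" unfolding s Z_def using N0 by simp
  finally show "fst (pathfinish (geo X Z t z th)) = fst x" by (simp add: vp_zp)
  have "qq th 1 = 4 * snd x / ?N" unfolding qq_def[OF G] unfolding thv by simp
  then show "snd (pathfinish (geo X Z t z th)) = snd x"
   using N0 by (simp add: pathfinish_def geo_def[OF G] ga_def[OF G] ch)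
 qed
 have len: "ln ((1 + sqrt th) / (1 - sqrt th)) = rr x"
 proof -
  define s where "s = sqrt th"
  have s: "s\<^sup>2 = th" "0 <= s" "s < 1" using th0[OF G] th1 by (auto simp: s_def)
  have w: "1 - s\<^sup>2 > 0" using s th1 by simp
  have vth: "vv x + 1 = 1 / (1 - s\<^sup>2)" unfolding s(1) thv vv_def using a N0 by simp
  have "vv x = 1 / (1 - s\<^sup>2) - 1" using vth by simp
  also have "... = s\<^sup>2 / (1 - s\<^sup>2)" using w by (simp add: field_simps)
  finally have v: "vv x = s\<^sup>2 / (1 - s\<^sup>2)" .
  have "rr x = 2 * ln (sqrt (vv x) + sqrt (vv x + 1))"
   using vv_nonneg[OF a] by (simp add: rr_def arsinh_real_def)
  also have "sqrt (vv x) + sqrt (vv x + 1) = (1 + s) / sqrt (1 - s\<^sup>2)"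
   unfolding vth unfolding v using s(2) by (simp add: real_sqrt_divide add_divide_distrib)
  also have "2 * ln ((1 + s) / sqrt (1 - s\<^sup>2)) = 2 * ln (1 + s) - ln (1 - s\<^sup>2)"
   using s w by (simp add: ln_div ln_sqrt)
  also have "1 - s\<^sup>2 = (1 + s) * (1 - s)" by (simp add: power2_eq_square algebra_simps)
  also have "2 * ln (1 + s) - ln ((1 + s) * (1 - s)) = ln ((1 + s) / (1 - s))"
   using s by (simp add: ln_div ln_mult)
  finally show ?thesis by (simp add: s_def)
 qed
 show ?thesis
  using geo_valid[OF G] geo_image[OF G] geo_start[OF G] fin geo_length[OF G] len by metis
qed

lemma DR_dist_eq: assumes x: "x \<in> DR" shows "DR_dist br DR_one x = rr x"
proof -
 have r0: "rr x >= 0" using vv_nonneg[of x] x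
  by (simp add: rr_def DR_iff) (metis arsinh_real_neg_iff linorder_not_le real_sqrt_ge_zero)
 have "Inf {curve_length met \<gamma> | \<gamma>. valid_path \<gamma> \<and> path_image \<gamma> \<subseteq> DR \<and> pathstart \<gamma> = DR_one \<and> pathfinish \<gamma> = x} = ennreal (rr x)"
 proof (rule antisym)
  obtain \<gamma> where "valid_path \<gamma>" "path_image \<gamma> \<subseteq> DR" "pathstart \<gamma> = (0,1)" "pathfinish \<gamma> = x" "curve_length met \<gamma> = ennreal (rr x)"
   using curve_upper[OF x] by blast
  then show "Inf {curve_length met \<gamma> | \<gamma>. valid_path \<gamma> \<and> path_image \<gamma> \<subseteq> DR \<and> pathstart \<gamma> = DR_one \<and> pathfinish \<gamma> = x} <= ennreal (rr x)"
   by (intro Inf_lower) (force simp: DR_one_def)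
  show "ennreal (rr x) <= Inf {curve_length met \<gamma> | \<gamma>. valid_path \<gamma> \<and> path_image \<gamma> \<subseteq> DR \<and> pathstart \<gamma> = DR_one \<and> pathfinish \<gamma> = x}"
   by (intro Inf_greatest) (auto simp: DR_one_def intro!: curve_lower)
 qed
 then show ?thesis using r0 by (simp add: DR_dist_def riem_dist_def)
qed

end

section \<open>One-sided calculus\<close>

abbreviation hder :: "(real => 'b::real_normed_vector) => 'b => real => bool" where
 "hder f D x \<equiv> (f has_vector_derivative D) (at x within {0..})"

abbreviation hder1 :: "(real => 'b::real_normed_vector) => 'b => real => bool" where
 "hder1 f D x \<equiv> (f has_vector_derivative D) (at x within {1..})"

text \<open>Radial smooth functions live on a half line with smoothness up to the end point, so derivatives are taken within the set \<open>S\<close>.\<close>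

primrec diffs_on :: "nat => real set => (real => 'b::real_normed_vector) => bool" where
 "diffs_on 0 S f \<longleftrightarrow> continuous_on S f"
| "diffs_on (Suc k) S f \<longleftrightarrow>
   (\<exists>f'. (\<forall>x\<in>S. (f has_vector_derivative f' x) (at x within S)) \<and> diffs_on k S f')"

lemma has_vector_derivative_continuous_on':
 "(!!x. x \<in> S ==> (f has_vector_derivative f' x) (at x within S)) ==> continuous_on S f"
 by (auto simp: continuous_on_eq_continuous_within intro: has_vector_derivative_continuous)

lemma vector_chain_within:
 assumes "(h has_vector_derivative h') (at x within S)" "(f has_vector_derivative f') (at (h x) within T)" "h ` S \<subseteq> T"
 shows "((%x. f (h x)) has_vector_derivative h' *\<^sub>R f') (at x within S)"
 using vector_diff_chain_within[OF assms(1) has_vector_derivative_within_subset[OF assms(2,3)]]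
 by (simp add: o_def)

lemma diffs_onI:
 assumes "!!x. x \<in> S ==> (f has_vector_derivative f' x) (at x within S)" "diffs_on k S f'"
 shows "diffs_on (Suc k) S f"
 using assms by auto

lemma diffs_on_continuous: "diffs_on k S f ==> continuous_on S f"
 by (cases k) (auto intro: has_vector_derivative_continuous_on')

lemma diffs_on_SucD: "diffs_on (Suc k) S f ==> diffs_on k S f"
proof (induction k arbitrary: f)
 case 0 then show ?case using diffs_on_continuous[of "Suc 0"] by simp
next
 case (Suc k)
 then obtain f' where "\<forall>x\<in>S. (f has_vector_derivative f' x) (at x within S)" "diffs_on (Suc k) S f'"
  by (auto simp only: diffs_on.simps(2)[of "Suc k"])
 then show ?case using Suc.IH[of f'] by auto
qed

lemma diffs_on_cong:
 assumes "!!x. x \<in> S ==> f x = g x" "diffs_on k S f" shows "diffs_on k S g"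
proof (cases k)
 case 0 then show ?thesis using assms continuous_on_eq by auto
next
 case (Suc l)
 then obtain f' where f': "\<forall>x\<in>S. (f has_vector_derivative f' x) (at x within S)" "diffs_on l S f'"
  using assms(2) by auto
 have "(g has_vector_derivative f' x) (at x within S)" if "x \<in> S" for x
  using f'(1) that assms(1) has_vector_derivative_transform[OF that, of g f] by auto
 then show ?thesis using Suc f'(2) by auto
qed

lemma diffs_on_seq:
 assumes "!!i x. x \<in> S ==> (g i has_vector_derivative g (Suc i) x) (at x within S)"
 shows "diffs_on k S (g i)"
proof (induction k arbitrary: i)
 case 0 then show ?case using assms has_vector_derivative_continuous_on'[of S "g i" "g (Suc i)"] by simp
next
 case (Suc k) then show ?case using assms by (intro diffs_onI)
qed

lemma diffs_on_const: "diffs_on k S (%x. c)"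
proof (induction k arbitrary: c)
 case (Suc k) show ?case by (rule diffs_onI[where f' = "%x. 0"]) (use Suc in auto)
qed simp

lemma diffs_on_id: "diffs_on k S (%x. x)"
proof (cases k)
 case (Suc l)
 show ?thesis unfolding Suc by (rule diffs_onI[where f' = "%x. 1"]) (auto simp: diffs_on_const intro: has_vector_derivative_id)
qed simp

lemma diffs_on_add: "diffs_on k S f ==> diffs_on k S g ==> diffs_on k S (%x. f x + g x)"
proof (induction k arbitrary: f g)
 case 0 then show ?case by (auto intro: continuous_intros)
next
 case (Suc k)
 from Suc.prems obtain f' g' where "\<forall>x\<in>S. (f has_vector_derivative f' x) (at x within S)" "diffs_on k S f'"
  "\<forall>x\<in>S. (g has_vector_derivative g' x) (at x within S)" "diffs_on k S g'" by auto
 then show ?case by (intro diffs_onI[where f' = "%x. f' x + g' x"]) (auto intro: Suc.IH has_vector_derivative_add)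
qed

lemma diffs_on_linear:
 assumes "bounded_linear L" shows "diffs_on k S f ==> diffs_on k S (%x. L (f x))"
proof (induction k arbitrary: f)
 case 0 then show ?case using bounded_linear.continuous_on[OF assms] by auto
next
 case (Suc k)
 from Suc.prems obtain f' where "\<forall>x\<in>S. (f has_vector_derivative f' x) (at x within S)" "diffs_on k S f'" by auto
 then show ?case by (intro diffs_onI[where f' = "%x. L (f' x)"]) (auto intro: Suc.IH bounded_linear.has_vector_derivative[OF assms])
qed

lemma diffs_on_bilinear:
 assumes B: "bounded_bilinear B"
 shows "diffs_on k S f ==> diffs_on k S g ==> diffs_on k S (%x. B (f x) (g x))"
proof (induction k arbitrary: f g)
 case 0 then show ?case using bounded_bilinear.continuous_on[OF B] by auto
next
 case (Suc k)
 from Suc.prems obtain f' g' where d: "\<forall>x\<in>S. (f has_vector_derivative f' x) (at x within S)" "diffs_on k S f'"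
  "\<forall>x\<in>S. (g has_vector_derivative g' x) (at x within S)" "diffs_on k S g'" by auto
 have s: "diffs_on k S f" "diffs_on k S g" using Suc.prems diffs_on_SucD by blast+
 show ?case
  by (rule diffs_onI[where f' = "%x. B (f x) (g' x) + B (f' x) (g x)"])
    (use d s in \<open>auto intro!: Suc.IH diffs_on_add bounded_bilinear.has_vector_derivative[OF B]\<close>)
qed

lemmas diffs_on_mult = diffs_on_bilinear[OF bounded_bilinear_mult]
lemmas diffs_on_scaleR = diffs_on_bilinear[OF bounded_bilinear_scaleR]

lemma diffs_on_uminus: "diffs_on k S f ==> diffs_on k S (%x. - f x)"
 by (rule diffs_on_linear[OF bounded_linear_minus[OF bounded_linear_ident]])

lemma diffs_on_diff: "diffs_on k S f ==> diffs_on k S g ==> diffs_on k S (%x. f x - g x)"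
 using diffs_on_add[of k S f "%x. - g x"] diffs_on_uminus[of k S g] by simp

lemma diffs_on_power: "diffs_on k S f ==> diffs_on k S (%x. (f x :: 'a::real_normed_algebra_1) ^ n)"
 by (induction n) (auto intro: diffs_on_const diffs_on_mult)

lemma diffs_on_compose:
 assumes "h ` S \<subseteq> T"
 shows "diffs_on k T f ==> diffs_on k S h ==> diffs_on k S (%x. f (h x))"
proof (induction k arbitrary: f)
 case 0 then show ?case using assms continuous_on_compose2 by auto
next
 case (Suc k)
 from Suc.prems obtain f' h' where d: "\<forall>x\<in>T. (f has_vector_derivative f' x) (at x within T)" "diffs_on k T f'"
  "\<forall>x\<in>S. (h has_vector_derivative h' x) (at x within S)" "diffs_on k S h'" by auto
 have s: "diffs_on k S h" using Suc.prems diffs_on_SucD by blast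
 show ?case
 proof (rule diffs_onI[where f' = "%x. h' x *\<^sub>R f' (h x)"])
  show "diffs_on k S (%x. h' x *\<^sub>R f' (h x))"
   by (rule diffs_on_scaleR[OF d(4) Suc.IH[OF d(2) s]])
  fix x assume x: "x \<in> S"
  show "((%x. f (h x)) has_vector_derivative h' x *\<^sub>R f' (h x)) (at x within S)"
   by (rule vector_chain_within[of h _ x S f _ T]) (use d x assms in auto)
 qed
qed

lemma diffs_on_inverse: "0 \<notin> S ==> diffs_on k S (inverse :: real => real)"
proof (induction k)
 case 0 then show ?case by (auto intro!: continuous_intros)
next
 case (Suc k)
 show ?case
 proof (rule diffs_onI[where f' = "%x. - (inverse x * inverse x)"])
  fix x assume "x \<in> S"
  then have "x \<noteq> 0" using Suc.prems by auto
  then show "(inverse has_vector_derivative - (inverse x * inverse x)) (at x within S)"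
   using DERIV_inverse[of x S] by (simp add: has_real_derivative_iff_has_vector_derivative power2_eq_square)
 qed (use Suc in \<open>auto intro!: diffs_on_uminus diffs_on_mult\<close>)
qed

lemma diffs_on_recip:
 "diffs_on k S f ==> (!!x. x \<in> S ==> f x \<noteq> (0::real)) ==> diffs_on k S (%x. inverse (f x))"
 by (rule diffs_on_compose[OF _ diffs_on_inverse[of "- {0}"]]) auto

lemma diffs_on_powr_pos: "diffs_on k {0<..} (%x::real. x powr r)"
proof (induction k arbitrary: r)
 case 0 then show ?case by (auto intro!: continuous_intros)
next
 case (Suc k)
 show ?case
 proof (rule diffs_onI[where f' = "%x. r * x powr (r - 1)"])
  fix x :: real assume "x \<in> {0<..}"
  then show "((%x. x powr r) has_vector_derivative r * x powr (r - 1)) (at x within {0<..})"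
   using has_real_derivative_powr[of x r]
   by (auto simp: has_real_derivative_iff_has_vector_derivative[symmetric] intro: has_field_derivative_at_within)
 qed (auto intro!: diffs_on_mult diffs_on_const Suc)
qed

lemma diffs_on_powr:
 "diffs_on k S f ==> (!!x. x \<in> S ==> f x > (0::real)) ==> diffs_on k S (%x. f x powr r)"
 by (rule diffs_on_compose[OF _ diffs_on_powr_pos]) auto

lemma diffs_on_exp: "diffs_on k S (exp :: real => real)"
 by (rule diffs_on_seq[of S "%_. exp"])
   (simp add: has_real_derivative_iff_has_vector_derivative[symmetric] has_field_derivative_at_within)

lemma diffs_on_sinh_cosh: "diffs_on k S (sinh :: real => real)" "diffs_on k S (cosh :: real => real)"
proof -
 have d: "diffs_on k S (%x::real. (1/2) * (exp x - exp (-x)))" "diffs_on k S (%x::real. (1/2) * (exp x + exp (-x)))"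
  by (intro diffs_on_mult diffs_on_const diffs_on_diff diffs_on_add diffs_on_exp
    diffs_on_compose[OF subset_UNIV diffs_on_exp] diffs_on_uminus diffs_on_id)+
 show "diffs_on k S (sinh :: real => real)" by (rule diffs_on_cong[OF _ d(1)]) (simp add: sinh_def)
 show "diffs_on k S (cosh :: real => real)" by (rule diffs_on_cong[OF _ d(2)]) (simp add: cosh_def)
qed

lemma diffs_on_derivative:
 assumes nb: "!!x. x \<in> S ==> at x within S \<noteq> bot" and f: "!!k. diffs_on k S f"
 shows "\<exists>f'. (\<forall>x\<in>S. (f has_vector_derivative f' x) (at x within S)) \<and> (\<forall>k. diffs_on k S f')"
proof -
 define f' where "f' x = vector_derivative f (at x within S)" for x
 have d: "(f has_vector_derivative f' x) (at x within S)" if "x \<in> S" for x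
  using f[of 1] that unfolding f'_def by (auto simp: vector_derivative_works[symmetric] differentiableI_vector)
 have "diffs_on k S f'" for k
 proof -
  obtain g where g: "\<forall>x\<in>S. (f has_vector_derivative g x) (at x within S)" "diffs_on k S g"
   using f[of "Suc k"] by auto
  have "g x = f' x" if "x \<in> S" for x
   using vector_derivative_unique_within[OF nb[OF that]] g(1) d[OF that] that by blast
  then show ?thesis using diffs_on_cong g(2) by blast
 qed
 then show ?thesis using d by blast
qed

lemma halfline_nontrivial: "x \<in> {0..} ==> at x within {0..} \<noteq> (bot :: real filter)"
 unfolding trivial_limit_within islimpt_approachable
proof clarsimp
 fix e :: real assume "0 <= x" "0 < e"
 then show "\<exists>x'\<in>{0..}. x' \<noteq> x \<and> dist x' x < e"
  by (intro bexI[of _ "x + e / 2"]) (auto simp: dist_real_def)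
qed

text \<open>Differentiation under the integral sign. The star condition keeps the rescaled argument inside \<open>S\<close>.\<close>

lemma diffs_on_integral:
 fixes g :: "real => 'b::banach" and h :: "real => real"
 assumes S: "convex S" and star: "!!x \<theta>. x \<in> S ==> \<theta> \<in> {0..1} ==> h \<theta> * x \<in> S"
  and h: "continuous_on {0..1} h"
 shows "diffs_on k S g ==> continuous_on {0..1} \<kappa> ==>
   diffs_on k S (%x. integral {0..1} (%\<theta>. \<kappa> \<theta> *\<^sub>R g (h \<theta> * x)))"
proof (induction k arbitrary: g \<kappa>)
 have c: "continuous_on (S \<times> {0..1}) (%(x, \<theta>). \<kappa> \<theta> *\<^sub>R g (h \<theta> * x))"
  if "continuous_on S g" "continuous_on {0..1} \<kappa>" for g :: "real => 'b" and \<kappa> :: "real => real"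
  unfolding split_def
  by (intro continuous_intros continuous_on_compose2[OF that(1)] continuous_on_compose2[OF that(2)]
    continuous_on_compose2[OF h]) (use star in auto)
 {
  case 0
  then show ?case using integral_continuous_on_param[of S 0 1 "%x \<theta>. \<kappa> \<theta> *\<^sub>R g (h \<theta> * x)"] c by simp
 next
  case (Suc k)
  from Suc.prems obtain g' where g': "\<forall>x\<in>S. (g has_vector_derivative g' x) (at x within S)" "diffs_on k S g'" by auto
  have \<kappa>h: "continuous_on {0..1} (%\<theta>. \<kappa> \<theta> * h \<theta>)" using Suc.prems(2) h by (intro continuous_intros)
  have gc: "continuous_on S g" using Suc.prems(1) diffs_on_continuous by blast
  show ?case
  proof (rule diffs_onI[where f' = "%x. integral {0..1} (%\<theta>. (\<kappa> \<theta> * h \<theta>) *\<^sub>R g' (h \<theta> * x))"])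
   show "diffs_on k S (%x. integral {0..1} (%\<theta>. (\<kappa> \<theta> * h \<theta>) *\<^sub>R g' (h \<theta> * x)))"
    by (rule Suc.IH[OF g'(2) \<kappa>h])
   fix x assume x: "x \<in> S"
   show "((%x. integral {0..1} (%\<theta>. \<kappa> \<theta> *\<^sub>R g (h \<theta> * x))) has_vector_derivative
     integral {0..1} (%\<theta>. (\<kappa> \<theta> * h \<theta>) *\<^sub>R g' (h \<theta> * x))) (at x within S)"
    unfolding cbox_interval[symmetric]
   proof (rule leibniz_rule_vector_derivative[OF _ _ _ x S])
    fix y t :: real assume y: "y \<in> S" and t: "t \<in> cbox 0 1"
    have "((%x. h t * x) has_vector_derivative h t) (at y within S)"
     by (auto intro!: derivative_eq_intros simp flip: has_real_derivative_iff_has_vector_derivative)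
    then have "((%x. g (h t * x)) has_vector_derivative h t *\<^sub>R g' (h t * y)) (at y within S)"
     by (rule vector_chain_within[of "%x. h t * x" _ y S g _ S]) (use g'(1) star y t in auto)
    then show "((%x. \<kappa> t *\<^sub>R g (h t * x)) has_vector_derivative (\<kappa> t * h t) *\<^sub>R g' (h t * y)) (at y within S)"
     using bounded_linear.has_vector_derivative[OF bounded_linear_scaleR_right, of "%x. g (h t * x)" _ _ "\<kappa> t"] by fastforce
   next
    fix y assume y: "y \<in> S"
    have "continuous_on {0..1} (%\<theta>. \<kappa> \<theta> *\<^sub>R g (h \<theta> * y))"
     by (intro continuous_intros Suc.prems(2) continuous_on_compose2[OF gc] h) (use star y in auto)
    then show "(%\<theta>. \<kappa> \<theta> *\<^sub>R g (h \<theta> * y)) integrable_on cbox 0 1"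
     using integrable_continuous_interval by (simp add: cbox_interval)
   next
    show "continuous_on (S \<times> cbox 0 1) (%(x, t). (\<kappa> t * h t) *\<^sub>R g' (h t * x))"
     using c[OF diffs_on_continuous[OF g'(2)] \<kappa>h] by (simp add: cbox_interval)
   qed
  qed
 }
qed

lemma diffs_on_average:
 fixes g :: "real => 'b::banach"
 assumes "!!k. diffs_on k UNIV g"
 shows "diffs_on k UNIV (%x. integral {0..1} (%\<theta>. g (\<theta> * x)))"
 using diffs_on_integral[of UNIV "%\<theta>. \<theta>" k g "%_. 1"] assms by simp

lemma average_eq:
 fixes f :: "real => 'b::banach"
 assumes "!!x. (f has_vector_derivative f' x) (at x)"
 shows "s *\<^sub>R integral {0..1} (%\<theta>. f' (\<theta> * s)) = f s - f 0"
proof -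
 have "((%\<theta>. f (\<theta> * s)) has_vector_derivative s *\<^sub>R f' (\<theta> * s)) (at \<theta> within {0..1})" for \<theta>
 proof -
  have "((%\<theta>. \<theta> * s) has_vector_derivative s) (at \<theta>)"
   by (auto intro!: derivative_eq_intros simp flip: has_real_derivative_iff_has_vector_derivative)
  then have "((%\<theta>. f (\<theta> * s)) has_vector_derivative s *\<^sub>R f' (\<theta> * s)) (at \<theta>)"
   by (rule vector_chain_within[of "%\<theta>. \<theta> * s" _ \<theta> UNIV f _ UNIV]) (use assms in auto)
  then show ?thesis by (rule has_vector_derivative_at_within)
 qed
 then have "((%\<theta>. s *\<^sub>R f' (\<theta> * s)) has_integral f (1 * s) - f (0 * s)) {0..1}"
  by (intro fundamental_theorem_of_calculus) auto
 from integral_unique[OF this] show ?thesis by simp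
qed

text \<open>The quotient \<open>f' / sinh\<close> stays smooth at 0, because \<open>f'\<close> is odd: both \<open>f' s / s\<close> and \<open>sinh s / s\<close> are averages of smooth functions.\<close>

lemma even_deriv_quotient:
 fixes f :: "real => 'b::banach"
 assumes sm: "!!k. diffs_on k UNIV f" and ev: "!!s. f (- s) = f s"
 shows "\<exists>T. (\<forall>k. diffs_on k UNIV T) \<and> (\<forall>s. T (- s) = T s) \<and>
   (\<forall>s. (f has_vector_derivative (sinh s / 2) *\<^sub>R T s) (at s))"
proof -
 obtain f1 where f1: "!!x. (f has_vector_derivative f1 x) (at x)" "!!k. diffs_on k UNIV f1"
  using diffs_on_derivative[of UNIV f] sm by auto
 obtain f2 where f2: "!!x. (f1 has_vector_derivative f2 x) (at x)" "!!k. diffs_on k UNIV f2"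
  using diffs_on_derivative[of UNIV f1] f1(2) by auto
 have neg: "((%x::real. - x) has_vector_derivative -1) (at x)" for x
  by (auto intro!: derivative_eq_intros simp flip: has_real_derivative_iff_has_vector_derivative)
 have odd1: "f1 (- s) = - f1 s" for s
 proof -
  have "((%x. f (- x)) has_vector_derivative (-1) *\<^sub>R f1 (- s)) (at s)"
   by (rule vector_chain_within[OF neg f1(1) subset_UNIV])
  then have "(f has_vector_derivative - f1 (- s)) (at s)" using ev by simp
  then have "- f1 (- s) = f1 s" using f1(1) vector_derivative_unique_at by blast
  then show ?thesis by (metis minus_minus)
 qed
 have even2: "f2 (- s) = f2 s" for s
 proof -
  have "((%x. f1 (- x)) has_vector_derivative (-1) *\<^sub>R f2 (- s)) (at s)"
   by (rule vector_chain_within[OF neg f2(1) subset_UNIV])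
  then have "((%x. - f1 x) has_vector_derivative - f2 (- s)) (at s)" using odd1 by simp
  then have "((%x. - (- f1 x)) has_vector_derivative - (- f2 (- s))) (at s)" by (rule has_vector_derivative_minus)
  then have "(f1 has_vector_derivative f2 (- s)) (at s)" by simp
  then show ?thesis using f2(1) vector_derivative_unique_at by blast
 qed
 have f10: "f1 0 = 0" using odd1[of 0] by (simp add: eq_neg_iff_add_eq_0 flip: scaleR_2)
 define g where "g s = integral {0..1} (%\<theta>. f2 (\<theta> * s))" for s
 define c where "c s = integral {0..1} (%\<theta>. cosh (\<theta> * s))" for s :: real
 have g: "s *\<^sub>R g s = f1 s" for s using average_eq[of f1 f2 s] f2(1) f10 by (simp add: g_def)
 have "(sinh has_vector_derivative cosh x) (at x)" for x :: real
  by (auto intro!: derivative_eq_intros simp flip: has_real_derivative_iff_has_vector_derivative)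
 then have c: "s * c s = sinh s" for s using average_eq[of sinh cosh s] by (simp add: c_def)
 have c1: "c s >= 1" for s
 proof -
  have i: "(%\<theta>. cosh (\<theta> * s)) integrable_on {0..1}"
   by (intro integrable_continuous_interval continuous_intros)
  have "integral {0..1} (%\<theta>::real. 1::real) <= c s" unfolding c_def
   by (rule integral_le) (use i cosh_real_ge_1 in auto)
  then show ?thesis by simp
 qed
 define T where "T s = (2 * inverse (c s)) *\<^sub>R g s" for s
 have c0: "c s \<noteq> 0" for s using c1[of s] by linarith
 have "diffs_on k UNIV T" for k
  unfolding T_def[abs_def] using c0
  by (intro diffs_on_scaleR diffs_on_mult diffs_on_const diffs_on_recip)
    (auto simp: g_def[abs_def] c_def[abs_def] intro!: diffs_on_average f2 diffs_on_sinh_cosh)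
 moreover have "T (- s) = T s" for s
  unfolding T_def g_def c_def by (simp add: even2)
 moreover have "(sinh s / 2) *\<^sub>R T s = f1 s" for s
  unfolding T_def c[of s, symmetric] using c0[of s] g[of s] by (simp add: mult.commute)
 ultimately show ?thesis using f1(1) by metis
qed

definition sv :: "real => real" where "sv v = 2 * arsinh (sqrt v)"

lemma sv_deriv: assumes "v > 0" shows "(sv has_real_derivative 1 / sqrt (v * (1 + v))) (at v)"
proof -
 have "(sv has_real_derivative 2 * (1 / sqrt ((sqrt v)\<^sup>2 + 1) * (inverse (sqrt v) / 2))) (at v)"
  unfolding sv_def[abs_def]
  by (rule DERIV_cmult, rule DERIV_chain2[OF arsinh_real_has_field_derivative DERIV_real_sqrt[OF assms]])
 moreover have "2 * (1 / sqrt ((sqrt v)\<^sup>2 + 1) * (inverse (sqrt v) / 2)) = 1 / sqrt (v * (1 + v))"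
 proof -
  have "(sqrt v)\<^sup>2 = v" "sqrt (v * (1 + v)) = sqrt v * sqrt (v + 1)" "sqrt v > 0" "sqrt (v + 1) > 0"
   using assms by (simp_all add: real_sqrt_mult add.commute)
  then show ?thesis by (simp add: field_simps)
 qed
 ultimately show ?thesis by (simp only:)
qed

lemma sinh_sv: "v >= 0 ==> sinh (sv v / 2) = sqrt v" "v >= 0 ==> sinh (sv v) / 2 = sqrt (v * (1 + v))"
proof -
 show 1: "v >= 0 ==> sinh (sv v / 2) = sqrt v" by (simp add: sv_def)
 assume v: "v >= 0"
 have "sinh (sv v) = 2 * sinh (arsinh (sqrt v)) * cosh (arsinh (sqrt v))"
  unfolding sv_def by (rule sinh_double)
 also have "... = 2 * sqrt v * sqrt (v + 1)" using v by (simp add: cosh_arsinh_real)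
 finally show "sinh (sv v) / 2 = sqrt (v * (1 + v))" by (simp add: real_sqrt_mult add.commute)
qed

lemma sv_nonneg: "v >= 0 ==> sv v >= 0"
 unfolding sv_def by (metis arsinh_real_neg_iff linorder_not_le mult_nonneg_nonneg real_sqrt_ge_zero zero_le_numeral)

lemma sv_sinh: "s >= 0 ==> sv ((sinh (s / 2))\<^sup>2) = s"
 by (simp add: sv_def arsinh_sinh_real)

lemma continuous_on_sv: "continuous_on S sv"
 unfolding sv_def[abs_def] by (intro continuous_intros)

text \<open>Whitney: a smooth even function is a smooth function of \<open>sinh\<^sup>2 (s/2)\<close>. Each derivative in \<open>v\<close> is again smooth and even in \<open>s\<close> by the preceding lemma, which closes the induction.\<close>

lemma even_smooth_halfline:
 fixes f :: "real => 'b::banach"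
 assumes "!!k. diffs_on k UNIV f" "!!s. f (- s) = f s"
 shows "diffs_on k {0..} (%v. f (sv v))"
 using assms
proof (induction k arbitrary: f)
 case 0
 then have "continuous_on UNIV f" using diffs_on_continuous by blast
 then show ?case using continuous_on_compose2[OF _ continuous_on_sv] by auto
next
 case (Suc k)
 obtain T where T: "!!k. diffs_on k UNIV T" "!!s. T (- s) = T s"
  "!!s. (f has_vector_derivative (sinh s / 2) *\<^sub>R T s) (at s)"
  using even_deriv_quotient[OF Suc.prems] by blast
 have Tc: "continuous_on S (%v. T (sv v))" for S
  by (rule continuous_on_compose2[OF _ continuous_on_sv]) (use T(1) diffs_on_continuous in blast, simp)
 have fc: "continuous_on S (%v. f (sv v))" for S
  by (rule continuous_on_compose2[OF _ continuous_on_sv]) (use Suc.prems(1) diffs_on_continuous in blast, simp)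
 have d: "((%v. f (sv v)) has_vector_derivative T (sv v)) (at v)" if v: "v > 0" for v
 proof -
  have "((%v. f (sv v)) has_vector_derivative (1 / sqrt (v * (1 + v))) *\<^sub>R ((sinh (sv v) / 2) *\<^sub>R T (sv v))) (at v)"
   by (rule vector_chain_within[OF sv_deriv[OF v, unfolded has_real_derivative_iff_has_vector_derivative] T(3) subset_UNIV])
  moreover have "sqrt (v * (1 + v)) \<noteq> 0" using v by simp
  ultimately show ?thesis using v by (simp add: sinh_sv(2))
 qed
 have eq: "f (sv v) = f (sv 0) + integral {0..v} (%v. T (sv v))" if "v >= 0" for v
  using fundamental_theorem_of_calculus_interior[OF that fc d] by (auto simp: integral_unique)
 show ?case
 proof (rule diffs_onI[OF _ Suc.IH[OF T(1,2)]])
  fix v :: real assume v: "v \<in> {0..}"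
  have "((%u. integral {0..u} (%v. T (sv v))) has_vector_derivative T (sv v)) (at v within {0..v+1})"
   by (rule integral_has_vector_derivative[OF Tc]) (use v in auto)
  then have "((%u. f (sv 0) + integral {0..u} (%v. T (sv v))) has_vector_derivative 0 + T (sv v)) (at v within {0..v+1})"
   by (intro has_vector_derivative_add has_vector_derivative_const)
  then have "((%u. f (sv u)) has_vector_derivative T (sv v)) (at v within {0..v+1})"
   unfolding add_0 by (rule has_vector_derivative_transform[rotated 2]) (use v in \<open>auto intro: eq\<close>)
  moreover have "at v within {0..v+1} = at v within {0..}"
   by (rule at_within_nhd[of v "{..<v+1}"]) auto
  ultimately show "hder (%u. f (sv u)) (T (sv v)) v" by simp
 qed
qed

section \<open>Smooth radial functions\<close>

lemma Ck_on_cong: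
 assumes M: "open M"
 shows "(!!x. x \<in> M ==> f x = g x) ==> Ck_on k M f ==> Ck_on k M g"
proof (induction k arbitrary: f g)
 case 0 then show ?case using continuous_on_eq[of M f g] by simp
next
 case (Suc k)
 have d: "(g has_derivative frechet_derivative f (at x)) (at x)" if x: "x \<in> M" for x
 proof -
  have "(f has_derivative frechet_derivative f (at x)) (at x)"
   using Suc.prems(2) x by (simp add: frechet_derivative_works)
  then show ?thesis using has_derivative_transform_within_open[OF _ M x] Suc.prems(1) by blast
 qed
 have e: "frechet_derivative g (at x) = frechet_derivative f (at x)" if "x \<in> M" for x
  using d[OF that] frechet_derivative_at by metis
 have "Ck_on k M (%x. frechet_derivative g (at x) v)" for v
  by (rule Suc.IH[of "%x. frechet_derivative f (at x) v"]) (use Suc.prems(2) e in auto)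
 then show ?case using d by (auto simp: differentiable_def)
qed

lemma Ck_on_SucI:
 assumes M: "open M" and d: "!!x. x \<in> M ==> (f has_derivative f' x) (at x)"
  and c: "!!v. Ck_on k M (%x. f' x v)"
 shows "Ck_on (Suc k) M f"
proof -
 have e: "frechet_derivative f (at x) = f' x" if "x \<in> M" for x
  using d[OF that] frechet_derivative_at by metis
 have "Ck_on k M (%x. frechet_derivative f (at x) v)" for v
  by (rule Ck_on_cong[OF M _ c]) (simp add: e)
 then show ?thesis using d by (auto simp: differentiable_def)
qed

lemma Ck_on_deriv: "Ck_on (Suc k) M f ==> x \<in> M ==> (f has_derivative frechet_derivative f (at x)) (at x)"
 by (simp add: frechet_derivative_works)

lemma Ck_on_continuous: "Ck_on k M f ==> continuous_on M f"
 by (cases k) (auto intro!: continuous_at_imp_continuous_on differentiable_imp_continuous_within)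

lemma Ck_on_SucD: "Ck_on (Suc k) M f ==> Ck_on k M f"
proof (induction k arbitrary: f)
 case 0 then show ?case using Ck_on_continuous by (metis Ck_on.simps(1))
next
 case (Suc k)
 then have "\<forall>x\<in>M. f differentiable (at x)" "!!v. Ck_on (Suc k) M (%x. frechet_derivative f (at x) v)"
  by (auto simp only: Ck_on.simps(2)[of "Suc k"])
 then show ?case using Suc.IH by auto
qed

lemma Ck_on_const: "open M ==> Ck_on k M (%x. c)"
proof (induction k arbitrary: c)
 case (Suc k) show ?case by (rule Ck_on_SucI[OF Suc.prems, where f' = "%x v. 0"]) (use Suc in auto)
qed simp

lemma Ck_on_linear: assumes "open M" "bounded_linear L" shows "Ck_on k M L"
proof (cases k)
 case 0 then show ?thesis using assms(2) linear_continuous_on by auto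
next
 case (Suc l)
 then show ?thesis using assms
  by (auto intro!: Ck_on_SucI[where f' = "%x. L"] Ck_on_const bounded_linear_imp_has_derivative simp del: Ck_on.simps)
qed

lemma Ck_on_add: assumes M: "open M" shows "Ck_on k M f ==> Ck_on k M g ==> Ck_on k M (%x. f x + g x)"
proof (induction k arbitrary: f g)
 case 0 then show ?case by (auto intro: continuous_intros)
next
 case (Suc k)
 show ?case
  by (rule Ck_on_SucI[OF M has_derivative_add[OF Ck_on_deriv[OF Suc.prems(1)] Ck_on_deriv[OF Suc.prems(2)]]])
    (use Suc in auto)
qed

lemma Ck_on_bilinear:
 assumes M: "open M" and B: "bounded_bilinear B"
 shows "Ck_on k M f ==> Ck_on k M g ==> Ck_on k M (%x. B (f x) (g x))"
proof (induction k arbitrary: f g)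
 case 0 then show ?case using bounded_bilinear.continuous_on[OF B] by auto
next
 case (Suc k)
 have s: "Ck_on k M f" "Ck_on k M g" using Suc.prems Ck_on_SucD by blast+
 show ?case
  by (rule Ck_on_SucI[OF M bounded_bilinear.FDERIV[OF B Ck_on_deriv[OF Suc.prems(1)] Ck_on_deriv[OF Suc.prems(2)]]])
    (use Suc s in \<open>auto intro!: Ck_on_add[OF M]\<close>)
qed

lemma Ck_on_inverse:
 fixes f :: "'a::euclidean_space => real"
 assumes M: "open M" and nz: "!!x. x \<in> M ==> f x \<noteq> 0"
 shows "Ck_on k M f ==> Ck_on k M (%x. inverse (f x))"
proof (induction k)
 case 0 then show ?case using nz by (auto intro!: continuous_intros)
next
 case (Suc k)
 have i: "Ck_on k M (%x. inverse (f x))" using Suc Ck_on_SucD by blast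
 show ?case
 proof (rule Ck_on_SucI[OF M Deriv.has_derivative_inverse[OF nz Ck_on_deriv[OF Suc.prems]]])
  fix v
  have "Ck_on k M (%x. (-1) * (inverse (f x) * frechet_derivative f (at x) v * inverse (f x)))"
   using i Suc.prems by (intro Ck_on_bilinear[OF M bounded_bilinear_mult] Ck_on_const[OF M]) auto
  then show "Ck_on k M (%x. - (inverse (f x) * frechet_derivative f (at x) v * inverse (f x)))" by simp
 qed auto
qed

lemma has_derivative_halfline_compose:
 fixes F :: "real => 'b::real_normed_vector"
 assumes M: "open M" and x: "x \<in> M" and w0: "!!x. x \<in> M ==> w x >= 0"
  and F: "(F has_vector_derivative F') (at (w x) within {0..})"
  and w: "(w has_derivative w') (at x)"
 shows "((%x. F (w x)) has_derivative (%h. w' h *\<^sub>R F')) (at x)"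
proof -
 have "w ` M \<subseteq> {0..}" using w0 by auto
 then have "(F has_derivative (%h. h *\<^sub>R F')) (at (w x) within w ` M)"
  using F unfolding has_vector_derivative_def by (rule has_derivative_subset[rotated])
 then have "((%x. F (w x)) has_derivative (%h. w' h *\<^sub>R F')) (at x within M)"
  using has_derivative_in_compose[of w w' x M F] has_derivative_at_withinI[OF w] by blast
 then show ?thesis by (simp add: at_within_open[OF x M])
qed

lemma Ck_on_halfline_compose:
 fixes F :: "real => 'b::real_normed_vector"
 assumes M: "open M" and w0: "!!x. x \<in> M ==> w x >= 0"
 shows "diffs_on k {0..} F ==> Ck_on k M w ==> Ck_on k M (%x. F (w x))"
proof (induction k arbitrary: F)
 case 0 then show ?case using w0 continuous_on_compose2[of "{0..}" F M w] by auto
next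
 case (Suc k)
 then obtain F' where F': "\<forall>x\<in>{0..}. hder F (F' x) x" "diffs_on k {0..} F'" by auto
 have s: "Ck_on k M w" using Suc.prems Ck_on_SucD by blast
 show ?case
 proof (rule Ck_on_SucI[OF M])
  fix x assume x: "x \<in> M"
  show "((%x. F (w x)) has_derivative (%h. frechet_derivative w (at x) h *\<^sub>R F' (w x))) (at x)"
   by (rule has_derivative_halfline_compose[OF M x w0]) (use F'(1) w0[OF x] Ck_on_deriv[OF Suc.prems(2) x] in auto)
 next
  fix v
  show "Ck_on k M (%x. frechet_derivative w (at x) v *\<^sub>R F' (w x))"
   using Suc.prems(2) by (intro Ck_on_bilinear[OF M bounded_bilinear_scaleR] Suc.IH[OF F'(2) s]) auto
 qed
qed

lemma open_DR: "open (DR :: ('n::euclidean_space \<times> real) set)"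
 unfolding DR_def by (intro open_Times) auto

lemma Ck_on_vertical_curve:
 fixes f :: "'n::euclidean_space \<times> real => 'b::real_normed_vector"
 shows "Ck_on k DR f ==> diffs_on k UNIV (%s. f (0, exp s))"
proof (induction k arbitrary: f)
 case 0
 then have "continuous_on DR f" by simp
 have "continuous_on UNIV (%s::real. (0::'n, exp s))" by (intro continuous_intros)
 then have "continuous_on UNIV (%s. f (0, exp s))"
  by (rule continuous_on_compose2[OF \<open>continuous_on DR f\<close>]) (auto simp: DR_def)
 then show ?case by simp
next
 case (Suc k)
 let ?f' = "%x. frechet_derivative f (at x) (0, 1)"
 show ?case
 proof (rule diffs_onI[where f' = "%s. exp s *\<^sub>R ?f' (0, exp s)"])
  fix s :: real
  have "((%s. (0::'n, exp s)) has_derivative (%h. (0, exp s * h))) (at s)"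
   by (auto intro!: derivative_eq_intros)
  moreover have "(0::'n, exp s) \<in> DR" by (simp add: DR_def)
  ultimately have "((%s. f (0, exp s)) has_derivative (%h. frechet_derivative f (at (0, exp s)) (0, exp s * h))) (at s)"
   using has_derivative_compose[of "%s. (0::'n, exp s)" _ s UNIV f] Ck_on_deriv[OF Suc.prems] by blast
  moreover have "frechet_derivative f (at (0, exp s)) (0, exp s * h) = h *\<^sub>R exp s *\<^sub>R ?f' (0, exp s)" for h
  proof -
   have "linear (frechet_derivative f (at (0, exp s)))"
    using Ck_on_deriv[OF Suc.prems \<open>(0, exp s) \<in> DR\<close>] has_derivative_linear by blast
   then have "frechet_derivative f (at (0, exp s)) ((h * exp s) *\<^sub>R (0, 1)) = (h * exp s) *\<^sub>R ?f' (0, exp s)"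
    by (rule linear_scale)
   then show ?thesis by (simp add: mult.commute)
  qed
  ultimately show "((%s. f (0, exp s)) has_vector_derivative exp s *\<^sub>R ?f' (0, exp s)) (at s within UNIV)"
   by (simp add: has_vector_derivative_def)
 next
  have "Ck_on k DR ?f'" using Suc.prems by simp
  then show "diffs_on k UNIV (%s. exp s *\<^sub>R ?f' (0, exp s))"
   by (intro diffs_on_scaleR diffs_on_exp Suc.IH)
 qed
qed

context htype
begin

lemma Ck_on_vv: "Ck_on k DR vv"
proof -
 note O = open_DR
 have s: "Ck_on k DR (snd :: 'n \<times> real => real)" by (rule Ck_on_linear[OF O bounded_linear_snd])
 have v: "Ck_on k DR (%x::'n \<times> real. vp (fst x))"
  by (rule Ck_on_linear[OF O bounded_linear_compose[OF bounded_linear_vp bounded_linear_fst]])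
 have z: "Ck_on k DR (%x::'n \<times> real. zp (fst x))"
  by (rule Ck_on_linear[OF O bounded_linear_compose[OF bounded_linear_zp bounded_linear_fst]])
 note ops = Ck_on_add[OF O] Ck_on_bilinear[OF O bounded_bilinear_mult] Ck_on_bilinear[OF O bounded_bilinear_inner] Ck_on_const[OF O]
 have BB: "Ck_on k DR BB"
  unfolding BB_def[abs_def] divide_inverse by (intro ops s v)
 have NN: "Ck_on k DR NN"
  unfolding NN_def[abs_def] power2_eq_square by (intro ops BB z)
 have "Ck_on k DR (%x. NN x * inverse (4 * snd x) + (-1))"
  by (intro ops NN Ck_on_inverse[OF O] s) (simp add: DR_iff)
 moreover have "vv = (%x. NN x * inverse (4 * snd x) + (-1))"
  by (rule ext) (simp only: vv_def divide_inverse diff_conv_add_uminus)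
 ultimately show ?thesis by simp
qed

lemma vv_ge0: "x \<in> DR ==> vv x >= 0" by (simp add: vv_nonneg DR_iff)

lemma smooth_on_radial: "(!!k. diffs_on k {0..} F) ==> smooth_on DR (%x. F (vv x))"
 unfolding smooth_on_def by (auto intro!: Ck_on_halfline_compose[OF open_DR vv_ge0] Ck_on_vv)

lemma rr_sv: "rr x = sv (vv x)" by (simp add: rr_def sv_def)

lemma vv_rr: "x \<in> DR ==> vv x = (sinh (rr x / 2))\<^sup>2"
 using vv_ge0[of x] by (simp add: rr_sv sinh_sv(1))

lemma rr_nonneg: "x \<in> DR ==> rr x >= 0" by (simp add: rr_sv sv_nonneg vv_ge0)

lemma vv_vertical: "vv (0, exp s) = (sinh (s / 2))\<^sup>2"
proof -
 have e: "exp s = (exp (s/2))\<^sup>2" by (simp add: power2_eq_square flip: exp_add)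
 have "vv (0, exp s) = ((1 + exp s)\<^sup>2) / (4 * exp s) - 1" by (simp add: vv_def NN_def BB_def vp_simps zp_simps)
 also have "... = (exp s - 1)\<^sup>2 / (4 * exp s)" by (simp add: field_simps power2_eq_square)
 also have "... = ((exp (s/2) - exp (-(s/2))) / 2)\<^sup>2"
  unfolding e exp_minus by (simp add: field_simps power2_eq_square)
 finally show ?thesis by (simp add: sinh_def)
qed

lemma radial_iff: "radial br f \<longleftrightarrow> (\<forall>x\<in>DR. \<forall>y\<in>DR. vv x = vv y \<longrightarrow> f x = f y)"
proof -
 have "rr x = rr y \<longleftrightarrow> vv x = vv y" if "x \<in> DR" "y \<in> DR" for x y
  using vv_rr[OF that(1)] vv_rr[OF that(2)] rr_sv[of x] rr_sv[of y] by metis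
 then show ?thesis unfolding radial_def by (auto simp: DR_dist_eq)
qed

lemma vertical_DR: "(0::'n, exp s) \<in> DR" by (simp add: DR_def)

text \<open>On the vertical geodesic \<open>s \<mapsto> (0, exp s)\<close> a radial function becomes an even function of \<open>s\<close>.\<close>

lemma smooth_radial_profile:
 assumes f: "smooth_on DR f" "radial br f"
 shows "\<exists>F. (\<forall>k. diffs_on k {0..} F) \<and> (\<forall>x\<in>DR. f x = F (vv x))"
proof (intro exI conjI)
 show "\<forall>k. diffs_on k {0..} (%v. (%s. f (0, exp s)) (sv v))"
 proof (intro allI even_smooth_halfline)
  show "diffs_on k UNIV (%s. f (0, exp s))" for k using f(1) Ck_on_vertical_curve by (auto simp: smooth_on_def)
  show "f (0, exp (- s)) = f (0, exp s)" for s
  proof -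
   have "vv (0, exp (- s)) = vv (0, exp s)" unfolding vv_vertical by simp
   then show ?thesis using f(2) vertical_DR unfolding radial_iff by blast
  qed
 qed
 show "\<forall>x\<in>DR. f x = (%v. f (0, exp (sv v))) (vv x)"
 proof
  fix x :: "'n \<times> real" assume x: "x \<in> DR"
  have "vv (0, exp (sv (vv x))) = vv x" using vv_ge0[OF x] by (simp only: vv_vertical sinh_sv(1)) simp
  then show "f x = f (0, exp (sv (vv x)))" using f(2) vertical_DR x unfolding radial_iff by metis
 qed
qed

lemma profile_eq: assumes "s >= 0" "!!x. x \<in> DR ==> f x = F (vv x)"
 shows "profile br f s = F ((sinh (s / 2))\<^sup>2)"
proof -
 let ?P = "%x. x \<in> DR \<and> DR_dist br DR_one x = s"
 have "?P (0, exp s)"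
  using vertical_DR[of s] assms(1) by (auto simp: DR_dist_eq rr_sv vv_vertical sv_sinh)
 then have "?P (SOME x. ?P x)" by (rule someI)
 then have "(SOME x. ?P x) \<in> DR" "rr (SOME x. ?P x) = s" by (auto simp: DR_dist_eq)
 then show ?thesis unfolding profile_def using assms(2) vv_rr by simp
qed

lemma laplacian_radial:
 fixes F :: "real => complex"
 assumes f: "!!x. x \<in> DR ==> f x = F (vv x)"
  and F1: "!!v. v >= 0 ==> hder F (F1 v) v"
  and F2: "!!v. v >= 0 ==> hder F1 (F2 v) v"
  and x: "x \<in> DR"
 shows "DR_laplacian br f x = (vv x * (1 + vv x)) *\<^sub>R F2 (vv x) + ((Q + 1) * vv x + nS / 2) *\<^sub>R F1 (vv x)"
proof -
 have a: "snd x > 0" using x by (simp add: DR_iff)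
 have df: "frechet_derivative f (at y) j = dvv y j *\<^sub>R F1 (vv y)" if y: "y \<in> DR" for y j
 proof -
  have "((%x. F (vv x)) has_derivative (%h. dvv y h *\<^sub>R F1 (vv y))) (at y)"
   by (rule has_derivative_halfline_compose[OF open_DR y vv_ge0 F1 vv_deriv]) (use y vv_ge0 in \<open>auto simp: DR_iff\<close>)
  then have "(f has_derivative (%h. dvv y h *\<^sub>R F1 (vv y))) (at y)"
   using has_derivative_transform_within_open[OF _ open_DR y] f by (metis (no_types, lifting))
  then show ?thesis using frechet_derivative_at by metis
 qed
 have inner_eq: "sqrt (gram_det met y) *\<^sub>R (\<Sum>j\<in>Basis. cometric met y i j *\<^sub>R frechet_derivative f (at y) j)
   = inner (hh (snd y) *\<^sub>R TT y) i *\<^sub>R F1 (vv y)" if y: "y \<in> DR" and i: "i \<in> Basis" for y i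
 proof -
  have ay: "snd y > 0" using y by (simp add: DR_iff)
  have "(\<Sum>j\<in>Basis. cometric met y i j *\<^sub>R frechet_derivative f (at y) j)
    = (\<Sum>j\<in>Basis. cmet y i j * met y (TT y) j) *\<^sub>R F1 (vv y)"
   unfolding df[OF y] cometric_eq[OF ay] met_TT[OF ay] by (simp add: scaleR_sum_left)
  then show ?thesis unfolding sum_cmet[OF ay i] sqrt_gram_det[OF ay] by simp
 qed
 have D: "frechet_derivative (%y. sqrt (gram_det met y) *\<^sub>R (\<Sum>j\<in>Basis. cometric met y i j *\<^sub>R frechet_derivative f (at y) j)) (at x) i
   = (inner (hh (snd x) *\<^sub>R TT x) i * dvv x i) *\<^sub>R F2 (vv x) + inner (dhT x i) i *\<^sub>R F1 (vv x)" if i: "i \<in> Basis" for i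
 proof -
  have "((%y. F1 (vv y)) has_derivative (%h. dvv x h *\<^sub>R F2 (vv x))) (at x)"
   by (rule has_derivative_halfline_compose[OF open_DR x vv_ge0 F2 vv_deriv]) (use x vv_ge0 a in auto)
  then have "((%y. inner (hh (snd y) *\<^sub>R TT y) i *\<^sub>R F1 (vv y)) has_derivative
    (%h. inner (hh (snd x) *\<^sub>R TT x) i *\<^sub>R dvv x h *\<^sub>R F2 (vv x) + inner (dhT x h) i *\<^sub>R F1 (vv x))) (at x)"
   by (rule has_derivative_scaleR[OF has_derivative_inner_left[OF hT_deriv[OF a]]])
  then have "((%y. sqrt (gram_det met y) *\<^sub>R (\<Sum>j\<in>Basis. cometric met y i j *\<^sub>R frechet_derivative f (at y) j)) has_derivative
    (%h. inner (hh (snd x) *\<^sub>R TT x) i *\<^sub>R dvv x h *\<^sub>R F2 (vv x) + inner (dhT x h) i *\<^sub>R F1 (vv x))) (at x)"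
   by (rule has_derivative_transform_within_open[OF _ open_DR x]) (simp add: inner_eq[OF _ i])
  from frechet_derivative_at[OF this] show ?thesis by (metis (no_types, lifting) scaleR_scaleR)
 qed
 have l: "linear (dvv x)" using vv_deriv[OF a, of UNIV] has_derivative_linear by blast
 have s1: "(\<Sum>i\<in>Basis. inner (hh (snd x) *\<^sub>R TT x) i * dvv x i) = hh (snd x) * (vv x * (1 + vv x))"
  unfolding linear_basis_sum_real(1)[OF l] linear_scale[OF l] dvv_TT[OF a] by simp
 have "DR_laplacian br f x = (1 / hh (snd x)) *\<^sub>R (\<Sum>i\<in>Basis.
   (inner (hh (snd x) *\<^sub>R TT x) i * dvv x i) *\<^sub>R F2 (vv x) + inner (dhT x i) i *\<^sub>R F1 (vv x))"
  unfolding DR_laplacian_def laplace_beltrami_def sqrt_gram_det[OF a]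
  by (rule arg_cong[where f = "%z. _ *\<^sub>R z"]) (rule sum.cong[OF refl D])
 also have "... = (1 / hh (snd x)) *\<^sub>R ((hh (snd x) * (vv x * (1 + vv x))) *\<^sub>R F2 (vv x)
   + (hh (snd x) * ((Q + 1) * vv x + nS / 2)) *\<^sub>R F1 (vv x))"
  unfolding sum.distrib scaleR_sum_left[symmetric] s1 div_hT[OF a] ..
 also have "... = (vv x * (1 + vv x)) *\<^sub>R F2 (vv x) + ((Q + 1) * vv x + nS / 2) *\<^sub>R F1 (vv x)"
  using hh_pos[OF a] by (simp add: scaleR_add_right)
 finally show ?thesis .
qed

end

section \<open>The radial Laplacian\<close>

context htype
begin

definition cS :: real where "cS = (real (mz br) + 1) / 2"

lemma nS_cS: "nS / 2 + cS = Q + 1"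
 by (simp add: nS_def cS_def dimS_def hdim_def field_simps)

lemma dimS_ge2: "dimS br >= 2" using mz_pos by (simp add: dimS_def)

text \<open>The operator \<open>gr\<close> is the mean \<open>f \<mapsto> (1 / WW s) \<integral> AA f\<close> over a ball (lemma \<open>WW_gr\<close>). The formula after the substitution \<open>w = y\<^sup>2 v\<close> shows that it preserves smoothness up to \<open>v = 0\<close>.\<close>

definition gw :: "(real => 'b::banach) => real => 'b" where
 "gw f w = (1 + w) powr (cS - 1) *\<^sub>R f w"

definition gJ :: "(real => 'b::banach) => real => 'b" where
 "gJ f v = integral {0..1} (%y. (2 * y ^ (dimS br - 1)) *\<^sub>R gw f (y\<^sup>2 * v))"

definition gr :: "(real => 'b::banach) => real => 'b" where
 "gr f v = (1 + v) powr (- cS) *\<^sub>R gJ f v"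

lemma diffs_on_1p_powr: "diffs_on k {0..} (%v::real. (1 + v) powr r)"
 by (intro diffs_on_powr diffs_on_add diffs_on_const diffs_on_id) auto

lemma diffs_on_gw: "diffs_on k {0..} f ==> diffs_on k {0..} (gw f)"
 unfolding gw_def[abs_def] by (intro diffs_on_scaleR diffs_on_1p_powr)

lemma diffs_on_gJ: "diffs_on k {0..} f ==> diffs_on k {0..} (gJ f)"
 unfolding gJ_def[abs_def]
 by (rule diffs_on_integral) (auto intro!: diffs_on_gw continuous_intros mult_nonneg_nonneg)

lemma diffs_on_gr: "diffs_on k {0..} f ==> diffs_on k {0..} (gr f)"
 unfolding gr_def[abs_def] by (intro diffs_on_scaleR diffs_on_1p_powr diffs_on_gJ)

lemma gJ_ode:
 fixes f :: "real => 'b::banach"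
 assumes f: "diffs_on 1 {0..} f"
 obtains J' where "!!v. v >= 0 ==> hder (gJ f) (J' v) v"
  "!!v. v >= 0 ==> v *\<^sub>R J' v + (nS / 2) *\<^sub>R gJ f v = gw f v"
proof -
 let ?n = "dimS br"
 obtain g' where g': "!!w. w >= 0 ==> hder (gw f) (g' w) w" "continuous_on {0..} g'"
  using diffs_on_gw[OF f] by auto
 obtain J' where J': "!!v. v >= 0 ==> hder (gJ f) (J' v) v"
  using diffs_on_gJ[OF f] by auto
 have gc: "continuous_on {0..} (gw f)" using diffs_on_gw[OF f] diffs_on_continuous by blast
 have eq: "v *\<^sub>R J' v + (nS / 2) *\<^sub>R gJ f v = gw f v" if v: "v >= 0" for v
 proof -
  let ?I = "integral {0..1} (%y. (2 * y ^ (?n - 1) * y\<^sup>2) *\<^sub>R g' (y\<^sup>2 * v))"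
  have "((%x. integral (cbox 0 1) (%y. (2 * y ^ (?n - 1)) *\<^sub>R gw f (y\<^sup>2 * x))) has_vector_derivative
    integral (cbox 0 1) (%y. (2 * y ^ (?n - 1) * y\<^sup>2) *\<^sub>R g' (y\<^sup>2 * v))) (at v within {0..})"
  proof (rule leibniz_rule_vector_derivative)
   fix x t :: real assume x: "x \<in> {0..}" and t: "t \<in> cbox 0 1"
   have "hder (%x. t\<^sup>2 * x) (t\<^sup>2) x"
    by (auto intro!: derivative_eq_intros simp flip: has_real_derivative_iff_has_vector_derivative)
   then have "hder (%x. gw f (t\<^sup>2 * x)) (t\<^sup>2 *\<^sub>R g' (t\<^sup>2 * x)) x"
    by (rule vector_chain_within[of "%x. t\<^sup>2 * x" _ x "{0..}" "gw f" _ "{0..}"]) (use g'(1) x in auto)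
   then show "hder (%x. (2 * t ^ (?n - 1)) *\<^sub>R gw f (t\<^sup>2 * x)) ((2 * t ^ (?n - 1) * t\<^sup>2) *\<^sub>R g' (t\<^sup>2 * x)) x"
    using bounded_linear.has_vector_derivative[OF bounded_linear_scaleR_right, of "%x. gw f (t\<^sup>2 * x)" _ _ "2 * t ^ (?n - 1)"]
    by fastforce
  next
   fix x :: real assume x: "x \<in> {0..}"
   have "continuous_on {0..1} (%y. (2 * y ^ (?n - 1)) *\<^sub>R gw f (y\<^sup>2 * x))"
    by (intro continuous_intros continuous_on_compose2[OF gc]) (use x in auto)
   then show "(%y. (2 * y ^ (?n - 1)) *\<^sub>R gw f (y\<^sup>2 * x)) integrable_on cbox 0 1"
    using integrable_continuous_interval by (simp add: cbox_interval)
  next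
   show "continuous_on ({0..} \<times> cbox 0 1) (%(x, t). (2 * t ^ (?n - 1) * t\<^sup>2) *\<^sub>R g' (t\<^sup>2 * x))"
    unfolding split_def by (intro continuous_intros continuous_on_compose2[OF g'(2)]) auto
  qed (use v in auto)
  then have "hder (gJ f) ?I v"
   by (simp add: gJ_def[abs_def] cbox_interval)
  then have JI: "J' v = ?I"
   using J'[OF v] vector_derivative_unique_within[OF halfline_nontrivial] v by auto
  have i1: "(%y. (2 * y ^ (?n - 1) * y\<^sup>2) *\<^sub>R g' (y\<^sup>2 * v)) integrable_on {0..1}"
   by (intro integrable_continuous_interval continuous_intros continuous_on_compose2[OF g'(2)]) (use v in auto)
  have i2: "(%y. (2 * y ^ (?n - 1)) *\<^sub>R gw f (y\<^sup>2 * v)) integrable_on {0..1}"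
   by (intro integrable_continuous_interval continuous_intros continuous_on_compose2[OF gc]) (use v in auto)
  have "((%y. y ^ ?n *\<^sub>R (2 * y * v) *\<^sub>R g' (y\<^sup>2 * v) + (real ?n * y ^ (?n - 1)) *\<^sub>R gw f (y\<^sup>2 * v)) has_integral
    1 ^ ?n *\<^sub>R gw f (1\<^sup>2 * v) - 0 ^ ?n *\<^sub>R gw f (0\<^sup>2 * v)) {0..1}"
  proof (rule fundamental_theorem_of_calculus)
   fix y :: real assume y: "y \<in> {0..1}"
   have "((%y. y\<^sup>2 * v) has_vector_derivative 2 * y * v) (at y within {0..1})"
    by (auto intro!: derivative_eq_intros simp flip: has_real_derivative_iff_has_vector_derivative)
   then have 1: "((%y. gw f (y\<^sup>2 * v)) has_vector_derivative (2 * y * v) *\<^sub>R g' (y\<^sup>2 * v)) (at y within {0..1})"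
    by (rule vector_chain_within[of "%y. y\<^sup>2 * v" _ y "{0..1}" "gw f" _ "{0..}"]) (use g'(1) v in auto)
   have 2: "((%y. y ^ ?n) has_real_derivative real ?n * y ^ (?n - 1)) (at y within {0..1})"
    by (auto intro!: derivative_eq_intros)
   show "((%y. y ^ ?n *\<^sub>R gw f (y\<^sup>2 * v)) has_vector_derivative
     y ^ ?n *\<^sub>R (2 * y * v) *\<^sub>R g' (y\<^sup>2 * v) + (real ?n * y ^ (?n - 1)) *\<^sub>R gw f (y\<^sup>2 * v)) (at y within {0..1})"
    by (rule has_vector_derivative_scaleR[OF 2 1])
  qed simp
  then have "gw f v = integral {0..1} (%y. y ^ ?n *\<^sub>R (2 * y * v) *\<^sub>R g' (y\<^sup>2 * v) + (real ?n * y ^ (?n - 1)) *\<^sub>R gw f (y\<^sup>2 * v))"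
   using dimS_ge2 by (simp add: integral_unique power_0_left)
  also have "... = integral {0..1} (%y. v *\<^sub>R ((2 * y ^ (?n - 1) * y\<^sup>2) *\<^sub>R g' (y\<^sup>2 * v)) + (nS / 2) *\<^sub>R ((2 * y ^ (?n - 1)) *\<^sub>R gw f (y\<^sup>2 * v)))"
  proof (rule integral_cong)
   fix y :: real
   have "y ^ ?n = y * y ^ (?n - 1)" using dimS_ge2 by (metis Suc_diff_1 less_le_trans pos2 power_Suc)
   then show "y ^ ?n *\<^sub>R (2 * y * v) *\<^sub>R g' (y\<^sup>2 * v) + (real ?n * y ^ (?n - 1)) *\<^sub>R gw f (y\<^sup>2 * v)
    = v *\<^sub>R ((2 * y ^ (?n - 1) * y\<^sup>2) *\<^sub>R g' (y\<^sup>2 * v)) + (nS / 2) *\<^sub>R ((2 * y ^ (?n - 1)) *\<^sub>R gw f (y\<^sup>2 * v))"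
    by (simp add: nS_def power2_eq_square mult_ac)
  qed
  also have "... = v *\<^sub>R ?I + (nS / 2) *\<^sub>R gJ f v"
   unfolding gJ_def integral_add[OF integrable_cmul[OF i1] integrable_cmul[OF i2]] integral_cmul ..
  finally show ?thesis by (simp add: JI)
 qed
 show ?thesis using that[OF J' eq] by blast
qed

text \<open>The radial part of the Laplacian in the coordinate \<open>v\<close>; \<open>F1\<close> and \<open>F2\<close> are the derivatives of the function.\<close>

definition Lop :: "(real => 'b::real_vector) => (real => 'b) => real => 'b" where
 "Lop F1 F2 v = (v * (1 + v)) *\<^sub>R F2 v + ((Q + 1) * v + nS / 2) *\<^sub>R F1 v"

text \<open>Thus \<open>gr f\<close> is the derivative of a solution of \<open>Lop u = f\<close>.\<close>

lemma gr_ode: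
 fixes f :: "real => 'b::banach"
 assumes f: "diffs_on 1 {0..} f"
  and d: "hder (gr f) X v" and v: "v >= 0"
 shows "(v * (1 + v)) *\<^sub>R X + ((Q + 1) * v + nS / 2) *\<^sub>R gr f v = f v"
proof -
 obtain J' where J': "!!v. v >= 0 ==> hder (gJ f) (J' v) v"
  "!!v. v >= 0 ==> v *\<^sub>R J' v + (nS / 2) *\<^sub>R gJ f v = gw f v"
  using gJ_ode[OF f] by blast
 let ?p = "(1 + v) powr (- cS)"
 have "((%v. (1 + v) powr (- cS)) has_real_derivative - cS * ?p / (1 + v)) (at v within {0..})"
  using v by (auto intro!: derivative_eq_intros simp: powr_diff)
 from has_vector_derivative_scaleR[OF this J'(1)[OF v]]
 have "hder (gr f) (?p *\<^sub>R J' v + (- cS * ?p / (1 + v)) *\<^sub>R gJ f v) v"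
  by (simp add: gr_def[abs_def])
 then have X: "X = ?p *\<^sub>R J' v + (- cS * ?p / (1 + v)) *\<^sub>R gJ f v"
  using d vector_derivative_unique_within[OF halfline_nontrivial] v by auto
 have Q: "Q + 1 = nS / 2 + cS" using nS_cS by simp
 have c: "(v * (1 + v)) * (- cS * ?p / (1 + v)) = - (cS * v * ?p)" using v by simp
 have "(v * (1 + v)) *\<^sub>R X + ((Q + 1) * v + nS / 2) *\<^sub>R gr f v
   = ((1 + v) * ?p) *\<^sub>R (v *\<^sub>R J' v) + (- (cS * v * ?p) + ((nS / 2 + cS) * v + nS / 2) * ?p) *\<^sub>R gJ f v"
  unfolding X gr_def scaleR_add_right scaleR_scaleR c Q by (simp add: algebra_simps)
 also have "- (cS * v * ?p) + ((nS / 2 + cS) * v + nS / 2) * ?p = ((1 + v) * ?p) * (nS / 2)"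
  by (simp add: algebra_simps)
 also have "((1 + v) * ?p) *\<^sub>R (v *\<^sub>R J' v) + (((1 + v) * ?p) * (nS / 2)) *\<^sub>R gJ f v
   = ((1 + v) * ?p) *\<^sub>R (v *\<^sub>R J' v + (nS / 2) *\<^sub>R gJ f v)" by (simp add: scaleR_add_right)
 also have "... = ((1 + v) * ?p * (1 + v) powr (cS - 1)) *\<^sub>R f v"
  unfolding J'(2)[OF v] gw_def by simp
 also have "(1 + v) * ?p * (1 + v) powr (cS - 1) = 1"
 proof -
  have "(1 + v) powr 1 * (1 + v) powr (- cS) * (1 + v) powr (cS - 1) = (1 + v) powr 0"
   by (simp only: powr_add[symmetric]) simp
  then show ?thesis using v by simp
 qed
 finally show ?thesis by simp
qed

text \<open>The coordinate \<open>vv\<close> in terms of the distance; \<open>WW\<close> is the weight \<open>AA\<close> times the derivative of \<open>vs\<close>, and makes the radial Laplacian a divergence.\<close>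

definition vs :: "real => real" where "vs s = (sinh (s / 2))\<^sup>2"
definition WW :: "real => real" where
 "WW s = 2 ^ (mv br + mz br) * sinh (s / 2) ^ (mv br + mz br + 1) * cosh (s / 2) ^ (mz br + 1)"
abbreviation AA :: "real => real" where "AA \<equiv> DR_weight br"

lemma vs_nonneg [simp]: "vs s >= 0" by (simp add: vs_def)
lemma vs_0 [simp]: "vs 0 = 0" by (simp add: vs_def)

lemma vs_1: "1 + vs s = (cosh (s / 2))\<^sup>2" by (simp add: vs_def cosh_square_eq)

lemma vs_deriv: "(vs has_real_derivative sinh (s / 2) * cosh (s / 2)) (at s within S)"
 unfolding vs_def[abs_def] by (auto intro!: derivative_eq_intros simp: power2_eq_square)

lemma WW_AA: "WW s = AA s * (sinh (s / 2) * cosh (s / 2))"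
 by (simp add: WW_def DR_weight_def)

lemma WW_deriv: "(WW has_real_derivative AA s * ((Q + 1) * vs s + nS / 2)) (at s within S)"
proof -
 let ?p = "mv br + mz br" and ?k = "mz br"
 have "(WW has_real_derivative 2 ^ ?p * ((real (?p + 1) * sinh (s/2) ^ ?p * (cosh (s/2) / 2)) * cosh (s/2) ^ (?k+1)
   + sinh (s/2) ^ (?p+1) * (real (?k + 1) * cosh (s/2) ^ ?k * (sinh (s/2) / 2)))) (at s within S)"
  unfolding WW_def[abs_def] by (auto intro!: derivative_eq_intros simp: algebra_simps simp del: power_Suc of_nat_Suc)
 also have "2 ^ ?p * ((real (?p + 1) * sinh (s/2) ^ ?p * (cosh (s/2) / 2)) * cosh (s/2) ^ (?k+1)
   + sinh (s/2) ^ (?p+1) * (real (?k + 1) * cosh (s/2) ^ ?k * (sinh (s/2) / 2)))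
   = AA s * (real (?p + 1) / 2 * (cosh (s/2))\<^sup>2 + real (?k + 1) / 2 * (sinh (s/2))\<^sup>2)"
  by (simp add: DR_weight_def power2_eq_square algebra_simps add_divide_distrib)
 also have "real (?p + 1) / 2 * (cosh (s/2))\<^sup>2 + real (?k + 1) / 2 * (sinh (s/2))\<^sup>2 = (Q + 1) * vs s + nS / 2"
  unfolding vs_1[symmetric] unfolding vs_def[symmetric] by (simp add: hdim_def nS_def dimS_def field_simps)
 finally show ?thesis .
qed

lemma WW_F1_deriv:
 fixes F1 :: "real => 'b::real_normed_vector"
 assumes F2: "!!v. v >= 0 ==> hder F1 (F2 v) v"
 shows "((%s. WW s *\<^sub>R F1 (vs s)) has_vector_derivative AA s *\<^sub>R Lop F1 F2 (vs s)) (at s within S)"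
proof -
 have "((%s. F1 (vs s)) has_vector_derivative (sinh (s / 2) * cosh (s / 2)) *\<^sub>R F2 (vs s)) (at s within S)"
  by (rule vector_chain_within[OF vs_deriv[unfolded has_real_derivative_iff_has_vector_derivative] F2]) auto
 from has_vector_derivative_scaleR[OF WW_deriv this]
 have "((%s. WW s *\<^sub>R F1 (vs s)) has_vector_derivative
   WW s *\<^sub>R (sinh (s / 2) * cosh (s / 2)) *\<^sub>R F2 (vs s) + (AA s * ((Q + 1) * vs s + nS / 2)) *\<^sub>R F1 (vs s)) (at s within S)" .
 moreover have "WW s * (sinh (s / 2) * cosh (s / 2)) = AA s * (vs s * (1 + vs s))"
  unfolding WW_AA vs_1 by (simp add: vs_def power2_eq_square)
 ultimately show ?thesis by (simp add: Lop_def scaleR_add_right)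
qed

lemma AA_nonneg: "s >= 0 ==> AA s >= 0" by (simp add: DR_weight_def)
lemma AA_pos: "s > 0 ==> AA s > 0" by (simp add: DR_weight_def)
lemma continuous_on_AA [continuous_intros]: "continuous_on S AA"
 unfolding DR_weight_def[abs_def] by (intro continuous_intros) auto
lemma continuous_on_vs [continuous_intros]: "continuous_on S vs"
 unfolding vs_def[abs_def] by (intro continuous_intros) auto
lemma continuous_on_WW [continuous_intros]: "continuous_on S WW"
 unfolding WW_def[abs_def] by (intro continuous_intros) auto
lemma WW_0 [simp]: "WW 0 = 0" by (simp add: WW_def)
lemma WW_pos: "s > 0 ==> WW s > 0" by (simp add: WW_def)

lemma AA_mono: "0 <= s ==> s <= t ==> AA s <= AA t"
 unfolding DR_weight_def
 by (intro mult_mono power_mono) (auto simp: cosh_real_nonneg_le_iff intro!: mult_nonneg_nonneg)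

lemma WW_gr:
 fixes f :: "real => 'b::banach"
 assumes f: "diffs_on 1 {0..} f" and s: "s >= 0"
 shows "((%\<tau>. AA \<tau> *\<^sub>R f (vs \<tau>)) has_integral WW s *\<^sub>R gr f (vs s)) {0..s}"
proof -
 obtain X where X: "!!v. v >= 0 ==> hder (gr f) (X v) v"
  using diffs_on_gr[OF f] by auto
 have "((%\<tau>. AA \<tau> *\<^sub>R Lop (gr f) X (vs \<tau>)) has_integral WW s *\<^sub>R gr f (vs s) - WW 0 *\<^sub>R gr f (vs 0)) {0..s}"
  by (rule fundamental_theorem_of_calculus[OF s]) (rule WW_F1_deriv[OF X])
 moreover have "Lop (gr f) X (vs \<tau>) = f (vs \<tau>)" for \<tau>
  using gr_ode[OF f X] by (simp add: Lop_def)
 ultimately show ?thesis by simp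
qed

end

section \<open>Polar decomposition of the volume\<close>

lemma integral_lborel_shift:
 fixes f :: "'a::euclidean_space => real"
 assumes "f \<in> borel_measurable borel"
 shows "integral\<^sup>L lborel (%x. f (c + x)) = integral\<^sup>L lborel f"
proof -
 have "integral\<^sup>L lborel f = integral\<^sup>L (distr lborel borel ((+) c)) f" by (simp add: lborel_distr_plus)
 also have "... = integral\<^sup>L lborel (%x. f (c + x))" by (rule integral_distr) (use assms in auto)
 finally show ?thesis ..
qed

lemma integrable_compact_support:
 fixes f :: "'a::euclidean_space => real"
 assumes "continuous_on UNIV f" "compact K" "!!x. x \<notin> K ==> f x = 0"
 shows "integrable lborel f"
proof -
 have "integrable lborel (%x. indicator K x *\<^sub>R f x)"
  by (rule borel_integrable_compact[OF assms(2) continuous_on_subset[OF assms(1)]]) simp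
 moreover have "(%x. indicator K x *\<^sub>R f x) = f" by (rule ext) (use assms(3) in \<open>auto simp: indicator_def\<close>)
 ultimately show ?thesis by simp
qed

text \<open>The difference quotients of \<open>f\<close> along \<open>b\<close> have integral 0, by translation invariance.\<close>

lemma integral_directional_derivative_eq_0:
 fixes f :: "'a::euclidean_space => real"
 assumes d: "!!x. (f has_derivative f' x) (at x)" and K: "compact K"
  and f0: "!!x. x \<notin> K ==> f x = 0" and c: "continuous_on UNIV (%x. f' x b)"
 shows "integral\<^sup>L lborel (%x. f' x b) = 0"
proof -
 define e where "e n = 1 / real (Suc n)" for n
 have e: "e n > 0" "e n <= 1" for n by (auto simp: e_def)
 define s where "s n x = (f (e n *\<^sub>R b + x) - f x) / e n" for n x
 have fc: "continuous_on UNIV f" using d has_derivative_continuous_on by blast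
 have fm: "f \<in> borel_measurable borel" using fc borel_measurable_continuous_onI by blast
 have fi: "integrable lborel f" by (rule integrable_compact_support[OF fc K f0])
 have f'0: "f' x b = 0" if "x \<notin> K" for x
 proof -
  have "(f has_derivative (%_. 0)) (at x)"
   by (rule has_derivative_transform_within_open[OF has_derivative_const, of "- K"])
     (use K compact_imp_closed f0 that in auto)
  then have "f' x = (%_. 0)" using d has_derivative_unique by blast
  then show ?thesis by simp
 qed
 obtain C where C: "!!x. \<bar>f' x b\<bar> <= C"
 proof -
  have "compact ((%x. f' x b) ` K)" by (rule compact_continuous_image[OF continuous_on_subset[OF c] K]) simp
  then obtain C where "\<forall>x\<in>(%x. f' x b) ` K. norm x <= C" using compact_imp_bounded bounded_iff by metis
  then have "\<bar>f' x b\<bar> <= max C 0" for x using f'0[of x] by (cases "x \<in> K") fastforce+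
  then show ?thesis using that by blast
 qed
 have line: "((%t. f (t *\<^sub>R b + x)) has_real_derivative f' (t *\<^sub>R b + x) b) (at t)" for t x
 proof -
  have "((%t. t *\<^sub>R b + x) has_derivative (%h. h *\<^sub>R b)) (at t)" by (auto intro!: derivative_eq_intros)
  then have "((%t. f (t *\<^sub>R b + x)) has_derivative (%h. f' (t *\<^sub>R b + x) (h *\<^sub>R b))) (at t)"
   by (rule has_derivative_compose) (rule d)
  moreover have "f' (t *\<^sub>R b + x) (h *\<^sub>R b) = f' (t *\<^sub>R b + x) b * h" for h
   using linear_scale[OF has_derivative_linear[OF d]] by simp
  ultimately show ?thesis by (simp add: has_field_derivative_def)
 qed
 define K' where "K' = (%(x, t). x - t *\<^sub>R b) ` (K \<times> {0..1})"
 have cK': "compact K'" unfolding K'_def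
  by (rule compact_continuous_image) (auto intro!: continuous_intros compact_Times K simp: split_def)
 have "integral\<^sup>L lborel (s n) = 0" for n
 proof -
  have sh: "integrable lborel (%x. f (e n *\<^sub>R b + x))"
   using fi integrable_distr_eq[of "(+) (e n *\<^sub>R b)" lborel borel f] fm by (simp add: lborel_distr_plus)
  show ?thesis unfolding s_def
   using sh fi integral_lborel_shift[OF fm, of "e n *\<^sub>R b"] by simp
 qed
 moreover have "(%n. integral\<^sup>L lborel (s n)) \<longlonglongrightarrow> integral\<^sup>L lborel (%x. f' x b)"
 proof (rule integral_dominated_convergence[where w = "%x. C * indicator K' x"])
  show "(%x. f' x b) \<in> borel_measurable lborel" using c borel_measurable_continuous_onI by simp
  show "s n \<in> borel_measurable lborel" for n unfolding s_def using fm by measurable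
  show "integrable lborel (%x. C * indicator K' x :: real)"
   using cK' emeasure_bounded_finite[OF compact_imp_bounded[OF cK']] borel_compact[OF cK'] by simp
  show "AE x in lborel. (%n. s n x) \<longlonglongrightarrow> f' x b"
  proof (rule AE_I2)
   fix x
   have "((%h. (f ((0 + h) *\<^sub>R b + x) - f (0 *\<^sub>R b + x)) / h) \<longlongrightarrow> f' (0 *\<^sub>R b + x) b) (at 0)"
    using line[of x 0] unfolding DERIV_def .
   moreover have "filterlim e (at 0) sequentially"
    unfolding filterlim_at using e(1) LIMSEQ_inverse_real_of_nat
    by (auto simp: e_def[abs_def] inverse_eq_divide intro!: always_eventually)
   ultimately show "(%n. s n x) \<longlonglongrightarrow> f' x b"
    unfolding s_def using filterlim_compose[of "%h. (f ((0 + h) *\<^sub>R b + x) - f (0 *\<^sub>R b + x)) / h" _ "at 0" e sequentially]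
    by simp
  qed
  show "AE x in lborel. norm (s n x) <= C * indicator K' x" for n
  proof (rule AE_I2)
   fix x
   obtain z where z: "0 < z" "z < e n" "f (e n *\<^sub>R b + x) - f (0 *\<^sub>R b + x) = (e n - 0) * f' (z *\<^sub>R b + x) b"
    using MVT2[OF e(1)[of n], of "%t. f (t *\<^sub>R b + x)" "%t. f' (t *\<^sub>R b + x) b"] line by blast
   have sx: "s n x = f' (z *\<^sub>R b + x) b" unfolding s_def using z(3) e(1)[of n] by simp
   show "norm (s n x) <= C * indicator K' x"
   proof (cases "x \<in> K'")
    case True then show ?thesis using C by (simp add: sx)
   next
    case False
    have "z *\<^sub>R b + x \<notin> K"
    proof
     assume "z *\<^sub>R b + x \<in> K"
     then have "(%(x, t). x - t *\<^sub>R b) (z *\<^sub>R b + x, z) \<in> K'"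
      unfolding K'_def using z e(2)[of n] by (intro imageI) auto
     then show False using False by simp
    qed
    then show ?thesis using f'0 by (simp add: sx False)
   qed
  qed
 qed
 ultimately show ?thesis by (simp add: LIMSEQ_const_iff)
qed

text \<open>Applied twice, this gives cutoffs of class \<open>C\<^sup>1\<close> that decrease to indicators of sublevel sets.\<close>

definition sqp :: "real => real" where "sqp x = (max 0 x)\<^sup>2"

lemma sqp_deriv: "(sqp has_real_derivative 2 * max 0 x) (at x)"
proof -
 consider "x > 0" | "x < 0" | "x = 0" by linarith
 then show ?thesis
 proof cases
  case 1
  have "((%x. x\<^sup>2) has_real_derivative 2 * x) (at x)" by (auto intro!: derivative_eq_intros)
  then have "(sqp has_real_derivative 2 * x) (at x)"
   by (rule has_field_derivative_transform_within_open[where S = "{0<..}"]) (use 1 in \<open>auto simp: sqp_def\<close>)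
  then show ?thesis using 1 by simp
 next
  case 2
  have "(sqp has_real_derivative 0) (at x)"
   by (rule has_field_derivative_transform_within_open[OF DERIV_const, where S = "{..<0}"]) (use 2 in \<open>auto simp: sqp_def\<close>)
  then show ?thesis using 2 by simp
 next
  case 3
  have "((%h::real. (max 0 h)\<^sup>2 / h) \<longlongrightarrow> 0) (at 0)"
  proof (rule Lim_null_comparison[where g = "%h. \<bar>h\<bar>"])
   show "\<forall>\<^sub>F h::real in at 0. norm ((max 0 h)\<^sup>2 / h) <= \<bar>h\<bar>"
    by (rule always_eventually) (auto simp: max_def power2_eq_square)
   show "((%h::real. \<bar>h\<bar>) \<longlongrightarrow> 0) (at 0)" by (rule tendsto_eq_intros refl)+ simp
  qed
  then show ?thesis using 3 by (simp add: DERIV_def sqp_def)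
 qed
qed

lemma diffs_on_sqp: "diffs_on 1 S sqp"
 unfolding One_nat_def
 by (rule diffs_onI[where f' = "%x. 2 * max 0 x"])
   (auto simp: has_real_derivative_iff_has_vector_derivative[symmetric] has_field_derivative_at_within[OF sqp_deriv]
    intro!: continuous_intros)

definition cutoff :: "real => nat => real => real" where
 "cutoff a j v = sqp (1 - sqp (real (Suc j) * (v - a)))"

lemma diffs_on_cutoff: "diffs_on 1 S (cutoff a j)"
 unfolding cutoff_def[abs_def]
 by (intro diffs_on_compose[OF subset_UNIV diffs_on_sqp] diffs_on_diff diffs_on_const diffs_on_mult diffs_on_id)

lemma sqp_nonneg: "sqp x >= 0" by (simp add: sqp_def)
lemma cutoff_bounds: "cutoff a j v >= 0" "cutoff a j v <= 1"
proof -
 show "cutoff a j v >= 0" by (simp add: cutoff_def sqp_nonneg)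
 have "max 0 (1 - sqp (real (Suc j) * (v - a))) <= 1" using sqp_nonneg by simp
 then show "cutoff a j v <= 1" unfolding cutoff_def sqp_def[of "1 - _"] by (intro power_le_one) auto
qed
lemma cutoff_1: "v <= a ==> cutoff a j v = 1"
proof -
 assume "v <= a"
 then have "real (Suc j) * (v - a) <= 0" by (intro mult_nonneg_nonpos) auto
 then show ?thesis by (simp add: cutoff_def sqp_def max_def)
qed
lemma cutoff_0: "real (Suc j) * (v - a) >= 1 ==> cutoff a j v = 0"
proof -
 assume w: "real (Suc j) * (v - a) >= 1"
 then have "1 <= (real (Suc j) * (v - a))\<^sup>2" by (rule one_le_power)
 moreover have "max 0 (real (Suc j) * (v - a)) = real (Suc j) * (v - a)" using w by linarith
 ultimately have "max 0 (1 - sqp (real (Suc j) * (v - a))) = 0" unfolding sqp_def by simp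
 then show ?thesis by (simp add: cutoff_def sqp_def[of "1 - _"])
qed
lemma cutoff_0': "v > a + 1 ==> cutoff a j v = 0"
proof (rule cutoff_0)
 assume "v > a + 1"
 then have "1 * 1 <= real (Suc j) * (v - a)" by (intro mult_mono) auto
 then show "1 <= real (Suc j) * (v - a)" by simp
qed
lemma cutoff_tendsto: "(%j. cutoff a j v) \<longlonglongrightarrow> (if v <= a then 1 else 0)"
proof (cases "v <= a")
 case True then show ?thesis by (simp add: cutoff_1)
next
 case False
 then obtain n where n: "1 / (v - a) < real n" using reals_Archimedean2 by blast
 have "cutoff a j v = 0" if "j >= n" for j
 proof (rule cutoff_0)
  have "1 / (v - a) < real (Suc j)" using n that by simp
  then show "1 <= real (Suc j) * (v - a)" using False by (simp add: divide_less_eq)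
 qed
 then have "(%j. cutoff a j v) \<longlonglongrightarrow> 0"
  by (intro tendsto_eventually eventually_sequentiallyI[of n]) auto
 then show ?thesis using False by simp
qed

context htype
begin

lemma continuous_on_NN: "continuous_on UNIV NN"
 by (rule has_derivative_continuous_on[OF NN_deriv])

lemma vv_measurable [measurable]: "vv \<in> borel_measurable borel"
proof -
 have "NN \<in> borel_measurable borel" using continuous_on_NN borel_measurable_continuous_onI by blast
 moreover have "(snd :: 'n \<times> real => real) \<in> borel_measurable borel"
  by (intro borel_measurable_continuous_onI continuous_intros)
 ultimately show ?thesis unfolding vv_def[abs_def] by measurable
qed

lemma sv_measurable [measurable]: "sv \<in> borel_measurable borel"
 using continuous_on_sv borel_measurable_continuous_onI by blast
lemma rr_measurable [measurable]: "rr \<in> borel_measurable borel"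
 unfolding rr_sv[abs_def] by measurable

lemma hh_snd_measurable [measurable]: "(%x::'n \<times> real. hh (snd x)) \<in> borel_measurable borel"
proof -
 have "(snd :: 'n \<times> real => real) \<in> borel_measurable borel"
  by (intro borel_measurable_continuous_onI continuous_intros)
 then show ?thesis unfolding hh_def by measurable
qed

lemma DR_borel [measurable]: "(DR :: ('n \<times> real) set) \<in> sets borel" by (rule borel_open[OF open_DR])

lemma compact_sublevel: "compact {x \<in> DR. vv x <= R}"
proof (cases "R >= 0")
 case False
 then have "{x \<in> DR. vv x <= R} = {}" using vv_ge0 by force
 then show ?thesis by (simp only: compact_empty)
next
 case R: True
 define c where "c = 1 / (4 * (1 + R))"
 have c0: "c > 0" using R by (simp add: c_def)
 define b where "b = 4 * (1 + R)"
 have bds: "c <= snd x \<and> snd x <= b \<and> norm (fst x) <= (4 * b + 1) + (4 * b * (1 + R) + 1)" if x: "x \<in> DR" "vv x <= R" for x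
 proof -
  have a: "snd x > 0" using x by (simp add: DR_iff)
  have N: "NN x <= 4 * snd x * (1 + R)" using x(2) a by (simp add: vv_def field_simps)
  have z0: "inner (zp (fst x)) (zp (fst x)) >= 0" and v0: "inner (vp (fst x)) (vp (fst x)) >= 0" by simp_all
  have B1: "BB x >= 1 + snd x" using v0 by (simp add: BB_def)
  have B2: "(BB x)\<^sup>2 <= 4 * snd x * (1 + R)" using N z0 unfolding NN_def by linarith
  have "1 <= (BB x)\<^sup>2" using B1 a by (simp add: power2_eq_square mult_ge1_I)
  then have 1: "c <= snd x" using B2 R by (simp add: c_def field_simps)
  have "snd x * BB x <= BB x * BB x" using B1 a by (intro mult_right_mono) auto
  then have "snd x * BB x <= snd x * b" using B2 by (simp add: b_def power2_eq_square mult_ac)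
  then have Bb: "BB x <= b" using a by simp
  then have 2: "snd x <= b" using B1 by simp
  have V: "(norm (vp (fst x)))\<^sup>2 <= 4 * b" using Bb a by (simp add: BB_def power2_norm_eq_inner)
  have "4 * snd x * (1 + R) <= 4 * b * (1 + R)" using 2 R by (intro mult_right_mono) auto
  then have Z: "(norm (zp (fst x)))\<^sup>2 <= 4 * b * (1 + R)"
   using N zero_le_power2[of "BB x"] unfolding NN_def power2_norm_eq_inner by linarith
  have le: "y <= M + 1" if "y\<^sup>2 <= M" "M >= 0" for y M :: real
  proof (rule ccontr)
   assume "\<not> y <= M + 1"
   then have "y > M + 1" by simp
   then have "y * y > (M + 1) * (M + 1)" using that(2) by (intro mult_strict_mono) auto
   then have "y * y > M" using that(2) by (simp add: algebra_simps) (smt (verit) mult_nonneg_nonneg)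
   then show False using that by (simp add: power2_eq_square)
  qed
  have "norm (fst x) <= norm (vp (fst x)) + norm (zp (fst x))" by (metis norm_triangle_ineq vp_zp)
  also have "... <= (4 * b + 1) + (4 * b * (1 + R) + 1)"
   using le[OF V] le[OF Z] R by (simp add: b_def)
  finally show ?thesis using 1 2 by simp
 qed
 let ?K = "{x \<in> DR. vv x <= R}"
 have eq: "?K = {x \<in> UNIV \<times> {c..}. vv x <= R}"
  using bds c0 by (auto simp: DR_def mem_Times_iff)
 have cont: "continuous_on (UNIV \<times> {c..}) vv"
  by (rule continuous_on_subset[OF continuous_on_vv]) (use c0 in \<open>auto simp: DR_def\<close>)
 have "closed ?K"
  unfolding eq using continuous_closed_preimage[OF cont _ closed_atMost[of R]]
  by (simp add: closed_Times vimage_def Int_def)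
 moreover have "bounded ?K"
 proof (rule bounded_subset)
  show "bounded (cball 0 ((4 * b + 1) + (4 * b * (1 + R) + 1)) \<times> {0..b} :: ('n \<times> real) set)"
   by (intro bounded_Times bounded_cball bounded_closed_interval)
  show "?K \<subseteq> cball 0 ((4 * b + 1) + (4 * b * (1 + R) + 1)) \<times> {0..b}"
   using bds c0 by (force simp: mem_Times_iff)
 qed
 ultimately show ?thesis by (simp add: compact_eq_bounded_closed)
qed

text \<open>The divergence theorem for the field \<open>\<xi>(vv) TT\<close>.\<close>

lemma integral_Lop_eq_0:
 assumes X1: "!!v. v >= 0 ==> hder \<xi> (\<xi>' v) v" and X2: "continuous_on {0..} \<xi>'"
  and R: "!!v. v > R ==> \<xi> v = (0::real)" and R0: "R >= 0"
 shows "integral\<^sup>L lborel (%x. indicator DR x * (hh (snd x) * Lop \<xi> \<xi>' (vv x))) = 0"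
proof -
 let ?K = "{x \<in> DR. vv x <= R}"
 have K: "compact ?K" by (rule compact_sublevel)
 have X0: "\<xi>' v = 0" if v: "v > R" for v
 proof -
  have "(\<xi> has_vector_derivative 0) (at v)"
   by (rule has_vector_derivative_transform_within_open[OF has_vector_derivative_const, of "{R<..}"]) (use v R in auto)
  then have "hder \<xi> 0 v" by (rule has_vector_derivative_at_within)
  then show ?thesis using X1[of v] v R0 vector_derivative_unique_within[OF halfline_nontrivial, of v] by auto
 qed
 define Y where "Y i x = (if x \<in> DR then inner (hh (snd x) *\<^sub>R TT x) i * \<xi> (vv x) else 0)" for i x
 define Y' where "Y' i x w = (if x \<in> DR then inner (hh (snd x) *\<^sub>R TT x) i * (dvv x w * \<xi>' (vv x)) + inner (dhT x w) i * \<xi> (vv x) else 0)" for i x w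
 have dY: "(Y i has_derivative Y' i x) (at x)" for i x
 proof (cases "x \<in> DR")
  case True
  then have a: "snd x > 0" by (simp add: DR_iff)
  have "((%y. \<xi> (vv y)) has_derivative (%h. dvv x h *\<^sub>R \<xi>' (vv x))) (at x)"
   by (rule has_derivative_halfline_compose[OF open_DR True vv_ge0 X1 vv_deriv]) (use True vv_ge0 a in auto)
  then have "((%y. inner (hh (snd y) *\<^sub>R TT y) i * \<xi> (vv y)) has_derivative
    (%h. inner (hh (snd x) *\<^sub>R TT x) i * (dvv x h *\<^sub>R \<xi>' (vv x)) + inner (dhT x h) i * \<xi> (vv x))) (at x)"
   by (rule has_derivative_mult[OF has_derivative_inner_left[OF hT_deriv[OF a]]])
  then have "((%y. inner (hh (snd y) *\<^sub>R TT y) i * \<xi> (vv y)) has_derivative Y' i x) (at x)"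
   using True by (simp add: Y'_def[abs_def])
  then show ?thesis
   by (rule has_derivative_transform_within_open[OF _ open_DR True]) (simp add: Y_def)
 next
  case False
  have "(Y i has_derivative (%_. 0)) (at x)"
   by (rule has_derivative_transform_within_open[OF has_derivative_const, of "- ?K"])
     (use False K compact_imp_closed R in \<open>auto simp: Y_def\<close>)
  then show ?thesis using False by (simp add: Y'_def[abs_def])
 qed
 have cY': "continuous_on UNIV (%x. Y' i x b)" for i b
 proof -
  have hhc: "continuous_on DR (%x::'n\<times>real. hh (snd x))"
   unfolding hh_def by (intro continuous_intros) (auto simp: DR_iff)
  have c: "continuous_on DR BB" "continuous_on DR NN" "continuous_on DR TT"
   using has_derivative_continuous_on[OF BB_deriv] has_derivative_continuous_on[OF NN_deriv]
    has_derivative_continuous_on[OF TT_deriv] by blast+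
  have cd: "continuous_on DR (%x. dBB x b)" unfolding dBB_def by (intro continuous_intros) auto
  have cn: "continuous_on DR (%x. dNN x b)" unfolding dNN_def by (intro continuous_intros c cd)
  have cv: "continuous_on DR (%x. dvv x b)" unfolding dvv_def by (intro continuous_intros c cn) (auto simp: DR_iff)
  have cT: "continuous_on DR (%x. dTT x b)" unfolding dTT_def by (intro continuous_intros c cd cn) auto
  have cX: "continuous_on DR (%x. \<xi> (vv x))" "continuous_on DR (%x. \<xi>' (vv x))"
  proof -
   have s: "vv ` DR \<subseteq> {0..}" using vv_ge0 by blast
   have "continuous_on {0..} \<xi>" by (rule has_vector_derivative_continuous_on'[of _ \<xi> \<xi>']) (use X1 in auto)
   from continuous_on_compose2[OF this continuous_on_vv s] continuous_on_compose2[OF X2 continuous_on_vv s]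
   show "continuous_on DR (%x. \<xi> (vv x))" "continuous_on DR (%x. \<xi>' (vv x))" .
  qed
  have "continuous_on DR (%x. inner (hh (snd x) *\<^sub>R TT x) i * (dvv x b * \<xi>' (vv x)) + inner (dhT x b) i * \<xi> (vv x))"
   unfolding dhT_def by (intro continuous_intros c cv cT cX hhc) (auto simp: DR_iff)
  then have 1: "continuous_on DR (%x. Y' i x b)" by (rule continuous_on_eq) (simp add: Y'_def)
  have "continuous_on (- ?K) (%x::'n \<times> real. 0::real)" by simp
  then have 2: "continuous_on (- ?K) (%x. Y' i x b)"
   by (rule continuous_on_eq) (auto simp: Y'_def R X0)
  have "continuous_on (DR \<union> - ?K) (%x. Y' i x b)"
   by (rule continuous_on_open_Un[OF open_DR _ 1 2]) (use K compact_imp_closed in auto)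
  moreover have "DR \<union> - ?K = UNIV" by auto
  ultimately show ?thesis by simp
 qed
 have Y0: "Y i x = 0" "Y' i x b = 0" if "x \<notin> ?K" for i x b using that R X0 by (auto simp: Y_def Y'_def)
 have z: "integral\<^sup>L lborel (%x. Y' i x i) = 0" for i
  by (rule integral_directional_derivative_eq_0[OF dY K Y0(1) cY'])
 have ii: "integrable lborel (%x. Y' i x i)" for i
  by (rule integrable_compact_support[OF cY' K Y0(2)])
 have "(\<Sum>i\<in>Basis. Y' i x i) = indicator DR x * (hh (snd x) * Lop \<xi> \<xi>' (vv x))" for x
 proof (cases "x \<in> DR")
  case True
  then have a: "snd x > 0" by (simp add: DR_iff)
  have l: "linear (dvv x)" using vv_deriv[OF a, of UNIV] has_derivative_linear by blast
  have s1: "(\<Sum>i\<in>Basis. inner (hh (snd x) *\<^sub>R TT x) i * dvv x i) = hh (snd x) * (vv x * (1 + vv x))"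
   unfolding linear_basis_sum_real(1)[OF l] linear_scale[OF l] dvv_TT[OF a] by simp
  have "(\<Sum>i\<in>Basis. Y' i x i) = (\<Sum>i\<in>Basis. inner (hh (snd x) *\<^sub>R TT x) i * dvv x i) * \<xi>' (vv x)
    + (\<Sum>i\<in>Basis. inner (dhT x i) i) * \<xi> (vv x)"
   using True by (simp add: Y'_def sum.distrib sum_distrib_right mult.assoc del: inner_scaleR_left)
  then show ?thesis unfolding s1 div_hT[OF a] using True by (simp add: Lop_def algebra_simps)
 qed (simp add: Y'_def)
 then have "integral\<^sup>L lborel (%x. indicator DR x * (hh (snd x) * Lop \<xi> \<xi>' (vv x))) = integral\<^sup>L lborel (%x. \<Sum>i\<in>Basis. Y' i x i)"
  by simp
 also have "... = 0" using z ii by simp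
 finally show ?thesis .
qed

end

context htype
begin

definition vol :: "('n \<times> real) measure" where
 "vol = density lborel (%x. ennreal (indicator DR x * hh (snd x)))"

lemma riem_volume_eq: "riem_volume DR met = vol"
proof -
 have "(%x. ennreal (indicator DR x * sqrt (gram_det met x))) = (%x. ennreal (indicator DR x * hh (snd x)))"
  by (rule ext) (auto simp: indicator_def DR_iff sqrt_gram_det)
 then show ?thesis by (simp add: riem_volume_def vol_def)
qed

lemma sets_vol [simp, measurable_cong]: "sets vol = sets borel" by (simp add: vol_def)
lemma space_vol [simp]: "space vol = UNIV" by (simp add: vol_def)

text \<open>The two functionals whose proportionality is the integration formula in polar coordinates.\<close>

definition Iint :: "(real => real) => real" where
 "Iint \<theta> = integral\<^sup>L lborel (%x. indicator DR x * (hh (snd x) * \<theta> (vv x)))"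
definition Jint :: "(real => real) => real" where
 "Jint \<theta> = integral\<^sup>L lborel (%s. indicator {0..} s * (AA s * \<theta> (vs s)))"

lemma vs_measurable [measurable]: "vs \<in> borel_measurable borel"
 using continuous_on_vs borel_measurable_continuous_onI by blast
lemma AA_measurable [measurable]: "AA \<in> borel_measurable borel"
 using continuous_on_AA borel_measurable_continuous_onI by blast

lemma sv_vs: "s >= 0 ==> sv (vs s) = s" by (simp add: vs_def sv_sinh)
lemma vs_sv: "v >= 0 ==> vs (sv v) = v" by (simp add: vs_def sinh_sv)
lemma vs_mono: "0 <= s ==> s <= t ==> vs s <= vs t" unfolding vs_def by (intro power_mono) auto
lemma vs_le_iff: "0 <= s ==> 0 <= a ==> vs s <= a \<longleftrightarrow> s <= sv a"
 using vs_mono[of s "sv a"] vs_mono[of "sv a" s] vs_sv[of a] sv_vs[of s] sv_nonneg[of a]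
 by (cases "s <= sv a") (auto simp: not_le intro: antisym)
lemma sv_mono: "0 <= a ==> a <= b ==> sv a <= sv b"
 using vs_le_iff[of "sv a" b] sv_nonneg[of a] vs_sv[of a] by auto

lemma integrable_I:
 assumes th: "continuous_on {0..} \<theta>" and R: "!!v. v > R ==> \<theta> v = 0"
 shows "integrable lborel (%x. indicator DR x * (hh (snd x) * \<theta> (vv x)))"
proof -
 let ?K = "{x \<in> DR. vv x <= R}"
 have "continuous_on DR (%x. hh (snd x) * \<theta> (vv x))"
  using vv_ge0 unfolding hh_def
  by (intro continuous_intros continuous_on_compose2[OF th continuous_on_vv]) (auto simp: DR_iff)
 then have "continuous_on ?K (%x. hh (snd x) * \<theta> (vv x))" by (rule continuous_on_subset) auto
 from borel_integrable_compact[OF compact_sublevel this]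
 have "integrable lborel (%x. indicator ?K x *\<^sub>R (hh (snd x) * \<theta> (vv x)))" .
 moreover have "(%x. indicator ?K x *\<^sub>R (hh (snd x) * \<theta> (vv x))) = (%x. indicator DR x * (hh (snd x) * \<theta> (vv x)))"
  by (rule ext) (use R in \<open>auto simp: indicator_def\<close>)
 ultimately show ?thesis by simp
qed

lemma integrable_J:
 assumes th: "continuous_on {0..} \<theta>" and R: "!!v. v > R ==> \<theta> v = 0" and R0: "R >= 0"
 shows "integrable lborel (%s. indicator {0..} s * (AA s * \<theta> (vs s)))"
  "S >= sv R ==> ((%s. AA s * \<theta> (vs s)) has_integral Jint \<theta>) {0..S}"
proof -
 have main: "integrable lborel (%s. indicator {0..} s * (AA s * \<theta> (vs s))) \<and> ((%s. AA s * \<theta> (vs s)) has_integral Jint \<theta>) {0..S}"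
  if S: "S >= sv R" for S
 proof -
  have "continuous_on {0..S} (%s. AA s * \<theta> (vs s))"
   by (intro continuous_intros continuous_on_compose2[OF th continuous_on_vs]) auto
  from borel_integrable_compact[OF _ this]
  have i: "integrable lborel (%s. indicator {0..S} s *\<^sub>R (AA s * \<theta> (vs s)))" by simp
  have z: "\<theta> (vs s) = 0" if "s >= 0" "s > S" for s
  proof (rule R)
   show "vs s > R" using vs_le_iff[OF that(1) R0] that(2) S by linarith
  qed
  have eq: "(%s. indicator {0..S} s *\<^sub>R (AA s * \<theta> (vs s))) = (%s. indicator {0..} s * (AA s * \<theta> (vs s)))"
   by (rule ext) (use z in \<open>auto simp: indicator_def\<close>)
  have "((%s. indicator {0..S} s *\<^sub>R (AA s * \<theta> (vs s))) has_integral Jint \<theta>) UNIV"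
   using has_integral_integral_lborel[OF i] unfolding Jint_def eq .
  moreover have e2: "(%s. indicator {0..S} s *\<^sub>R (AA s * \<theta> (vs s))) = (%s. if s \<in> {0..S} then AA s * \<theta> (vs s) else 0)"
   by (rule ext) (auto simp: indicator_def)
  ultimately have "((%s. AA s * \<theta> (vs s)) has_integral Jint \<theta>) {0..S}"
   unfolding e2 has_integral_restrict_UNIV by blast
  then show ?thesis using i eq by simp
 qed
 show "integrable lborel (%s. indicator {0..} s * (AA s * \<theta> (vs s)))" using main[OF order_refl] by (rule conjunct1)
 show "((%s. AA s * \<theta> (vs s)) has_integral Jint \<theta>) {0..S}" if "S >= sv R" using main[OF that] by (rule conjunct2)
qed

text \<open>If \<open>Jint \<theta> = 0\<close>, then \<open>gr \<theta>\<close> has bounded support and \<open>\<theta>\<close> is the divergence of the field belonging to it. So the kernel of \<open>Jint\<close> is contained in that of \<open>Iint\<close>, and the two are proportional.\<close>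

lemma Iint_eq_0:
 assumes th: "diffs_on 1 {0..} \<theta>" and R: "!!v. v > R ==> \<theta> v = 0" and R0: "R >= 0" and J: "Jint \<theta> = 0"
 shows "Iint \<theta> = 0"
proof -
 obtain X where X: "!!v. v >= 0 ==> hder (gr \<theta>) (X v) v" "continuous_on {0..} X"
  using diffs_on_gr[OF th] by auto
 have L: "Lop (gr \<theta>) X v = \<theta> v" if "v >= 0" for v
  using gr_ode[OF th X(1)] that by (simp add: Lop_def)
 have g0: "gr \<theta> v = 0" if v: "v > R" for v
 proof -
  have s: "sv v >= sv R" "sv v >= 0" using v R0 sv_mono sv_nonneg by auto
  have "sv v > 0" using v R0 by (simp add: sv_def)
  have "((%s. AA s * \<theta> (vs s)) has_integral 0) {0..sv v}"
   using integrable_J(2)[OF diffs_on_continuous[OF th] R R0 s(1)] J by simp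
  moreover have "((%s. AA s * \<theta> (vs s)) has_integral WW (sv v) * gr \<theta> (vs (sv v))) {0..sv v}"
   using WW_gr[OF th s(2)] by simp
  ultimately have "WW (sv v) * gr \<theta> (vs (sv v)) = 0" using has_integral_unique by blast
  then have "WW (sv v) * gr \<theta> v = 0" using vs_sv[of v] v R0 by simp
  then show ?thesis using WW_pos[OF \<open>sv v > 0\<close>] by simp
 qed
 have "integral\<^sup>L lborel (%x. indicator DR x * (hh (snd x) * Lop (gr \<theta>) X (vv x))) = 0"
  by (rule integral_Lop_eq_0[OF X g0 R0])
 moreover have "(%x. indicator DR x * (hh (snd x) * Lop (gr \<theta>) X (vv x))) = (%x. indicator DR x * (hh (snd x) * \<theta> (vv x)))"
  by (rule ext) (use L vv_ge0 in \<open>auto simp: indicator_def\<close>)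
 ultimately show ?thesis by (simp add: Iint_def)
qed

text \<open>The constant of proportionality, read off at one test function.\<close>

definition cpol :: real where "cpol = Iint (cutoff 1 0) / Jint (cutoff 1 0)"

lemma Jint_cutoff_pos: "Jint (cutoff 1 0) > 0"
proof -
 have "((%s. AA s * cutoff 1 0 (vs s)) has_integral Jint (cutoff 1 0)) {0..sv 2}"
  by (rule integrable_J(2)[where R = 2, OF diffs_on_continuous[OF diffs_on_cutoff]]) (auto intro: cutoff_0')
 then have i: "(%s. AA s * cutoff 1 0 (vs s)) integrable_on {0..sv 2}" "integral {0..sv 2} (%s. AA s * cutoff 1 0 (vs s)) = Jint (cutoff 1 0)"
  by (auto simp: integral_unique)
 have s1: "sv 1 > 0" by (simp add: sv_def)
 have "0 < AA (sv 1 / 2) * (sv 1 / 2)" using s1 AA_pos by simp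
 also have "... = integral {sv 1 / 2..sv 1} (%s. AA (sv 1 / 2))" using s1 by simp
 also have "... <= integral {sv 1 / 2..sv 1} (%s. AA s * cutoff 1 0 (vs s))"
 proof (rule integral_le)
  show "(%s. AA s * cutoff 1 0 (vs s)) integrable_on {sv 1 / 2..sv 1}"
   by (rule integrable_on_subinterval[OF i(1)]) (use s1 sv_mono[of 1 2] in auto)
  fix s assume s: "s \<in> {sv 1 / 2..sv 1}"
  then have "vs s <= 1" using vs_le_iff[of s 1] s1 by auto
  then show "AA (sv 1 / 2) <= AA s * cutoff 1 0 (vs s)" using AA_mono[of "sv 1 / 2" s] s s1 by (simp add: cutoff_1)
 qed (rule integrable_const_ivl)
 also have "... <= integral {0..sv 2} (%s. AA s * cutoff 1 0 (vs s))"
 proof (rule integral_subset_le)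
  show "{sv 1 / 2..sv 1} \<subseteq> {0..sv 2}" using s1 sv_mono[of 1 2] by auto
  show "(%s. AA s * cutoff 1 0 (vs s)) integrable_on {sv 1 / 2..sv 1}"
   by (rule integrable_on_subinterval[OF i(1)]) (use s1 sv_mono[of 1 2] in auto)
 qed (use i in \<open>auto simp: AA_nonneg cutoff_bounds\<close>)
 finally show ?thesis using i(2) by simp
qed

lemma Iint_cutoff: assumes a: "a >= 0" shows "Iint (cutoff a j) = cpol * Jint (cutoff a j)"
proof -
 define r where "r = Jint (cutoff a j) / Jint (cutoff 1 0)"
 define \<theta> where "\<theta> v = cutoff a j v + - r * cutoff 1 0 v" for v
 have c: "continuous_on {0..} (cutoff a j)" "continuous_on {0..} (cutoff 1 0)"
  using diffs_on_continuous[OF diffs_on_cutoff] by blast+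
 have z: "cutoff a j v = 0" "cutoff 1 0 v = 0" if "v > a + 2" for v using that a by (auto intro: cutoff_0')
 have I: "integrable lborel (%x. indicator DR x * (hh (snd x) * cutoff a j (vv x)))"
  "integrable lborel (%x. indicator DR x * (hh (snd x) * cutoff 1 0 (vv x)))"
  using integrable_I[OF c(1) z(1)] integrable_I[OF c(2) z(2)] by blast+
 have J: "integrable lborel (%s. indicator {0..} s * (AA s * cutoff a j (vs s)))"
  "integrable lborel (%s. indicator {0..} s * (AA s * cutoff 1 0 (vs s)))"
  using integrable_J(1)[OF c(1) z(1)] integrable_J(1)[OF c(2) z(2)] a by auto
 have "Jint \<theta> = Jint (cutoff a j) + - r * Jint (cutoff 1 0)"
  unfolding Jint_def \<theta>_def using J
  by (subst Bochner_Integration.integral_mult_right_zero[symmetric], subst Bochner_Integration.integral_add[symmetric])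
    (auto simp: algebra_simps)
 then have J0: "Jint \<theta> = 0" using Jint_cutoff_pos by (simp add: r_def)
 have "Iint \<theta> = Iint (cutoff a j) + - r * Iint (cutoff 1 0)"
  unfolding Iint_def \<theta>_def using I
  by (subst Bochner_Integration.integral_mult_right_zero[symmetric], subst Bochner_Integration.integral_add[symmetric])
    (auto simp: algebra_simps)
 moreover have "Iint \<theta> = 0"
 proof (rule Iint_eq_0[OF _ _ _ J0])
  show "diffs_on 1 {0..} \<theta>" unfolding \<theta>_def[abs_def]
   by (intro diffs_on_add diffs_on_mult diffs_on_const diffs_on_cutoff)
  show "\<theta> v = 0" if "v > a + 2" for v using z[OF that] by (simp add: \<theta>_def)
 qed (use a in simp)
 ultimately show ?thesis by (simp add: r_def cpol_def)
qed

lemma emeasure_density_real: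
 assumes "integrable M f" "!!x. f x >= 0" "!!x. f x = indicator X x * g x" "X \<in> sets M"  "(%x. ennreal (g x)) \<in> borel_measurable M"
 shows "emeasure (density M (%x. ennreal (g x))) X = ennreal (integral\<^sup>L M f)"
proof -
 have "emeasure (density M (%x. ennreal (g x))) X = (\<integral>\<^sup>+x. ennreal (g x) * indicator X x \<partial>M)"
  by (rule emeasure_density) (use assms in auto)
 also have "... = (\<integral>\<^sup>+x. ennreal (f x) \<partial>M)"
  by (rule nn_integral_cong) (auto simp: assms(3) indicator_def)
 also have "... = ennreal (integral\<^sup>L M f)" by (rule nn_integral_eq_integral[OF assms(1)]) (simp add: assms(2))
 finally show ?thesis .
qed

definition NA :: "real measure" where "NA = density lborel (%s. ennreal (indicator {0..} s * AA s))"

lemma sublevel_measure: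
 assumes a: "a >= 0"
 shows "emeasure vol {x \<in> DR. vv x <= a} = ennreal (cpol * Jint (%v. if v <= a then 1 else 0))"
  "emeasure NA {s. 0 <= s \<and> s <= sv a} = ennreal (Jint (%v. if v <= a then 1 else 0))"
  "Iint (%v. if v <= a then 1 else 0) = cpol * Jint (%v. if v <= a then 1 else 0)"
proof -
 let ?\<chi> = "%v. if v <= a then 1 else (0::real)"
 have c: "continuous_on {0..} (cutoff a 0)" using diffs_on_continuous[OF diffs_on_cutoff] by blast
 have z: "cutoff a j v = 0" if "v > a + 1" for v j using that by (rule cutoff_0')
 have dom: "cutoff a j v <= cutoff a 0 v" for j v
 proof (cases "v <= a")
  case False
  have "max 0 (real (Suc 0) * (v - a)) <= max 0 (real (Suc j) * (v - a))" using False by (simp add: mult_right_mono)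
  then have "sqp (real (Suc 0) * (v - a)) <= sqp (real (Suc j) * (v - a))" unfolding sqp_def by (intro power_mono) auto
  then show ?thesis unfolding cutoff_def sqp_def[of "1 - _"] by (intro power_mono) auto
 qed (simp add: cutoff_1)
 have cm: "cutoff a j \<in> borel_measurable borel" for j
  using diffs_on_continuous[OF diffs_on_cutoff, of UNIV] borel_measurable_continuous_onI by blast
 note [measurable] = cm
 have hp: "hh (snd x) >= 0" for x :: "'n \<times> real" by (simp add: hh_def)
 have I: "(%j. Iint (cutoff a j)) \<longlonglongrightarrow> Iint ?\<chi> \<and> integrable lborel (%x. indicator DR x * (hh (snd x) * ?\<chi> (vv x)))"
 proof -
  let ?w = "%x. indicator DR x * (hh (snd x) * cutoff a 0 (vv x))"
  have w: "integrable lborel ?w" by (rule integrable_I[OF c z])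
  have lim: "AE x in lborel. (%j. indicator DR x * (hh (snd x) * cutoff a j (vv x))) \<longlonglongrightarrow> indicator DR x * (hh (snd x) * ?\<chi> (vv x))"
   by (intro AE_I2 tendsto_mult tendsto_const cutoff_tendsto)
  have b: "AE x in lborel. norm (indicator DR x * (hh (snd x) * cutoff a j (vv x))) <= ?w x" for j
   using hp dom cutoff_bounds(1)[of a j] by (intro AE_I2) (auto simp: indicator_def abs_mult intro!: mult_left_mono)
  have m: "(%x. indicator DR x * (hh (snd x) * cutoff a j (vv x))) \<in> borel_measurable lborel" for j by measurable
  have m': "(%x. indicator DR x * (hh (snd x) * ?\<chi> (vv x))) \<in> borel_measurable lborel" by measurable
  show ?thesis
   unfolding Iint_def
   using integral_dominated_convergence[OF m' m w lim b] integrable_dominated_convergence[OF m' m w lim b] by blast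
 qed
 have J: "(%j. Jint (cutoff a j)) \<longlonglongrightarrow> Jint ?\<chi> \<and> integrable lborel (%s. indicator {0..} s * (AA s * ?\<chi> (vs s)))"
 proof -
  let ?w = "%s. indicator {0..} s * (AA s * cutoff a 0 (vs s))"
  have w: "integrable lborel ?w" by (rule integrable_J(1)[OF c, of "a + 1"]) (use a z in auto)
  have lim: "AE x in lborel. (%j. indicator {0..} x * (AA x * cutoff a j (vs x))) \<longlonglongrightarrow> indicator {0..} x * (AA x * ?\<chi> (vs x))"
   by (intro AE_I2 tendsto_mult tendsto_const cutoff_tendsto)
  have b: "AE x in lborel. norm (indicator {0..} x * (AA x * cutoff a j (vs x))) <= ?w x" for j
   using AA_nonneg dom cutoff_bounds(1)[of a j] by (intro AE_I2) (auto simp: indicator_def abs_mult intro!: mult_left_mono)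
  have m: "(%s. indicator {0..} s * (AA s * cutoff a j (vs s))) \<in> borel_measurable lborel" for j by measurable
  have m': "(%s. indicator {0..} s * (AA s * ?\<chi> (vs s))) \<in> borel_measurable lborel" by measurable
  show ?thesis
   unfolding Jint_def
   using integral_dominated_convergence[OF m' m w lim b] integrable_dominated_convergence[OF m' m w lim b] by blast
 qed
 have "(%j. Iint (cutoff a j)) \<longlonglongrightarrow> cpol * Jint ?\<chi>"
  unfolding Iint_cutoff[OF a] using J by (intro tendsto_mult tendsto_const) auto
 then show IJ: "Iint ?\<chi> = cpol * Jint ?\<chi>" using I LIMSEQ_unique by blast
 have "emeasure vol {x \<in> DR. vv x <= a} = ennreal (Iint ?\<chi>)"
  unfolding vol_def Iint_def
  by (rule emeasure_density_real) (use I hp in \<open>auto simp: indicator_def\<close>)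
 then show "emeasure vol {x \<in> DR. vv x <= a} = ennreal (cpol * Jint ?\<chi>)" using IJ by simp
 show "emeasure NA {s. 0 <= s \<and> s <= sv a} = ennreal (Jint ?\<chi>)"
  unfolding NA_def Jint_def
  by (rule emeasure_density_real) (use J AA_nonneg vs_le_iff a in \<open>auto simp: indicator_def\<close>)
qed

lemma cpol_pos: "cpol > 0" and Jint_chi_pos: "Jint (%v. if v <= 1 then 1 else 0) > 0"
proof -
 let ?\<chi> = "%v. if v <= 1 then 1 else (0::real)"
 have J0: "Jint ?\<chi> >= 0" unfolding Jint_def
  by (rule integral_nonneg_AE) (auto intro!: AE_I2 simp: indicator_def AA_nonneg)
 have "emeasure vol {x \<in> DR. vv x <= 1} \<noteq> 0"
 proof
  assume "emeasure vol {x \<in> DR. vv x <= 1} = 0"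
  then have "{x \<in> DR. vv x <= 1} \<in> null_sets vol"
   by (auto intro!: null_setsI)
  then have ae: "AE x in lborel. x \<in> {x \<in> DR. vv x <= 1} \<longrightarrow> ennreal (indicator DR x * hh (snd x)) = 0"
   unfolding vol_def by (subst (asm) null_sets_density_iff) auto
  have "AE x in lborel. x \<notin> {x \<in> DR. vv x < 1}"
   using ae by eventually_elim (auto simp: DR_iff ennreal_eq_0_iff hh_def)
  moreover have "{x \<in> DR. vv x < 1} \<in> sets lborel" by measurable
  ultimately have "{x \<in> DR. vv x < 1} \<in> null_sets lborel" by (simp add: AE_iff_null_sets)
  then have "negligible {x \<in> DR. vv x < 1}"
   by (simp add: negligible_iff_null_sets null_sets_completionI)
  moreover have "open {x \<in> DR. vv x < 1}"
   using continuous_open_preimage[OF continuous_on_vv open_DR open_lessThan[of 1]] by (simp add: vimage_def Int_def)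
  moreover have "(0, 1) \<in> {x \<in> DR. vv x < 1}" using vv_eq_0[of "(0,1)"] by (simp add: DR_def)
  ultimately show False using open_not_negligible by blast
 qed
 then have "cpol * Jint ?\<chi> > 0" using sublevel_measure(1)[of 1] by (auto simp: ennreal_eq_0_iff not_le)
 then show "cpol > 0" "Jint ?\<chi> > 0" using J0 by (auto simp: zero_less_mult_iff)
qed

lemma sets_NA [simp, measurable_cong]: "sets NA = sets borel" by (simp add: NA_def)
lemma space_NA [simp]: "space NA = UNIV" by (simp add: NA_def)

text \<open>Sublevel sets of the distance form a generator that is stable under intersections.\<close>

lemma distr_vol: "scale_measure (ennreal (1 / cpol)) (distr vol borel rr) = NA"
proof (rule measure_eqI_generator_eq[where E = "range atMost" and \<Omega> = UNIV and A = "%i. {..real i}"])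
 have eq: "emeasure (distr vol borel rr) {..t} = ennreal cpol * emeasure NA {..t}" for t
 proof -
  have d: "emeasure (distr vol borel rr) {..t} = emeasure vol {x. rr x <= t}"
   by (subst emeasure_distr) (auto simp: vimage_def)
  also have "... = emeasure vol {x \<in> DR. rr x <= t}"
  proof (rule emeasure_eq_AE)
   show "AE x in vol. (x \<in> {x. rr x <= t}) = (x \<in> {x \<in> DR. rr x <= t})"
    unfolding vol_def by (subst AE_density) (auto intro!: AE_I2 simp: indicator_def split: if_splits)
  qed auto
  finally have 1: "emeasure (distr vol borel rr) {..t} = emeasure vol {x \<in> DR. rr x <= t}" .
  have "emeasure NA {..t} = emeasure NA {s. 0 <= s \<and> s <= t}"
  proof (rule emeasure_eq_AE)
   show "AE x in NA. (x \<in> {..t}) = (x \<in> {s. 0 <= s \<and> s <= t})"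
    unfolding NA_def by (subst AE_density) (auto intro!: AE_I2 simp: indicator_def split: if_splits)
   have "{s. 0 <= s \<and> s <= t} = {0..t}" by auto
   then show "{s. 0 <= s \<and> s <= t} \<in> sets NA" by simp
  qed auto
  note 2 = this
  show ?thesis
  proof (cases "t >= 0")
   case True
   have e: "{x \<in> DR. rr x <= t} = {x \<in> DR. vv x <= vs t}"
    using vv_rr rr_nonneg vs_le_iff[of _ "vs t"] sv_vs[OF True] by (auto simp: vs_def[symmetric])
   show ?thesis unfolding 1 2 e using sublevel_measure(1,2)[of "vs t"] sv_vs[OF True] cpol_pos
    by (simp add: ennreal_mult')
  next
   case False
   then have "{x \<in> DR. rr x <= t} = {}" "{s. 0 <= s \<and> s <= t} = {}" using rr_nonneg by force+
   then show ?thesis unfolding 1 2 by (simp only: emeasure_empty mult_zero_right)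
  qed
 qed
 show "emeasure (scale_measure (ennreal (1 / cpol)) (distr vol borel rr)) X = emeasure NA X" if "X \<in> range atMost" for X
  using that eq cpol_pos by (auto simp: mult.assoc[symmetric] ennreal_mult'[symmetric])
 have fin: "emeasure NA {..t} \<noteq> \<infinity>" for t
 proof -
  have "emeasure NA {..t} = emeasure NA {s. 0 <= s \<and> s <= t}"
  proof (rule emeasure_eq_AE)
   show "AE x in NA. (x \<in> {..t}) = (x \<in> {s. 0 <= s \<and> s <= t})"
    unfolding NA_def by (subst AE_density) (auto intro!: AE_I2 simp: indicator_def split: if_splits)
   have "{s. 0 <= s \<and> s <= t} = {0..t}" by auto
   then show "{s. 0 <= s \<and> s <= t} \<in> sets NA" by simp
  qed auto
  also have "... <= emeasure NA {s. 0 <= s \<and> s <= sv (vs (max 0 t))}"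
  proof (rule emeasure_mono)
   have "{s. 0 <= s \<and> s <= sv (vs (max 0 t))} = {0..sv (vs (max 0 t))}" by auto
   then show "{s. 0 <= s \<and> s <= sv (vs (max 0 t))} \<in> sets NA" by simp
   show "{s. 0 <= s \<and> s <= t} \<subseteq> {s. 0 <= s \<and> s <= sv (vs (max 0 t))}" using sv_vs[of "max 0 t"] by auto
  qed
  also have "... < \<infinity>" using sublevel_measure(2)[of "vs (max 0 t)"] by simp
  finally show ?thesis by simp
 qed
 show "emeasure (scale_measure (ennreal (1 / cpol)) (distr vol borel rr)) {..real i} \<noteq> \<infinity>" for i
  using fin eq by (simp add: ennreal_mult_eq_top_iff)
 show "sets (scale_measure (ennreal (1 / cpol)) (distr vol borel rr)) = sigma_sets UNIV (range atMost)"
  "sets NA = sigma_sets UNIV (range (atMost :: real => real set))"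
  by (simp_all add: borel_eq_atMost)
 show "Int_stable (range (atMost :: real => real set))" by (auto simp: Int_stable_def)
 show "(\<Union>i. {..real i}) = UNIV" using real_arch_simple by auto
qed auto

lemma polar_nn:
 assumes F: "F \<in> borel_measurable borel"
 shows "ennreal (1 / cpol) * (\<integral>\<^sup>+x\<in>DR. F (DR_dist br DR_one x) \<partial>riem_volume DR met)
   = (\<integral>\<^sup>+s\<in>{0..}. F s * ennreal (AA s) \<partial>lborel)"
proof -
 have "(\<integral>\<^sup>+x\<in>DR. F (DR_dist br DR_one x) \<partial>riem_volume DR met) = (\<integral>\<^sup>+x. F (rr x) * indicator DR x \<partial>vol)"
  unfolding riem_volume_eq by (rule nn_integral_cong) (auto simp: indicator_def DR_dist_eq)
 also have "... = (\<integral>\<^sup>+x. F (rr x) \<partial>vol)"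
 proof (rule nn_integral_cong_AE)
  show "AE x in vol. F (rr x) * indicator DR x = F (rr x)"
   unfolding vol_def by (subst AE_density) (auto intro!: AE_I2 simp: indicator_def)
 qed
 also have "... = (\<integral>\<^sup>+s. F s \<partial>distr vol borel rr)" using F by (subst nn_integral_distr) auto
 also have "ennreal (1 / cpol) * ... = (\<integral>\<^sup>+s. F s \<partial>NA)"
  unfolding distr_vol[symmetric] using F by (subst nn_integral_scale_measure) auto
 also have "... = (\<integral>\<^sup>+s\<in>{0..}. F s * ennreal (AA s) \<partial>lborel)"
  unfolding NA_def using F
  by (subst nn_integral_density) (auto intro!: nn_integral_cong simp: indicator_def mult.commute)
 finally show ?thesis .
qed

lemma DR_const_eq: "DR_const br = 1 / cpol"
 unfolding DR_const_def
proof (rule the_equality)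
 show "0 < 1 / cpol \<and> (\<forall>F::real => ennreal. F \<in> borel_measurable borel \<longrightarrow>
   ennreal (1 / cpol) * (\<integral>\<^sup>+x\<in>DR. F (DR_dist br DR_one x) \<partial>riem_volume DR met) =
   (\<integral>\<^sup>+s\<in>{0..}. F s * ennreal (AA s) \<partial>lborel))"
  using cpol_pos polar_nn by auto
 fix \<kappa> assume k: "0 < \<kappa> \<and> (\<forall>F::real => ennreal. F \<in> borel_measurable borel \<longrightarrow>
   ennreal \<kappa> * (\<integral>\<^sup>+x\<in>DR. F (DR_dist br DR_one x) \<partial>riem_volume DR met) =
   (\<integral>\<^sup>+s\<in>{0..}. F s * ennreal (AA s) \<partial>lborel))"
 define F :: "real => ennreal" where "F = indicator {0..sv 1}"
 have Fm: "F \<in> borel_measurable borel" by (simp add: F_def)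
 define a where "a = (\<integral>\<^sup>+x\<in>DR. F (DR_dist br DR_one x) \<partial>riem_volume DR met)"
 have e: "ennreal \<kappa> * a = ennreal (1 / cpol) * a"
  using k polar_nn[OF Fm] Fm unfolding a_def by auto
 have "a = emeasure vol {x \<in> DR. vv x <= 1}"
 proof -
  have "a = (\<integral>\<^sup>+x. indicator {x \<in> DR. vv x <= 1} x \<partial>vol)"
   unfolding a_def riem_volume_eq
  proof (rule nn_integral_cong)
   fix x :: "'n \<times> real"
   have "rr x \<in> {0..sv 1} \<longleftrightarrow> vv x <= 1" if "x \<in> DR"
    using rr_nonneg[OF that] vv_rr[OF that] vs_le_iff[of "rr x" 1] by (auto simp: vs_def[symmetric])
   then show "F (DR_dist br DR_one x) * indicator DR x = indicator {x \<in> DR. vv x <= 1} x"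
    by (auto simp: F_def indicator_def DR_dist_eq)
  qed
  then show ?thesis by simp
 qed
 moreover have "cpol * Jint (%v. if v <= 1 then 1 else 0) > 0"
  by (rule mult_pos_pos[OF cpol_pos]) (rule Jint_chi_pos)
 ultimately have a: "a = ennreal (cpol * Jint (%v. if v <= 1 then 1 else 0))" "cpol * Jint (%v. if v <= 1 then 1 else 0) > 0"
  using sublevel_measure(1)[of 1] by auto
 show "\<kappa> = 1 / cpol"
 proof -
  have "ennreal (\<kappa> * (cpol * Jint (%v. if v <= 1 then 1 else 0))) = ennreal (1 / cpol * (cpol * Jint (%v. if v <= 1 then 1 else 0)))"
   using e k cpol_pos unfolding a(1) by (simp only: ennreal_mult'[symmetric] less_imp_le divide_nonneg_pos zero_le_one)
  then have "\<kappa> * (cpol * Jint (%v. if v <= 1 then 1 else 0)) = 1 / cpol * (cpol * Jint (%v. if v <= 1 then 1 else 0))"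
   using k cpol_pos Jint_chi_pos by (subst (asm) ennreal_inj) (auto simp: less_imp_le)
  then show ?thesis using a(2) cpol_pos Jint_chi_pos by (simp only: mult_cancel_right) simp
 qed
qed

end

section \<open>Spherical functions\<close>

lemma diffs_on_antiderivative:
 fixes g :: "real => 'b::banach"
 assumes g: "diffs_on k {0..} g"
 shows "v >= 0 ==> hder (%u. integral {0..u} g) (g v) v"
  "diffs_on (Suc k) {0..} (%v. integral {0..v} g)"
proof -
 have gc: "continuous_on {0..} g" using g diffs_on_continuous by blast
 have d: "hder (%u. integral {0..u} g) (g v) v" if v: "v >= 0" for v
 proof -
  have "((%u. integral {0..u} g) has_vector_derivative g v) (at v within {0..v+1})"
   by (rule integral_has_vector_derivative[OF continuous_on_subset[OF gc]]) (use v in auto)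
  moreover have "at v within {0..v+1} = at v within {0..}"
   by (rule at_within_nhd[of v "{..<v+1}"]) auto
  ultimately show ?thesis by simp
 qed
 then show "v >= 0 ==> hder (%u. integral {0..u} g) (g v) v" .
 show "diffs_on (Suc k) {0..} (%v. integral {0..v} g)" by (rule diffs_onI[OF d g]) auto
qed

context htype
begin

lemma DR_measure_eq: "DR_measure br = scale_measure (ennreal (1 / cpol)) vol"
 by (simp add: DR_measure_def DR_const_eq riem_volume_eq)

lemma sets_DR_measure [simp, measurable_cong]: "sets (DR_measure br) = sets borel" by (simp add: DR_measure_eq)
lemma space_DR_measure [simp]: "space (DR_measure br) = UNIV" by (simp add: DR_measure_eq space_scale_measure)

lemma distr_DR: "distr (DR_measure br) borel rr = NA"
proof (rule measure_eqI)
 fix X assume X: "X \<in> sets (distr (DR_measure br) borel rr)"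
 have "emeasure (distr (DR_measure br) borel rr) X = emeasure (DR_measure br) (rr -` X)"
  using X by (subst emeasure_distr) auto
 also have "... = emeasure (scale_measure (ennreal (1 / cpol)) (distr vol borel rr)) X"
  using X by (simp add: DR_measure_eq emeasure_distr)
 finally show "emeasure (distr (DR_measure br) borel rr) X = emeasure NA X" by (simp add: distr_vol)
qed simp

lemma AE_DR: "AE x in DR_measure br. x \<in> DR"
proof -
 have "AE x in vol. x \<in> DR" unfolding vol_def by (subst AE_density) (auto intro!: AE_I2 simp: indicator_def split: if_splits)
 then have "emeasure vol (- DR) = 0" by (subst (asm) AE_iff_measurable[of "- DR"]) auto
 then have "emeasure (DR_measure br) (- DR) = 0" by (simp add: DR_measure_eq)
 then show ?thesis by (subst AE_iff_measurable[of "- DR"]) auto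
qed

lemma DR_integral_radial:
 fixes G :: "real => complex"
 assumes f: "!!x. x \<in> DR ==> f x = G (rr x)" and G [measurable]: "G \<in> borel_measurable borel"
 shows "(LINT x:DR|DR_measure br. f x) = (LINT s|lborel. (indicator {0..} s * AA s) *\<^sub>R G s)"
proof -
 have "(LINT x:DR|DR_measure br. f x) = (LINT x|DR_measure br. indicator DR x *\<^sub>R G (rr x))"
  unfolding set_lebesgue_integral_def by (rule Bochner_Integration.integral_cong) (auto simp: f indicator_def)
 also have "... = (LINT x|DR_measure br. G (rr x))"
 proof (rule integral_cong_AE)
  show "AE x in DR_measure br. indicator DR x *\<^sub>R G (rr x) = G (rr x)"
   using AE_DR by eventually_elim simp
 qed measurable
 also have "... = (LINT s|distr (DR_measure br) borel rr. G s)" by (rule integral_distr[symmetric]) measurable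
 also have "... = (LINT s|lborel. (indicator {0..} s * AA s) *\<^sub>R G s)"
  unfolding distr_DR NA_def
  by (rule integral_density) (auto intro!: AE_I2 simp: indicator_def AA_nonneg)
 finally show ?thesis .
qed

lemma DR_ball_eq: "DR_ball br R = {x \<in> DR. rr x < R}" by (auto simp: DR_ball_def DR_dist_eq)

lemma DR_ball_sets [measurable]: "DR_ball br R \<in> sets borel" unfolding DR_ball_eq by measurable

lemma DR_ball_finite: "emeasure (DR_measure br) (DR_ball br R) < \<infinity>"
proof -
 have "emeasure (DR_measure br) (DR_ball br R) <= emeasure (DR_measure br) (rr -` {..R})"
  by (rule emeasure_mono) (use measurable_sets[OF rr_measurable, of "{..R}"] in \<open>auto simp: DR_ball_eq\<close>)
 also have "... = emeasure NA {..R}" unfolding distr_DR[symmetric] by (subst emeasure_distr) auto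
 also have "... <= emeasure NA ({..<0} \<union> {0..max 0 R})" by (rule emeasure_mono) auto
 also have "... <= emeasure NA {..<0} + emeasure NA {0..max 0 R}" by (rule emeasure_subadditive) auto
 also have "emeasure NA {..<0} = 0"
  unfolding NA_def by (subst emeasure_density) (auto simp: nn_integral_0_iff_AE indicator_def)
 also have "emeasure NA {0..max 0 R} < \<infinity>"
 proof -
  have "{0..max 0 R} = {s. 0 <= s \<and> s <= sv (vs (max 0 R))}" using sv_vs[of "max 0 R"] by auto
  then show ?thesis using sublevel_measure(2)[of "vs (max 0 R)"] by simp
 qed
 finally show ?thesis by simp
qed

text \<open>A right inverse of \<open>Lop\<close> that vanishes at the origin. Iterating it on the constant 1 gives the power series in \<open>\<mu>\<close> of the spherical function.\<close>

definition Gop :: "(real => 'b::banach) => real => 'b" where "Gop f v = integral {0..v} (gr f)"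

lemma gw_integrand_cont:
 fixes f :: "real => 'b::banach"
 assumes "continuous_on {0..} f" "v >= 0"
 shows "continuous_on {0..1} (%y. (2 * y ^ (dimS br - 1)) *\<^sub>R gw f (y\<^sup>2 * v))"
proof -
 have gc: "continuous_on {0..} (gw f)" using diffs_on_gw[of 0 f] assms(1) by simp
 show ?thesis by (intro continuous_intros continuous_on_compose2[OF gc]) (use assms(2) in auto)
qed

lemma norm_gr_le:
 fixes f :: "real => 'b::banach"
 assumes f: "continuous_on {0..} f" and v: "v >= 0" and b: "!!w. 0 <= w ==> w <= v ==> norm (f w) <= C"
 shows "norm (gr f v) <= C"
proof -
 let ?n = "dimS br"
 have C: "C >= 0" using b[of v] v norm_ge_zero[of "f v"] by linarith
 have c1: "cS >= 1" using mz_pos by (simp add: cS_def)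
 have "norm (gJ f v) <= integral {0..1} (%y. 2 * y * ((1 + v) powr cS * C))"
  unfolding gJ_def
 proof (rule integral_norm_bound_integral)
  show "(%y. (2 * y ^ (?n - 1)) *\<^sub>R gw f (y\<^sup>2 * v)) integrable_on {0..1}"
   by (rule integrable_continuous_interval[OF gw_integrand_cont[OF f v]])
  show "(%y. 2 * y * ((1 + v) powr cS * C)) integrable_on {0..1}"
   by (intro integrable_continuous_interval continuous_intros)
  fix y :: real assume y: "y \<in> {0..1}"
  have y2: "y\<^sup>2 * v <= v" using y v mult_right_mono[of "y\<^sup>2" 1 v] by (simp add: power_le_one)
  have "(1 + y\<^sup>2 * v) powr (cS - 1) <= (1 + v) powr (cS - 1)"
   using y2 v c1 by (intro powr_mono2) auto
  also have "... <= (1 + v) powr cS" using v by (intro powr_mono) auto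
  finally have p: "(1 + y\<^sup>2 * v) powr (cS - 1) <= (1 + v) powr cS" .
  have g: "norm (gw f (y\<^sup>2 * v)) <= (1 + v) powr cS * C"
   unfolding gw_def norm_scaleR using p b[of "y\<^sup>2 * v"] y2 v C by (intro mult_mono) auto
  have "y ^ (?n - 1) <= y ^ 1" using y dimS_ge2 by (intro power_decreasing) auto
  then show "norm ((2 * y ^ (?n - 1)) *\<^sub>R gw f (y\<^sup>2 * v)) <= 2 * y * ((1 + v) powr cS * C)"
   unfolding norm_scaleR using g y C by (intro mult_mono) auto
 qed
 also have "... = (1 + v) powr cS * C"
 proof -
  have "((%y. 2 * y * ((1 + v) powr cS * C)) has_integral 1\<^sup>2 * ((1 + v) powr cS * C) - 0\<^sup>2 * ((1 + v) powr cS * C)) {0..1}"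
   by (rule fundamental_theorem_of_calculus)
     (auto intro!: derivative_eq_intros simp flip: has_real_derivative_iff_has_vector_derivative)
  then show ?thesis by (simp add: integral_unique)
 qed
 finally have "norm (gr f v) <= (1 + v) powr (- cS) * ((1 + v) powr cS * C)"
  unfolding gr_def by (simp add: mult_left_mono)
 also have "... = C" using v by (simp add: powr_minus)
 finally show ?thesis .
qed

lemma gr_diff:
 fixes f g :: "real => 'b::banach"
 assumes "continuous_on {0..} f" "continuous_on {0..} g" "v >= 0"
 shows "gr (%v. f v - g v) v = gr f v - gr g v"
proof -
 have "(%y. (2 * y ^ (dimS br - 1)) *\<^sub>R gw (%v. f v - g v) (y\<^sup>2 * v))
   = (%y. (2 * y ^ (dimS br - 1)) *\<^sub>R gw f (y\<^sup>2 * v) - (2 * y ^ (dimS br - 1)) *\<^sub>R gw g (y\<^sup>2 * v))"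
  by (simp add: gw_def scaleR_diff_right)
 then have "gJ (%v. f v - g v) v = gJ f v - gJ g v"
  unfolding gJ_def using integrable_continuous_interval[OF gw_integrand_cont[OF assms(1,3)]]
   integrable_continuous_interval[OF gw_integrand_cont[OF assms(2,3)]]
  by (simp add: Henstock_Kurzweil_Integration.integral_diff)
 then show ?thesis by (simp add: gr_def scaleR_diff_right)
qed

lemma gr_cmult: "gr (%v. c *\<^sub>R f v) v = c *\<^sub>R gr f v" for f :: "real => 'b::banach"
proof -
 have "(%y. (2 * y ^ (dimS br - 1)) *\<^sub>R gw (%v. c *\<^sub>R f v) (y\<^sup>2 * v)) = (%y. c *\<^sub>R ((2 * y ^ (dimS br - 1)) *\<^sub>R gw f (y\<^sup>2 * v)))"
  by (auto simp: gw_def)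
 then have "gJ (%v. c *\<^sub>R f v) v = c *\<^sub>R gJ f v" unfolding gJ_def by (simp only: integral_cmul)
 then show ?thesis by (simp add: gr_def)
qed

lemma continuous_on_gr: "continuous_on {0..} f ==> continuous_on {0..} (gr f)" for f :: "real => 'b::banach"
 using diffs_on_gr[of 0 f] by simp

lemma gr_integrable: "continuous_on {0..} f ==> gr f integrable_on {0..v}" for f :: "real => 'b::banach"
 by (rule integrable_continuous_interval) (rule continuous_on_subset[OF continuous_on_gr], auto)

lemma norm_Gop_le:
 fixes f :: "real => 'b::banach"
 assumes f: "continuous_on {0..} f" and v: "v >= 0" "v <= V" and b: "!!w. 0 <= w ==> w <= V ==> norm (f w) <= C * w ^ k / fact k" and C: "C >= 0"
 shows "norm (Gop f v) <= C * v ^ Suc k / fact (Suc k)"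
proof -
 have "norm (Gop f v) <= integral {0..v} (%w. C * w ^ k / fact k)"
  unfolding Gop_def
 proof (rule integral_norm_bound_integral[OF gr_integrable[OF f]])
  show "(%w. C * w ^ k / fact k) integrable_on {0..v}" by (intro integrable_continuous_interval continuous_intros) auto
  fix x assume x: "x \<in> {0..v}"
  show "norm (gr f x) <= C * x ^ k / fact k"
  proof (rule norm_gr_le[OF f])
   fix w assume w: "0 <= w" "w <= x"
   have "norm (f w) <= C * w ^ k / fact k" using b w x v by auto
   also have "... <= C * x ^ k / fact k" using w C by (intro divide_right_mono mult_left_mono power_mono) auto
   finally show "norm (f w) <= C * x ^ k / fact k" .
  qed (use x in auto)
 qed
 also have "... = C * v ^ Suc k / fact (Suc k)"
 proof -
  have "((%w. C * w ^ k / fact k) has_integral C * v ^ Suc k / fact (Suc k) - C * 0 ^ Suc k / fact (Suc k)) {0..v}"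
  proof (rule fundamental_theorem_of_calculus[OF v(1)])
   fix x :: real
   have "((%w. C * w ^ Suc k / fact (Suc k)) has_real_derivative C * (real (Suc k) * x ^ k) / fact (Suc k)) (at x within {0..v})"
    by (auto intro!: derivative_eq_intros simp del: power_Suc fact_Suc of_nat_Suc)
   moreover have "C * (real (Suc k) * x ^ k) / fact (Suc k) = C * x ^ k / fact k"
    unfolding fact_Suc of_nat_mult by (simp del: of_nat_Suc)
   ultimately show "((%w. C * w ^ Suc k / fact (Suc k)) has_vector_derivative C * x ^ k / fact k) (at x within {0..v})"
    by (simp only: has_real_derivative_iff_has_vector_derivative)
  qed
  then have "integral {0..v} (%w. C * w ^ k / fact k) = C * v ^ Suc k / fact (Suc k) - C * 0 ^ Suc k / fact (Suc k)"
   by (rule integral_unique)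
  then show ?thesis by (simp only: power_0_Suc mult_zero_right div_0 diff_zero)
 qed
 finally show ?thesis .
qed

primrec pk :: "nat => real => real" where
 "pk 0 = (%v. 1)"
| "pk (Suc k) = Gop (pk k)"

lemma pk_continuous: "continuous_on {0..} (pk k)"
proof (induction k)
 case (Suc k)
 have "diffs_on 0 {0..} (gr (pk k))" using continuous_on_gr[OF Suc] by simp
 from diffs_on_continuous[OF diffs_on_antiderivative(2)[OF this]] show ?case by (simp add: Gop_def[abs_def])
qed simp

lemma pk_bound: "v >= 0 ==> \<bar>pk k v\<bar> <= v ^ k / fact k"
proof (induction k arbitrary: v)
 case (Suc k)
 show ?case using norm_Gop_le[OF pk_continuous[of k] Suc.prems order_refl, of 1 k] Suc.IH by simp
qed simp

text \<open>The cutoff \<open>max 0 v\<close> keeps the series convergent for every real \<open>v\<close>, so that joint measurability needs no restriction to the half line.\<close>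

definition Phi :: "real => real => real" where
 "Phi \<mu> v = (\<Sum>k. (- \<mu>) ^ k * pk k (max 0 v))"

lemma Phi_term_bound: "0 <= v ==> v <= V ==> \<bar>(- \<mu>) ^ k * pk k (max 0 v)\<bar> <= (\<bar>\<mu>\<bar> * V) ^ k / fact k"
proof -
 assume v: "0 <= v" "v <= V"
 have "\<bar>(- \<mu>) ^ k * pk k (max 0 v)\<bar> <= \<bar>\<mu>\<bar> ^ k * (v ^ k / fact k)"
  unfolding abs_mult power_abs using v pk_bound[of v k] by (intro mult_mono) auto
 also have "... <= \<bar>\<mu>\<bar> ^ k * (V ^ k / fact k)" using v by (intro mult_left_mono divide_right_mono power_mono) auto
 finally show ?thesis by (simp add: power_mult_distrib)
qed

lemma summable_exp_terms: "summable (%k. (c::real) ^ k / fact k)"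
 using summable_exp_generic[of c] by (simp add: divide_inverse mult.commute)

lemma Phi_summable: "summable (%k. (- \<mu>) ^ k * pk k (max 0 v))"
 by (rule summable_comparison_test[OF _ summable_exp_terms[of "\<bar>\<mu>\<bar> * max 0 v"]])
   (use Phi_term_bound[of "max 0 v" "max 0 v" \<mu>] in auto)

lemma Phi_uniform: "uniform_limit {0..V} (%n v. \<Sum>k<n. (- \<mu>) ^ k * pk k (max 0 v)) (Phi \<mu>) sequentially"
 unfolding Phi_def[abs_def]
 by (rule Weierstrass_m_test[OF _ summable_exp_terms[of "\<bar>\<mu>\<bar> * V"]]) (use Phi_term_bound in auto)

lemma Phi_continuous: "continuous_on {0..} (Phi \<mu>)"
proof -
 have pc: "continuous_on S (%v. pk k (max 0 v))" for k S
  by (rule continuous_on_compose2[OF pk_continuous]) (auto intro!: continuous_intros)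
 have "continuous_on {0..V} (Phi \<mu>)" for V
  by (rule uniform_limit_theorem[OF _ Phi_uniform]) (auto intro!: always_eventually continuous_intros pc)
 then have "continuous (at v within {0..}) (Phi \<mu>)" if "v >= 0" for v
 proof -
  have "continuous (at v within {0..v+1}) (Phi \<mu>)"
   using \<open>!!V. continuous_on {0..V} (Phi \<mu>)\<close>[of "v+1"] that by (simp add: continuous_on_eq_continuous_within)
  moreover have "at v within {0..v+1} = at v within {0..}"
   by (rule at_within_nhd[of v "{..<v+1}"]) auto
  ultimately show ?thesis by (simp add: continuous_within)
 qed
 then show ?thesis by (simp add: continuous_on_eq_continuous_within)
qed

lemma Phi_measurable [measurable]:
 assumes [measurable]: "f \<in> borel_measurable M" "g \<in> borel_measurable M"
 shows "(%x. Phi (f x) (g x)) \<in> borel_measurable M"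
proof -
 have pc: "continuous_on UNIV (%v. pk k (max 0 v))" for k
  by (rule continuous_on_compose2[OF pk_continuous]) (auto intro!: continuous_intros)
 have [measurable]: "(%v. pk k (max 0 v)) \<in> borel_measurable borel" for k
  by (rule borel_measurable_continuous_onI[OF pc])
 have [measurable]: "(%x. pk k (max 0 (g x))) \<in> borel_measurable M" for k
  using measurable_compose[OF assms(2), of "%v. pk k (max 0 v)" borel] by simp
 show ?thesis unfolding Phi_def by measurable
qed

text \<open>The integral form of \<open>Lop \<Phi> = - \<mu> \<Phi>\<close> with value 1 at the origin.\<close>

lemma Phi_fixpoint: assumes v: "v >= 0" shows "Phi \<mu> v = 1 - \<mu> * Gop (Phi \<mu>) v"
proof -
 define S where "S n v = (\<Sum>k<n. (- \<mu>) ^ k * pk k (max 0 v))" for n v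
 have pc: "continuous_on A (%v. pk k (max 0 v))" for k A
  by (rule continuous_on_compose2[OF pk_continuous]) (auto intro!: continuous_intros)
 have Sc: "continuous_on {0..} (S n)" for n unfolding S_def by (intro continuous_intros pc)
 have Ssuc: "S (Suc n) v = 1 - \<mu> * Gop (S n) v" if "v >= 0" for n v
  using that
 proof (induction n arbitrary: v)
  case 0
  have "gr (%v::real. 0::real) = (%v. 0)" by (auto simp: gr_def gJ_def gw_def)
  moreover have "S 0 = (%v. 0)" by (auto simp: S_def)
  ultimately show ?case by (simp add: S_def Gop_def)
 next
  case (Suc n)
  have g: "gr (S (Suc n)) w = gr (S n) w + (- \<mu>) ^ n * gr (pk n) w" if w: "w >= 0" for w
  proof -
   have "gr (%v. S (Suc n) v - S n v) w = gr (S (Suc n)) w - gr (S n) w" by (rule gr_diff[OF Sc Sc w])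
   moreover have "gr (%v. S (Suc n) v - S n v) w = gr (%v. (- \<mu>) ^ n *\<^sub>R pk n v) w"
   proof -
    have "gJ (%v. S (Suc n) v - S n v) w = gJ (%v. (- \<mu>) ^ n *\<^sub>R pk n v) w"
     unfolding gJ_def
    proof (rule integral_cong)
     fix y :: real
     have "max 0 (y\<^sup>2 * w) = y\<^sup>2 * w" using w by (simp add: max_def)
     then show "(2 * y ^ (dimS br - 1)) *\<^sub>R gw (%v. S (Suc n) v - S n v) (y\<^sup>2 * w)
       = (2 * y ^ (dimS br - 1)) *\<^sub>R gw (%v. (- \<mu>) ^ n *\<^sub>R pk n v) (y\<^sup>2 * w)"
      by (simp add: gw_def S_def)
    qed
    then show ?thesis by (simp add: gr_def)
   qed
   ultimately show ?thesis using gr_cmult[of "(- \<mu>) ^ n" "pk n" w] by simp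
  qed
  have "Gop (S (Suc n)) v = integral {0..v} (%w. gr (S n) w + (- \<mu>) ^ n *\<^sub>R gr (pk n) w)"
   unfolding Gop_def by (rule integral_cong) (use g in auto)
  also have "... = Gop (S n) v + (- \<mu>) ^ n * Gop (pk n) v"
   unfolding Gop_def using gr_integrable[OF Sc] gr_integrable[OF pk_continuous]
   by (subst integral_add) (auto intro: integrable_on_mult_right)
  finally have G: "Gop (S (Suc n)) v = Gop (S n) v + (- \<mu>) ^ n * Gop (pk n) v" .
  have IH: "S (Suc n) v = 1 - \<mu> * Gop (S n) v" by (rule Suc.IH[OF Suc.prems])
  have mx: "max 0 v = v" using Suc.prems by (simp add: max_def)
  have "S (Suc (Suc n)) v = S (Suc n) v + (- \<mu>) ^ Suc n * Gop (pk n) v"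
   unfolding S_def mx by (simp only: sum.lessThan_Suc pk.simps)
  then show ?case unfolding IH G by (simp add: algebra_simps)
 qed
 have lim: "(%n. S n v) \<longlonglongrightarrow> Phi \<mu> v"
  unfolding S_def Phi_def using Phi_summable summable_LIMSEQ by blast
 have "(%n. Gop (S n) v) \<longlonglongrightarrow> Gop (Phi \<mu>) v"
 proof (rule LIMSEQ_I)
  fix r :: real assume r: "r > 0"
  have "r / (v + 1) > 0" using r v by simp
  from uniform_limitD[OF Phi_uniform[of \<mu> v] this]
  have "\<exists>N. \<forall>n\<ge>N. \<forall>x\<in>{0..v}. dist (\<Sum>k<n. (- \<mu>) ^ k * pk k (max 0 x)) (Phi \<mu> x) < r / (v + 1)"
   unfolding eventually_sequentially .
  then obtain N where N0: "\<forall>n\<ge>N. \<forall>x\<in>{0..v}. dist (\<Sum>k<n. (- \<mu>) ^ k * pk k (max 0 x)) (Phi \<mu> x) < r / (v + 1)" ..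
  have N: "dist (S n x) (Phi \<mu> x) < r / (v + 1)" if "n >= N" "x \<in> {0..v}" for n x
   unfolding S_def using N0 that by blast
  have "norm (Gop (S n) v - Gop (Phi \<mu>) v) < r" if n: "n >= N" for n
  proof -
   have "Gop (S n) v - Gop (Phi \<mu>) v = integral {0..v} (%w. gr (S n) w - gr (Phi \<mu>) w)"
    unfolding Gop_def by (rule Henstock_Kurzweil_Integration.integral_diff[symmetric]) (rule gr_integrable Sc Phi_continuous)+
   also have "... = Gop (%v. S n v - Phi \<mu> v) v"
    unfolding Gop_def by (rule integral_cong) (use gr_diff[OF Sc Phi_continuous] in auto)
   finally have e: "Gop (S n) v - Gop (Phi \<mu>) v = Gop (%v. S n v - Phi \<mu> v) v" .
   have "norm (Gop (%v. S n v - Phi \<mu> v) v) <= (r / (v + 1)) * v ^ Suc 0 / fact (Suc 0)"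
   proof (rule norm_Gop_le[OF _ v order_refl])
    show "continuous_on {0..} (%v. S n v - Phi \<mu> v)" by (intro continuous_intros Sc Phi_continuous)
    fix w assume w: "0 <= w" "w <= v"
    show "norm (S n w - Phi \<mu> w) <= (r / (v + 1)) * w ^ 0 / fact 0"
     using N[OF n, of w] w by (simp add: dist_norm less_imp_le)
   qed (use r v in simp)
   then have "norm (Gop (S n) v - Gop (Phi \<mu>) v) <= (r / (v + 1)) * v ^ Suc 0 / fact (Suc 0)" by (simp only: e)
   also have "... = r * (v / (v + 1))" by simp
   also have "... < r * 1" using r v by (intro mult_strict_left_mono) auto
   finally show ?thesis by simp
  qed
  then show "\<exists>no. \<forall>n\<ge>no. norm (Gop (S n) v - Gop (Phi \<mu>) v) < r" by blast
 qed
 then have "(%n. 1 - \<mu> * Gop (S n) v) \<longlonglongrightarrow> 1 - \<mu> * Gop (Phi \<mu>) v" by (intro tendsto_intros)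
 then have "(%n. S (Suc n) v) \<longlonglongrightarrow> 1 - \<mu> * Gop (Phi \<mu>) v" unfolding Ssuc[OF v] .
 then show ?thesis using LIMSEQ_unique[OF LIMSEQ_Suc[OF lim]] by blast
qed

lemma Phi_smooth: "diffs_on k {0..} (Phi \<mu>)"
proof (induction k)
 case 0 then show ?case using Phi_continuous by simp
next
 case (Suc k)
 have "diffs_on (Suc k) {0..} (%v. 1 - \<mu> * integral {0..v} (gr (Phi \<mu>)))"
  by (intro diffs_on_diff diffs_on_mult diffs_on_const diffs_on_antiderivative(2) diffs_on_gr Suc)
 then show ?case by (rule diffs_on_cong[rotated]) (use Phi_fixpoint in \<open>auto simp: Gop_def\<close>)
qed

lemma Phi_0: "Phi \<mu> 0 = 1" using Phi_fixpoint[of 0 \<mu>] by (simp add: Gop_def)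

definition Phi1 :: "real => real => real" where "Phi1 \<mu> v = - \<mu> * gr (Phi \<mu>) v"

lemma Phi_deriv: "v >= 0 ==> (Phi \<mu> has_real_derivative Phi1 \<mu> v) (at v within {0..})"
proof -
 assume v: "v >= 0"
 have "((%v. integral {0..v} (gr (Phi \<mu>))) has_real_derivative gr (Phi \<mu>) v) (at v within {0..})"
  using diffs_on_antiderivative(1)[OF diffs_on_gr[OF Phi_smooth] v]
  by (simp add: has_real_derivative_iff_has_vector_derivative)
 then have "((%v. 1 - \<mu> * integral {0..v} (gr (Phi \<mu>))) has_real_derivative 0 - \<mu> * gr (Phi \<mu>) v) (at v within {0..})"
  by (intro DERIV_diff DERIV_const DERIV_cmult)
 then have "((%v. 1 - \<mu> * integral {0..v} (gr (Phi \<mu>))) has_real_derivative Phi1 \<mu> v) (at v within {0..})"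
  by (simp add: Phi1_def)
 then show ?thesis
  by (rule has_field_derivative_transform_within[OF _ zero_less_one]) (use v Phi_fixpoint in \<open>auto simp: Gop_def\<close>)
qed

definition Phi2 :: "real => real => real" where
 "Phi2 \<mu> v = - \<mu> * vector_derivative (gr (Phi \<mu>)) (at v within {0..})"

lemma gr_Phi_deriv:
 assumes v: "v >= 0"
 shows "hder (gr (Phi \<mu>)) (vector_derivative (gr (Phi \<mu>)) (at v within {0..})) v"
proof -
 obtain X where "\<forall>v\<in>{0..}. hder (gr (Phi \<mu>)) (X v) v"
  using diffs_on_gr[OF Phi_smooth[of 1 \<mu>]] unfolding One_nat_def diffs_on.simps by (elim exE conjE)
 then have "gr (Phi \<mu>) differentiable (at v within {0..})" using v differentiableI_vector by auto
 then show ?thesis by (simp add: vector_derivative_works)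
qed

lemma Phi1_deriv: "v >= 0 ==> (Phi1 \<mu> has_real_derivative Phi2 \<mu> v) (at v within {0..})"
 unfolding Phi1_def[abs_def] Phi2_def
 by (rule DERIV_cmult) (simp add: gr_Phi_deriv has_real_derivative_iff_has_vector_derivative)

lemma Phi_Lop: assumes v: "v >= 0" shows "Lop (Phi1 \<mu>) (Phi2 \<mu>) v = - \<mu> * Phi \<mu> v"
 unfolding gr_ode[OF Phi_smooth[of 1] gr_Phi_deriv[OF v] v, symmetric] Lop_def Phi1_def Phi2_def real_scaleR_def
 by (simp add: algebra_simps)

end

section \<open>Rapid decrease of all derivatives\<close>

text \<open>All derivatives up to order \<open>M\<close> on \<open>[1,\<infinity>)\<close> satisfy \<open>W\<close>. The origin is left out because \<open>coth\<close>, a coefficient of the Laplacian in the distance coordinate, is unbounded there; near the origin compactness gives all bounds.\<close>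

primrec dW :: "((real => 'b::real_normed_vector) => bool) => nat => (real => 'b) => bool" where
 "dW W 0 h \<longleftrightarrow> W h"
| "dW W (Suc M) h \<longleftrightarrow> W h \<and>
   (\<exists>h'. (\<forall>s\<ge>1. hder1 h (h' s) s) \<and> dW W M h')"

lemma dW_I:
 assumes "W h" "!!s. s >= 1 ==> hder1 h (h' s) s" "dW W M h'"
 shows "dW W (Suc M) h"
 using assms by auto

lemma dW_D:
 "dW W (Suc M) h ==> \<exists>h'. W h \<and> (\<forall>s\<ge>1. hder1 h (h' s) s) \<and> dW W M h'"
 by auto

lemma dW_SucD: "dW W (Suc M) h ==> dW W M h"
proof (induction M arbitrary: h)
 case (Suc M)
 from dW_D[OF Suc.prems] obtain h' where h'0: "(W h) \<and> (\<forall>s\<ge>1. hder1 h (h' s) s) \<and> (dW W (Suc M) h')" ..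
  then have h': "W h" "!!s. s >= 1 ==> hder1 h (h' s) s" "dW W (Suc M) h'" by (simp_all del: dW.simps)
 show ?case by (rule dW_I[OF h'(1,2) Suc.IH[OF h'(3)]])
qed simp

lemma dW_add:
 assumes add: "!!f g. W f ==> W g ==> W (%s. f s + g s)"
 shows "dW W M f ==> dW W M g ==> dW W M (%s. f s + g s)"
proof (induction M arbitrary: f g)
 case (Suc M)
 from dW_D[OF Suc.prems(1)] obtain f' where f0: "(W f) \<and> (\<forall>s\<ge>1. hder1 f (f' s) s) \<and> (dW W M f')" ..
  then have f: "W f" "!!s. s >= 1 ==> hder1 f (f' s) s" "dW W M f'" by (simp_all del: dW.simps)
 from dW_D[OF Suc.prems(2)] obtain g' where g0: "(W g) \<and> (\<forall>s\<ge>1. hder1 g (g' s) s) \<and> (dW W M g')" ..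
  then have g: "W g" "!!s. s >= 1 ==> hder1 g (g' s) s" "dW W M g'" by (simp_all del: dW.simps)
 show ?case by (rule dW_I[OF add[OF f(1) g(1)] has_vector_derivative_add[OF f(2) g(2)] Suc.IH[OF f(3) g(3)]])
qed (simp add: add)

lemma dW_bilinear:
 assumes B: "bounded_bilinear B" and W: "!!b h. W1 b ==> W2 h ==> W3 (%s. B (b s) (h s))"
  and add: "!!f g. W3 f ==> W3 g ==> W3 (%s. f s + g s)"
 shows "dW W1 M b ==> dW W2 M h ==> dW W3 M (%s. B (b s) (h s))"
proof (induction M arbitrary: b h)
 case (Suc M)
 note addM = dW_add[where W = W3, OF add]
 from dW_D[OF Suc.prems(1)] obtain b' where b0: "(W1 b) \<and> (\<forall>s\<ge>1. hder1 b (b' s) s) \<and> (dW W1 M b')" ..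
  then have b: "W1 b" "!!s. s >= 1 ==> hder1 b (b' s) s" "dW W1 M b'" by (simp_all del: dW.simps)
 from dW_D[OF Suc.prems(2)] obtain h' where h0: "(W2 h) \<and> (\<forall>s\<ge>1. hder1 h (h' s) s) \<and> (dW W2 M h')" ..
  then have h: "W2 h" "!!s. s >= 1 ==> hder1 h (h' s) s" "dW W2 M h'" by (simp_all del: dW.simps)
 show ?case
  by (rule dW_I[OF W[OF b(1) h(1)] bounded_bilinear.has_vector_derivative[OF B b(2) h(2)]
     addM[OF _ _ Suc.IH[OF dW_SucD[OF Suc.prems(1)] h(3)] Suc.IH[OF b(3) dW_SucD[OF Suc.prems(2)]]]])
qed (simp add: W)

lemma dW_linear:
 assumes L: "bounded_linear L" and W: "!!h. W1 h ==> W2 (%s. L (h s))"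
 shows "dW W1 M h ==> dW W2 M (%s. L (h s))"
proof (induction M arbitrary: h)
 case (Suc M)
 from dW_D[OF Suc.prems] obtain h' where h0: "(W1 h) \<and> (\<forall>s\<ge>1. hder1 h (h' s) s) \<and> (dW W1 M h')" ..
  then have h: "W1 h" "!!s. s >= 1 ==> hder1 h (h' s) s" "dW W1 M h'" by (simp_all del: dW.simps)
 show ?case by (rule dW_I[OF W[OF h(1)] bounded_linear.has_vector_derivative[OF L h(2)] Suc.IH[OF h(3)]])
qed (simp add: W)

lemma halfline1_nontrivial: "s >= 1 ==> at s within {1..} \<noteq> (bot :: real filter)"
 using trivial_limit_within[of s "{1..}"] islimpt_subset[of s "{s..s+1}" "{1..}"] islimpt_Icc[of s "s+1" s]
 by auto

lemma dW_cong:
 assumes e: "!!f g. (!!s. s >= 1 ==> f s = g s) ==> W f ==> W g"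
  and fg: "!!s. s >= 1 ==> f s = g s" and f: "dW W M f"
 shows "dW W M g"
proof (cases M)
 case 0 then show ?thesis using e[of f g] fg f by simp
next
 case (Suc M')
 from dW_D[OF f[unfolded Suc]] obtain f' where f0: "(W f) \<and> (\<forall>s\<ge>1. hder1 f (f' s) s) \<and> (dW W M' f')" ..
  then have f: "W f" "!!s. s >= 1 ==> hder1 f (f' s) s" "dW W M' f'" by (simp_all del: dW.simps)
 have "hder1 g (f' s) s" if "s >= 1" for s
  by (rule has_vector_derivative_transform[OF _ _ f(2)[OF that]]) (use that fg in auto)
 moreover have "W g" by (rule e[of f g]) (use f fg in auto)
 ultimately show ?thesis unfolding Suc using f(3) by (intro dW_I)
qed

definition bnd :: "(real => 'b::real_normed_vector) => bool" where
 "bnd h \<longleftrightarrow> (\<exists>K. \<forall>s\<ge>1. norm (h s) <= K)"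

abbreviation env :: "real => nat => real => real => real" where
 "env K N q s \<equiv> K * inverse ((1 + s) ^ N) * exp (- q * s)"

definition dec :: "real => (real => 'b::real_normed_vector) => bool" where
 "dec q h \<longleftrightarrow> (\<forall>N. \<exists>K. \<forall>s\<ge>1. norm (h s) <= env K N q s)"

lemma bnd_add: "bnd f ==> bnd g ==> bnd (%s. f s + g s)"
 unfolding bnd_def by (meson add_mono norm_triangle_le order_refl)

lemma bnd_mult: "bnd f ==> bnd g ==> bnd (%s. f s * g s :: real)"
proof -
 assume "bnd f" "bnd g"
 then obtain K L where K: "!!s. s >= 1 ==> \<bar>f s\<bar> <= K" and L: "!!s. s >= 1 ==> \<bar>g s\<bar> <= L"
  by (auto simp: bnd_def)
 have "\<bar>f s * g s\<bar> <= K * L" if s: "s >= 1" for s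
  unfolding abs_mult by (intro mult_mono K L s) (use K[OF s] in auto)
 then show ?thesis unfolding bnd_def by (intro exI[of _ "K * L"]) auto
qed

lemma dec_add: assumes "dec q f" "dec q g" shows "dec q (%s. f s + g s)"
 unfolding dec_def
proof
 fix N
 obtain K L where K: "!!s. s >= 1 ==> norm (f s) <= env K N q s"
  and L: "!!s. s >= 1 ==> norm (g s) <= env L N q s"
  using assms unfolding dec_def by meson
 have "norm (f s + g s) <= (K + L) * inverse ((1 + s) ^ N) * exp (- q * s)" if "s >= 1" for s
  using norm_triangle_ineq[of "f s" "g s"] K[OF that] L[OF that] by (simp only: distrib_right)
 then show "\<exists>K. \<forall>s\<ge>1. norm (f s + g s) <= env K N q s" by blast
qed

lemma dec_scaleR: assumes "bnd b" "dec q f" shows "dec q (%s. b s *\<^sub>R f s)"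
 unfolding dec_def
proof
 fix N
 obtain K where K: "!!s. s >= 1 ==> norm (f s) <= env K N q s"
  using assms unfolding dec_def by meson
 obtain L where L: "!!s. s >= 1 ==> \<bar>b s\<bar> <= L" using assms unfolding bnd_def real_norm_def by blast
 have "norm (b s *\<^sub>R f s) <= (L * K) * inverse ((1 + s) ^ N) * exp (- q * s)" if "s >= 1" for s
 proof -
  have "norm (b s *\<^sub>R f s) <= L * (env K N q s)"
   unfolding norm_scaleR by (intro mult_mono K L that) (use L[OF that] in auto)
  then show ?thesis by (simp only: mult.assoc)
 qed
 then show "\<exists>K. \<forall>s\<ge>1. norm (b s *\<^sub>R f s) <= env K N q s" by blast
qed

lemma dec_linear: assumes L: "bounded_linear L" and f: "dec q f" shows "dec q (%s. L (f s))"
 unfolding dec_def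
proof
 fix N
 obtain K where K: "!!s. s >= 1 ==> norm (f s) <= env K N q s"
  using f unfolding dec_def by meson
 obtain B where B: "B > 0" "!!x. norm (L x) <= norm x * B" using bounded_linear.pos_bounded[OF L] by blast
 have "norm (L (f s)) <= (K * B) * inverse ((1 + s) ^ N) * exp (- q * s)" if "s >= 1" for s
 proof -
  have "norm (L (f s)) <= (env K N q s) * B"
   using B(2)[of "f s"] mult_right_mono[OF K[OF that], of B] B(1) by linarith
  then show ?thesis by (simp only: mult_ac)
 qed
 then show "\<exists>K. \<forall>s\<ge>1. norm (L (f s)) <= env K N q s" by blast
qed

abbreviation "Bd \<equiv> dW (bnd :: (real => real) => bool)"
abbreviation "Pd q \<equiv> dW (dec q)"

lemma Bd_mult: "Bd M b ==> Bd M h ==> Bd M (%s. b s * h s)"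
 by (rule dW_bilinear[OF bounded_bilinear_mult, where ?W1.0 = bnd and ?W2.0 = bnd]) (simp_all add: bnd_mult bnd_add)

lemma Bd_add: "Bd M f ==> Bd M g ==> Bd M (%s. f s + g s)"
 by (rule dW_add[where W = bnd]) (simp_all add: bnd_add)

lemma Pd_scaleR: "Bd M b ==> Pd q M h ==> Pd q M (%s. b s *\<^sub>R h s)"
 by (rule dW_bilinear[OF bounded_bilinear_scaleR, where ?W1.0 = bnd and ?W2.0 = "dec q"]) (simp_all add: dec_scaleR dec_add)

lemma Pd_add: "Pd q M f ==> Pd q M g ==> Pd q M (%s. f s + g s)"
 by (rule dW_add[where W = "dec q"]) (simp_all add: dec_add)

lemma Pd_linear: "bounded_linear L ==> Pd q M f ==> Pd q M (%s. L (f s))"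
 by (rule dW_linear[where ?W1.0 = "dec q"]) (simp_all add: dec_linear)

lemma Pd_cong: "(!!s. s >= 1 ==> f s = g s) ==> Pd q M f ==> Pd q M g"
 by (rule dW_cong[where W = "dec q" and f = f]) (auto simp: dec_def)

lemma Bd_const: "Bd M (%s. c)"
proof (induction M arbitrary: c)
 case 0 show ?case by (auto simp: bnd_def)
next
 case (Suc M) show ?case by (rule dW_I[OF _ _ Suc.IH[of 0]]) (auto simp: bnd_def)
qed

text \<open>The two functions are proved together: their derivatives are polynomials in both.\<close>

lemma Bd_coth: "Bd M (%s. cosh s / sinh s)" "Bd M (%s. 1 / sinh s)"
proof -
 have sp: "sinh s > 0" "sinh s >= 1" "cosh s <= 3 * sinh s" if "s >= 1" for s :: real
 proof -
  have s1: "sinh s >= s" using real_le_x_sinh[of s] that by (simp add: sinh_def exp_minus)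
  then show "sinh s > 0" "sinh s >= 1" using that by auto
  have "cosh s <= sinh s + exp (-s)" by (simp add: cosh_def sinh_def field_simps)
  moreover have "exp (- s) <= 1" using that by simp
  ultimately show "cosh s <= 3 * sinh s" using \<open>sinh s >= 1\<close> by linarith
 qed
 have b: "bnd (%s. cosh s / sinh s :: real)" "bnd (%s. 1 / sinh s :: real)"
 proof -
  show "bnd (%s. cosh s / sinh s :: real)" unfolding bnd_def
   by (rule exI[of _ 3]) (use sp in \<open>auto simp: divide_simps\<close>)
  show "bnd (%s. 1 / sinh s :: real)" unfolding bnd_def
   by (rule exI[of _ 1]) (use sp in \<open>auto simp: divide_simps\<close>)
 qed
 have d1: "hder1 (%s. cosh s / sinh s) ((-1) * ((1 / sinh s) * (1 / sinh s))) s"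
  if "s >= 1" for s :: real
  using sp(1)[OF that] cosh_square_eq[of s]
  by (auto intro!: derivative_eq_intros simp: has_real_derivative_iff_has_vector_derivative[symmetric] field_simps power2_eq_square)
 have d2: "hder1 (%s. 1 / sinh s) ((-1) * ((cosh s / sinh s) * (1 / sinh s))) s"
  if "s >= 1" for s :: real
  using sp(1)[OF that]
  by (auto intro!: derivative_eq_intros simp: has_real_derivative_iff_has_vector_derivative[symmetric] field_simps power2_eq_square)
 have "Bd M (%s. cosh s / sinh s) \<and> Bd M (%s. 1 / sinh s)"
 proof (induction M)
  case 0 show ?case using b by simp
 next
  case (Suc M)
  note I = conjunct1[OF Suc.IH] conjunct2[OF Suc.IH]
  have "Bd (Suc M) (%s. cosh s / sinh s)"
   by (rule dW_I[where h' = "%s. (-1) * ((1 / sinh s) * (1 / sinh s))"]) (fact b(1), rule d1, assumption, intro Bd_mult Bd_const I)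
  moreover have "Bd (Suc M) (%s. 1 / sinh s)"
   by (rule dW_I[where h' = "%s. (-1) * ((cosh s / sinh s) * (1 / sinh s))"]) (fact b(2), rule d2, assumption, intro Bd_mult Bd_const I)
  ultimately show ?case by blast
 qed
 then show "Bd M (%s. cosh s / sinh s)" "Bd M (%s. 1 / sinh s)" by auto
qed

lemma iterated_halfline_derivative:
 fixes h :: "real => 'b::real_normed_vector"
 assumes h: "!!k. diffs_on k {0..} h"
 defines "D \<equiv> %M. ((%h s. vector_derivative h (at s within {0..})) ^^ M) h"
 shows "diffs_on k {0..} (D M)" "s >= 0 ==> hder (D M) (D (Suc M) s) s"
proof -
 have step: "(\<forall>s\<ge>0. hder (D M) (D (Suc M) s) s) \<and> (\<forall>k. diffs_on k {0..} (D (Suc M)))"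
  if "\<forall>k. diffs_on k {0..} (D M)" for M
 proof -
  from that obtain g where g: "\<forall>x\<in>{0..}. hder (D M) (g x) x" "\<forall>k. diffs_on k {0..} g"
   using diffs_on_derivative[of "{0..}" "D M"] halfline_nontrivial by auto
  have e: "D (Suc M) x = g x" if "x \<in> {0..}" for x
   using vector_derivative_within[OF halfline_nontrivial[OF that] bspec[OF g(1) that]] by (simp add: D_def)
  then show ?thesis using g diffs_on_cong[of "{0..}" g "D (Suc M)"] by auto
 qed
 have all: "\<forall>k. diffs_on k {0..} (D M)" for M
 proof (induction M)
  case 0 show ?case using h by (simp add: D_def)
 next
  case (Suc M) then show ?case using step by blast
 qed
 show "diffs_on k {0..} (D M)" using all by blast
 show "s >= 0 ==> hder (D M) (D (Suc M) s) s" using step[OF all] by blast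
qed

text \<open>On \<open>[0,1]\<close> continuity is enough.\<close>

lemma dec_halfline:
 fixes h :: "real => 'b::real_normed_vector"
 assumes d: "dec q h" and c: "continuous_on {0..} h"
 shows "\<exists>K\<ge>0. \<forall>s\<ge>0. norm (h s) <= env K N q s"
proof -
 obtain K where K: "!!s. s >= 1 ==> norm (h s) <= env K N q s"
  using d unfolding dec_def by meson
 have "continuous_on {0..1} (%s. norm (h s) * ((1 + s) ^ N * exp (q * s)))"
  by (intro continuous_intros continuous_on_subset[OF c]) auto
 then have "bounded ((%s. norm (h s) * ((1 + s) ^ N * exp (q * s))) ` {0..1})"
  by (intro compact_imp_bounded compact_continuous_image) auto
 then obtain L where L: "\<forall>x\<in>(%s. norm (h s) * ((1 + s) ^ N * exp (q * s))) ` {0..1}. norm x <= L"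
  unfolding bounded_iff ..
 have L: "norm (h s) * ((1 + s) ^ N * exp (q * s)) <= L" if "s \<in> {0..1}" for s
  using bspec[OF L imageI[OF that]] by simp
 have "norm (h s) <= max 0 (max K L) * inverse ((1 + s) ^ N) * exp (- q * s)" if s: "s >= 0" for s
 proof -
  have p: "inverse ((1 + s) ^ N) * exp (- q * s) > 0" using s by simp
  have "norm (h s) <= (if s >= 1 then K else L) * (inverse ((1 + s) ^ N) * exp (- q * s))"
  proof (cases "s >= 1")
   case True then show ?thesis using K by (simp add: mult.assoc)
  next
   case False
   have e: "((1 + s) ^ N * exp (q * s)) * (inverse ((1 + s) ^ N) * exp (- q * s)) = 1"
    using s by (simp add: field_simps exp_minus)
   have "norm (h s) = norm (h s) * (((1 + s) ^ N * exp (q * s)) * (inverse ((1 + s) ^ N) * exp (- q * s)))"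
    unfolding e by simp
   also have "... = (norm (h s) * ((1 + s) ^ N * exp (q * s))) * (inverse ((1 + s) ^ N) * exp (- q * s))"
    by (simp only: mult.assoc)
   also have "... <= L * (inverse ((1 + s) ^ N) * exp (- q * s))"
    using L[of s] s False p by (intro mult_right_mono) auto
   finally show ?thesis using False by simp
  qed
  also have "... <= max 0 (max K L) * (inverse ((1 + s) ^ N) * exp (- q * s))"
   using p by (intro mult_right_mono) auto
  finally show ?thesis by (simp only: mult.assoc)
 qed
 then show ?thesis by (intro exI[of _ "max 0 (max K L)"]) auto
qed

section \<open>Bounds for spherical functions\<close>

context htype
begin

lemma Lop_add: "Lop (%v. f1 v - g1 v) (%v. f2 v - g2 v) v = Lop f1 f2 v - Lop g1 g2 v"
 for f1 f2 g1 g2 :: "real => 'b::real_vector"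
 by (simp add: Lop_def algebra_simps)

text \<open>Writing \<open>D\<close> as an integral of \<open>gr D\<close>, a solution that vanishes at 0 satisfies a Volterra equation, whose iteration has factorial decay.\<close>

lemma ode_unique:
 fixes D :: "real => 'b::banach"
 assumes D: "diffs_on 1 {0..} D"
  and d1: "!!v. v >= 0 ==> hder D (D1 v) v"
  and d2: "!!v. v >= 0 ==> hder D1 (D2 v) v"
  and eq: "!!v. v >= 0 ==> Lop D1 D2 v = (- \<mu>) *\<^sub>R D v" and D0: "D 0 = 0" and v: "v >= 0"
 shows "D v = 0"
proof -
 have Dc: "continuous_on {0..} D" using D diffs_on_continuous by blast
 have D1: "D1 w = (- \<mu>) *\<^sub>R gr D w" if w: "w > 0" for w
 proof -
  define s where "s = sv w"
  have s: "s > 0" "vs s = w" using w vs_sv[of w] by (auto simp: s_def sv_def)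
  have "((%s. AA s *\<^sub>R Lop D1 D2 (vs s)) has_integral WW s *\<^sub>R D1 (vs s) - WW 0 *\<^sub>R D1 (vs 0)) {0..s}"
   by (rule fundamental_theorem_of_calculus) (use s WW_F1_deriv[OF d2] in auto)
  then have 1: "((%s. (- \<mu>) *\<^sub>R (AA s *\<^sub>R D (vs s))) has_integral WW s *\<^sub>R D1 w) {0..s}"
   using s by (simp add: eq scaleR_left_commute mult.commute)
  have 2: "((%s. (- \<mu>) *\<^sub>R (AA s *\<^sub>R D (vs s))) has_integral (- \<mu>) *\<^sub>R (WW s *\<^sub>R gr D w)) {0..s}"
   using has_integral_cmul[OF WW_gr[OF D, of s], of "- \<mu>"] s by simp
  have "WW s *\<^sub>R D1 w = WW s *\<^sub>R ((- \<mu>) *\<^sub>R gr D w)"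
   using has_integral_unique[OF 1 2] by (simp add: scaleR_left_commute mult.commute)
  then show ?thesis using WW_pos[OF s(1)] by (simp only: scaleR_cancel_left) simp
 qed
 have DG: "D w = (- \<mu>) *\<^sub>R Gop D w" if w: "w >= 0" for w
 proof -
  have "(D1 has_integral D w - D 0) {0..w}"
   by (rule fundamental_theorem_of_calculus[OF w]) (auto intro: has_vector_derivative_within_subset[OF d1])
  then have "(D1 has_integral D w) {0..w}" using D0 by simp
  then have "((%w. (- \<mu>) *\<^sub>R gr D w) has_integral D w) {0..w}"
   by (rule has_integral_spike[of "{0}", rotated 2]) (use D1 in auto)
  moreover have "((%w. (- \<mu>) *\<^sub>R gr D w) has_integral (- \<mu>) *\<^sub>R Gop D w) {0..w}"
   unfolding Gop_def by (intro has_integral_cmul integrable_integral gr_integrable Dc)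
  ultimately show ?thesis using has_integral_unique by blast
 qed
 obtain C where C: "!!w. w \<in> {0..v} ==> norm (D w) <= C"
 proof -
  have "compact (D ` {0..v})" by (rule compact_continuous_image[OF continuous_on_subset[OF Dc]]) auto
  then obtain C where "\<forall>x\<in>D ` {0..v}. norm x <= C" using compact_imp_bounded bounded_iff by metis
  then show ?thesis by (intro that[of C]) auto
 qed
 have C0: "C >= 0" using C[of 0] v norm_ge_zero[of "D 0"] by (simp del: norm_ge_zero)
 have b: "norm (D w) <= C * \<bar>\<mu>\<bar> ^ k * w ^ k / fact k" if "0 <= w" "w <= v" for w k
  using that
 proof (induction k arbitrary: w)
  case 0 then show ?case using C by simp
 next
  case (Suc k)
  have "norm (D w) = \<bar>\<mu>\<bar> * norm (Gop D w)" by (subst DG[OF Suc.prems(1)]) simp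
  also have "... <= \<bar>\<mu>\<bar> * ((C * \<bar>\<mu>\<bar> ^ k) * w ^ Suc k / fact (Suc k))"
   by (intro mult_left_mono norm_Gop_le[OF Dc Suc.prems]) (use Suc.IH C0 in auto)
  finally show ?case by (simp add: mult_ac)
 qed
 have "(%k. C * ((\<bar>\<mu>\<bar> * v) ^ k / fact k)) \<longlonglongrightarrow> C * 0"
  by (intro tendsto_mult tendsto_const summable_LIMSEQ_zero summable_exp_terms)
 moreover have "norm (D v) <= C * ((\<bar>\<mu>\<bar> * v) ^ k / fact k)" for k
  using b[OF v order_refl, of k] by (simp add: power_mult_distrib mult_ac)
 ultimately have "norm (D v) <= C * 0" by (intro LIMSEQ_le_const) auto
 then show ?thesis by simp
qed

definition mu :: "real => real" where "mu lam = lam\<^sup>2 + Q\<^sup>2 / 4"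

lemma mu_pos: "mu lam > 0" using hdim_ge by (simp add: mu_def add_nonneg_pos)
lemma mu_ge: "mu lam >= 1 / 4" "lam\<^sup>2 <= mu lam" "Q\<^sup>2 / 4 <= mu lam"
proof -
 have "1 <= Q\<^sup>2" using one_le_power[OF hdim_ge] .
 then show "mu lam >= 1 / 4" "lam\<^sup>2 <= mu lam" "Q\<^sup>2 / 4 <= mu lam"
  using zero_le_power2[of lam] unfolding mu_def by linarith+
qed

text \<open>The power series satisfies the conditions that select the spherical function, and by \<open>ode_unique\<close> nothing else does.\<close>

lemma spherical_function_eq:
 assumes x: "x \<in> DR"
 shows "spherical_function br lam x = complex_of_real (Phi (mu lam) (vv x))"
proof -
 let ?P = "%\<phi>. smooth_on DR \<phi> \<and> radial br \<phi> \<and>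
   (\<forall>x\<in>DR. DR_laplacian br \<phi> x = - complex_of_real (lam\<^sup>2 + Q\<^sup>2 / 4) * \<phi> x) \<and> \<phi> DR_one = 1"
 have one: "DR_one \<in> DR" "vv DR_one = 0" using vv_eq_0[of DR_one] by (simp_all add: DR_one_def DR_def)
 define P2 where "P2 = Phi2 (mu lam)"
 have P2: "(Phi1 (mu lam) has_real_derivative P2 v) (at v within {0..})" "Lop (Phi1 (mu lam)) P2 v = - (mu lam) * Phi (mu lam) v" if "v >= 0" for v
  unfolding P2_def using Phi1_deriv[OF that] Phi_Lop[OF that] by auto
 define G where "G v = complex_of_real (Phi (mu lam) v)" for v
 define G1 where "G1 v = complex_of_real (Phi1 (mu lam) v)" for v
 define G2 where "G2 v = complex_of_real (P2 v)" for v
 have Gs: "diffs_on k {0..} G" for k unfolding G_def[abs_def] by (rule diffs_on_linear[OF bounded_linear_of_real Phi_smooth])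
 have Gd: "hder G (G1 v) v" "hder G1 (G2 v) v" if "v >= 0" for v
  using bounded_linear.has_vector_derivative[OF bounded_linear_of_real] Phi_deriv[OF that] P2(1)[OF that]
  by (auto simp: G_def[abs_def] G1_def[abs_def] G2_def[abs_def] has_real_derivative_iff_has_vector_derivative)
 have GL: "Lop G1 G2 v = (- mu lam) *\<^sub>R G v" if "v >= 0" for v
 proof -
  have "Lop G1 G2 v = complex_of_real (Lop (Phi1 (mu lam)) P2 v)"
   by (simp add: Lop_def G1_def G2_def scaleR_conv_of_real)
  then show ?thesis using P2(2)[OF that] by (simp add: G_def scaleR_conv_of_real)
 qed
 have "?P (%x. G (vv x))"
 proof (intro conjI ballI)
  show "smooth_on DR (%x. G (vv x))" by (rule smooth_on_radial[OF Gs])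
  show "radial br (%x. G (vv x))" by (auto simp: radial_iff)
  show "G (vv DR_one) = 1" by (simp add: one G_def Phi_0)
  fix x :: "'n \<times> real" assume x: "x \<in> DR"
  have "DR_laplacian br (%x. G (vv x)) x = Lop G1 G2 (vv x)"
   unfolding Lop_def by (rule laplacian_radial[OF refl Gd x])
  then show "DR_laplacian br (%x. G (vv x)) x = - complex_of_real (lam\<^sup>2 + Q\<^sup>2 / 4) * G (vv x)"
   using GL[OF vv_ge0[OF x]] by (simp add: mu_def scaleR_conv_of_real)
 qed
 then have ex: "\<exists>\<phi>. ?P \<phi>" by (rule exI[of ?P "%x. G (vv x)"])
 have P: "?P (spherical_function br lam)" unfolding spherical_function_def by (rule someI_ex[OF ex])
 obtain F where F0: "(\<forall>k. diffs_on k {0..} F) \<and> (\<forall>x\<in>DR. spherical_function br lam x = F (vv x))"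
  using smooth_radial_profile[OF conjunct1[OF P] conjunct1[OF conjunct2[OF P]]] ..
 then have F: "diffs_on k {0..} F" "y \<in> DR ==> spherical_function br lam y = F (vv y)" for k y
  by simp_all
 obtain F1 where F1: "\<forall>v\<in>{0..}. hder F (F1 v) v" "\<forall>k. diffs_on k {0..} F1"
  using diffs_on_derivative[OF halfline_nontrivial F(1)] by blast
 obtain F2 where F2: "\<forall>v\<in>{0..}. hder F1 (F2 v) v"
  using diffs_on_derivative[OF halfline_nontrivial, of F1] F1(2) by blast
 have surj: "\<exists>x\<in>DR. vv x = v" if "v >= 0" for v
  using vertical_DR[of "sv v"] vv_vertical[of "sv v"] that sinh_sv(1)[OF that] by (metis real_sqrt_pow2)
 have FL: "Lop F1 F2 v = (- mu lam) *\<^sub>R F v" if v: "v >= 0" for v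
 proof -
  obtain x where x: "x \<in> DR" "vv x = v" using surj[OF v] by blast
  have "DR_laplacian br (spherical_function br lam) x = Lop F1 F2 (vv x)"
   unfolding Lop_def by (rule laplacian_radial[where F = F and f = "spherical_function br lam", OF F(2) _ _ x(1)]) (use F1(1) F2 in auto)
  moreover have "DR_laplacian br (spherical_function br lam) x = - complex_of_real (mu lam) * F v"
   using P x F(2)[OF x(1)] by (simp add: mu_def)
  ultimately show ?thesis using x by (simp add: scaleR_conv_of_real)
 qed
 have FG: "F v - G v = 0" if v: "v >= 0" for v
 proof (rule ode_unique[where D = "%v. F v - G v" and \<mu> = "mu lam" and v = v])
  show "diffs_on 1 {0..} (%v. F v - G v)" by (intro diffs_on_diff F Gs)
  show "hder (%v. F v - G v) (F1 v - G1 v) v" if "v >= 0" for v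
   using F1(1) Gd(1) that by (intro has_vector_derivative_diff) auto
  show "hder (%v. F1 v - G1 v) (F2 v - G2 v) v" if "v >= 0" for v
   using F2 Gd(2) that by (intro has_vector_derivative_diff) auto
  show "Lop (%v. F1 v - G1 v) (%v. F2 v - G2 v) v = (- mu lam) *\<^sub>R (F v - G v)" if "v >= 0" for v
   unfolding Lop_add FL[OF that] GL[OF that] by (simp add: algebra_simps)
  show "F 0 - G 0 = 0" using F(2)[OF one(1)] P by (simp add: one G_def Phi_0)
 qed (rule v)
 from FG[OF vv_ge0[OF x]] have "F (vv x) = G (vv x)" by (simp only: right_minus_eq)
 then show ?thesis by (simp only: F(2)[OF x] G_def)
qed

text \<open>The energy \<open>\<phi>'\<^sup>2 + \<mu> \<phi>\<^sup>2\<close> decreases with the distance, since the first-order coefficient of the radial Laplacian is positive.\<close>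

lemma Phi_energy:
 assumes mu: "\<mu> >= 0" and v: "v >= 0"
 shows "v * (1 + v) * (Phi1 \<mu> v)\<^sup>2 + \<mu> * (Phi \<mu> v)\<^sup>2 <= \<mu>"
proof -
 define P2 where "P2 = Phi2 \<mu>"
 have P2: "(Phi1 \<mu> has_real_derivative P2 v) (at v within {0..})" "Lop (Phi1 \<mu>) P2 v = - \<mu> * Phi \<mu> v" if "v >= 0" for v
  unfolding P2_def using Phi1_deriv[OF that] Phi_Lop[OF that] by auto
 define E where "E v = v * (1 + v) * (Phi1 \<mu> v)\<^sup>2 + \<mu> * (Phi \<mu> v)\<^sup>2" for v
 define E' where "E' v = - ((nS - 1) + 2 * Q * v) * (Phi1 \<mu> v)\<^sup>2" for v
 have d: "(E has_real_derivative E' w) (at w within {0..})" if w: "w >= 0" for w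
 proof -
  have "(E has_real_derivative (1 + 2 * w) * (Phi1 \<mu> w)\<^sup>2 + w * (1 + w) * (2 * Phi1 \<mu> w * P2 w) + \<mu> * (2 * Phi \<mu> w * Phi1 \<mu> w)) (at w within {0..})"
   unfolding E_def[abs_def]
   by (rule derivative_eq_intros P2(1)[OF w] Phi_deriv[OF w] refl)+ (simp add: algebra_simps)
  also have "(1 + 2 * w) * (Phi1 \<mu> w)\<^sup>2 + w * (1 + w) * (2 * Phi1 \<mu> w * P2 w) + \<mu> * (2 * Phi \<mu> w * Phi1 \<mu> w)
    = (1 + 2 * w) * (Phi1 \<mu> w)\<^sup>2 + 2 * Phi1 \<mu> w * (w * (1 + w) * P2 w + \<mu> * Phi \<mu> w)"
   by (simp add: algebra_simps)
  also have "w * (1 + w) * P2 w + \<mu> * Phi \<mu> w = - ((Q + 1) * w + nS / 2) * Phi1 \<mu> w"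
   using P2(2)[OF w] by (simp add: Lop_def algebra_simps)
  also have "(1 + 2 * w) * (Phi1 \<mu> w)\<^sup>2 + 2 * Phi1 \<mu> w * (- ((Q + 1) * w + nS / 2) * Phi1 \<mu> w) = E' w"
   by (simp add: E'_def power2_eq_square algebra_simps)
  finally show ?thesis .
 qed
 have "(E' has_integral E v - E 0) {0..v}"
  by (rule fundamental_theorem_of_calculus[OF v])
    (auto simp: has_real_derivative_iff_has_vector_derivative[symmetric] intro!: DERIV_subset[OF d])
 from this has_integral_0 have "E v - E 0 <= 0"
 proof (rule has_integral_le)
  fix x assume x: "x \<in> {0..v}"
  have "nS >= 2" using dimS_ge2 by (simp add: nS_def)
  then have "(nS - 1) + 2 * Q * x >= 0" using x hdim_ge by simp
  then show "E' x <= 0" unfolding E'_def by (simp add: mult_nonpos_nonneg)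
 qed
 then show ?thesis by (simp add: E_def Phi_0)
qed

lemma Phi_le_1: assumes "\<mu> > 0" "v >= 0" shows "\<bar>Phi \<mu> v\<bar> <= 1"
proof -
 have "v * (1 + v) * (Phi1 \<mu> v)\<^sup>2 >= 0" using assms by simp
 then have "\<mu> * (Phi \<mu> v)\<^sup>2 <= \<mu> * 1" using Phi_energy[of \<mu> v] assms by linarith
 then have "(Phi \<mu> v)\<^sup>2 <= 1" using assms by simp
 then show ?thesis by (simp add: abs_square_le_1)
qed

text \<open>Spherical functions in the distance coordinate satisfy \<open>ph'' + bb ph' + \<mu> ph = 0\<close>; \<open>bb\<close> is the logarithmic derivative of the weight.\<close>

definition ph :: "real => real => real" where "ph \<mu> s = Phi \<mu> (vs s)"
definition vd :: "real => real" where "vd s = sinh (s / 2) * cosh (s / 2)"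
definition ph1 :: "real => real => real" where "ph1 \<mu> s = Phi1 \<mu> (vs s) * vd s"
definition bb :: "real => real" where "bb s = (Q * vs s + (nS - 1) / 2) / vd s"

lemma vd_pos: "s > 0 ==> vd s > 0" by (simp add: vd_def)
lemma vd_sinh: "vd s = sinh s / 2" using sinh_double[of "s/2"] by (simp add: vd_def)
lemma vd_sq: "(vd s)\<^sup>2 = vs s * (1 + vs s)" unfolding vs_1 by (simp add: vd_def vs_def power_mult_distrib)
lemma vd_deriv: "(vd has_real_derivative 1 / 2 + vs s) (at s within S)"
proof -
 have "(vd has_real_derivative (cosh (s/2) / 2) * cosh (s/2) + sinh (s/2) * (sinh (s/2) / 2)) (at s within S)"
  unfolding vd_def[abs_def] by (auto intro!: derivative_eq_intros)
 moreover have "(cosh (s/2) / 2) * cosh (s/2) + sinh (s/2) * (sinh (s/2) / 2) = 1 / 2 + vs s"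
  using vs_1[of s] by (simp add: vs_def power2_eq_square)
 ultimately show ?thesis by simp
qed
lemma vs_deriv': "(vs has_real_derivative vd s) (at s within S)" unfolding vd_def by (rule vs_deriv)
lemma WW_vd: "WW s = AA s * vd s" by (simp add: WW_AA vd_def)

lemma halfline_chain:
 assumes F: "!!v. v >= 0 ==> hder F (F1 v) v"
 shows "((%s. F (vs s)) has_vector_derivative vd s *\<^sub>R F1 (vs s)) (at s within S)"
 by (rule vector_chain_within[OF vs_deriv'[unfolded has_real_derivative_iff_has_vector_derivative] F]) auto

lemma ph_deriv: "(ph \<mu> has_real_derivative ph1 \<mu> s) (at s within S)"
 using halfline_chain[of "Phi \<mu>" "Phi1 \<mu>" s S] Phi_deriv
 by (auto simp: ph_def[abs_def] ph1_def has_real_derivative_iff_has_vector_derivative mult.commute)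

lemma ph1_deriv: assumes s: "s > 0" shows "(ph1 \<mu> has_real_derivative - bb s * ph1 \<mu> s - \<mu> * ph \<mu> s) (at s within S)"
proof -
 define P2 where "P2 = Phi2 \<mu>"
 have P2: "(Phi1 \<mu> has_real_derivative P2 v) (at v within {0..})" "Lop (Phi1 \<mu>) P2 v = - \<mu> * Phi \<mu> v" if "v >= 0" for v
  unfolding P2_def using Phi1_deriv[OF that] Phi_Lop[OF that] by auto
 have "((%s. Phi1 \<mu> (vs s)) has_real_derivative vd s * P2 (vs s)) (at s within S)"
  using halfline_chain[of "Phi1 \<mu>" P2 s S] P2(1) by (auto simp: has_real_derivative_iff_has_vector_derivative)
 then have "(ph1 \<mu> has_real_derivative (vd s * P2 (vs s)) * vd s + Phi1 \<mu> (vs s) * (1/2 + vs s)) (at s within S)"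
  unfolding ph1_def[abs_def] by (auto intro!: derivative_eq_intros vd_deriv)
 moreover have "(vd s * P2 (vs s)) * vd s + Phi1 \<mu> (vs s) * (1/2 + vs s) = - bb s * ph1 \<mu> s - \<mu> * ph \<mu> s"
 proof -
  have "(vd s * P2 (vs s)) * vd s = vs s * (1 + vs s) * P2 (vs s)" unfolding vd_sq[symmetric] by (simp add: power2_eq_square)
  also have "... = - \<mu> * Phi \<mu> (vs s) - ((Q + 1) * vs s + nS / 2) * Phi1 \<mu> (vs s)"
   using P2(2)[of "vs s"] by (simp add: Lop_def algebra_simps)
  moreover have "bb s * ph1 \<mu> s = (Q * vs s + (nS - 1) / 2) * Phi1 \<mu> (vs s)"
   using vd_pos[OF s] by (simp add: bb_def ph1_def)
  ultimately show ?thesis by (simp add: ph_def field_simps)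
 qed
 ultimately show ?thesis by simp
qed

lemma ph_bounds: assumes "\<mu> > 0" shows "\<bar>ph \<mu> s\<bar> <= 1" "(ph1 \<mu> s)\<^sup>2 <= \<mu>"
proof -
 show "\<bar>ph \<mu> s\<bar> <= 1" unfolding ph_def using Phi_le_1[OF assms] by simp
 have "(ph1 \<mu> s)\<^sup>2 = vs s * (1 + vs s) * (Phi1 \<mu> (vs s))\<^sup>2" by (simp add: ph1_def power_mult_distrib vd_sq mult.commute)
 moreover have "\<mu> * (Phi \<mu> (vs s))\<^sup>2 >= 0" using assms by simp
 moreover have "vs s * (1 + vs s) * (Phi1 \<mu> (vs s))\<^sup>2 + \<mu> * (Phi \<mu> (vs s))\<^sup>2 <= \<mu>"
  by (rule Phi_energy) (use assms in auto)
 ultimately show "(ph1 \<mu> s)\<^sup>2 <= \<mu>" by linarith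
qed

text \<open>The coefficient approaches its limit exponentially fast. This is what turns the equation into a perturbed harmonic oscillator.\<close>

lemma bb_eps: assumes s: "s >= 1" shows "0 <= bb s - Q" "bb s - Q <= 4 * nS * exp (- s)"
proof -
 have v0: "vd s > 0" using vd_pos s by simp
 have "vs s <= vd s"
 proof (rule power2_le_imp_le)
  show "(vs s)\<^sup>2 <= (vd s)\<^sup>2" unfolding vd_sq by (simp add: power2_eq_square algebra_simps)
 qed (use v0 in simp)
 have "(vd s)\<^sup>2 <= (vs s + 1/2)\<^sup>2" unfolding vd_sq by (simp add: power2_eq_square algebra_simps)
 then have u: "vd s <= vs s + 1/2" by (rule power2_le_imp_le) simp
 have n: "nS - 1 >= Q" by (simp add: nS_def dimS_def hdim_def)
 have e: "bb s - Q = (Q * (vs s - vd s) + (nS - 1) / 2) / vd s"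
  using v0 by (simp add: bb_def field_simps)
 have "Q * (- (1/2)) <= Q * (vs s - vd s)" using u hdim_ge by (intro mult_left_mono) auto
 moreover have "Q * (- (1/2)) >= - ((nS - 1) / 2)" using n by simp
 ultimately have "Q * (vs s - vd s) + (nS - 1) / 2 >= 0" by linarith
 then show "0 <= bb s - Q" unfolding e using v0 by simp
 have "Q * (vs s - vd s) <= 0" using \<open>vs s <= vd s\<close> hdim_ge by (simp add: mult_nonneg_nonpos)
 then have "bb s - Q <= ((nS - 1) / 2) / vd s" unfolding e using v0 by (intro divide_right_mono) linarith+
 also have "... <= (nS / 2) / (exp s / 8)"
 proof (rule frac_le)
  have "exp s >= 2" using exp_ge_add_one_self[of s] s by linarith
  then have "exp s * exp s >= 2 * 1" using s by (intro mult_mono) auto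
  then have "exp (- s) <= exp s / 2" by (simp add: exp_minus field_simps)
  then show "exp s / 8 <= vd s" by (simp add: vd_sinh sinh_def)
  show "0 <= nS / 2" by (simp add: nS_def)
 qed (use v0 in auto)
 also have "(nS / 2) / (exp s / 8) = 4 * nS * exp (- s)" by (simp add: exp_minus field_simps)
 finally show "bb s - Q <= 4 * nS * exp (- s)" .
qed

definition Kph :: "real => real" where
 "Kph lam = sqrt (5 * exp (Q) * mu lam * exp (2 * Q * nS / lam))"

text \<open>For \<open>w = exp (Q s/2) ph\<close> the equation reads \<open>w'' + \<lambda>\<^sup>2 w = \<close> terms with the integrable factor \<open>bb - Q\<close>, so a Gronwall argument bounds \<open>w'\<^sup>2 + \<lambda>\<^sup>2 w\<^sup>2\<close>.\<close>

lemma ph_decay: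
 assumes lam: "lam > 0" and s: "s >= 1"
 shows "\<bar>ph (mu lam) s\<bar> <= Kph lam / lam * exp (- (Q / 2) * s)"
  "\<bar>ph1 (mu lam) s\<bar> <= (Kph lam + Q / 2 * (Kph lam / lam)) * exp (- (Q / 2) * s)"
proof -
 let ?Q = "Q" and ?m = "mu lam"
 define w where "w s = exp (?Q / 2 * s) * ph ?m s" for s
 define w1 where "w1 s = exp (?Q / 2 * s) * (ph1 ?m s + ?Q / 2 * ph ?m s)" for s
 define E where "E s = (w1 s)\<^sup>2 + lam\<^sup>2 * (w s)\<^sup>2" for s
 define c where "c = 2 * ?Q * nS / lam"
 have dw: "(w has_real_derivative w1 s) (at s)" for s
  unfolding w_def[abs_def] w1_def by (auto intro!: derivative_eq_intros ph_deriv simp: algebra_simps)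
 have dw1: "(w1 has_real_derivative - (lam\<^sup>2) * w s - (bb s - ?Q) * (w1 s - ?Q / 2 * w s)) (at s)" if "s > 0" for s
 proof -
  have "(w1 has_real_derivative exp (?Q / 2 * s) * (?Q / 2) * (ph1 ?m s + ?Q / 2 * ph ?m s)
    + exp (?Q / 2 * s) * ((- bb s * ph1 ?m s - ?m * ph ?m s) + ?Q / 2 * ph1 ?m s)) (at s)"
  proof -
   have a: "((%s. exp (?Q / 2 * s)) has_real_derivative exp (?Q / 2 * s) * (?Q / 2)) (at s)"
    by (auto intro!: derivative_eq_intros)
   have b: "((%s. ph1 ?m s + ?Q / 2 * ph ?m s) has_real_derivative (- bb s * ph1 ?m s - ?m * ph ?m s) + ?Q / 2 * ph1 ?m s) (at s)"
    by (intro DERIV_add DERIV_cmult ph_deriv ph1_deriv[OF that])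
   show ?thesis unfolding w1_def[abs_def] by (rule DERIV_cong[OF DERIV_mult[OF a b]]) (simp add: mult_ac)
  qed
  moreover have "exp (?Q / 2 * s) * (?Q / 2) * (ph1 ?m s + ?Q / 2 * ph ?m s)
    + exp (?Q / 2 * s) * ((- bb s * ph1 ?m s - ?m * ph ?m s) + ?Q / 2 * ph1 ?m s)
   = - (lam\<^sup>2) * w s - (bb s - ?Q) * (w1 s - ?Q / 2 * w s)"
  proof -
   have ring: "e * h * (p1 + h * p) + e * ((- b * p1 - (l\<^sup>2 + h\<^sup>2) * p) + h * p1)
    = - (l\<^sup>2) * (e * p) - (b - 2 * h) * (e * (p1 + h * p) - h * (e * p))" for e h p p1 b l :: real
    by (simp add: power2_eq_square algebra_simps)
   show ?thesis using ring[of "exp (?Q / 2 * s)" "?Q / 2" "ph1 ?m s" "ph ?m s" "bb s" lam]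
    by (simp add: w_def w1_def mu_def power_divide)
  qed
  ultimately show ?thesis by simp
 qed
 have E0: "E s >= 0" for s by (simp add: E_def)
 have "E s * exp (c * exp (- s) * 2) <= E 1 * exp (c * exp (- 1) * 2)"
 proof (rule DERIV_nonpos_imp_nonincreasing[OF s])
  fix t :: real assume t: "1 <= t" "t <= s"
  define E' where "E' = 2 * w1 t * (- (lam\<^sup>2) * w t - (bb t - ?Q) * (w1 t - ?Q / 2 * w t)) + lam\<^sup>2 * (2 * w t * w1 t)"
  have tp: "t > 0" using t by simp
  have dE: "(E has_real_derivative E') (at t)"
   unfolding E_def[abs_def] E'_def by (auto intro!: derivative_eq_intros dw dw1[OF tp] simp: algebra_simps)
  have "((%t. E t * exp (c * exp (- t) * 2)) has_real_derivative (E' - E t * (c * exp (- t) * 2)) * exp (c * exp (- t) * 2)) (at t)"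
   by (auto intro!: derivative_eq_intros dE simp: algebra_simps)
  moreover have "E' <= E t * (c * exp (- t) * 2)"
  proof -
   have e: "0 <= bb t - ?Q" "bb t - ?Q <= 4 * nS * exp (- t)" using bb_eps t by auto
   have "E' = - 2 * ((bb t - ?Q) * (w1 t)\<^sup>2) + (bb t - ?Q) * (?Q * (w t * w1 t))"
    by (simp add: E'_def power2_eq_square algebra_simps diff_divide_distrib)
   also have "... <= (bb t - ?Q) * (?Q * (w t * w1 t))"
    using mult_nonneg_nonneg[OF e(1) zero_le_power2[of "w1 t"]] by linarith
   also have "... <= (bb t - ?Q) * (?Q * (E t / (2 * lam)))"
   proof -
    have "0 <= (w1 t - lam * w t)\<^sup>2" by simp
    then have "2 * lam * (w t * w1 t) <= E t" by (simp add: E_def power2_eq_square algebra_simps)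
    then have "w t * w1 t <= E t / (2 * lam)" using lam by (simp add: field_simps)
    then show ?thesis using e(1) hdim_ge by (intro mult_left_mono) auto
   qed
   also have "... <= (4 * nS * exp (- t)) * (?Q * (E t / (2 * lam)))"
    using e(2) hdim_ge lam E0 by (intro mult_right_mono) auto
   also have "... = E t * (c * exp (- t))" by (simp add: c_def)
   also have "... <= E t * (c * exp (- t) * 2)"
   proof (rule mult_left_mono[OF _ E0])
    have "0 <= c" using lam hdim_ge by (auto simp: c_def nS_def)
    then have "0 <= c * exp (- t)" by simp
    then show "c * exp (- t) <= c * exp (- t) * 2" by linarith
   qed
   finally show ?thesis .
  qed
  ultimately show "\<exists>y. ((%t. E t * exp (c * exp (- t) * 2)) has_real_derivative y) (at t) \<and> y <= 0"
   by (intro exI conjI) (auto simp: mult_nonpos_nonneg)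
 qed
 also have "... <= (5 * exp ?Q * ?m) * exp c"
 proof (rule mult_mono)
  have p: "\<bar>ph ?m 1\<bar> <= 1" "(ph1 ?m 1)\<^sup>2 <= ?m" using ph_bounds[OF mu_pos] by auto
  have p2: "(ph ?m 1)\<^sup>2 <= 1" using p(1) by (simp add: abs_square_le_1)
  have "(ph1 ?m 1 + ?Q / 2 * ph ?m 1)\<^sup>2 <= 2 * (ph1 ?m 1)\<^sup>2 + 2 * (?Q / 2 * ph ?m 1)\<^sup>2"
   using zero_le_power2[of "ph1 ?m 1 - ?Q / 2 * ph ?m 1"] by (simp add: power2_eq_square algebra_simps)
  also have "(?Q / 2 * ph ?m 1)\<^sup>2 <= (?Q\<^sup>2 / 4) * 1"
   unfolding power_mult_distrib using p2 by (intro mult_mono) (auto simp: power_divide)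
  finally have 1: "(ph1 ?m 1 + ?Q / 2 * ph ?m 1)\<^sup>2 <= 4 * ?m" using p(2) mu_ge(3)[of lam] by linarith
  have 2: "lam\<^sup>2 * (ph ?m 1)\<^sup>2 <= ?m" using mult_mono[OF mu_ge(2)[of lam] p2] mu_pos[of lam] by simp
  have ee: "(exp (?Q / 2 * 1))\<^sup>2 = exp ?Q" by (simp add: power2_eq_square flip: exp_add)
  have "E 1 = exp ?Q * ((ph1 ?m 1 + ?Q / 2 * ph ?m 1)\<^sup>2 + lam\<^sup>2 * (ph ?m 1)\<^sup>2)"
   unfolding E_def w_def w1_def power_mult_distrib ee by (simp add: algebra_simps)
  also have "... <= exp ?Q * (5 * ?m)" using 1 2 by (intro mult_left_mono) auto
  finally show "E 1 <= 5 * exp ?Q * ?m" by simp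
  have "exp (1::real) >= 2" using exp_ge_add_one_self[of 1] by simp
  then have "exp (- 1) * 2 <= (1::real)" by (simp add: exp_minus field_simps)
  then have "c * (exp (- 1) * 2) <= c * 1" using lam hdim_ge by (intro mult_left_mono) (auto simp: c_def nS_def)
  then show "exp (c * exp (- 1) * 2) <= exp c" by (simp add: mult.assoc)
 qed (use mu_pos[of lam] in auto)
 also have "... = (Kph lam)\<^sup>2" using mu_pos[of lam] by (simp add: Kph_def c_def)
 finally have "E s * exp (c * exp (- s) * 2) <= (Kph lam)\<^sup>2" .
 moreover have "E s * 1 <= E s * exp (c * exp (- s) * 2)"
  using E0[of s] lam hdim_ge by (intro mult_left_mono) (auto simp: c_def nS_def)
 ultimately have E: "E s <= (Kph lam)\<^sup>2" by simp
 have K0: "Kph lam >= 0" using mu_pos[of lam] by (simp add: Kph_def)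
 have "(lam * \<bar>w s\<bar>)\<^sup>2 <= (Kph lam)\<^sup>2" using E zero_le_power2[of "w1 s"] unfolding E_def power_mult_distrib power2_abs by linarith
 then have "lam * \<bar>w s\<bar> <= Kph lam" using K0 by (rule power2_le_imp_le)
 then have ws: "\<bar>w s\<bar> <= Kph lam / lam" using lam by (simp add: field_simps)
 have "\<bar>w1 s\<bar>\<^sup>2 <= (Kph lam)\<^sup>2"
  using E zero_le_power2[of "lam * w s"] unfolding E_def power_mult_distrib power2_abs by linarith
 then have w1s: "\<bar>w1 s\<bar> <= Kph lam" using K0 by (rule power2_le_imp_le)
 have p: "ph ?m s = w s * exp (- (?Q / 2) * s)" by (simp add: w_def exp_minus)
 have p1: "ph1 ?m s = (w1 s - ?Q / 2 * w s) * exp (- (?Q / 2) * s)"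
  by (simp add: w_def w1_def exp_minus algebra_simps)
 show "\<bar>ph ?m s\<bar> <= Kph lam / lam * exp (- (?Q / 2) * s)" unfolding p abs_mult abs_exp_cancel
  by (rule mult_right_mono[OF ws]) simp
 have "\<bar>w1 s - ?Q / 2 * w s\<bar> <= \<bar>w1 s\<bar> + ?Q / 2 * \<bar>w s\<bar>" using hdim_ge by (simp add: abs_mult abs_triangle_ineq4[THEN order_trans])
 also have "... <= Kph lam + ?Q / 2 * (Kph lam / lam)" using w1s ws hdim_ge by (intro add_mono mult_left_mono) auto
 finally show "\<bar>ph1 ?m s\<bar> <= (Kph lam + ?Q / 2 * (Kph lam / lam)) * exp (- (?Q / 2) * s)"
  unfolding p1 abs_mult abs_exp_cancel by (rule mult_right_mono) simp
qed

lemma Kph_bound: "\<exists>K0. \<forall>lam\<ge>1. Kph lam / lam <= K0 * mu lam"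
proof -
 define C where "C = sqrt (5 * exp (Q) * exp (2 * Q * nS))"
 have "Kph lam / lam <= (2 * C) * mu lam" if lam: "lam >= 1" for lam
 proof -
  have "2 * Q * nS / lam <= 2 * Q * nS / 1" using lam hdim_ge by (intro divide_left_mono) (auto simp: nS_def)
  then have "2 * Q * nS / lam <= 2 * Q * nS" by simp
  then have "5 * exp (Q) * mu lam * exp (2 * Q * nS / lam) <= 5 * exp (Q) * mu lam * exp (2 * Q * nS)"
   using mu_pos[of lam] by (intro mult_left_mono) auto
  then have "Kph lam <= sqrt (5 * exp (Q) * mu lam * exp (2 * Q * nS))" unfolding Kph_def by (rule real_sqrt_le_mono)
  also have "... = C * sqrt (mu lam)" by (simp add: C_def real_sqrt_mult)
  also have "sqrt (mu lam) <= 2 * mu lam"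
  proof (rule real_le_lsqrt)
   show "mu lam <= (2 * mu lam)\<^sup>2"
    using mult_left_mono[OF mu_ge(1)[of lam], of "4 * mu lam"] mu_pos[of lam] by (simp add: power2_eq_square)
  qed (use mu_pos[of lam] in auto)
  finally have "Kph lam <= (2 * C) * mu lam" by (simp add: C_def mult_ac)
  moreover have "Kph lam / lam <= Kph lam" using lam mu_pos[of lam] by (simp add: Kph_def divide_le_eq mult_ge1_I mult_left_le)
  ultimately show ?thesis by simp
 qed
 then show ?thesis by blast
qed

end

section \<open>Growth of the Plancherel density\<close>

lemma ratio_mono:
 fixes x y l :: real
 assumes "0 < x" "x <= y"
 shows "x / sqrt (x\<^sup>2 + l\<^sup>2) <= y / sqrt (y\<^sup>2 + l\<^sup>2)"
proof -
 have "x * sqrt (y\<^sup>2 + l\<^sup>2) <= y * sqrt (x\<^sup>2 + l\<^sup>2)"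
 proof (rule power2_le_imp_le)
  have "x\<^sup>2 * l\<^sup>2 <= y\<^sup>2 * l\<^sup>2" using assms by (intro mult_right_mono power_mono) auto
  then show "(x * sqrt (y\<^sup>2 + l\<^sup>2))\<^sup>2 <= (y * sqrt (x\<^sup>2 + l\<^sup>2))\<^sup>2"
   by (simp add: power_mult_distrib algebra_simps)
 qed (use assms in auto)
 moreover have "sqrt (x\<^sup>2 + l\<^sup>2) > 0" "sqrt (y\<^sup>2 + l\<^sup>2) > 0" using assms by (auto intro!: add_pos_nonneg)
 ultimately show ?thesis by (simp add: divide_simps mult.commute)
qed

abbreviation vline :: "real => real => complex" where "vline a l \<equiv> of_real a + \<i> * of_real l"

lemma vline_not_nonpos: "a > 0 ==> vline a l \<notin> \<int>\<^sub>\<le>\<^sub>0"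
 by (auto elim!: nonpos_Ints_cases simp: complex_eq_iff)

lemma norm_Gamma_series:
 assumes a: "a > 0" and n: "n > 0"
 shows "cmod (Gamma_series (vline a l) n) = Gamma_series a n * (\<Prod>k\<le>n. (a + real k) / sqrt ((a + real k)\<^sup>2 + l\<^sup>2))"
proof -
 have 1: "cmod (pochhammer (vline a l) (n + 1)) = (\<Prod>k\<le>n. sqrt ((a + real k)\<^sup>2 + l\<^sup>2))"
  unfolding pochhammer_prod prod_norm[symmetric] by (rule prod.cong) (auto simp: cmod_def lessThan_Suc_atMost[symmetric])
 have 2: "pochhammer a (n + 1) = (\<Prod>k\<le>n. a + real k)"
  unfolding pochhammer_prod by (rule prod.cong) (auto simp: lessThan_Suc_atMost[symmetric])
 have p: "(\<Prod>k\<le>n. a + real k) > 0" using a by (intro prod_pos) auto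
 have e: "cmod (exp (vline a l * of_real (ln (real n)))) = exp (a * ln (real n))"
  by (simp add: norm_exp_eq_Re)
 have ne: "a + real k \<noteq> 0" for k using a by (smt (verit) of_nat_0_le_iff)
 show ?thesis
  unfolding Gamma_series_def norm_divide norm_mult 1 2 prod_dividef using p e ne
  by simp
qed

text \<open>In Gauss' product for the Gamma function each factor of this ratio is \<open>(a + k) / |a + k + i l|\<close>, which increases with \<open>a\<close>.\<close>

lemma Gamma_vline_mono:
 assumes a: "0 < a" and ab: "a <= b"
 shows "cmod (Gamma (vline a l)) / Gamma a <= cmod (Gamma (vline b l)) / Gamma b"
proof -
 have b: "b > 0" using a ab by simp
 have lim: "(%n. cmod (Gamma_series (vline c l) n) / Gamma_series c n) \<longlonglongrightarrow> cmod (Gamma (vline c l)) / Gamma c" if "c > 0" for c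
  using less_imp_neq[OF Gamma_real_pos[OF that], symmetric] by (intro tendsto_intros Gamma_series_LIMSEQ)
 have gs: "Gamma_series c n > 0" if "c > 0" "n > 0" for c :: real and n
  using that by (simp add: Gamma_series_def pochhammer_pos)
 have "cmod (Gamma_series (vline a l) n) / Gamma_series a n <= cmod (Gamma_series (vline b l) n) / Gamma_series b n" if n: "n > 0" for n
  using norm_Gamma_series[OF a n] norm_Gamma_series[OF b n] gs[OF a n] gs[OF b n] a ab
  by (simp, intro prod_mono conjI ratio_mono) auto
 then show ?thesis
  by (intro LIMSEQ_le[OF lim[OF a] lim[OF b]]) (auto intro!: exI[of _ 1])
qed

text \<open>The preceding lemma raises \<open>a\<close> to \<open>b + N\<close>, and the functional equation returns to \<open>b\<close> at the cost of \<open>N\<close> linear factors.\<close>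

lemma Gamma_vline_compare:
 assumes a: "a > 0" and b: "b > 0"
 shows "\<exists>C N. C >= 0 \<and> (\<forall>l\<ge>0. cmod (Gamma (vline a l)) <= C * (1 + l) ^ N * cmod (Gamma (vline b l)))"
proof -
 obtain N where N: "a <= real N" using real_arch_simple by blast
 define C where "C = Gamma a / Gamma (b + real N) * (b + real N + 1) ^ N"
 have Ga: "Gamma a > 0" "Gamma (b + real N) > 0" using a b by (auto intro: Gamma_real_pos)
 have "cmod (Gamma (vline a l)) <= C * (1 + l) ^ N * cmod (Gamma (vline b l))" if l: "l >= 0" for l
 proof -
  have "cmod (Gamma (vline a l)) <= Gamma a / Gamma (b + real N) * cmod (Gamma (vline (b + real N) l))"
   using Gamma_vline_mono[OF a, of "b + real N" l] N b Ga by (simp add: field_simps)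
  also have "vline (b + real N) l = vline b l + of_nat N" by simp
  also have "Gamma (vline b l + of_nat N) = pochhammer (vline b l) N * Gamma (vline b l)"
   using pochhammer_Gamma[OF vline_not_nonpos[OF b], of l N] vline_not_nonpos[OF b] by (simp add: Gamma_eq_zero_iff)
  also have "cmod (pochhammer (vline b l) N * Gamma (vline b l)) <= ((b + real N + 1) ^ N * (1 + l) ^ N) * cmod (Gamma (vline b l))"
   unfolding norm_mult
  proof (rule mult_right_mono)
   have "cmod (pochhammer (vline b l) N) = (\<Prod>k<N. cmod (vline b l + of_nat k))"
    unfolding pochhammer_prod prod_norm[symmetric] by (simp add: atLeast0LessThan)
   also have "... <= (\<Prod>k<N. (b + real N + 1) * (1 + l))"
   proof (rule prod_mono, rule conjI)
    fix k assume k: "k \<in> {..<N}"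
    have "cmod (vline b l + of_nat k) = cmod (of_real (b + real k) + \<i> * of_real l)" by (simp add: add_ac)
    also have "... <= cmod (of_real (b + real k)) + cmod (\<i> * of_real l)" by (rule norm_triangle_ineq)
    also have "... = (b + real k) + l" using b l by (simp only: norm_of_real norm_mult norm_ii)
    also have "... <= (b + real N + 1) + (b + real N + 1) * l"
    proof (rule add_mono)
     show "b + real k <= b + real N + 1" using k by simp
     show "l <= (b + real N + 1) * l" using mult_right_mono[of 1 "b + real N + 1" l] b l by simp
    qed
    finally show "cmod (vline b l + of_nat k) <= (b + real N + 1) * (1 + l)" by (simp add: algebra_simps)
   qed simp
   also have "... = (b + real N + 1) ^ N * (1 + l) ^ N" by (simp add: power_mult_distrib)
   finally show "cmod (pochhammer (vline b l) N) <= (b + real N + 1) ^ N * (1 + l) ^ N" .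
  qed simp
  finally have "cmod (Gamma (vline a l)) <= Gamma a / Gamma (b + real N) * (((b + real N + 1) ^ N * (1 + l) ^ N) * cmod (Gamma (vline b l)))"
   using Ga by (meson divide_nonneg_pos less_imp_le mult_left_mono order_trans)
  then show ?thesis by (simp add: C_def mult_ac)
 qed
 moreover have "C >= 0" using Ga b by (simp add: C_def)
 ultimately show ?thesis by blast
qed

text \<open>The duplication formula on the imaginary axis.\<close>

lemma Gamma_duplicate_norm:
 assumes l: "l > 0"
 shows "cmod (Gamma (vline 1 l)) * cmod (Gamma (vline (1/2) l)) = 2 * l * sqrt pi * cmod (Gamma (2 * \<i> * of_real l))"
proof -
 define z where "z = \<i> * complex_of_real l"
 have z: "z \<notin> \<int>\<^sub>\<le>\<^sub>0" "z + 1/2 \<notin> \<int>\<^sub>\<le>\<^sub>0" "z \<noteq> 0"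
  using l by (auto simp: z_def elim!: nonpos_Ints_cases simp: complex_eq_iff)
 have "Gamma z * Gamma (z + 1/2) = exp ((1 - 2 * z) * of_real (ln 2)) * of_real (sqrt pi) * Gamma (2 * z)"
  by (rule Gamma_legendre_duplication[OF z(1,2)])
 moreover have "cmod (exp ((1 - 2 * z) * of_real (ln 2))) = 2" by (simp add: norm_exp_eq_Re z_def)
 ultimately have "cmod (Gamma z) * cmod (Gamma (z + 1/2)) = 2 * sqrt pi * cmod (Gamma (2 * z))"
  by (metis norm_mult norm_of_real abs_of_nonneg real_sqrt_ge_zero pi_ge_zero)
 moreover have "cmod (Gamma (z + 1)) = l * cmod (Gamma z)"
  using Gamma_plus1[of z] z(1,3) l by (simp add: norm_mult z_def)
 ultimately show ?thesis by (simp add: z_def add.commute mult_ac)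
qed

lemma plancherel_nonneg: "plancherel_density br l >= 0" by (simp add: plancherel_density_def)

lemma plancherel_0: "plancherel_density br 0 = 0"
 by (simp add: plancherel_density_def c_function_def)

text \<open>The two Gamma factors in the denominator of \<open>c\<close> are compared with those in the duplication formula, whose product cancels \<open>\<Gamma>(2 i l)\<close> up to a factor \<open>l\<close>.\<close>

lemma plancherel_bound:
 fixes br :: "'n::euclidean_space => 'n => 'n"
 assumes Q: "hdim br > 0"
 shows "\<exists>C N. C >= 0 \<and> (\<forall>l\<ge>0. plancherel_density br l <= C * (1 + l) ^ N)"
proof -
 obtain C1 N1 where C1: "C1 >= 0" "!!l. l >= 0 ==> cmod (Gamma (vline (hdim br / 2) l)) <= C1 * (1 + l) ^ N1 * cmod (Gamma (vline 1 l))"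
  using Gamma_vline_compare[of "hdim br / 2" 1] Q by auto
 obtain C2 N2 where C2: "C2 >= 0" "!!l. l >= 0 ==> cmod (Gamma (vline ((real (mv br) + 2) / 4) l)) <= C2 * (1 + l) ^ N2 * cmod (Gamma (vline (1/2) l))"
  using Gamma_vline_compare[of "(real (mv br) + 2) / 4" "1/2"] by auto
 define g where "g = cmod (Gamma (of_nat (dimS br) / 2))"
 have n0: "dimS br > 0" by (simp add: dimS_def)
 have g0: "g > 0"
 proof -
  have "complex_of_nat (dimS br) / 2 = of_real (real (dimS br) / 2)" by simp
  then have "g = \<bar>Gamma (real (dimS br) / 2)\<bar>" unfolding g_def by (simp only: Gamma_complex_of_real norm_of_real)
  then show ?thesis using Gamma_real_pos[of "real (dimS br) / 2"] n0 by simp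
 qed
 define K where "K = C1 * C2 * 2 * sqrt pi / (2 powr hdim br * g)"
 have K0: "K >= 0" using C1 C2 g0 by (simp add: K_def)
 have "plancherel_density br l <= K\<^sup>2 * (1 + l) ^ (2 * (N1 + N2 + 1))" if l: "l >= 0" for l
 proof (cases "l = 0")
  case True then show ?thesis by (simp add: plancherel_0)
 next
  case False
  then have lp: "l > 0" using l by simp
  define A where "A = cmod (Gamma (vline (hdim br / 2) l))"
  define B where "B = cmod (Gamma (vline ((real (mv br) + 2) / 4) l))"
  define G where "G = cmod (Gamma (2 * \<i> * of_real l))"
  have e1: "(complex_of_real (hdim br) + 2 * \<i> * of_real l) / 2 = vline (hdim br / 2) l" by simp
  have e2: "(of_nat (mv br) + 4 * \<i> * complex_of_real l + 2) / 4 = vline ((real (mv br) + 2) / 4) l"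
   by (simp add: add_divide_distrib)
  have p2: "cmod (2 powr (of_real (hdim br) - 2 * \<i> * of_real l)) = 2 powr hdim br"
   using norm_powr_real_powr'[of "2::complex" "of_real (hdim br) - 2 * \<i> * of_real l"] by (simp add: norm_powr_real_powr)
  have c: "cmod (c_function br l) = 2 powr hdim br * G / A * (g / B)"
   unfolding c_function_def norm_mult norm_divide e1 e2 p2 A_def B_def G_def g_def by simp
  have "2 * \<i> * complex_of_real l \<notin> \<int>\<^sub>\<le>\<^sub>0" using lp by (auto elim!: nonpos_Ints_cases simp: complex_eq_iff)
  then have G0: "G > 0" by (simp add: G_def Gamma_eq_zero_iff)
  have A0: "A > 0" "B > 0" unfolding A_def B_def zero_less_norm_iff Gamma_eq_zero_iff by (rule vline_not_nonpos, use Q in simp)+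
  have "1 / cmod (c_function br l) = A * B / (2 powr hdim br * G * g)"
   unfolding c using A0 G0 g0 by (simp add: field_simps)
  also have "... <= K * (1 + l) ^ (N1 + N2 + 1)"
  proof -
   have "A * B <= (C1 * (1 + l) ^ N1 * cmod (Gamma (vline 1 l))) * (C2 * (1 + l) ^ N2 * cmod (Gamma (vline (1/2) l)))"
    unfolding A_def B_def using C1 C2 l by (intro mult_mono) auto
   also have "... = C1 * C2 * (1 + l) ^ (N1 + N2) * (cmod (Gamma (vline 1 l)) * cmod (Gamma (vline (1/2) l)))"
    by (simp add: power_add mult_ac)
   also have "... = C1 * C2 * (1 + l) ^ (N1 + N2) * (2 * l * sqrt pi * G)"
    unfolding Gamma_duplicate_norm[OF lp] G_def ..
   also have "... <= C1 * C2 * (1 + l) ^ (N1 + N2) * (2 * (1 + l) * sqrt pi * G)"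
    using C1 C2 l G0 by (intro mult_left_mono mult_right_mono) auto
   finally have "A * B / (2 powr hdim br * G * g) <= C1 * C2 * (1 + l) ^ (N1 + N2) * (2 * (1 + l) * sqrt pi * G) / (2 powr hdim br * G * g)"
    using G0 g0 by (intro divide_right_mono) auto
   also have "... = K * (1 + l) ^ (N1 + N2 + 1)" using G0 g0 by (simp add: K_def mult_ac)
   finally show ?thesis .
  qed
  finally have "(1 / cmod (c_function br l))\<^sup>2 <= (K * (1 + l) ^ (N1 + N2 + 1))\<^sup>2" by (intro power_mono) auto
  also have "... = K\<^sup>2 * (1 + l) ^ (2 * (N1 + N2 + 1))"
   unfolding power_mult_distrib power_mult[symmetric] by (simp only: mult.commute)
  finally show ?thesis by (simp add: plancherel_density_def power_divide)
 qed
 then show ?thesis using zero_le_power2[of K] by blast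
qed

lemma plancherel_measurable:
 fixes br :: "'n::euclidean_space => 'n => 'n"
 assumes Q: "hdim br > 0"
 shows "(%l. indicator {0..} l * plancherel_density br l) \<in> borel_measurable borel"
proof -
 have e1: "(complex_of_real (hdim br) + 2 * \<i> * of_real l) / 2 = vline (hdim br / 2) l" for l by simp
 have e2: "(of_nat (mv br) + 4 * \<i> * complex_of_real l + 2) / 4 = vline ((real (mv br) + 2) / 4) l" for l
  by (simp add: add_divide_distrib)
 have n: "2 * \<i> * complex_of_real l \<notin> \<int>\<^sub>\<le>\<^sub>0" if "l > 0" for l
  using that by (auto elim!: nonpos_Ints_cases simp: complex_eq_iff)
 have Gc: "continuous_on {0<..} (%l. Gamma (h l))" if "continuous_on {0<..} h" "!!l. l > 0 ==> h l \<notin> \<int>\<^sub>\<le>\<^sub>0" for h :: "real => complex"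
  by (rule continuous_on_compose2[OF continuous_on_Gamma[of "- \<int>\<^sub>\<le>\<^sub>0"] that(1)]) (use that(2) in auto)
 have v: "vline a l \<notin> \<int>\<^sub>\<le>\<^sub>0" if "a > 0" for a l using vline_not_nonpos[OF that] .
 have q: "hdim br / 2 > 0" "(real (mv br) + 2) / 4 > 0" using Q by auto
 have cp: "continuous_on {0<..} (%l::real. 2 powr (of_real (hdim br) - 2 * \<i> * of_real l) :: complex)"
  unfolding powr_def by (auto intro!: continuous_intros)
 have "continuous_on {0<..} (c_function br)"
  unfolding c_function_def[abs_def] e1 e2
  by (intro continuous_on_mult continuous_on_divide continuous_on_const Gc cp continuous_intros)
    (use n v[OF q(1)] v[OF q(2)] in \<open>auto simp: Gamma_eq_zero_iff\<close>)
 moreover have "c_function br l \<noteq> 0" if "l > 0" for l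
 proof -
  have "Gamma (of_nat (dimS br) / 2 :: complex) \<noteq> 0"
  proof -
   have e: "complex_of_nat (dimS br) / 2 = of_real (real (dimS br) / 2)" by simp
   have "real (dimS br) / 2 > 0" by (simp add: dimS_def)
   then have "Gamma (real (dimS br) / 2) \<noteq> 0" using Gamma_real_pos less_imp_neq by metis
   then show ?thesis unfolding e Gamma_complex_of_real of_real_eq_0_iff .
  qed
  then show ?thesis unfolding c_function_def e1 e2
   using n[OF that] v[OF q(1), of l] v[OF q(2), of l] by (simp add: Gamma_eq_zero_iff)
 qed
 ultimately have "continuous_on {0<..} (plancherel_density br)"
  unfolding plancherel_density_def[abs_def] by (intro continuous_intros) auto
 from borel_measurable_continuous_on_indicator[OF _ this]
 have "(%l. indicator {0<..} l *\<^sub>R plancherel_density br l) \<in> borel_measurable borel" by simp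
 moreover have "(%l. indicator {0<..} l *\<^sub>R plancherel_density br l) = (%l. indicator {0..} l * plancherel_density br l)"
 proof (rule ext)
  fix l :: real
  show "indicator {0<..} l *\<^sub>R plancherel_density br l = indicator {0..} l * plancherel_density br l"
   by (cases "l = 0") (auto simp: indicator_def plancherel_0)
 qed
 ultimately show ?thesis by simp
qed

section \<open>Superpositions in Lebesgue norms\<close>

lemma ennreal_powr_ennreal: "x >= 0 ==> ennreal_powr (ennreal x) r = ennreal (x powr r)"
 by (simp add: ennreal_powr_def)

lemma convex_on_powr_nonneg:
 fixes r :: real
 assumes r: "r >= 1"
 shows "convex_on {0..} (%x::real. x powr r)"
proof (rule convex_onI)
 fix t x y :: real assume t: "0 < t" "t < 1" and xy: "x \<in> {0..}" "y \<in> {0..}"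
 have le: "s powr r <= s" if "0 < s" "s < 1" for s :: real
  using powr_mono'[of 1 r s] that r by simp
 show "((1 - t) *\<^sub>R x + t *\<^sub>R y) powr r <= (1 - t) * x powr r + t * y powr r"
 proof (cases "x = 0 \<or> y = 0")
  case True
  then show ?thesis
  proof
   assume x: "x = 0"
   have "t powr r * y powr r <= t * y powr r" using le[OF t] by (intro mult_right_mono) auto
   then show ?thesis using x t xy r by (simp add: powr_mult)
  next
   assume y: "y = 0"
   have "(1 - t) powr r * x powr r <= (1 - t) * x powr r" using le[of "1 - t"] t by (intro mult_right_mono) auto
   then show ?thesis using y t xy r by (simp add: powr_mult)
  qed
 next
  case False
  then show ?thesis using convex_onD[OF powr_convex[OF r], of t x y] t xy by simp
 qed
qed simp

lemma powr_sum_le: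
 fixes r :: real
 assumes r: "r >= 1" and I: "finite I" and w: "!!i. i \<in> I ==> w i >= 0" and f: "!!i. i \<in> I ==> f i >= 0"
  and W: "W = sum w I" "W > 0"
 shows "(\<Sum>i\<in>I. w i * f i) powr r <= W powr r * (\<Sum>i\<in>I. (w i / W) * f i powr r)"
proof -
 have ne: "I \<noteq> {}" using W by auto
 have cv: "convex_on {0..} (%x::real. x powr r)" by (rule convex_on_powr_nonneg[OF r])
 have "(\<Sum>i\<in>I. (w i / W) *\<^sub>R f i) powr r <= (\<Sum>i\<in>I. (w i / W) * f i powr r)"
  by (rule convex_on_sum[OF I ne cv]) (use W w f in \<open>auto simp: sum_divide_distrib[symmetric]\<close>)
 then have "W powr r * (\<Sum>i\<in>I. (w i / W) *\<^sub>R f i) powr r <= W powr r * (\<Sum>i\<in>I. (w i / W) * f i powr r)"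
  by (rule mult_left_mono) simp_all
 moreover have "W powr r * (\<Sum>i\<in>I. (w i / W) *\<^sub>R f i) powr r = (W * (\<Sum>i\<in>I. (w i / W) *\<^sub>R f i)) powr r"
  by (rule powr_mult[symmetric])
 moreover have "W * (\<Sum>i\<in>I. (w i / W) *\<^sub>R f i) = (\<Sum>i\<in>I. w i * f i)"
  using W by (simp add: sum_distrib_left)
 ultimately show ?thesis by simp
qed

text \<open>By convexity of \<open>x powr r\<close>, and pointwise if \<open>p\<close> is infinite. It is used with weights \<open>C\<^sup>k / k!\<close>, whose sum is bounded independently of the number of terms.\<close>

lemma Lp_norm_combination:
 fixes F :: "'a => real" and f :: "'i => 'a => real"
 assumes p: "p >= 1" and I: "finite I" and w: "!!i. i \<in> I ==> w i >= 0" and W: "sum w I > 0"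
  and f: "!!i. i \<in> I ==> f i \<in> borel_measurable M" "!!i x. i \<in> I ==> f i x >= 0"
  and F: "F \<in> borel_measurable M" "!!x. F x >= 0" "!!x. x \<in> space M ==> F x <= (\<Sum>i\<in>I. w i * f i x)"
  and b: "b >= 0" "!!i. i \<in> I ==> Lp_norm p M (%x. ennreal (f i x)) <= ennreal b"
 shows "Lp_norm p M (%x. ennreal (F x)) <= ennreal (sum w I * b)"
proof (cases "p = \<infinity>")
 case True
 have "AE x in M. \<forall>i\<in>I. f i x <= b"
 proof (rule AE_finite_allI[OF I])
  fix i assume i: "i \<in> I"
  have "AE x in M. ennreal (f i x) <= esssup M (%x. ennreal (f i x))" by (rule esssup_AE)
  then show "AE x in M. f i x <= b"
  proof eventually_elim
   case (elim x)
   also have "esssup M (%x. ennreal (f i x)) <= ennreal b" using b(2)[OF i] True by (simp add: Lp_norm_def)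
   finally show ?case using b(1) by simp
  qed
 qed
 then have "AE x in M. ennreal (F x) <= ennreal (sum w I * b)"
  using AE_space
 proof eventually_elim
  case (elim x)
  have "F x <= (\<Sum>i\<in>I. w i * f i x)" using F(3) elim by simp
  also have "... <= (\<Sum>i\<in>I. w i * b)" using elim w by (intro sum_mono mult_left_mono) auto
  finally show ?case by (simp add: sum_distrib_right ennreal_leI)
 qed
 then show ?thesis using True F(1) by (simp add: Lp_norm_def esssup_I)
next
 case False
 define r where "r = enn2real p"
 have r: "r >= 1" using p False enn2real_mono[OF p] by (simp add: r_def less_top)
 define W' where "W' = sum w I"
 have Wp: "W' > 0" using W by (simp add: W'_def)
 have fi: "(\<integral>\<^sup>+x. ennreal (f i x powr r) \<partial>M) <= ennreal (b powr r)" if i: "i \<in> I" for i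
 proof -
  define J where "J = (\<integral>\<^sup>+x. ennreal (f i x powr r) \<partial>M)"
  have le: "ennreal_powr J (1 / r) <= ennreal b"
   using b(2)[OF i] False f(2)[OF i] by (simp add: Lp_norm_def J_def r_def ennreal_powr_ennreal)
  then have "J \<noteq> \<infinity>" by (auto simp: ennreal_powr_def top_unique)
  then obtain j where j: "J = ennreal j" "j >= 0" by (cases J) auto
  then have "j powr (1 / r) <= b" using le b(1) by (simp add: ennreal_powr_ennreal)
  then have "(j powr (1 / r)) powr r <= b powr r" using r by (intro powr_mono2) auto
  then have "j <= b powr r" using r j(2) by (simp add: powr_powr)
  then show ?thesis using j unfolding J_def[symmetric] by (simp add: ennreal_leI)
 qed
 have "(\<integral>\<^sup>+x. ennreal (F x powr r) \<partial>M) <= (\<integral>\<^sup>+x. (\<Sum>i\<in>I. ennreal (W' powr r * (w i / W')) * ennreal (f i x powr r)) \<partial>M)"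
 proof (rule nn_integral_mono)
  fix x assume x: "x \<in> space M"
  have "F x powr r <= (\<Sum>i\<in>I. w i * f i x) powr r" using F x r by (intro powr_mono2) auto
  also have "... <= W' powr r * (\<Sum>i\<in>I. (w i / W') * f i x powr r)"
   by (rule powr_sum_le[OF r I]) (use w f(2) Wp in \<open>auto simp: W'_def\<close>)
  also have "... = (\<Sum>i\<in>I. W' powr r * (w i / W') * f i x powr r)" by (simp add: sum_distrib_left mult.assoc)
  finally have "ennreal (F x powr r) <= ennreal (\<Sum>i\<in>I. W' powr r * (w i / W') * f i x powr r)" by (rule ennreal_leI)
  also have "... = (\<Sum>i\<in>I. ennreal (W' powr r * (w i / W') * f i x powr r))"
   using w Wp by (intro sum_ennreal[symmetric]) auto
  also have "... = (\<Sum>i\<in>I. ennreal (W' powr r * (w i / W')) * ennreal (f i x powr r))"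
   using w Wp by (intro sum.cong refl ennreal_mult) auto
  finally show "ennreal (F x powr r) <= (\<Sum>i\<in>I. ennreal (W' powr r * (w i / W')) * ennreal (f i x powr r))" .
 qed
 also have "... = (\<Sum>i\<in>I. ennreal (W' powr r * (w i / W')) * (\<integral>\<^sup>+x. ennreal (f i x powr r) \<partial>M))"
  using f(1) by (subst nn_integral_sum) (auto simp: nn_integral_cmult)
 also have "... <= (\<Sum>i\<in>I. ennreal (W' powr r * (w i / W')) * ennreal (b powr r))"
  by (intro sum_mono mult_left_mono fi) auto
 also have "... = (\<Sum>i\<in>I. ennreal (W' powr r * (w i / W') * b powr r))"
  using w Wp by (intro sum.cong refl ennreal_mult[symmetric]) auto
 also have "... = ennreal (\<Sum>i\<in>I. W' powr r * (w i / W') * b powr r)"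
  using w Wp by (intro sum_ennreal) auto
 also have "(\<Sum>i\<in>I. W' powr r * (w i / W') * b powr r) = W' powr r * b powr r"
  using Wp unfolding sum_distrib_right[symmetric] sum_distrib_left[symmetric] sum_divide_distrib[symmetric] W'_def[symmetric] by simp
 also have "... = (W' * b) powr r" using Wp b(1) by (simp add: powr_mult)
 finally have le: "(\<integral>\<^sup>+x. ennreal (F x powr r) \<partial>M) <= ennreal ((W' * b) powr r)" .
 then obtain j where j: "(\<integral>\<^sup>+x. ennreal (F x powr r) \<partial>M) = ennreal j" "j >= 0"
  by (cases "(\<integral>\<^sup>+x. ennreal (F x powr r) \<partial>M)") (auto simp: top_unique)
 have jl: "j <= (W' * b) powr r" using le j by simp
 have "Lp_norm p M (%x. ennreal (F x)) = ennreal (j powr (1 / r))"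
  using False F(2) j by (simp add: Lp_norm_def r_def[symmetric] ennreal_powr_ennreal)
 also have "j powr (1 / r) <= ((W' * b) powr r) powr (1 / r)" using jl j r by (intro powr_mono2) auto
 then have "ennreal (j powr (1 / r)) <= ennreal (W' * b)"
  using r Wp b(1) by (simp add: powr_powr ennreal_leI)
 finally show ?thesis by (simp add: W'_def)
qed

lemma Lp_norm_const:
 assumes p: "p >= 1" and M: "emeasure M (space M) < \<infinity>" and c: "c >= 0"
 shows "Lp_norm p M (%x. ennreal c) <= ennreal (c * max 1 (measure M (space M)))"
proof (cases "p = \<infinity>")
 case True
 have "esssup M (%x. ennreal c) <= ennreal c" by (intro esssup_I) auto
 also have "... <= ennreal (c * max 1 (measure M (space M)))"
  using c mult_left_mono[of 1 "max 1 (measure M (space M))" c] by (intro ennreal_leI) auto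
 finally show ?thesis using True by (simp add: Lp_norm_def)
next
 case False
 define r where "r = enn2real p"
 have r: "r >= 1" using p False enn2real_mono[OF p] by (simp add: r_def less_top)
 define m where "m = measure M (space M)"
 have m: "emeasure M (space M) = ennreal m" "m >= 0" using M by (auto simp: m_def emeasure_eq_ennreal_measure less_top)
 have "(\<integral>\<^sup>+x. ennreal (c powr r) \<partial>M) = ennreal (c powr r * m)" using m by (simp add: ennreal_mult)
 then have "Lp_norm p M (%x. ennreal c) = ennreal ((c powr r * m) powr (1 / r))"
  using False c m by (simp add: Lp_norm_def r_def[symmetric] ennreal_powr_ennreal)
 also have "(c powr r * m) powr (1 / r) = c * m powr (1 / r)"
  using r c m by (simp add: powr_mult powr_powr)
 also have "m powr (1 / r) <= (max 1 m) powr (1 / r)" using m r by (intro powr_mono2) auto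
 also have "(max 1 m) powr (1 / r) <= (max 1 m) powr 1" using r by (intro powr_mono) auto
 also have "... = max 1 m" by simp
 finally show ?thesis using c by (simp add: m_def mult_left_mono ennreal_leI)
qed

section \<open>Multipliers and polynomials in the resolvent\<close>

text \<open>Weierstrass in the variable \<open>y = 1 / (l\<^sup>2 + q)\<close>, which ranges over \<open>(0, 1/q]\<close>. As \<open>m\<close> need not have a limit at infinity, it is first cut off beyond \<open>j\<close>.\<close>

lemma resolvent_polynomial_approx:
 fixes m :: "real => real"
 assumes q: "q > 0" and m: "continuous_on {0..} m" "!!l. l >= 0 ==> \<bar>m l\<bar> <= 1" and e: "e > 0"
 shows "\<exists>a n. \<forall>l\<ge>0. \<bar>(\<Sum>i\<le>n. a i * (1 / (l\<^sup>2 + q)) ^ i) - m l\<bar> <= e + (if l > real j then 1 else 0)"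
proof -
 define J where "J = real j + 1"
 have J0: "J > 0" by (simp add: J_def)
 define ct where "ct l = max 0 (min 1 (J - l))" for l
 define c where "c = 1 / (J\<^sup>2 + q)"
 have c0: "c > 0" "c <= 1 / q" using q J0 by (auto simp: c_def intro!: divide_left_mono mult_pos_pos add_nonneg_pos)
 define g where "g y = m (sqrt (1 / y - q)) * ct (sqrt (1 / y - q))" for y
 define F where "F y = (if y <= c then 0 else g y)" for y
 have ypos: "1 / y - q >= 0" if "y \<in> {c..1/q}" for y
 proof -
  have "y > 0" using that c0 by auto
  then show ?thesis using that q by (simp add: field_simps)
 qed
 have gc: "continuous_on {c..1/q} g"
  unfolding g_def ct_def
  by (intro continuous_intros continuous_on_compose2[OF m(1)]) (use ypos c0 in auto)
 have gcz: "g c = 0"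
 proof -
  have "1 / c - q = J\<^sup>2" using q J0 by (simp add: c_def)
  then show ?thesis using J0 by (simp add: g_def ct_def)
 qed
 have "continuous_on ({0..c} \<union> {c..1/q}) (%y. if y <= c then 0 else g y)"
  by (rule continuous_on_cases) (use gc gcz in auto)
 moreover have "{0..c} \<union> {c..1/q} = {0..1/q}" using c0 by auto
 ultimately have Fc: "continuous_on {0..1/q} F" by (simp add: F_def[abs_def])
 obtain P where P: "real_polynomial_function P" "!!y. y \<in> {0..1/q} ==> \<bar>F y - P y\<bar> < e"
  using Stone_Weierstrass_real_polynomial_function[OF compact_Icc Fc e] by blast
 obtain a n where an: "P = (%x. \<Sum>i\<le>n. a i * x ^ i)" using P(1) real_polynomial_function_iff_sum by blast
 have "\<bar>P (1 / (l\<^sup>2 + q)) - m l\<bar> <= e + (if l > real j then 1 else 0)" if l: "l >= 0" for l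
 proof -
  define y where "y = 1 / (l\<^sup>2 + q)"
  have lq: "l\<^sup>2 + q > 0" using q by (simp add: add_nonneg_pos)
  have y: "y \<in> {0..1/q}" using q lq by (auto simp: y_def intro!: divide_left_mono)
  have s: "sqrt (1 / y - q) = l" using l by (simp add: y_def)
  have Fy: "F y = m l * ct l"
  proof (cases "y <= c")
   case True
   then have "J\<^sup>2 + q <= l\<^sup>2 + q" using lq J0 q by (simp add: y_def c_def divide_simps add_pos_pos split: if_splits)
   then have "J <= l" using l J0 power2_le_imp_le[of J l] by simp
   then show ?thesis using True by (simp add: F_def ct_def)
  next
   case False then show ?thesis by (simp add: F_def g_def s)
  qed
  have "\<bar>P y - m l\<bar> <= \<bar>F y - P y\<bar> + \<bar>m l * ct l - m l\<bar>" unfolding Fy by linarith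
  also have "\<bar>m l * ct l - m l\<bar> = \<bar>m l\<bar> * \<bar>ct l - 1\<bar>" by (simp add: abs_mult[symmetric] algebra_simps)
  also have "... <= 1 * (if l > real j then 1 else 0)"
   using m(2)[OF l] by (intro mult_mono) (auto simp: ct_def J_def)
  finally show ?thesis using P(2)[OF y] unfolding y_def by simp
 qed
 then show ?thesis unfolding an by blast
qed

text \<open>Under an integrable density the tail beyond \<open>j\<close> is small, so one polynomial approximates \<open>m h\<close> in a weighted mean and in a weighted mean square at once.\<close>

lemma multiplier_approx:
 fixes m :: "real => real" and h :: "real => complex" and w1 w2 :: "real => real"
 assumes q: "q > 0" and m: "continuous_on {0..} m" "!!l. l >= 0 ==> \<bar>m l\<bar> <= 1"
  and w: "integrable lborel (%l. w1 l * cmod (h l))" "integrable lborel (%l. w2 l * (cmod (h l))\<^sup>2)"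
  and w0: "!!l. w1 l >= 0" "!!l. w2 l >= 0" "!!l. l < 0 ==> w1 l = 0" "!!l. l < 0 ==> w2 l = 0" and \<delta>: "\<delta> > 0"
 shows "\<exists>a n. \<forall>g. (\<forall>l. g l = of_real (\<Sum>i\<le>n. a i * (1 / (l\<^sup>2 + q)) ^ i) * h l) \<longrightarrow>
   (\<integral>\<^sup>+l. ennreal (w1 l * cmod (g l - of_real (m l) * h l)) \<partial>lborel) <= ennreal \<delta> \<and>
   (\<integral>\<^sup>+l. ennreal (w2 l * (cmod (g l - of_real (m l) * h l))\<^sup>2) \<partial>lborel) <= ennreal \<delta>"
proof -
 define U where "U l = w1 l * cmod (h l) + w2 l * (cmod (h l))\<^sup>2" for l
 have U: "integrable lborel U" unfolding U_def using w by simp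
 have U0: "U l >= 0" for l using w0 by (simp add: U_def)
 have "(%j. integral\<^sup>L lborel (%l. (if l > real j then 1 else 0) * U l)) \<longlonglongrightarrow> integral\<^sup>L lborel (%l::real. 0::real)"
 proof (rule integral_dominated_convergence[where w = U])
  show "AE l in lborel. (%j. (if l > real j then 1 else 0) * U l) \<longlonglongrightarrow> 0"
  proof (rule AE_I2)
   fix l :: real
   obtain N where "l <= real N" using real_arch_simple by blast
   then show "(%j. (if l > real j then 1 else 0) * U l) \<longlonglongrightarrow> 0"
    by (intro tendsto_eventually eventually_sequentiallyI[of N]) auto
  qed
  show "(%l. (if l > real j then 1 else 0) * U l) \<in> borel_measurable lborel" for j using U by measurable
  show "AE l in lborel. norm ((if l > real j then 1 else 0) * U l) <= U l" for j using U0 by (intro AE_I2) auto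
 qed (use U in auto)
 then have "\<forall>\<^sub>F j in sequentially. integral\<^sup>L lborel (%l. (if l > real j then 1 else 0) * U l) < \<delta> / 4"
  using \<delta> by (intro order_tendstoD(2)) auto
 then obtain j where j: "integral\<^sup>L lborel (%l. (if l > real j then 1 else 0) * U l) < \<delta> / 4"
  by (auto simp: eventually_sequentially)
 define e where "e = min 1 (\<delta> / (4 * (integral\<^sup>L lborel U + 1)))"
 have IU: "integral\<^sup>L lborel U >= 0" using U0 by simp
 have e: "e > 0" "e <= 1" using \<delta> IU by (auto simp: e_def)
 have eU: "e * integral\<^sup>L lborel U <= \<delta> / 4"
 proof -
  have "e * integral\<^sup>L lborel U <= (\<delta> / (4 * (integral\<^sup>L lborel U + 1))) * (integral\<^sup>L lborel U + 1)"
   using IU e \<delta> by (intro mult_mono) (auto simp: e_def)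
  also have "... = \<delta> / 4"
  proof -
   have "integral\<^sup>L lborel U + 1 \<noteq> 0" using IU by linarith
   then show ?thesis by (simp only: divide_divide_eq_left' times_divide_eq_left mult.assoc) (simp add: field_simps)
  qed
  finally show ?thesis .
 qed
 obtain a n where an: "!!l. l >= 0 ==> \<bar>(\<Sum>i\<le>n. a i * (1 / (l\<^sup>2 + q)) ^ i) - m l\<bar> <= e + (if l > real j then 1 else 0)"
  using resolvent_polynomial_approx[OF q m e(1), of j] by blast
 define V where "V l = 2 * (e * U l + (if l > real j then 1 else 0) * U l)" for l
 have i2: "integrable lborel (%l. (if l > real j then 1 else 0) * U l)"
  by (rule Bochner_Integration.integrable_bound[OF U]) (use U U0 in \<open>auto intro!: AE_I2\<close>)
 have V: "integrable lborel V" unfolding V_def using U i2 by simp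
 have "integral\<^sup>L lborel V = 2 * (e * integral\<^sup>L lborel U + integral\<^sup>L lborel (%l. (if l > real j then 1 else 0) * U l))"
  unfolding V_def using U i2 by simp
 moreover have "2 * (x + y) <= \<delta>" if "x <= \<delta> / 4" "y < \<delta> / 4" for x y using that by simp
 ultimately have IV: "integral\<^sup>L lborel V <= \<delta>" using eU j by metis
 have V0: "V l >= 0" for l using U0 e by (simp add: V_def)
 have nV: "(\<integral>\<^sup>+l. ennreal (V l) \<partial>lborel) <= ennreal \<delta>"
  using nn_integral_eq_integral[OF V] V0 IV by (simp add: ennreal_leI)
 have "(\<integral>\<^sup>+l. ennreal (w1 l * cmod (g l - of_real (m l) * h l)) \<partial>lborel) <= ennreal \<delta> \<and>
   (\<integral>\<^sup>+l. ennreal (w2 l * (cmod (g l - of_real (m l) * h l))\<^sup>2) \<partial>lborel) <= ennreal \<delta>"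
  if g: "\<forall>l. g l = of_real (\<Sum>i\<le>n. a i * (1 / (l\<^sup>2 + q)) ^ i) * h l" for g
 proof -
  have pt: "w1 l * cmod (g l - of_real (m l) * h l) <= V l \<and> w2 l * (cmod (g l - of_real (m l) * h l))\<^sup>2 <= V l" for l
  proof (cases "l >= 0")
   case False then show ?thesis using w0 V0 by simp
  next
   case True
   define E where "E = e + (if l > real j then 1 else 0)"
   have E: "0 <= E" "E <= 2" using e by (auto simp: E_def)
   have VE: "V l = 2 * (E * U l)" by (simp add: V_def E_def algebra_simps)
   have "g l - of_real (m l) * h l = of_real ((\<Sum>i\<le>n. a i * (1 / (l\<^sup>2 + q)) ^ i) - m l) * h l"
    using g by (simp only: of_real_diff left_diff_distrib)
   then have c: "cmod (g l - of_real (m l) * h l) <= E * cmod (h l)"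
    using an[OF True] by (simp only: norm_mult norm_of_real E_def) (intro mult_right_mono, auto)
   have "w1 l * cmod (g l - of_real (m l) * h l) <= E * (w1 l * cmod (h l))"
    using mult_left_mono[OF c w0(1)[of l]] by (simp add: mult_ac)
   also have "... <= E * U l" using E w0(2) by (intro mult_left_mono) (auto simp: U_def)
   also have "... <= V l" using E U0[of l] unfolding VE by simp
   finally have 1: "w1 l * cmod (g l - of_real (m l) * h l) <= V l" .
   have "(cmod (g l - of_real (m l) * h l))\<^sup>2 <= (E * cmod (h l))\<^sup>2" using c by (intro power_mono) auto
   also have "... = (E * E) * (cmod (h l))\<^sup>2" by (simp add: power2_eq_square mult_ac)
   also have "... <= (2 * E) * (cmod (h l))\<^sup>2" using E by (intro mult_right_mono) auto
   finally have "w2 l * (cmod (g l - of_real (m l) * h l))\<^sup>2 <= 2 * (E * (w2 l * (cmod (h l))\<^sup>2))"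
    using mult_left_mono[of _ _ "w2 l"] w0(2)[of l] by (fastforce simp: mult_ac)
   also have "... <= V l" unfolding VE using E w0(1) by (intro mult_left_mono) (auto simp: U_def)
   finally show ?thesis using 1 by simp
  qed
  show ?thesis
   by (intro conjI order_trans[OF nn_integral_mono nV] ennreal_leI conjunct1[OF pt] conjunct2[OF pt])
 qed
 then show ?thesis by blast
qed

section \<open>The Schwartz class in the radial coordinate\<close>

context htype
begin

text \<open>Membership of \<open>x \<mapsto> F (vv x)\<close> in the Schwartz class, see \<open>schwartz2_rapid\<close> and \<open>rapid_schwartz2\<close>.\<close>

definition rapid :: "(real => complex) => bool" where
 "rapid F \<longleftrightarrow> (\<forall>k. diffs_on k {0..} F) \<and> (\<forall>M. Pd (Q / 2) M (%s. F (vs s)))"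

lemma diffs_on_vs: "diffs_on k S vs"
 unfolding vs_def[abs_def]
 by (intro diffs_on_power diffs_on_compose[of "%s. s / 2" S UNIV _ sinh] diffs_on_sinh_cosh)
   (auto intro: diffs_on_linear[OF bounded_linear_divide diffs_on_id])

lemma diffs_on_comp_vs: "diffs_on k {0..} F ==> diffs_on k {0..} (%s. F (vs s))"
 by (rule diffs_on_compose[OF _ _ diffs_on_vs]) auto

lemma Bd_bb: "Bd M bb"
proof -
 have "Bd M (%s. Q * (cosh s / sinh s) + (nS - 1 - Q) * (1 / sinh s))"
  by (intro Bd_add Bd_mult Bd_const Bd_coth)
 moreover have "(%s. Q * (cosh s / sinh s) + (nS - 1 - Q) * (1 / sinh s)) = bb"
 proof
  fix s :: real
  have vs: "vs s = (cosh s - 1) / 2" using cosh_double_cosh[of "s/2"] vs_1[of s] by simp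
  show "Q * (cosh s / sinh s) + (nS - 1 - Q) * (1 / sinh s) = bb s"
   unfolding bb_def vd_sinh vs by (cases "sinh s = 0") (simp_all add: field_simps)
 qed
 ultimately show ?thesis by simp
qed

lemma schwartz2_rapid:
 assumes f: "f \<in> schwartz2 br"
 obtains F where "rapid F" "!!x. x \<in> DR ==> f x = F (vv x)"
proof -
 have "\<exists>F. (\<forall>k. diffs_on k {0..} F) \<and> (\<forall>x\<in>DR. f x = F (vv x))"
  using smooth_radial_profile f by (simp add: schwartz2_def)
 then obtain F where F: "!!k. diffs_on k {0..} F" "!!x. x \<in> DR ==> f x = F (vv x)" by blast
 have pe: "profile br f s = F (vs s)" if "s >= 0" for s
  unfolding vs_def by (rule profile_eq[OF that]) (rule F(2))
 have dp: "diffs_on k {0..} (profile br f)" for k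
  by (rule diffs_on_cong[OF _ diffs_on_comp_vs[OF F(1)]]) (use pe in auto)
 define D where "D M = ((%h s. vector_derivative h (at s within {0..})) ^^ M) (profile br f)" for M
 have Dd: "hder1 (D M) (D (Suc M) s) s" if "s >= 1" for s M
  unfolding D_def by (rule has_vector_derivative_within_subset[OF iterated_halfline_derivative(2)[OF dp]]) (use that in auto)
 have dD: "dec (Q / 2) (D M)" for M
  unfolding dec_def
 proof
  fix N
  obtain K where K: "\<forall>s\<ge>0. cmod (D M s) <= env K N (Q / 2) s"
   using f unfolding schwartz2_def D_def by blast
  show "\<exists>K. \<forall>s\<ge>1. cmod (D M s) <= env K N (Q / 2) s"
   by (rule exI[of _ K]) (use K in auto)
 qed
 have PD: "Pd (Q / 2) M (D j)" for M j
 proof (induction M arbitrary: j)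
  case (Suc M) show ?case by (rule dW_I[where h' = "D (Suc j)"]) (rule dD, rule Dd, assumption, rule Suc.IH)
 qed (use dD in simp)
 have Pp: "Pd (Q / 2) M (%s. F (vs s))" for M
  by (rule Pd_cong[OF _ PD[of M 0]]) (use pe in \<open>simp add: D_def\<close>)
 show thesis by (rule that[of F]) (use F Pp in \<open>auto simp: rapid_def\<close>)
qed

lemma rapid_schwartz2:
 assumes F: "rapid F"
 shows "(%x. F (vv x)) \<in> schwartz2 br"
proof -
 have sm: "diffs_on k {0..} F" for k using F by (simp add: rapid_def)
 let ?f = "%x. F (vv x)"
 have pe: "profile br ?f s = F (vs s)" if "s >= 0" for s using profile_eq[OF that, of ?f F] by (simp add: vs_def)
 have dp: "diffs_on k {0..} (profile br ?f)" for k
  by (rule diffs_on_cong[OF _ diffs_on_comp_vs[OF sm]]) (use pe in auto)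
 define D where "D M = ((%h s. vector_derivative h (at s within {0..})) ^^ M) (profile br ?f)" for M
 have Dd: "hder1 (D M) (D (Suc M) s) s" if "s >= 1" for s M
  unfolding D_def by (rule has_vector_derivative_within_subset[OF iterated_halfline_derivative(2)[OF dp]]) (use that in auto)
 have c: "continuous_on {0..} (D M)" for M
  unfolding D_def by (rule diffs_on_continuous[OF iterated_halfline_derivative(1)[OF dp, of 0]])
 have P0: "Pd (Q / 2) M (D 0)" for M
  by (rule Pd_cong[where f = "%s. F (vs s)"]) (use pe F in \<open>auto simp: rapid_def D_def\<close>)
 have PD: "\<forall>M. Pd (Q / 2) M (D j)" for j
 proof (induction j)
  case (Suc j)
  show ?case
  proof
   fix M
   from dW_D[OF spec[OF Suc.IH, of "Suc M"]] obtain h' where h'0: "dec (Q / 2) (D j) \<and> (\<forall>s\<ge>1. hder1 (D j) (h' s) s) \<and> Pd (Q / 2) M h'" ..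
  then have h': "!!s. s >= 1 ==> hder1 (D j) (h' s) s" "Pd (Q / 2) M h'" by (simp_all del: dW.simps)
   show "Pd (Q / 2) M (D (Suc j))"
    by (rule Pd_cong[OF _ h'(2)], rule vector_derivative_unique_within[OF halfline1_nontrivial h'(1) Dd])
  qed
 qed (intro allI P0)
 have dD: "dec (Q / 2) (D M)" for M using spec[OF PD[of M], of 0] by simp
 have "\<exists>K. \<forall>s\<ge>0. cmod (D M s) <= env K N (Q / 2) s" for M N
  using dec_halfline[OF dD c] by blast
 moreover have "smooth_on DR ?f" by (rule smooth_on_radial[OF sm])
 moreover have "radial br ?f" by (simp add: radial_iff)
 ultimately show ?thesis by (simp add: schwartz2_def D_def)
qed

lemma rapid_add: "rapid F ==> rapid G ==> rapid (%v. F v + G v)"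
 unfolding rapid_def by (simp add: diffs_on_add Pd_add[of _ _ "%s. F (vs s)" "%s. G (vs s)"] del: dW.simps)

lemma rapid_linear: "bounded_linear L ==> rapid F ==> rapid (%v. L (F v))"
 unfolding rapid_def by (simp add: diffs_on_linear Pd_linear[of L _ _ "%s. F (vs s)"] del: dW.simps)

text \<open>In the distance coordinate \<open>Lop F\<close> is \<open>h'' + bb h'\<close>, and \<open>bb\<close> has bounded derivatives.\<close>

lemma rapid_Lop:
 assumes F: "rapid F"
 obtains F1 F2 where "!!v. v >= 0 ==> hder F (F1 v) v"
  "!!v. v >= 0 ==> hder F1 (F2 v) v"
  "dec (Q / 2) (%s. vd s *\<^sub>R F1 (vs s))" "rapid (Lop F1 F2)" "continuous_on {0..} F1"
proof -
 have sm: "!!k. diffs_on k {0..} F" using F by (simp add: rapid_def)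
 obtain F1 where F1: "!!v. v >= 0 ==> hder F (F1 v) v" "!!k. diffs_on k {0..} F1"
  using diffs_on_derivative[OF halfline_nontrivial sm] by auto
 obtain F2 where F2: "!!v. v >= 0 ==> hder F1 (F2 v) v" "!!k. diffs_on k {0..} F2"
  using diffs_on_derivative[OF halfline_nontrivial F1(2)] by auto
 have smL: "diffs_on k {0..} (Lop F1 F2)" for k
  unfolding Lop_def[abs_def]
  by (intro diffs_on_add diffs_on_scaleR diffs_on_mult F1(2) F2(2) diffs_on_const diffs_on_id)
 let ?h = "%s. F (vs s)" and ?k = "%s. vd s *\<^sub>R F1 (vs s)"
 have dh: "(?h has_vector_derivative ?k s) (at s within S)" for s S
  by (rule halfline_chain) (rule F1(1))
 have dk: "hder1 ?k (Lop F1 F2 (vs s) - bb s *\<^sub>R ?k s) s" if s: "s >= 1" for s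
 proof -
  have "hder1 ?k (vd s *\<^sub>R (vd s *\<^sub>R F2 (vs s)) + (1 / 2 + vs s) *\<^sub>R F1 (vs s)) s"
   by (rule has_vector_derivative_scaleR[OF vd_deriv halfline_chain[OF F2(1)]])
  moreover have "vd s *\<^sub>R (vd s *\<^sub>R F2 (vs s)) + (1 / 2 + vs s) *\<^sub>R F1 (vs s) = Lop F1 F2 (vs s) - bb s *\<^sub>R ?k s"
  proof -
   have b: "bb s * vd s = Q * vs s + (nS - 1) / 2" using vd_pos[of s] s by (simp add: bb_def)
   have "Lop F1 F2 (vs s) - bb s *\<^sub>R ?k s = (vs s * (1 + vs s)) *\<^sub>R F2 (vs s) + ((Q + 1) * vs s + nS / 2 - bb s * vd s) *\<^sub>R F1 (vs s)"
    unfolding Lop_def by (simp add: scaleR_left_diff_distrib)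
   also have "(Q + 1) * vs s + nS / 2 - bb s * vd s = 1 / 2 + vs s" unfolding b by (simp add: field_simps)
   also have "vs s * (1 + vs s) = vd s * vd s" using vd_sq[of s] by (simp add: power2_eq_square)
   finally show ?thesis by simp
  qed
  ultimately show ?thesis by simp
 qed
 have Pk: "Pd (Q / 2) M ?k \<and> Pd (Q / 2) M (%s. Lop F1 F2 (vs s))" for M
 proof -
  have "Pd (Q / 2) (Suc (Suc M)) ?h" using F unfolding rapid_def by (elim conjE) (rule spec)
  from dW_D[OF this] obtain h' where h'0: "dec (Q / 2) ?h \<and> (\<forall>s\<ge>1. hder1 ?h (h' s) s) \<and> Pd (Q / 2) (Suc M) h'" ..
  then have h': "!!s. s >= 1 ==> hder1 ?h (h' s) s" "Pd (Q / 2) (Suc M) h'" by (simp_all del: dW.simps)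
  have k: "Pd (Q / 2) (Suc M) ?k"
   by (rule Pd_cong[OF _ h'(2)], rule vector_derivative_unique_within[OF halfline1_nontrivial h'(1) dh])
  from dW_D[OF this] obtain k' where k'0: "dec (Q / 2) ?k \<and> (\<forall>s\<ge>1. hder1 ?k (k' s) s) \<and> Pd (Q / 2) M k'" ..
  then have k': "!!s. s >= 1 ==> hder1 ?k (k' s) s" "Pd (Q / 2) M k'" by (simp_all del: dW.simps)
  have e: "k' s + bb s *\<^sub>R ?k s = Lop F1 F2 (vs s)" if "s >= 1" for s
   using vector_derivative_unique_within[OF halfline1_nontrivial[OF that] k'(1)[OF that] dk[OF that]] by simp
  have "Pd (Q / 2) M (%s. Lop F1 F2 (vs s))"
   by (rule Pd_cong[OF e], assumption, rule Pd_add[OF k'(2) Pd_scaleR[OF Bd_bb dW_SucD[OF k]]])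
  then show ?thesis using dW_SucD[OF k] by blast
 qed
 show thesis
 proof (rule that[of F1 F2])
  show "rapid (Lop F1 F2)" using smL Pk by (simp add: rapid_def)
  show "dec (Q / 2) ?k" using Pk[of 0] by simp
  show "continuous_on {0..} F1" using F1(2) diffs_on_continuous by blast
 qed (use F1 F2 in auto)
qed

end

section \<open>The inverse Laplacian\<close>

context htype
begin

lemma AA_le_exp: assumes s: "s >= 0" shows "AA s <= exp (Q * s)"
proof -
 have e: "2 * sinh (s / 2) <= exp (s / 2)" "cosh (s / 2) <= exp (s / 2)"
  using s by (auto simp: sinh_def cosh_def)
 have "AA s = (2 * sinh (s / 2)) ^ (mv br + mz br) * cosh (s / 2) ^ mz br"
  by (simp add: DR_weight_def power_mult_distrib)
 also have "... <= exp (s / 2) ^ (mv br + mz br) * exp (s / 2) ^ mz br"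
  using s by (intro mult_mono power_mono e) auto
 also have "... = exp (Q * s)"
  unfolding exp_of_nat_mult[symmetric] exp_add[symmetric] hdim_def by (simp add: field_simps)
 finally show ?thesis .
qed

lemma AA_ge_exp: assumes s: "s >= 1" shows "exp (Q * s) <= 2 ^ (mv br + 2 * mz br) * AA s"
proof -
 have "exp s >= 2" using exp_ge_add_one_self[of s] s by linarith
 then have "2 <= exp (s / 2) * exp (s / 2)" by (simp add: exp_add[symmetric])
 then have "2 * exp (- (s / 2)) <= exp (s / 2) * exp (s / 2) * exp (- (s / 2))"
  by (intro mult_right_mono) auto
 also have "... = exp (s / 2)" by (simp add: exp_add[symmetric])
 finally have e: "exp (s / 2) <= 2 * (2 * sinh (s / 2))" "exp (s / 2) <= 2 * cosh (s / 2)"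
  by (auto simp: sinh_def cosh_def)
 have "exp (Q * s) = exp (s / 2) ^ (mv br + mz br) * exp (s / 2) ^ mz br"
  unfolding exp_of_nat_mult[symmetric] exp_add[symmetric] hdim_def by (simp add: field_simps)
 also have "... <= (2 * (2 * sinh (s / 2))) ^ (mv br + mz br) * (2 * cosh (s / 2)) ^ mz br"
  by (intro mult_mono power_mono e) (use s in auto)
 also have "... = 2 ^ (mv br + 2 * mz br) * AA s"
 proof -
  have "(2::real) ^ (mv br + 2 * mz br) = 2 ^ (mv br + mz br) * 2 ^ mz br" by (simp add: power_add[symmetric])
  then show ?thesis unfolding DR_weight_def power_mult_distrib by (simp only: mult_ac)
 qed
 finally show ?thesis .
qed

lemma power_le_exp:
 fixes q :: real
 assumes q: "q > 0"
 shows "\<exists>K. K >= 0 \<and> (\<forall>x\<ge>0. (1 + x) ^ N <= K * exp (q * x))"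
proof (intro exI conjI allI impI)
 let ?a = "q / real (Suc N)"
 show "(max 1 (1 / ?a)) ^ N >= 0" by simp
 fix x :: real assume x: "x >= 0"
 have a: "?a > 0" using q by simp
 have "1 + x <= max 1 (1 / ?a) * (1 + ?a * x)"
 proof -
  have "x = (1 / ?a) * (?a * x)" using q by (simp del: of_nat_Suc)
  also have "... <= max 1 (1 / ?a) * (?a * x)" using a x by (intro mult_right_mono mult_nonneg_nonneg) (auto simp del: of_nat_Suc)
  finally have "x <= max 1 (1 / ?a) * (?a * x)" .
  moreover have "1 <= max 1 (1 / ?a)" by simp
  ultimately show ?thesis unfolding distrib_left by linarith
 qed
 also have "... <= max 1 (1 / ?a) * exp (?a * x)" by (intro mult_left_mono exp_ge_add_one_self) auto
 finally have "(1 + x) ^ N <= (max 1 (1 / ?a) * exp (?a * x)) ^ N" using x by (intro power_mono) auto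
 also have "... = (max 1 (1 / ?a)) ^ N * exp (real N * (?a * x))" by (simp only: power_mult_distrib exp_of_nat_mult)
 also have "... <= (max 1 (1 / ?a)) ^ N * exp (q * x)"
 proof -
  have "real N / real (Suc N) <= 1" by simp
  from mult_right_mono[OF this, of "q * x"] have "real N * (?a * x) <= q * x" using q x by (simp add: mult_ac)
  then show ?thesis by (intro mult_left_mono) auto
 qed
 finally show "(1 + x) ^ N <= (max 1 (1 / ?a)) ^ N * exp (q * x)" .
qed

lemma has_integral_exp_halfline:
 fixes c :: real
 assumes c: "c \<noteq> 0" and ab: "a <= b"
 shows "((%t. exp (c * t)) has_integral (exp (c * b) - exp (c * a)) / c) {a..b}"
proof -
 have "((%t. exp (c * t)) has_integral exp (c * b) / c - exp (c * a) / c) {a..b}"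
 proof (rule fundamental_theorem_of_calculus[OF ab])
  fix t
  show "((%t. exp (c * t) / c) has_vector_derivative exp (c * t)) (at t within {a..b})"
   unfolding has_real_derivative_iff_has_vector_derivative[symmetric]
   by (rule derivative_eq_intros refl | use c in simp)+
 qed
 then show ?thesis by (simp add: diff_divide_distrib)
qed

text \<open>This is \<open>(1 / AA s) \<integral> AA f\<close> over \<open>[0,s]\<close>, where \<open>AA f\<close> grows like \<open>exp (Q \<tau>/2)\<close>: the integral is dominated by its upper end, and division by \<open>AA s\<close> restores the decay of \<open>f\<close>.\<close>

lemma dec_mean:
 assumes F: "rapid F"
 shows "dec (Q / 2) (%s. vd s *\<^sub>R gr F (vs s))"
 unfolding dec_def
proof
 fix N
 let ?q = "Q / 2"
 have q: "?q > 0" using hdim_ge by simp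
 have sm: "!!k. diffs_on k {0..} F" and d: "dec ?q (%s. F (vs s))"
  using F spec[of "%M. Pd ?q M (%s. F (vs s))" 0] by (auto simp: rapid_def)
 have c: "continuous_on {0..} (%s. F (vs s))" by (rule diffs_on_continuous[OF diffs_on_comp_vs[OF sm]])
 obtain K where K0: "K >= 0" and K: "!!s. s >= 0 ==> cmod (F (vs s)) <= env K N ?q s"
  using dec_halfline[OF d c, of N] by blast
 have "?q / 2 > 0" using q by simp
 from power_le_exp[OF this] obtain L where "L >= 0 \<and> (\<forall>x\<ge>0. (1 + x) ^ N <= L * exp (?q / 2 * x))" ..
 then have L0: "L >= 0" and L: "!!x. x >= 0 ==> (1 + x) ^ N <= L * exp (?q / 2 * x)" by simp_all
 define C where "C = 2 ^ (mv br + 2 * mz br) * (K * L / (?q / 2))"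
 have "cmod (vd s *\<^sub>R gr F (vs s)) <= C * inverse ((1 + s) ^ N) * exp (- ?q * s)" if s: "s >= 1" for s
 proof -
  let ?c = "K * L * inverse ((1 + s) ^ N) * exp (?q / 2 * s)"
  have i1: "((%\<tau>. AA \<tau> *\<^sub>R F (vs \<tau>)) has_integral WW s *\<^sub>R gr F (vs s)) {0..s}"
   by (rule WW_gr) (use sm s in auto)
  have i2: "((%\<tau>. ?c * exp (?q / 2 * \<tau>)) has_integral ?c * ((exp (?q / 2 * s) - exp (?q / 2 * 0)) / (?q / 2))) {0..s}"
   by (intro has_integral_mult_right has_integral_exp_halfline) (use q s in auto)
  have "cmod (AA \<tau> *\<^sub>R F (vs \<tau>)) <= ?c * exp (?q / 2 * \<tau>)" if t: "\<tau> \<in> {0..s}" for \<tau>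
  proof -
   have t0: "\<tau> >= 0" "s - \<tau> >= 0" using t by auto
   \<comment> \<open>The polynomial factor moves from \<open>\<tau>\<close> to \<open>s\<close> at the price of a power of \<open>1 + (s - \<tau>)\<close>, absorbed by half of the exponential.\<close>
   have "(1 + \<tau>) * (1 + (s - \<tau>)) = 1 + s + \<tau> * (s - \<tau>)" by (simp add: algebra_simps)
   then have "1 + s <= (1 + \<tau>) * (1 + (s - \<tau>))" using mult_nonneg_nonneg[OF t0] by linarith
   then have "(1 + s) ^ N <= (1 + \<tau>) ^ N * (1 + (s - \<tau>)) ^ N"
    using s power_mono[of "1 + s" "(1 + \<tau>) * (1 + (s - \<tau>))" N] by (simp only: power_mult_distrib)
   also have "... <= (1 + \<tau>) ^ N * (L * exp (?q / 2 * (s - \<tau>)))" using t0 by (intro mult_left_mono L) auto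
   finally have "inverse ((1 + \<tau>) ^ N) <= inverse ((1 + s) ^ N) * (L * exp (?q / 2 * (s - \<tau>)))"
    using s t0 by (simp add: field_simps)
   then have i: "K * inverse ((1 + \<tau>) ^ N) * exp (- ?q * \<tau>) <= K * (inverse ((1 + s) ^ N) * (L * exp (?q / 2 * (s - \<tau>)))) * exp (- ?q * \<tau>)"
    using K0 by (intro mult_right_mono mult_left_mono) auto
   have "cmod (AA \<tau> *\<^sub>R F (vs \<tau>)) <= exp (Q * \<tau>) * (K * inverse ((1 + \<tau>) ^ N) * exp (- ?q * \<tau>))"
    unfolding norm_scaleR using AA_le_exp[of \<tau>] AA_nonneg[of \<tau>] K[of \<tau>] t0 by (intro mult_mono) auto
   also have "... <= exp (Q * \<tau>) * (K * (inverse ((1 + s) ^ N) * (L * exp (?q / 2 * (s - \<tau>)))) * exp (- ?q * \<tau>))"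
    using i by (intro mult_left_mono) auto
   also have "... = K * L * inverse ((1 + s) ^ N) * (exp (Q * \<tau>) * (exp (?q / 2 * (s - \<tau>)) * exp (- ?q * \<tau>)))"
    by (simp only: mult_ac)
   also have "exp (Q * \<tau>) * (exp (?q / 2 * (s - \<tau>)) * exp (- ?q * \<tau>)) = exp (?q / 2 * s) * exp (?q / 2 * \<tau>)"
    unfolding exp_add[symmetric] by (simp add: field_simps)
   finally show ?thesis by (simp only: mult_ac)
  qed
  moreover have nW: "cmod (WW s *\<^sub>R gr F (vs s)) = AA s * cmod (vd s *\<^sub>R gr F (vs s))"
  proof -
   have "WW s *\<^sub>R gr F (vs s) = AA s *\<^sub>R (vd s *\<^sub>R gr F (vs s))" by (simp add: WW_vd)
   then show ?thesis using AA_nonneg[of s] s by (simp only: norm_scaleR[of "AA s"] abs_of_nonneg)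
  qed
  ultimately have "cmod (WW s *\<^sub>R gr F (vs s)) <= ?c * ((exp (?q / 2 * s) - exp (?q / 2 * 0)) / (?q / 2))"
   using integral_norm_bound_integral[OF has_integral_integrable[OF i1] has_integral_integrable[OF i2]] i1 i2
   by (simp only: integral_unique)
  also have "... <= ?c * (exp (?q / 2 * s) / (?q / 2))"
   using q K0 L0 s by (intro mult_left_mono divide_right_mono) auto
  also have "... = K * L / (?q / 2) * inverse ((1 + s) ^ N) * exp (?q * s)"
  proof -
   have e: "exp (?q / 2 * s) * exp (?q / 2 * s) = exp (?q * s)" unfolding exp_add[symmetric] by simp
   have "a * b * i * x * (x / r) = a * b / r * i * (x * x)" for a b i x r :: real by simp
   then show ?thesis unfolding e[symmetric] .
  qed
  finally have 1: "AA s * cmod (vd s *\<^sub>R gr F (vs s)) <= K * L / (?q / 2) * inverse ((1 + s) ^ N) * exp (?q * s)"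
   unfolding nW .
  have "exp (Q * s) * cmod (vd s *\<^sub>R gr F (vs s)) <= 2 ^ (mv br + 2 * mz br) * AA s * cmod (vd s *\<^sub>R gr F (vs s))"
   using AA_ge_exp[OF s] by (intro mult_right_mono) auto
  also have "... = 2 ^ (mv br + 2 * mz br) * (AA s * cmod (vd s *\<^sub>R gr F (vs s)))" by (rule mult.assoc)
  also have "... <= 2 ^ (mv br + 2 * mz br) * (K * L / (?q / 2) * inverse ((1 + s) ^ N) * exp (?q * s))"
   by (rule mult_left_mono[OF 1]) simp
  finally have 2: "exp (Q * s) * cmod (vd s *\<^sub>R gr F (vs s))
   <= 2 ^ (mv br + 2 * mz br) * (K * L / (?q / 2) * inverse ((1 + s) ^ N) * exp (?q * s))" .
  have e: "exp (- (Q * s)) * exp (?q * s) = exp (- ?q * s)" unfolding exp_add[symmetric] by simp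
  have A: "cmod (vd s *\<^sub>R gr F (vs s)) = exp (- (Q * s)) * (exp (Q * s) * cmod (vd s *\<^sub>R gr F (vs s)))"
   unfolding mult.assoc[symmetric] exp_add[symmetric] by simp
  have B: "exp (- (Q * s)) * (exp (Q * s) * cmod (vd s *\<^sub>R gr F (vs s))) <= exp (- (Q * s)) * (2 ^ (mv br + 2 * mz br) * (K * L / (?q / 2) * inverse ((1 + s) ^ N) * exp (?q * s)))"
   by (rule mult_left_mono[OF 2]) simp
  have D: "exp (- (Q * s)) * (2 ^ (mv br + 2 * mz br) * (K * L / (?q / 2) * inverse ((1 + s) ^ N) * exp (?q * s)))
    = C * inverse ((1 + s) ^ N) * (exp (- (Q * s)) * exp (?q * s))" unfolding C_def by (simp only: mult_ac)
  show ?thesis by (rule order_trans[OF eq_refl[OF A] order_trans[OF B eq_refl[OF D[unfolded e]]]])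
 qed
 then show "\<exists>K. \<forall>s\<ge>1. cmod (vd s *\<^sub>R gr F (vs s)) <= env K N ?q s" by blast
qed

text \<open>The limit \<open>L\<close> at infinity exists, and the tail integral decays as its integrand.\<close>

lemma dec_antiderivative:
 fixes E :: "real => complex"
 assumes q: "q > 0" and k: "dec q k"
  and E: "!!s. s >= 1 ==> hder1 E (k s) s"
 shows "\<exists>L. dec q (%s. L - E s)"
proof -
 have bound: "\<exists>K\<ge>0. \<forall>s t. 1 <= s \<longrightarrow> s <= t \<longrightarrow> norm (E t - E s) <= env K N q s" for N
 proof -
  obtain K where K: "!!s. s >= 1 ==> norm (k s) <= env K N q s"
   using k unfolding dec_def by meson
  have K0: "K >= 0"
  proof -
   have "0 <= K * (inverse ((1 + 1) ^ N) * exp (- q * 1))" using order_trans[OF norm_ge_zero K[OF order_refl]] by (simp only: mult.assoc)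
   moreover have "inverse ((1 + 1) ^ N) * exp (- q * 1) > 0" by simp
   ultimately show ?thesis using mult_neg_pos[of K "inverse ((1 + 1) ^ N) * exp (- q * 1)"] by linarith
  qed
  have "norm (E t - E s) <= K / q * inverse ((1 + s) ^ N) * exp (- q * s)" if s: "1 <= s" "s <= t" for s t
  proof -
   let ?c = "K * inverse ((1 + s) ^ N)"
   have i1: "(k has_integral E t - E s) {s..t}"
    by (rule fundamental_theorem_of_calculus[OF s(2)])
      (rule has_vector_derivative_within_subset[OF E], use s in auto)
   have i2: "((%\<tau>. ?c * exp (- q * \<tau>)) has_integral ?c * ((exp (- q * t) - exp (- q * s)) / (- q))) {s..t}"
    by (intro has_integral_mult_right has_integral_exp_halfline) (use q s in auto)
   have "norm (k \<tau>) <= ?c * exp (- q * \<tau>)" if t: "\<tau> \<in> {s..t}" for \<tau>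
   proof -
    have "inverse ((1 + \<tau>) ^ N) <= inverse ((1 + s) ^ N)" using t s by (intro le_imp_inverse_le power_mono) auto
    then have "K * inverse ((1 + \<tau>) ^ N) * exp (- q * \<tau>) <= ?c * exp (- q * \<tau>)"
     using K0 by (intro mult_right_mono mult_left_mono) auto
    then show ?thesis using K[of \<tau>] t s by simp
   qed
   then have "norm (E t - E s) <= ?c * ((exp (- q * t) - exp (- q * s)) / (- q))"
    using integral_norm_bound_integral[OF has_integral_integrable[OF i1] has_integral_integrable[OF i2]] i1 i2
    by (simp only: integral_unique)
   also have "(exp (- q * t) - exp (- q * s)) / (- q) = (exp (- q * s) - exp (- q * t)) / q"
    using q by (simp add: field_simps)
   also have "?c * ... <= ?c * (exp (- q * s) / q)"
    using q K0 s by (intro mult_left_mono divide_right_mono) auto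
   finally show ?thesis by (simp only: mult_ac times_divide_eq_right times_divide_eq_left)
  qed
  then show ?thesis using K0 q by (intro exI[of _ "K / q"]) auto
 qed
 obtain K where K0: "K >= 0" and K: "!!s t. 1 <= s ==> s <= t ==> norm (E t - E s) <= env K 1 q s"
  using bound[of 1] by blast
 define x where "x n = E (real (Suc n))" for n
 have lim0: "(%n. K * inverse (1 + real (Suc n))) \<longlonglongrightarrow> 0" by real_asymp
 have "Cauchy x"
 proof (rule CauchyI')
  fix e :: real assume e: "e > 0"
  have "\<forall>\<^sub>F n in sequentially. K * inverse (1 + real (Suc n)) < e" using order_tendstoD(2)[OF lim0 e] .
  then obtain M where M: "!!n. n >= M ==> K * inverse (1 + real (Suc n)) < e" by (auto simp: eventually_sequentially)
  show "\<exists>M. \<forall>m\<ge>M. \<forall>n>m. dist (x m) (x n) < e"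
  proof (intro exI[of _ M] allI impI)
   fix m n assume mn: "m >= M" "n > m"
   have "norm (x n - x m) <= K * inverse ((1 + real (Suc m)) ^ 1) * exp (- q * real (Suc m))"
    unfolding x_def by (rule K) (use mn in auto)
   also have "... <= K * inverse ((1 + real (Suc m)) ^ 1) * 1"
    using K0 q by (intro mult_left_mono) (auto intro!: mult_nonneg_nonneg)
   also have "... < e" using M[OF mn(1)] by simp
   finally show "dist (x m) (x n) < e" by (simp add: dist_norm norm_minus_commute)
  qed
 qed
 then obtain L where L: "x \<longlonglongrightarrow> L" using Cauchy_convergent_iff convergent_def by blast
 have "dec q (%s. L - E s)"
  unfolding dec_def
 proof
  fix N
  obtain K where K: "!!s t. 1 <= s ==> s <= t ==> norm (E t - E s) <= env K N q s"
   using bound[of N] by blast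
  have "norm (L - E s) <= env K N q s" if s: "s >= 1" for s
  proof (rule LIMSEQ_le_const2)
   show "(%n. norm (x n - E s)) \<longlonglongrightarrow> norm (L - E s)" by (intro tendsto_intros L)
   obtain M where M: "s <= real M" using real_arch_simple by blast
   show "\<exists>M. \<forall>n\<ge>M. norm (x n - E s) <= env K N q s"
    unfolding x_def by (intro exI[of _ M] allI impI K) (use s M in auto)
  qed
  then show "\<exists>K. \<forall>s\<ge>1. norm (L - E s) <= env K N q s" by blast
 qed
 then show ?thesis by blast
qed

text \<open>The Schwartz class is stable under the inverse Laplacian: \<open>U\<close> is a primitive of \<open>- gr F\<close> that is normalised to vanish at infinity. Its derivatives follow from the first-order equation for \<open>gr F\<close>.\<close>

lemma rapid_inverse_laplacian:
 assumes F: "rapid F"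
 obtains U where "rapid U" "!!v. v >= 0 ==> hder U (- gr F v) v"
proof -
 let ?q = "Q / 2"
 have q: "?q > 0" using hdim_ge by simp
 have sm: "!!k. diffs_on k {0..} F" using F by (simp add: rapid_def)
 let ?k = "%s. vd s *\<^sub>R gr F (vs s)"
 have dG: "v >= 0 ==> hder (Gop F) (gr F v) v" for v
  unfolding Gop_def[abs_def] by (rule diffs_on_antiderivative(1)[OF diffs_on_gr[OF sm, of 0]])
 have dE: "((%s. Gop F (vs s)) has_vector_derivative ?k s) (at s within S)" for s S
  by (rule halfline_chain) (rule dG)
 have "\<exists>L. dec ?q (%s. L - Gop F (vs s))"
  by (rule dec_antiderivative[OF q dec_mean[OF F] dE])
 then obtain L where L: "dec ?q (%s. L - Gop F (vs s))" ..
 define U where "U v = L - Gop F v" for v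
 have dU: "hder U (- gr F v) v" if "v >= 0" for v
  unfolding U_def[abs_def] using has_vector_derivative_diff[OF has_vector_derivative_const dG[OF that], of L] by simp
 have smG: "diffs_on (Suc k) {0..} (Gop F)" for k
  unfolding Gop_def[abs_def] by (rule diffs_on_antiderivative(2)[OF diffs_on_gr[OF sm]])
 have smU: "diffs_on k {0..} U" for k
  unfolding U_def[abs_def] by (intro diffs_on_diff diffs_on_const diffs_on_SucD[OF smG])
 have dk: "hder1 ?k (F (vs s) + (- 1) *\<^sub>R (bb s *\<^sub>R ?k s)) s" if s: "s >= 1" for s
 proof -
  have "\<exists>X. (\<forall>v\<in>{0..}. hder (gr F) (X v) v) \<and> continuous_on {0..} X"
   using diffs_on_gr[OF sm, of "Suc 0"] by (simp only: diffs_on.simps)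
  then obtain X where "(\<forall>v\<in>{0..}. hder (gr F) (X v) v) \<and> continuous_on {0..} X" ..
  then have X: "!!v. v >= 0 ==> hder (gr F) (X v) v" by simp
  have "hder1 ?k (vd s *\<^sub>R (vd s *\<^sub>R X (vs s)) + (1 / 2 + vs s) *\<^sub>R gr F (vs s)) s"
   by (rule has_vector_derivative_scaleR[OF vd_deriv halfline_chain[OF X]])
  moreover have "vd s *\<^sub>R (vd s *\<^sub>R X (vs s)) + (1 / 2 + vs s) *\<^sub>R gr F (vs s) = F (vs s) + (- 1) *\<^sub>R (bb s *\<^sub>R ?k s)"
  proof -
   have b: "bb s * vd s = Q * vs s + (nS - 1) / 2" using vd_pos[of s] s by (simp add: bb_def)
   have o: "(vs s * (1 + vs s)) *\<^sub>R X (vs s) + ((Q + 1) * vs s + nS / 2) *\<^sub>R gr F (vs s) = F (vs s)"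
    by (rule gr_ode[OF sm X]) auto
   have "F (vs s) + (- 1) *\<^sub>R (bb s *\<^sub>R ?k s) = F (vs s) - (bb s * vd s) *\<^sub>R gr F (vs s)"
    by (simp only: scaleR_scaleR scaleR_minus1_left) simp
   also have "... = ((vs s * (1 + vs s)) *\<^sub>R X (vs s) + ((Q + 1) * vs s + nS / 2) *\<^sub>R gr F (vs s)) - (bb s * vd s) *\<^sub>R gr F (vs s)"
    by (simp only: o)
   also have "... = (vs s * (1 + vs s)) *\<^sub>R X (vs s) + ((Q + 1) * vs s + nS / 2 - bb s * vd s) *\<^sub>R gr F (vs s)"
    by (simp only: scaleR_left_diff_distrib add_diff_eq)
   also have "(Q + 1) * vs s + nS / 2 - bb s * vd s = 1 / 2 + vs s" unfolding b by (simp add: field_simps)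
   also have "vs s * (1 + vs s) = vd s * vd s" using vd_sq[of s] by (simp add: power2_eq_square)
   finally show ?thesis by (simp only: scaleR_scaleR)
  qed
  ultimately show ?thesis by (simp only:)
 qed
 have Pk: "Pd ?q M ?k" for M
 proof (induction M)
  case 0 show ?case using dec_mean[OF F] by simp
 next
  case (Suc M)
  have FM: "Pd ?q M (%s. F (vs s))" using F unfolding rapid_def by (elim conjE) (rule spec)
  show ?case
   by (rule dW_I[where h' = "%s. F (vs s) + (- 1) *\<^sub>R (bb s *\<^sub>R ?k s)"])
     (rule dec_mean[OF F], rule dk, assumption, rule Pd_add[OF FM Pd_scaleR[OF Bd_const Pd_scaleR[OF Bd_bb Suc.IH]]])
 qed
 have "Pd ?q M (%s. U (vs s))" for M
 proof (cases M)
  case 0 then show ?thesis using L by (simp add: U_def)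
 next
  case (Suc M')
  have dU': "((%s. U (vs s)) has_vector_derivative (- 1) *\<^sub>R ?k s) (at s within S)" for s S
   using halfline_chain[of U "%v. - gr F v", OF dU] by simp
  show ?thesis unfolding Suc
   by (rule dW_I[where h' = "%s. (- 1) *\<^sub>R ?k s"])
     (use L in \<open>simp add: U_def\<close>, rule dU', rule Pd_scaleR[OF Bd_const Pk])
 qed
 then have "rapid U" unfolding rapid_def by (intro conjI allI smU)
 then show thesis by (rule that[OF _ dU])
qed

end

section \<open>The spherical transform\<close>

context htype
begin

text \<open>The integrand of the spherical transform in the distance coordinate.\<close>

abbreviation tri :: "(real => complex) => real => real => complex" where
 "tri F lam s \<equiv> (indicator {0..} s * AA s) *\<^sub>R (F (vs s) * of_real (ph (mu lam) s))"

definition tr :: "(real => complex) => real => complex" where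
 "tr F lam = (LINT s|lborel. tri F lam s)"

lemma rapid_continuous: "rapid F ==> continuous_on {0..} F"
 unfolding rapid_def using diffs_on_continuous by blast

lemma comp_vs_measurable [measurable (raw)]:
 assumes "continuous_on {0..} F" "g \<in> borel_measurable M"
 shows "(%x. F (vs (g x)) :: complex) \<in> borel_measurable M"
proof -
 have "continuous_on UNIV (%s. F (vs s))"
  by (rule continuous_on_compose2[OF assms(1) continuous_on_vs]) auto
 then have "(%s. F (vs s)) \<in> borel_measurable borel" by (rule borel_measurable_continuous_onI)
 then show ?thesis using assms(2) by measurable
qed

lemma ph_measurable [measurable (raw)]:
 assumes [measurable]: "f \<in> borel_measurable M" "g \<in> borel_measurable M"
 shows "(%x. ph (mu (f x)) (g x)) \<in> borel_measurable M"
 unfolding ph_def mu_def by measurable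

lemma spherical_transform_eq:
 assumes F: "continuous_on {0..} F" and f: "!!x. x \<in> DR ==> f x = F (vv x)"
 shows "spherical_transform br f lam = tr F lam"
 unfolding spherical_transform_def tr_def
proof (rule DR_integral_radial)
 fix x :: "'n \<times> real" assume x: "x \<in> DR"
 have "vs (rr x) = vv x" using vv_rr[OF x] by (simp add: vs_def)
 then show "f x * spherical_function br lam x = F (vs (rr x)) * of_real (ph (mu lam) (rr x))"
  using f[OF x] spherical_function_eq[OF x] by (simp add: ph_def)
next
 show "(%s. F (vs s) * complex_of_real (ph (mu lam) s)) \<in> borel_measurable borel"
  using comp_vs_measurable[OF F, of "%s. s" borel] by measurable
qed

lemma inverse_square_integrable:
 "integrable lborel (%s::real. indicator {0..} s * inverse ((1 + s)\<^sup>2))"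
proof (rule integrableI_nonneg)
 have "(\<integral>\<^sup>+ s. ennreal (inverse ((1 + s)\<^sup>2)) * indicator {0..} s \<partial>lborel) = ennreal (0 - (- inverse (1 + 0 :: real)))"
 proof (rule nn_integral_FTC_atLeast)
  fix s :: real assume "0 <= s"
  then show "((%s. - inverse (1 + s)) has_real_derivative inverse ((1 + s)\<^sup>2)) (at s)"
   by (auto intro!: derivative_eq_intros simp: power2_eq_square)
 next
  show "((%s::real. - inverse (1 + s)) \<longlongrightarrow> 0) at_top" by real_asymp
 qed auto
 then show "(\<integral>\<^sup>+ s. ennreal (indicator {0..} s * inverse ((1 + s)\<^sup>2)) \<partial>lborel) < \<infinity>"
  by (simp add: ennreal_mult' ennreal_indicator mult.commute)
qed auto

lemma Kph_nonneg: "lam > 0 ==> Kph lam / lam >= 0"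
 using mu_pos[of lam] by (simp add: Kph_def)

lemma tr_integrand_bound:
 assumes F: "rapid F"
 obtains C where "C >= 0"
  "!!lam s. lam > 0 ==> cmod (tri F lam s)
    <= C * (1 + Kph lam / lam) * (indicator {0..} s * inverse ((1 + s)\<^sup>2))"
proof -
 let ?q = "Q / 2"
 have d: "dec ?q (%s. F (vs s))"
  using F spec[of "%M. Pd ?q M (%s. F (vs s))" 0] by (auto simp: rapid_def)
 have c: "continuous_on {0..} (%s. F (vs s))"
  by (rule continuous_on_compose2[OF rapid_continuous[OF F] continuous_on_vs]) auto
 obtain K where K0: "K >= 0" and K: "!!s. s >= 0 ==> cmod (F (vs s)) <= K * inverse ((1 + s)\<^sup>2) * exp (- ?q * s)"
  using dec_halfline[OF d c, of 2] by blast
 have Q: "Q > 0" using hdim_ge by simp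
 have "cmod (tri F lam s)
    <= (K * exp (Q)) * (1 + Kph lam / lam) * (indicator {0..} s * inverse ((1 + s)\<^sup>2))" if lam: "lam > 0" for lam s
 proof (cases "s >= 0")
  case False then show ?thesis by simp
 next
  case True
  have e: "exp (Q * s) * exp (- ?q * s) = exp (?q * s)" unfolding exp_add[symmetric] by (simp add: field_simps)
  have "exp (Q * s) * exp (- ?q * s) * \<bar>ph (mu lam) s\<bar> <= exp (Q) * (1 + Kph lam / lam)"
  proof (cases "s >= 1")
   case s: True
   have "exp (?q * s) * \<bar>ph (mu lam) s\<bar> <= exp (?q * s) * (Kph lam / lam * exp (- ?q * s))"
    by (intro mult_left_mono ph_decay(1)[OF lam s]) simp
   also have "... = Kph lam / lam" by (simp add: exp_minus field_simps)
   also have "... <= 1 * (1 + Kph lam / lam)" by simp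
   also have "... <= exp (Q) * (1 + Kph lam / lam)"
    using Kph_nonneg[OF lam] Q by (intro mult_right_mono) auto
   finally show ?thesis unfolding e .
  next
   case False
   have "?q * s <= Q" using mult_mono[of ?q "Q" s 1] False True Q by simp
   then have "exp (?q * s) * \<bar>ph (mu lam) s\<bar> <= exp (Q) * 1"
    using ph_bounds(1)[OF mu_pos] by (intro mult_mono) auto
   also have "... <= exp (Q) * (1 + Kph lam / lam)" using Kph_nonneg[OF lam] by (intro mult_left_mono) auto
   finally show ?thesis unfolding e .
  qed
  then have b: "(K * inverse ((1 + s)\<^sup>2)) * (exp (Q * s) * exp (- ?q * s) * \<bar>ph (mu lam) s\<bar>)
    <= (K * inverse ((1 + s)\<^sup>2)) * (exp (Q) * (1 + Kph lam / lam))"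
   using K0 by (intro mult_left_mono) auto
  have "cmod (tri F lam s) = AA s * (cmod (F (vs s)) * \<bar>ph (mu lam) s\<bar>)"
   using True AA_nonneg[OF True] by (simp add: norm_mult)
  also have "... <= exp (Q * s) * ((K * inverse ((1 + s)\<^sup>2) * exp (- ?q * s)) * \<bar>ph (mu lam) s\<bar>)"
   by (intro mult_mono AA_le_exp K mult_right_mono) (use True AA_nonneg[OF True] in auto)
  also have "... = (K * inverse ((1 + s)\<^sup>2)) * (exp (Q * s) * exp (- ?q * s) * \<bar>ph (mu lam) s\<bar>)"
   by (simp only: mult_ac)
  also note b
  finally have "cmod (tri F lam s)
    <= (K * inverse ((1 + s)\<^sup>2)) * (exp (Q) * (1 + Kph lam / lam))" .
  also have "... = (K * exp (Q)) * (1 + Kph lam / lam) * (1 * inverse ((1 + s)\<^sup>2))"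
   by (simp only: mult_ac mult_1_left)
  finally show ?thesis using True by simp
 qed
 then show thesis using K0 by (intro that[of "K * exp (Q)"]) auto
qed

lemma tr_integrand_measurable:
 fixes F :: "real => complex"
 assumes F: "continuous_on {0..} F"
 shows "(%s. tri F lam s) \<in> borel_measurable borel"
 using comp_vs_measurable[OF F, of "%s. s" borel] by measurable

lemma tr_integrable:
 assumes F: "rapid F" and lam: "lam > 0"
 shows "integrable lborel (%s. tri F lam s)"
proof (rule tr_integrand_bound[OF F])
 fix C assume C: "C >= 0" "!!lam s. lam > 0 ==> cmod (tri F lam s)
    <= C * (1 + Kph lam / lam) * (indicator {0..} s * inverse ((1 + s)\<^sup>2))"
 show ?thesis
 proof (rule Bochner_Integration.integrable_bound)
  show "integrable lborel (%s. C * (1 + Kph lam / lam) * (indicator {0..} s * inverse ((1 + s)\<^sup>2)))"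
   by (intro integrable_mult_right inverse_square_integrable)
  show "AE s in lborel. norm (tri F lam s)
    <= norm (C * (1 + Kph lam / lam) * (indicator {0..} s * inverse ((1 + s)\<^sup>2)))"
   by (intro AE_I2 order_trans[OF C(2)[OF lam]]) (simp only: real_norm_def abs_ge_self)
 qed (use tr_integrand_measurable[OF rapid_continuous[OF F]] in simp)
qed

lemma tr_bound:
 assumes F: "rapid F"
 obtains C where "C >= 0" "!!lam. lam > 0 ==> cmod (tr F lam) <= C * (1 + Kph lam / lam)"
proof (rule tr_integrand_bound[OF F])
 fix C assume C: "C >= 0" "!!lam s. lam > 0 ==> cmod (tri F lam s)
    <= C * (1 + Kph lam / lam) * (indicator {0..} s * inverse ((1 + s)\<^sup>2))"
 define I where "I = (LINT s|lborel. indicator {0..} s * inverse ((1 + s :: real)\<^sup>2))"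
 have I0: "I >= 0" unfolding I_def by (intro Bochner_Integration.integral_nonneg) auto
 have "cmod (tr F lam) <= (C * I) * (1 + Kph lam / lam)" if lam: "lam > 0" for lam
 proof -
  have "cmod (tr F lam) <= (LINT s|lborel. C * (1 + Kph lam / lam) * (indicator {0..} s * inverse ((1 + s)\<^sup>2)))"
   unfolding tr_def
   by (rule order_trans[OF integral_norm_bound integral_mono[OF integrable_norm[OF tr_integrable[OF F lam]]]])
     (intro integrable_mult_right inverse_square_integrable C(2)[OF lam])+
  also have "... = C * (1 + Kph lam / lam) * I" unfolding I_def by (rule integral_mult_right_zero)
  also have "... = (C * I) * (1 + Kph lam / lam)" by (simp only: mult_ac)
  finally show ?thesis .
 qed
 then show thesis using C(1) I0 by (intro that[of "C * I"]) auto
qed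

lemma tr_measurable:
 assumes F: "rapid F"
 shows "tr F \<in> borel_measurable borel"
proof -
 have "(%p. (indicator {0..} (snd p) * AA (snd p)) *\<^sub>R (F (vs (snd p)) * of_real (ph (mu (fst p)) (snd p))))
   \<in> borel_measurable (borel \<Otimes>\<^sub>M lborel)"
  using comp_vs_measurable[OF rapid_continuous[OF F], of snd "borel \<Otimes>\<^sub>M lborel"] by measurable
 then have "(%lam. (LINT s|lborel. tri F lam s)) \<in> borel_measurable borel"
  by (intro lborel.borel_measurable_lebesgue_integral) (simp add: split_def)
 then show ?thesis by (simp only: tr_def[abs_def])
qed

lemma tr_add:
 assumes "rapid F" "rapid G" "lam > 0"
 shows "tr (%v. F v + G v) lam = tr F lam + tr G lam"
 unfolding tr_def distrib_right scaleR_add_right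
 by (rule Bochner_Integration.integral_add) (intro tr_integrable assms)+

lemma tr_scaleR: "tr (%v. c *\<^sub>R F v) lam = c *\<^sub>R tr F lam"
proof -
 have "tr (%v. c *\<^sub>R F v) lam = (LINT s|lborel. c *\<^sub>R (tri F lam s))"
  unfolding tr_def by (rule arg_cong[where f = "integral\<^sup>L lborel"]) (simp add: fun_eq_iff)
 then show ?thesis unfolding tr_def by (simp only: integral_scaleR_right)
qed

lemma tr_cong: "(!!v. v >= 0 ==> F v = G v) ==> tr F lam = tr G lam"
 unfolding tr_def by simp

text \<open>Green's identity; by the decay of \<open>F\<close> and of the spherical function the boundary terms are \<open>O(1/y)\<close>.\<close>

lemma tr_laplacian:
 assumes F: "rapid F" and F1: "!!v. v >= 0 ==> hder F (F1 v) v"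
  and F2: "!!v. v >= 0 ==> hder F1 (F2 v) v"
  and d1: "dec (Q / 2) (%s. vd s *\<^sub>R F1 (vs s))" and L: "rapid (Lop F1 F2)" and lam: "lam > 0"
 shows "tr (Lop F1 F2) lam = - mu lam *\<^sub>R tr F lam"
proof -
 let ?q = "Q / 2" and ?m = "mu lam"
 define P where "P s = (WW s *\<^sub>R F1 (vs s)) * of_real (ph ?m s)" for s
 define R where "R s = (WW s * Phi1 ?m (vs s)) *\<^sub>R F (vs s)" for s
 define g where "g s = (indicator {0..} s * AA s) *\<^sub>R (Lop F1 F2 (vs s) * of_real (ph ?m s))
   + ?m *\<^sub>R ((indicator {0..} s * AA s) *\<^sub>R (F (vs s) * of_real (ph ?m s)))" for s
 have gi: "integrable lborel g"
  unfolding g_def by (intro Bochner_Integration.integrable_add integrable_scaleR_right tr_integrable F L lam)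
 have Ig: "integral\<^sup>L lborel g = tr (Lop F1 F2) lam + ?m *\<^sub>R tr F lam"
  unfolding g_def tr_def integral_scaleR_right[symmetric]
  by (rule Bochner_Integration.integral_add) (intro integrable_scaleR_right tr_integrable F L lam)+
 have dP: "(P has_vector_derivative (WW s *\<^sub>R F1 (vs s)) * of_real (ph1 ?m s) + (AA s *\<^sub>R Lop F1 F2 (vs s)) * of_real (ph ?m s)) (at s within S)" for s S
 proof -
  have "((%s. complex_of_real (ph ?m s)) has_vector_derivative of_real (ph1 ?m s)) (at s within S)"
   using ph_deriv[of ?m s S] by (intro has_vector_derivative_of_real) (simp add: has_real_derivative_iff_has_vector_derivative)
  from has_vector_derivative_mult[OF WW_F1_deriv[OF F2] this]
  show ?thesis unfolding P_def[abs_def] .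
 qed
 have dR: "(R has_vector_derivative (WW s * Phi1 ?m (vs s)) *\<^sub>R (vd s *\<^sub>R F1 (vs s)) + (AA s * (- ?m * ph ?m s)) *\<^sub>R F (vs s)) (at s within S)" for s S
 proof -
  have "((%s. WW s *\<^sub>R Phi1 ?m (vs s)) has_vector_derivative AA s *\<^sub>R Lop (Phi1 ?m) (Phi2 ?m) (vs s)) (at s within S)"
   by (rule WW_F1_deriv) (use Phi1_deriv in \<open>simp add: has_real_derivative_iff_has_vector_derivative\<close>)
  then have "((%s. WW s * Phi1 ?m (vs s)) has_real_derivative AA s * (- ?m * ph ?m s)) (at s within S)"
   by (simp add: has_real_derivative_iff_has_vector_derivative Phi_Lop ph_def)
  from has_vector_derivative_scaleR[OF this halfline_chain[OF F1]]
  show ?thesis unfolding R_def[abs_def] .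
 qed
 have dPR: "((%s. P s - R s) has_vector_derivative g s) (at s within {0..y})" if s: "s \<in> {0..y}" for s y
 proof -
  have "(WW s *\<^sub>R F1 (vs s)) * of_real (ph1 ?m s) + (AA s *\<^sub>R Lop F1 F2 (vs s)) * of_real (ph ?m s)
   - ((WW s * Phi1 ?m (vs s)) *\<^sub>R (vd s *\<^sub>R F1 (vs s)) + (AA s * (- ?m * ph ?m s)) *\<^sub>R F (vs s)) = g s"
   using s by (simp add: g_def ph1_def scaleR_conv_of_real algebra_simps)
  then show ?thesis using has_vector_derivative_diff[OF dP dR, of s "{0..y}"] by (simp only:)
 qed
 have int: "(LINT s|lborel. indicator {..y} s *\<^sub>R g s) = P y - R y" if y: "y >= 0" for y
 proof -
  have "(g has_integral (P y - R y) - (P 0 - R 0)) {0..y}"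
   by (rule fundamental_theorem_of_calculus[OF y dPR])
  then have "integral {0..y} g = P y - R y" by (simp add: integral_unique P_def R_def)
  moreover have "set_integrable lborel {0..y} g"
   unfolding set_integrable_def using integrable_mult_indicator[of "{0..y}" lborel g] gi by simp
  ultimately have "(LINT s:{0..y}|lborel. g s) = P y - R y" using set_borel_integral_eq_integral(2) by metis
  moreover have "(%s. indicator {..y} s *\<^sub>R g s) = (%s. indicator {0..y} s *\<^sub>R g s)"
   by (auto simp: g_def indicator_def)
  ultimately show ?thesis by (simp only: set_lebesgue_integral_def)
 qed
 obtain K1 where K1: "!!s. s >= 1 ==> cmod (vd s *\<^sub>R F1 (vs s)) <= K1 * inverse ((1 + s) ^ 1) * exp (- ?q * s)"
  using d1 unfolding dec_def by meson
 have d0: "dec ?q (%s. F (vs s))"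
  using F spec[of "%M. Pd ?q M (%s. F (vs s))" 0] by (auto simp: rapid_def)
 obtain K2 where K2: "!!s. s >= 1 ==> cmod (F (vs s)) <= K2 * inverse ((1 + s) ^ 1) * exp (- ?q * s)"
  using d0 unfolding dec_def by meson
 define a where "a = Kph lam / lam"
 define b where "b = Kph lam + Q / 2 * (Kph lam / lam)"
 have bd: "cmod (P y - R y) <= (K1 * a + K2 * b) * inverse (1 + y)" if y: "y >= 1" for y
 proof -
  have e: "exp (Q * y) * (exp (- ?q * y) * exp (- ?q * y)) = 1"
   unfolding exp_add[symmetric] by simp
  have A: "0 <= AA y" "AA y <= exp (Q * y)" using AA_nonneg AA_le_exp y by auto
  note n1 = order_trans[OF norm_ge_zero K1[OF y]]
  have n2: "0 <= b * exp (- ?q * y)" unfolding b_def by (rule order_trans[OF abs_ge_zero ph_decay(2)[OF lam y]])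
  have "P y = AA y *\<^sub>R ((vd y *\<^sub>R F1 (vs y)) * of_real (ph ?m y))" by (simp add: P_def WW_vd)
  then have "cmod (P y) = AA y * (cmod (vd y *\<^sub>R F1 (vs y)) * \<bar>ph ?m y\<bar>)"
   using A(1) by (simp only: norm_scaleR[of "AA y"] norm_mult norm_of_real abs_of_nonneg)
  also have "... <= exp (Q * y) * ((K1 * inverse ((1 + y) ^ 1) * exp (- ?q * y)) * (a * exp (- ?q * y)))"
   unfolding a_def by (intro mult_mono A(2) K1 y ph_decay(1)[OF lam y]) (rule exp_ge_zero n1 | simp)+
  also have "... = (K1 * a) * inverse (1 + y) * (exp (Q * y) * (exp (- ?q * y) * exp (- ?q * y)))"
   by (simp only: mult_ac power_one_right)
  finally have 1: "cmod (P y) <= (K1 * a) * inverse (1 + y)" unfolding e by simp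
  have "R y = AA y *\<^sub>R (ph1 ?m y *\<^sub>R F (vs y))" by (simp add: R_def WW_vd ph1_def mult_ac)
  then have "cmod (R y) = AA y * (\<bar>ph1 ?m y\<bar> * cmod (F (vs y)))"
   using A(1) by (simp only: norm_scaleR abs_of_nonneg)
  also have "... <= exp (Q * y) * ((b * exp (- ?q * y)) * (K2 * inverse ((1 + y) ^ 1) * exp (- ?q * y)))"
   unfolding b_def by (intro mult_mono A(2) K2 y ph_decay(2)[OF lam y]) (rule exp_ge_zero n2[unfolded b_def] | simp)+
  also have "... = (K2 * b) * inverse (1 + y) * (exp (Q * y) * (exp (- ?q * y) * exp (- ?q * y)))"
   by (simp only: mult_ac power_one_right)
  finally have 2: "cmod (R y) <= (K2 * b) * inverse (1 + y)" unfolding e by simp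
  show ?thesis using norm_triangle_ineq4[of "P y" "R y"] 1 2 unfolding distrib_right by linarith
 qed
 have "((%y. P y - R y) \<longlongrightarrow> 0) at_top"
 proof (rule Lim_null_comparison)
  show "\<forall>\<^sub>F y in at_top. cmod (P y - R y) <= (K1 * a + K2 * b) * inverse (1 + y)"
   using eventually_ge_at_top[of 1] by eventually_elim (rule bd)
  have "((%y::real. inverse (1 + y)) \<longlongrightarrow> 0) at_top" by real_asymp
  from tendsto_mult_left[OF this, of "K1 * a + K2 * b"]
  show "((%y. (K1 * a + K2 * b) * inverse (1 + y)) \<longlongrightarrow> 0) at_top" by simp
 qed
 moreover have "((%y. P y - R y) \<longlongrightarrow> integral\<^sup>L lborel g) at_top"
 proof (rule Lim_transform_eventually[OF tendsto_integral_at_top[OF _ gi]])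
  show "\<forall>\<^sub>F y in at_top. (LINT s|lborel. indicator {..y} s *\<^sub>R g s) = P y - R y"
   using eventually_ge_at_top[of 0] by eventually_elim (rule int)
 qed simp
 ultimately have "integral\<^sup>L lborel g = 0" using tendsto_unique[OF trivial_limit_at_top_linorder] by metis
 then have "tr (Lop F1 F2) lam + ?m *\<^sub>R tr F lam = 0" using Ig by (simp only:)
 then show ?thesis by (simp only: add_eq_0_iff2 scaleR_minus_left)
qed

text \<open>On the transform side the inverse Laplacian is division by \<open>mu\<close>. Hence every polynomial in the resolvent acts on the Schwartz class.\<close>

lemma rapid_inverse:
 assumes F: "rapid F"
 shows "\<exists>U. rapid U \<and> (\<forall>lam>0. tr U lam = (1 / mu lam) *\<^sub>R tr F lam)"
proof (rule rapid_inverse_laplacian[OF F])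
 fix U assume U: "rapid U" and dU: "!!v. v >= 0 ==> hder U (- gr F v) v"
 have sm: "!!k. diffs_on k {0..} F" using F by (simp add: rapid_def)
 show ?thesis
 proof (rule rapid_Lop[OF U])
  fix F1 F2 assume F1: "!!v. v >= 0 ==> hder U (F1 v) v"
   and F2: "!!v. v >= 0 ==> hder F1 (F2 v) v"
   and d1: "dec (Q / 2) (%s. vd s *\<^sub>R F1 (vs s))" and L: "rapid (Lop F1 F2)"
  have e1: "gr F v = - F1 v" if "v >= 0" for v
   using vector_derivative_unique_within[OF halfline_nontrivial F1[OF that] dU[OF that]] that by simp
  have dg: "hder (gr F) (- F2 v) v" if v: "v >= 0" for v
   by (rule has_vector_derivative_transform[OF _ _ has_vector_derivative_minus[OF F2[OF v]]]) (use v e1 in auto)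
  have "Lop F1 F2 v = (- 1) *\<^sub>R F v" if v: "v >= 0" for v
  proof -
   have h: "(v * (1 + v)) *\<^sub>R (- F2 v) + ((Q + 1) * v + nS / 2) *\<^sub>R (- F1 v) = F v"
    using gr_ode[OF sm dg[OF v] v] unfolding e1[OF v] .
   show ?thesis unfolding h[symmetric] Lop_def by simp
  qed
  then have t': "tr (Lop F1 F2) lam = tr (%v. (- 1) *\<^sub>R F v) lam" for lam by (rule tr_cong)
  have t: "tr (Lop F1 F2) lam = - tr F lam" for lam using t'[of lam] unfolding tr_scaleR by simp
  have "tr U lam = (1 / mu lam) *\<^sub>R tr F lam" if lam: "lam > 0" for lam
  proof -
   have "tr F lam = mu lam *\<^sub>R tr U lam"
    using tr_laplacian[OF U F1 F2 d1 L lam] t[of lam] by simp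
   then show ?thesis using mu_pos[of lam] by simp
  qed
  then show ?thesis using U by blast
 qed
qed

lemma rapid_inverse_power:
 assumes F: "rapid F"
 shows "\<exists>U. rapid U \<and> (\<forall>lam>0. tr U lam = (1 / mu lam) ^ i *\<^sub>R tr F lam)"
proof (induction i)
 case 0 show ?case using F by auto
next
 case (Suc i)
 then obtain U where U: "rapid U \<and> (\<forall>lam>0. tr U lam = (1 / mu lam) ^ i *\<^sub>R tr F lam)" ..
 from rapid_inverse[OF conjunct1[OF U]] obtain V where V: "rapid V \<and> (\<forall>lam>0. tr V lam = (1 / mu lam) *\<^sub>R tr U lam)" ..
 show ?case by (rule exI[of _ V]) (use U V in simp)
qed

lemma rapid_resolvent_polynomial:
 assumes F: "rapid F"
 shows "\<exists>G. rapid G \<and> (\<forall>lam>0. tr G lam = (\<Sum>i\<le>n. a i * (1 / mu lam) ^ i) *\<^sub>R tr F lam)"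
proof (induction n)
 case 0
 show ?case
  by (rule exI[of _ "%v. a 0 *\<^sub>R F v"]) (simp add: tr_scaleR rapid_linear[OF bounded_linear_scaleR_right F])
next
 case (Suc n)
 then obtain G where G: "rapid G \<and> (\<forall>lam>0. tr G lam = (\<Sum>i\<le>n. a i * (1 / mu lam) ^ i) *\<^sub>R tr F lam)" ..
 from rapid_inverse_power[OF F] obtain U where U: "rapid U \<and> (\<forall>lam>0. tr U lam = (1 / mu lam) ^ Suc n *\<^sub>R tr F lam)" ..
 have U': "rapid (%v. a (Suc n) *\<^sub>R U v)" using U by (intro rapid_linear[OF bounded_linear_scaleR_right]) simp
 have "tr (%v. G v + a (Suc n) *\<^sub>R U v) lam = (\<Sum>i\<le>Suc n. a i * (1 / mu lam) ^ i) *\<^sub>R tr F lam" if "lam > 0" for lam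
 proof -
  have "tr (%v. G v + a (Suc n) *\<^sub>R U v) lam = tr G lam + a (Suc n) *\<^sub>R tr U lam"
   using tr_add[OF conjunct1[OF G] U' that] by (simp only: tr_scaleR)
  also have "... = (\<Sum>i\<le>n. a i * (1 / mu lam) ^ i) *\<^sub>R tr F lam + a (Suc n) *\<^sub>R ((1 / mu lam) ^ Suc n *\<^sub>R tr F lam)"
   using G U that by (simp only:)
  finally show ?thesis by (simp only: sum.atMost_Suc scaleR_add_left scaleR_scaleR)
 qed
 then show ?case using rapid_add[OF conjunct1[OF G] U'] by blast
qed

text \<open>Each application of the Laplacian gains a factor \<open>mu\<close>.\<close>

lemma tr_decay:
 assumes F: "rapid F"
 shows "\<exists>C\<ge>0. \<forall>lam\<ge>1. cmod (tr F lam) * mu lam ^ k <= C * mu lam"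
 using F
proof (induction k arbitrary: F)
 case 0
 show ?case
 proof (rule tr_bound[OF 0])
  fix C assume C: "C >= 0" "!!lam. lam > 0 ==> cmod (tr F lam) <= C * (1 + Kph lam / lam)"
  from Kph_bound obtain K0 where K0: "\<forall>lam\<ge>1. Kph lam / lam <= K0 * mu lam" ..
  have "cmod (tr F lam) * mu lam ^ 0 <= C * (4 + max 0 K0) * mu lam" if lam: "lam >= 1" for lam
  proof -
   have "Kph lam / lam <= K0 * mu lam" using K0 lam by simp
   also have "... <= max 0 K0 * mu lam" using mu_pos[of lam] by (intro mult_right_mono) auto
   finally have "1 + Kph lam / lam <= 4 * mu lam + max 0 K0 * mu lam"
    using mu_ge(1)[of lam] by linarith
   then have "1 + Kph lam / lam <= (4 + max 0 K0) * mu lam" by (simp only: distrib_right)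
   then have "C * (1 + Kph lam / lam) <= C * ((4 + max 0 K0) * mu lam)" using C(1) by (rule mult_left_mono)
   then show ?thesis using C(2)[of lam] lam by (simp only: mult.assoc power_0 mult_1_right) linarith
  qed
  then show ?thesis using C(1) by (intro exI[of _ "C * (4 + max 0 K0)"]) auto
 qed
next
 case (Suc k)
 show ?case
 proof (rule rapid_Lop[OF Suc.prems])
  fix F1 F2 assume a: "!!v. v >= 0 ==> hder F (F1 v) v"
   "!!v. v >= 0 ==> hder F1 (F2 v) v"
   "dec (Q / 2) (%s. vd s *\<^sub>R F1 (vs s))" and L: "rapid (Lop F1 F2)"
  from Suc.IH[OF L] obtain C where C: "C >= 0 \<and> (\<forall>lam\<ge>1. cmod (tr (Lop F1 F2) lam) * mu lam ^ k <= C * mu lam)" ..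
  have "cmod (tr F lam) * mu lam ^ Suc k <= C * mu lam" if lam: "lam >= 1" for lam
  proof -
   have "cmod (tr (Lop F1 F2) lam) = mu lam * cmod (tr F lam)"
    using tr_laplacian[OF Suc.prems a L, of lam] lam mu_pos[of lam] by simp
   moreover have "cmod (tr (Lop F1 F2) lam) * mu lam ^ k <= C * mu lam" using C lam by simp
   ultimately show ?thesis by (simp only: power_Suc mult_ac)
  qed
  then show ?thesis using C by blast
 qed
qed

end

section \<open>Maximal functions of superpositions\<close>

context htype
begin

definition dd :: "real => real" where
 "dd lam = indicator {0..} lam * plancherel_density br lam"

lemma dd_nonneg: "dd l >= 0" by (simp add: dd_def plancherel_nonneg)

lemma dd_0: "l <= 0 ==> dd l = 0" by (cases "l = 0") (simp_all add: dd_def plancherel_0)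

lemma hdim_pos: "Q > 0" using hdim_ge by simp

lemma dd_measurable [measurable]: "dd \<in> borel_measurable borel"
 using plancherel_measurable[OF hdim_pos] by (simp add: dd_def[abs_def])

lemma Phi_abs_le_1: "\<bar>Phi (mu lam) v\<bar> <= 1"
proof -
 have "Phi (mu lam) v = Phi (mu lam) (max 0 v)" by (simp add: Phi_def)
 then show ?thesis using Phi_le_1[OF mu_pos, of "max 0 v" lam] by simp
qed

definition L1 :: "(real => complex) => bool" where
 "L1 h \<longleftrightarrow> h \<in> borel_measurable borel \<and> integrable lborel (%l. dd l * cmod (h l))"

definition n1 :: "(real => complex) => real" where
 "n1 h = (LINT l|lborel. dd l * cmod (h l))"

text \<open>The argument \<open>max 0 l\<close> makes the phase measurable on the whole line; the density \<open>dd\<close> vanishes for negative \<open>l\<close>. The function \<open>h\<close> stands for the transform of the initial datum, and multipliers act on it although they leave the Schwartz class.\<close>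

definition dpi :: "(real => real) => (real => complex) => real => real => real => complex" where
 "dpi \<psi> h t v l = dd l *\<^sub>R (of_real (Phi (mu l) v) * exp (\<i> * of_real (t * \<psi> (max 0 l))) * h l)"

definition dp :: "(real => real) => (real => complex) => real => real => complex" where
 "dp \<psi> h t v = (LINT l|lborel. dpi \<psi> h t v l)"

lemma norm_dpi_le: "cmod (dpi \<psi> h t v l) <= dd l * cmod (h l)"
proof -
 have "cmod (dpi \<psi> h t v l) = dd l * (\<bar>Phi (mu l) v\<bar> * cmod (h l))"
  using dd_nonneg[of l] by (simp add: dpi_def norm_mult)
 also have "... <= dd l * (1 * cmod (h l))"
  by (intro mult_left_mono mult_right_mono Phi_abs_le_1 dd_nonneg) simp
 finally show ?thesis by simp
qed

lemma phase_continuous: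
 fixes \<psi> :: "real => real"
 assumes "continuous_on {0..} \<psi>"
 shows "continuous_on UNIV (%l. \<psi> (max 0 l))"
proof -
 have c: "continuous_on UNIV (%l::real. (l + \<bar>l\<bar>) / 2)" by (intro continuous_intros) auto
 have e: "max 0 l = (l + \<bar>l\<bar>) / 2" for l :: real by (simp add: max_def)
 show ?thesis unfolding e by (rule continuous_on_compose2[OF assms c]) auto
qed

lemma phase_measurable:
 fixes \<psi> :: "real => real"
 shows "continuous_on {0..} \<psi> ==> (%l. \<psi> (max 0 l)) \<in> borel_measurable borel"
 by (rule borel_measurable_continuous_onI[OF phase_continuous])

lemma mu_measurable [measurable]: "mu \<in> borel_measurable borel"
 unfolding mu_def[abs_def] by measurable

lemma dpi_measurable:
 assumes \<psi>: "continuous_on {0..} \<psi>" and h: "h \<in> borel_measurable borel"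
 shows "(%p. dpi \<psi> h t (fst p) (snd p)) \<in> borel_measurable (borel \<Otimes>\<^sub>M lborel)"
  "dpi \<psi> h t v \<in> borel_measurable borel"
proof -
 note [measurable] = phase_measurable[OF \<psi>] h
 show "(%p. dpi \<psi> h t (fst p) (snd p)) \<in> borel_measurable (borel \<Otimes>\<^sub>M lborel)"
  unfolding dpi_def by measurable
 show "dpi \<psi> h t v \<in> borel_measurable borel"
  unfolding dpi_def[abs_def] by measurable
qed

lemma dpi_integrable:
 assumes \<psi>: "continuous_on {0..} \<psi>" and h: "L1 h"
 shows "integrable lborel (dpi \<psi> h t v)"
proof (rule Bochner_Integration.integrable_bound)
 show "integrable lborel (%l. dd l * cmod (h l))" using h by (simp add: L1_def)
 show "AE l in lborel. norm (dpi \<psi> h t v l) <= norm (dd l * cmod (h l))"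
  by (intro AE_I2 order_trans[OF norm_dpi_le]) simp
qed (use dpi_measurable(2)[OF \<psi>] h in \<open>simp add: L1_def\<close>)

lemma dp_bound:
 assumes \<psi>: "continuous_on {0..} \<psi>" and h: "L1 h"
 shows "cmod (dp \<psi> h t v) <= n1 h"
 unfolding dp_def n1_def
 by (rule order_trans[OF integral_norm_bound integral_mono[OF integrable_norm[OF dpi_integrable[OF \<psi> h]]]])
   (use h norm_dpi_le in \<open>simp_all add: L1_def\<close>)

lemma dp_continuous:
 assumes \<psi>: "continuous_on {0..} \<psi>" and h: "L1 h"
 shows "continuous_on UNIV (%t. dp \<psi> h t v)"
proof (rule continuous_at_imp_continuous_on, rule ballI, rule continuous_at_sequentiallyI)
 fix t :: real and u :: "nat => real" assume u: "u \<longlonglongrightarrow> t"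
 show "(%n. dp \<psi> h (u n) v) \<longlonglongrightarrow> dp \<psi> h t v"
  unfolding dp_def
 proof (rule integral_dominated_convergence[where w = "%l. dd l * cmod (h l)"])
  show "integrable lborel (%l. dd l * cmod (h l))" using h by (simp add: L1_def)
  show "dpi \<psi> h t v \<in> borel_measurable lborel" "!!n. dpi \<psi> h (u n) v \<in> borel_measurable lborel"
   using dpi_measurable(2)[OF \<psi>] h by (simp_all add: L1_def)
  show "AE l in lborel. (%n. dpi \<psi> h (u n) v l) \<longlonglongrightarrow> dpi \<psi> h t v l"
   unfolding dpi_def by (intro AE_I2 tendsto_intros u)
  show "!!n. AE l in lborel. norm (dpi \<psi> h (u n) v l) <= dd l * cmod (h l)"
   by (intro AE_I2 norm_dpi_le)
 qed
qed

lemma dp_measurable: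
 assumes \<psi>: "continuous_on {0..} \<psi>" and h: "L1 h"
 shows "(%v. dp \<psi> h t v) \<in> borel_measurable borel"
 unfolding dp_def
 by (rule lborel.borel_measurable_lebesgue_integral) (use dpi_measurable(1)[OF \<psi>] h in \<open>simp add: L1_def split_def\<close>)

definition MM :: "(real => real) => (real => complex) => real => real" where
 "MM \<psi> h v = (SUP t\<in>{0<..<1}. cmod (dp \<psi> h t v))"

lemma MM_upper:
 assumes "continuous_on {0..} \<psi>" "L1 h" "t \<in> {0<..<1}"
 shows "cmod (dp \<psi> h t v) <= MM \<psi> h v"
 unfolding MM_def by (rule cSUP_upper[OF assms(3)]) (use dp_bound[OF assms(1,2)] in \<open>auto simp: bdd_above_def\<close>)

lemma MM_least: "(!!t. t \<in> {0<..<1} ==> cmod (dp \<psi> h t v) <= c) ==> MM \<psi> h v <= c"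
 unfolding MM_def by (rule cSUP_least) auto

lemma MM_nonneg: assumes "continuous_on {0..} \<psi>" "L1 h" shows "MM \<psi> h v >= 0"
 by (rule order_trans[OF norm_ge_zero MM_upper[OF assms, of "1/2"]]) simp

text \<open>By continuity in \<open>t\<close> the supremum may be taken over countably many times, which makes the maximal function measurable.\<close>

lemma MM_rational:
 assumes \<psi>: "continuous_on {0..} \<psi>" and h: "L1 h"
 shows "MM \<psi> h v = (SUP t\<in>{0<..<1} \<inter> \<rat>. cmod (dp \<psi> h t v))"
proof (rule antisym)
 have bdd: "bdd_above ((%t. cmod (dp \<psi> h t v)) ` ({0<..<1} \<inter> \<rat>))"
  using dp_bound[OF \<psi> h] by (auto simp: bdd_above_def)
 have cl: "{0<..<1} \<subseteq> closure ({0<..<1::real} \<inter> \<rat>)"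
  using open_Int_closure_subset[of "{0<..<1::real}" \<rat>] by (simp add: Rats_closure_real)
 show "MM \<psi> h v <= (SUP t\<in>{0<..<1} \<inter> \<rat>. cmod (dp \<psi> h t v))"
 proof (rule MM_least)
  fix t :: real assume "t \<in> {0<..<1}"
  then have t: "t \<in> closure ({0<..<1} \<inter> \<rat>)" using cl by blast
  show "cmod (dp \<psi> h t v) <= (SUP t\<in>{0<..<1} \<inter> \<rat>. cmod (dp \<psi> h t v))"
  proof (rule continuous_le_on_closure[OF _ t])
   show "continuous_on (closure ({0<..<1} \<inter> \<rat>)) (%t. cmod (dp \<psi> h t v))"
    by (intro continuous_on_norm continuous_on_subset[OF dp_continuous[OF \<psi> h]]) simp
  qed (rule cSUP_upper[OF _ bdd])
 qed
 have "1/2 \<in> {0<..<1} \<inter> (\<rat> :: real set)" by simp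
 then have ne: "{0<..<1} \<inter> (\<rat> :: real set) \<noteq> {}" by blast
 show "(SUP t\<in>{0<..<1} \<inter> \<rat>. cmod (dp \<psi> h t v)) <= MM \<psi> h v"
  by (rule cSUP_least[OF ne]) (rule MM_upper[OF \<psi> h], simp)
qed

lemma MM_measurable:
 assumes \<psi>: "continuous_on {0..} \<psi>" and h: "L1 h"
 shows "MM \<psi> h \<in> borel_measurable borel"
proof -
 have "(%v. SUP t\<in>{0<..<1} \<inter> \<rat>. cmod (dp \<psi> h t v)) \<in> borel_measurable borel"
 proof (rule borel_measurable_cSUP)
  show "countable ({0<..<1::real} \<inter> \<rat>)" using countable_rat by blast
  show "(%v. cmod (dp \<psi> h t v)) \<in> borel_measurable borel" for t
   using dp_measurable[OF \<psi> h] by measurable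
  show "bdd_above ((%t. cmod (dp \<psi> h t v)) ` ({0<..<1} \<inter> \<rat>))" for v
   using dp_bound[OF \<psi> h] by (auto simp: bdd_above_def)
 qed
 moreover have "MM \<psi> h = (%v. SUP t\<in>{0<..<1} \<inter> \<rat>. cmod (dp \<psi> h t v))"
  by (rule ext) (rule MM_rational[OF \<psi> h])
 ultimately show ?thesis by simp
qed

lemma dispersive_eq:
 assumes F: "continuous_on {0..} F" and f: "!!x. x \<in> DR ==> f x = F (vv x)" and x: "x \<in> DR"
 shows "dispersive br \<psi> t f x = dp \<psi> (tr F) t (vv x)"
proof -
 have "indicator {0..} l *\<^sub>R (spherical_function br l x * exp (\<i> * of_real (t * \<psi> l)) * spherical_transform br f l * of_real (plancherel_density br l))
   = dpi \<psi> (tr F) t (vv x) l" for l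
  by (cases "l >= 0")
    (simp_all add: dpi_def dd_def spherical_function_eq[OF x] spherical_transform_eq[OF F f] scaleR_conv_of_real mult_ac)
 then show ?thesis by (simp add: dispersive_def dp_def set_lebesgue_integral_def)
qed

lemma maximal_function_eq:
 assumes F: "continuous_on {0..} F" and f: "!!x. x \<in> DR ==> f x = F (vv x)" and x: "x \<in> DR"
  and \<psi>: "continuous_on {0..} \<psi>" and h: "L1 (tr F)"
 shows "maximal_function br \<psi> f x = ennreal (MM \<psi> (tr F) (vv x))"
proof -
 have e: "maximal_function br \<psi> f x = (SUP t\<in>{0<..<1}. ennreal (cmod (dp \<psi> (tr F) t (vv x))))"
  unfolding maximal_function_def by (intro SUP_cong refl) (simp only: dispersive_eq[OF F f x])
 show ?thesis unfolding e
 proof (rule antisym)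
 show "(SUP t\<in>{0<..<1}. ennreal (cmod (dp \<psi> (tr F) t (vv x)))) <= ennreal (MM \<psi> (tr F) (vv x))"
  by (intro SUP_least ennreal_leI MM_upper[OF \<psi> h])
 show "ennreal (MM \<psi> (tr F) (vv x)) <= (SUP t\<in>{0<..<1}. ennreal (cmod (dp \<psi> (tr F) t (vv x))))" (is "_ <= ?S")
 proof (cases "?S = \<infinity>")
  case False
  then obtain r where r: "?S = ennreal r" "r >= 0" by (cases ?S) auto
  have "cmod (dp \<psi> (tr F) t (vv x)) <= r" if "t \<in> {0<..<1}" for t
  proof -
   have "ennreal (cmod (dp \<psi> (tr F) t (vv x))) <= ?S" by (rule SUP_upper[OF that])
   then show ?thesis unfolding r(1) using r(2) by simp
  qed
  then have "MM \<psi> (tr F) (vv x) <= r" by (rule MM_least)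
  then show ?thesis unfolding r(1) by (rule ennreal_leI)
 qed (simp only: infinity_ennreal_def top_greatest)
 qed
qed

lemma L1_mult:
 assumes h: "L1 h" and m: "m \<in> borel_measurable borel" "!!l. l >= 0 ==> \<bar>m l\<bar> <= c"
 shows "L1 (%l. of_real (m l) * h l)"
proof -
 have [measurable]: "h \<in> borel_measurable borel" "m \<in> borel_measurable borel" using h m by (auto simp: L1_def)
 have "integrable lborel (%l. dd l * cmod (of_real (m l) * h l))"
 proof (rule Bochner_Integration.integrable_bound)
  show "integrable lborel (%l. c * (dd l * cmod (h l)))" using h by (simp add: L1_def)
  show "AE l in lborel. norm (dd l * cmod (of_real (m l) * h l)) <= norm (c * (dd l * cmod (h l)))"
  proof (rule AE_I2)
   fix l :: real
   have "dd l * cmod (of_real (m l) * h l) = \<bar>m l\<bar> * (dd l * cmod (h l))" by (simp add: norm_mult)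
   also have "... <= c * (dd l * cmod (h l))"
   proof (cases "l >= 0")
    case True then show ?thesis using m(2) dd_nonneg by (intro mult_right_mono mult_nonneg_nonneg) auto
   qed (simp add: dd_0)
   finally show "norm (dd l * cmod (of_real (m l) * h l)) <= norm (c * (dd l * cmod (h l)))"
    using dd_nonneg[of l] by (simp add: norm_mult)
  qed
 qed measurable
 then show ?thesis by (simp add: L1_def)
qed

lemma MM_diff:
 assumes \<psi>: "continuous_on {0..} \<psi>" and h: "L1 h" and g: "L1 g" and t: "t \<in> {0<..<1}"
 shows "cmod (dp \<psi> h t v) <= MM \<psi> g v + n1 (%l. g l - h l)"
proof -
 have [measurable]: "h \<in> borel_measurable borel" "g \<in> borel_measurable borel" using h g by (auto simp: L1_def)
 have L: "L1 (%l. g l - h l)"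
 proof -
  have "integrable lborel (%l. dd l * cmod (g l - h l))"
  proof (rule Bochner_Integration.integrable_bound)
   show "integrable lborel (%l. dd l * cmod (g l) + dd l * cmod (h l))" using h g by (simp add: L1_def)
   show "AE l in lborel. norm (dd l * cmod (g l - h l)) <= norm (dd l * cmod (g l) + dd l * cmod (h l))"
    using mult_left_mono[OF norm_triangle_ineq4 dd_nonneg] dd_nonneg
    by (intro AE_I2) (simp add: distrib_left abs_of_nonneg)
  qed measurable
  then show ?thesis by (simp add: L1_def)
 qed
 have "dp \<psi> g t v - dp \<psi> h t v = dp \<psi> (%l. g l - h l) t v"
  unfolding dp_def Bochner_Integration.integral_diff[OF dpi_integrable[OF \<psi> g] dpi_integrable[OF \<psi> h], symmetric]
  by (rule arg_cong[where f = "integral\<^sup>L lborel"]) (simp add: dpi_def fun_eq_iff right_diff_distrib scaleR_diff_right)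
 then have "cmod (dp \<psi> g t v - dp \<psi> h t v) <= n1 (%l. g l - h l)" using dp_bound[OF \<psi> L] by (simp only:)
 moreover have "cmod (dp \<psi> h t v) <= cmod (dp \<psi> g t v) + cmod (dp \<psi> g t v - dp \<psi> h t v)"
  by (metis norm_minus_commute norm_triangle_sub)
 ultimately show ?thesis using MM_upper[OF \<psi> g t, of v] by linarith
qed

text \<open>Taylor expansion of \<open>exp (i t \<Delta>)\<close> in \<open>exp (i t \<psi>2) = exp (i t \<psi>1) exp (i t \<Delta>)\<close>, valid for \<open>l > \<Lambda>\<close>. For \<open>l <= \<Lambda>\<close> the two sides differ by at most 2.\<close>

lemma phase_taylor:
 assumes \<psi>1: "continuous_on {0..} \<psi>1" and \<psi>2: "continuous_on {0..} \<psi>2" and h: "L1 h"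
  and C: "C > 0" and \<Delta>: "!!l. l > \<Lambda> ==> \<Delta> l = \<psi>2 l - \<psi>1 l" "!!l. \<bar>\<Delta> l\<bar> <= C" "\<Delta> \<in> borel_measurable borel"
  and t: "t \<in> {0<..<1}"
 shows "cmod (dp \<psi>2 h t v) <= (\<Sum>k\<le>K. C ^ k / fact k * cmod (dp \<psi>1 (%l. of_real ((\<Delta> l / C) ^ k) * h l) t v))
   + C ^ Suc K / fact (Suc K) * n1 h + 2 * (LINT l|lborel. indicator {0..\<Lambda>} l * (dd l * cmod (h l)))"
proof -
 have [measurable]: "h \<in> borel_measurable borel" "\<Delta> \<in> borel_measurable borel" using h \<Delta>(3) by (auto simp: L1_def)
 let ?m = "%k l. of_real ((\<Delta> l / C) ^ k) * h l"
 let ?c = "%k. (\<i> * of_real t) ^ k * of_real (C ^ k / fact k) :: complex"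
 let ?e = "C ^ Suc K / fact (Suc K)"
 have Lm: "L1 (?m k)" for k
 proof (rule L1_mult[OF h, of _ 1])
  show "\<bar>(\<Delta> l / C) ^ k\<bar> <= 1" for l
   unfolding power_abs using \<Delta>(2)[of l] C by (intro power_le_one) auto
 qed measurable
 define r where "r l = dpi \<psi>2 h t v l - (\<Sum>k\<le>K. ?c k * dpi \<psi>1 (?m k) t v l)" for l
 have ri: "integrable lborel r"
  unfolding r_def by (intro Bochner_Integration.integrable_diff Bochner_Integration.integrable_sum integrable_mult_right dpi_integrable \<psi>1 \<psi>2 h Lm)
 have Ir: "integral\<^sup>L lborel r = dp \<psi>2 h t v - (\<Sum>k\<le>K. ?c k * dp \<psi>1 (?m k) t v)"
 proof -
  have s: "integrable lborel (%l. ?c k * dpi \<psi>1 (?m k) t v l)" for k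
   by (intro integrable_mult_right dpi_integrable \<psi>1 Lm)
  have "integral\<^sup>L lborel r = dp \<psi>2 h t v - (LINT l|lborel. (\<Sum>k\<le>K. ?c k * dpi \<psi>1 (?m k) t v l))"
   unfolding r_def dp_def
   by (rule Bochner_Integration.integral_diff) (intro dpi_integrable \<psi>2 h Bochner_Integration.integrable_sum s)+
  also have "(LINT l|lborel. (\<Sum>k\<le>K. ?c k * dpi \<psi>1 (?m k) t v l)) = (\<Sum>k\<le>K. LINT l|lborel. ?c k * dpi \<psi>1 (?m k) t v l)"
   by (rule Bochner_Integration.integral_sum) (rule s)
  also have "... = (\<Sum>k\<le>K. ?c k * dp \<psi>1 (?m k) t v)"
   unfolding dp_def by (intro sum.cong refl integral_mult_right_zero)
  finally show ?thesis .
 qed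
 have rb: "cmod (r l) <= ?e * (dd l * cmod (h l)) + 2 * (indicator {0..\<Lambda>} l * (dd l * cmod (h l)))" for l
 proof (cases "l >= 0")
  case False then show ?thesis by (simp add: r_def dpi_def dd_0)
 next
  case True
  define E1 E2 where "E1 = exp (\<i> * complex_of_real (t * \<psi>1 l))" and "E2 = exp (\<i> * complex_of_real (t * \<psi>2 l))"
  define x where "x = t * \<Delta> l"
  define T where "T = (\<Sum>k\<le>K. (\<i> * complex_of_real x) ^ k / fact k)"
  have nE: "cmod E1 = 1" "cmod E2 = 1" "cmod (iexp x) = 1" unfolding E1_def E2_def by (simp_all only: norm_exp_i_times)
  have tt: "0 <= t" "t <= 1" using t by auto
  have xC: "\<bar>x\<bar> <= C" using mult_mono[of "\<bar>t\<bar>" 1 "\<bar>\<Delta> l\<bar>" C] \<Delta>(2)[of l] tt by (simp add: x_def abs_mult)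
  have "cmod (iexp x - T) <= \<bar>x\<bar> ^ Suc K / fact (Suc K)" unfolding T_def by (rule iexp_approx1)
  also have "... <= ?e" using xC by (intro divide_right_mono power_mono) auto
  finally have a: "cmod (iexp x - T) <= ?e" .
  have tm: "?c k * dpi \<psi>1 (?m k) t v l = dd l *\<^sub>R (of_real (Phi (mu l) v) * (E1 * ((\<i> * complex_of_real x) ^ k / fact k)) * h l)" for k
   using True C by (simp add: dpi_def E1_def x_def power_mult_distrib power_divide scaleR_conv_of_real)
  have "r l = dd l *\<^sub>R (of_real (Phi (mu l) v) * (E2 - E1 * T) * h l)"
  proof -
   have "(\<Sum>k\<le>K. ?c k * dpi \<psi>1 (?m k) t v l) = dd l *\<^sub>R (of_real (Phi (mu l) v) * (E1 * T) * h l)"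
    unfolding tm T_def by (simp only: scaleR_sum_right sum_distrib_left sum_distrib_right)
   then show ?thesis using True unfolding r_def
    by (simp only: dpi_def E2_def max_absorb2) (simp add: right_diff_distrib left_diff_distrib scaleR_diff_right)
  qed
  then have rn: "cmod (r l) = (dd l * cmod (h l)) * (\<bar>Phi (mu l) v\<bar> * cmod (E2 - E1 * T))"
   using dd_nonneg[of l] by (simp add: norm_mult)
  have nb: "cmod (E2 - E1 * T) <= ?e + 2 * indicator {0..\<Lambda>} l"
  proof (cases "l > \<Lambda>")
   case g: True
   have "E2 = E1 * iexp x" unfolding E1_def E2_def x_def exp_add[symmetric] \<Delta>(1)[OF g] by (simp add: algebra_simps)
   then have "E2 - E1 * T = E1 * (iexp x - T)" by (simp only: right_diff_distrib)
   then have "cmod (E2 - E1 * T) = cmod (iexp x - T)" using nE by (simp only: norm_mult mult_1_left)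
   then show ?thesis using a g by simp
  next
   case False
   have "E2 - E1 * T = (E2 - E1 * iexp x) + E1 * (iexp x - T)" by (simp add: right_diff_distrib)
   then have "cmod (E2 - E1 * T) <= cmod (E2 - E1 * iexp x) + cmod (E1 * (iexp x - T))" by (simp only: norm_triangle_ineq)
   also have "cmod (E1 * (iexp x - T)) = cmod (iexp x - T)" using nE by (simp only: norm_mult mult_1_left)
   also have "cmod (E2 - E1 * iexp x) <= cmod E2 + cmod (E1 * iexp x)" by (rule norm_triangle_ineq4)
   also have "... = 2" using nE by (simp add: norm_mult)
   finally show ?thesis using a False True by simp
  qed
  have "\<bar>Phi (mu l) v\<bar> * cmod (E2 - E1 * T) <= 1 * (?e + 2 * indicator {0..\<Lambda>} l)"
   by (intro mult_mono Phi_abs_le_1 nb) auto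
  then have "cmod (r l) <= (dd l * cmod (h l)) * (1 * (?e + 2 * indicator {0..\<Lambda>} l))"
   unfolding rn using dd_nonneg[of l] by (intro mult_left_mono) auto
  then show ?thesis by (simp add: algebra_simps)
 qed
 have i0: "integrable lborel (%l. dd l * cmod (h l))" using h by (simp add: L1_def)
 have i1: "integrable lborel (%l. indicator {0..\<Lambda>} l * (dd l * cmod (h l)))"
  using integrable_mult_indicator[of "{0..\<Lambda>}" lborel, OF _ i0] by simp
 have "cmod (integral\<^sup>L lborel r) <= (LINT l|lborel. ?e * (dd l * cmod (h l)) + 2 * (indicator {0..\<Lambda>} l * (dd l * cmod (h l))))"
  by (rule order_trans[OF integral_norm_bound integral_mono[OF integrable_norm[OF ri]]])
    (intro Bochner_Integration.integrable_add integrable_mult_right i0 i1 rb)+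
 also have "... = ?e * n1 h + 2 * (LINT l|lborel. indicator {0..\<Lambda>} l * (dd l * cmod (h l)))"
  unfolding n1_def using i0 i1 by (simp only: Bochner_Integration.integral_add integrable_mult_right integral_mult_right_zero)
 finally have R: "cmod (integral\<^sup>L lborel r) <= ?e * n1 h + 2 * (LINT l|lborel. indicator {0..\<Lambda>} l * (dd l * cmod (h l)))" .
 have "cmod (\<Sum>k\<le>K. ?c k * dp \<psi>1 (?m k) t v) <= (\<Sum>k\<le>K. C ^ k / fact k * cmod (dp \<psi>1 (?m k) t v))"
 proof (rule order_trans[OF norm_sum], rule sum_mono)
  fix k
  have "cmod (?c k) = \<bar>t\<bar> ^ k * (C ^ k / fact k)"
  proof -
   have "cmod (complex_of_real (C ^ k / fact k)) = C ^ k / fact k" using C by (simp only: norm_of_real abs_of_nonneg) simp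
   then show ?thesis by (simp only: norm_mult norm_power norm_ii norm_of_real mult_1_left)
  qed
  also have "... <= 1 * (C ^ k / fact k)" using t C by (intro mult_right_mono power_le_one) auto
  finally have "cmod (?c k) <= C ^ k / fact k" by simp
  then show "cmod (?c k * dp \<psi>1 (?m k) t v) <= C ^ k / fact k * cmod (dp \<psi>1 (?m k) t v)"
   unfolding norm_mult[of "?c k"] by (rule mult_right_mono) simp
 qed
 moreover have "dp \<psi>2 h t v = integral\<^sup>L lborel r + (\<Sum>k\<le>K. ?c k * dp \<psi>1 (?m k) t v)" using Ir by simp
 then have "cmod (dp \<psi>2 h t v) <= cmod (integral\<^sup>L lborel r) + cmod (\<Sum>k\<le>K. ?c k * dp \<psi>1 (?m k) t v)"
  by (simp only: norm_triangle_ineq)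
 ultimately show ?thesis using R by linarith
qed

end

section \<open>Transference\<close>

lemma Lp_norm_cong:
 assumes "!!x. x \<in> space M ==> F x = G x"
 shows "Lp_norm p M F = Lp_norm p M G"
proof -
 have "F \<in> borel_measurable M \<longleftrightarrow> G \<in> borel_measurable M" by (rule measurable_cong) (rule assms)
 moreover have "Limsup (ae_filter M) F = Limsup (ae_filter M) G"
  by (rule Limsup_eq) (use assms in \<open>auto intro!: AE_I2\<close>)
 ultimately have "esssup M F = esssup M G" by (simp add: esssup_def)
 moreover have "(\<integral>\<^sup>+x. ennreal_powr (F x) (enn2real p) \<partial>M) = (\<integral>\<^sup>+x. ennreal_powr (G x) (enn2real p) \<partial>M)"
  by (rule nn_integral_cong) (simp add: assms)
 ultimately show ?thesis by (simp add: Lp_norm_def)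
qed

lemma exp_partial_sum_le:
 fixes C :: real
 assumes "C >= 0"
 shows "(\<Sum>k\<le>K. C ^ k / fact k) <= exp C"
proof -
 have "(\<Sum>k\<in>{..K}. C ^ k /\<^sub>R fact k) <= (\<Sum>k. C ^ k /\<^sub>R fact k)"
  using summable_exp_generic[of C] assms by (intro sum_le_suminf) auto
 then show ?thesis by (simp add: exp_def divide_inverse mult.commute)
qed

context htype
begin

definition w2 :: "real => real => real" where "w2 \<beta> l = mu l powr \<beta> * dd l"

definition N2 :: "real => (real => complex) => ennreal" where
 "N2 \<beta> h = (\<integral>\<^sup>+l. ennreal (w2 \<beta> l * (cmod (h l))\<^sup>2) \<partial>lborel)"

lemma w2_nonneg: "w2 \<beta> l >= 0" using dd_nonneg by (simp add: w2_def)

lemma w2_0: "l <= 0 ==> w2 \<beta> l = 0" by (simp add: w2_def dd_0)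

lemma w2_measurable [measurable]: "w2 \<beta> \<in> borel_measurable borel"
 unfolding w2_def[abs_def] by measurable

lemma sobolev_norm_eq:
 assumes F: "continuous_on {0..} F" and f: "!!x. x \<in> DR ==> f x = F (vv x)"
 shows "sobolev_norm br \<beta> f = ennreal_powr (N2 \<beta> (tr F)) (1 / 2)"
proof -
 have "ennreal ((l\<^sup>2 + Q\<^sup>2 / 4) powr \<beta> * (cmod (spherical_transform br f l))\<^sup>2 * plancherel_density br l) * indicator {0..} l
   = ennreal (w2 \<beta> l * (cmod (tr F l))\<^sup>2)" for l
  by (cases "l >= 0") (simp_all add: spherical_transform_eq[OF F f] w2_def dd_def mu_def mult_ac)
 then show ?thesis by (simp only: sobolev_norm_def N2_def)
qed

lemma dd_growth: "\<exists>D N. D >= 0 \<and> (\<forall>l\<ge>0. dd l <= D * (1 + l) ^ N)"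
 using plancherel_bound[OF hdim_pos] by (simp add: dd_def)

lemma mu_powr_ge: "\<beta> >= 0 ==> 1 <= 4 powr \<beta> * mu l powr \<beta>"
proof -
 assume b: "\<beta> >= 0"
 have "1 <= (4 * mu l) powr \<beta>" using mu_ge(1)[of l] b by (intro ge_one_powr_ge_zero) auto
 then show ?thesis using mu_pos[of l] by (simp add: powr_mult)
qed

lemma N2_integrable:
 assumes "h \<in> borel_measurable borel" "N2 \<beta> h \<noteq> \<infinity>"
 shows "integrable lborel (%l. w2 \<beta> l * (cmod (h l))\<^sup>2)"
proof (rule integrableI_nonneg)
 note [measurable] = assms(1)
 show "(%l. w2 \<beta> l * (cmod (h l))\<^sup>2) \<in> borel_measurable lborel" by measurable
 show "(\<integral>\<^sup>+ l. ennreal (w2 \<beta> l * (cmod (h l))\<^sup>2) \<partial>lborel) < \<infinity>" using assms(2) by (simp add: N2_def less_top)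
qed (simp add: w2_nonneg)

text \<open>Low frequencies are controlled by the Sobolev norm, high ones by the decay of the transform.\<close>

lemma L1_tr:
 assumes F: "rapid F" and \<beta>: "\<beta> >= 0" and fin: "N2 \<beta> (tr F) \<noteq> \<infinity>"
 shows "L1 (tr F)"
proof -
 note [measurable] = tr_measurable[OF F]
 obtain D N where D: "D >= 0" "!!l. l >= 0 ==> dd l <= D * (1 + l) ^ N" using dd_growth by blast
 from tr_decay[OF F, of "N + 2"] obtain C where C: "C >= 0 \<and> (\<forall>lam\<ge>1. cmod (tr F lam) * mu lam ^ (N + 2) <= C * mu lam)" ..
 let ?h = "%l. cmod (tr F l)"
 define w where "w l = D * 2 ^ N * indicator {0..1} l + 4 powr \<beta> * (w2 \<beta> l * (?h l)\<^sup>2)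
   + D * C * 2 ^ N * 4 * (indicator {0..} l * inverse ((1 + l)\<^sup>2))" for l :: real
 have wi: "integrable lborel w"
  unfolding w_def
  by (intro Bochner_Integration.integrable_add integrable_mult_right inverse_square_integrable N2_integrable[OF tr_measurable[OF F]] fin)
    (rule integrable_real_indicator, simp_all)
 have w1: "0 <= D * 2 ^ N * indicator {0..1} l" "0 <= 4 powr \<beta> * (w2 \<beta> l * (?h l)\<^sup>2)"
  "0 <= D * C * 2 ^ N * 4 * (indicator {0..} l * inverse ((1 + l)\<^sup>2))" for l
  using D(1) C w2_nonneg by auto
 have "dd l * ?h l <= w l" for l
 proof -
  consider "l < 0" | "0 <= l" "l < 1" | "1 <= l" by linarith
  then show ?thesis
  proof cases
   case 1
   then have "dd l = 0" by (simp add: dd_0)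
   then show ?thesis using w1[of l] unfolding w_def by simp
  next
   case 2
   have "dd l <= D * (1 + l) ^ N" by (rule D(2)[OF 2(1)])
   also have "... <= D * 2 ^ N" using D(1) 2 by (intro mult_left_mono power_mono) auto
   finally have a: "dd l <= D * 2 ^ N" .
   have "dd l * (?h l)\<^sup>2 <= (4 powr \<beta> * mu l powr \<beta>) * (dd l * (?h l)\<^sup>2)"
    using mult_right_mono[OF mu_powr_ge[OF \<beta>, of l], of "dd l * (?h l)\<^sup>2"] dd_nonneg by simp
   then have b: "dd l * (?h l)\<^sup>2 <= 4 powr \<beta> * (w2 \<beta> l * (?h l)\<^sup>2)" by (simp only: w2_def mult_ac)
   have "0 <= (?h l - 1)\<^sup>2 + 1 + (?h l)\<^sup>2" by simp
   then have "?h l <= 1 + (?h l)\<^sup>2" by (simp add: power2_eq_square algebra_simps)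
   then have "dd l * ?h l <= dd l * (1 + (?h l)\<^sup>2)" by (intro mult_left_mono dd_nonneg)
   then have "dd l * ?h l <= D * 2 ^ N + 4 powr \<beta> * (w2 \<beta> l * (?h l)\<^sup>2)" using a b by (simp only: distrib_left mult_1_right)
   moreover have ind: "indicator {0..1} l = (1 :: real)" using 2 by simp
   ultimately show ?thesis using w1(3)[of l] unfolding w_def ind by linarith
  next
   case 3
   have m: "mu l >= l\<^sup>2" "mu l > 0" using mu_ge(2)[of l] mu_pos[of l] by auto
   have "l <= l\<^sup>2" using 3 mult_right_mono[of 1 l l] by (simp add: power2_eq_square)
   then have l2: "1 + l <= 2 * mu l" using m 3 by linarith
   have "?h l * mu l ^ (N + 2) <= C * mu l" using C 3 by blast
   then have "?h l * mu l ^ (N + 1) * mu l <= C * mu l" by (simp only: power_add power_one_right power2_eq_square mult_ac)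
   then have hb: "?h l * mu l ^ (N + 1) <= C" by (rule mult_right_le_imp_le[OF _ m(2)])
   have "dd l <= D * (1 + l) ^ N" by (rule D(2)) (use 3 in simp)
   also have "... <= D * (2 * mu l) ^ N" using D(1) l2 3 by (intro mult_left_mono power_mono) auto
   finally have "dd l * ?h l <= (D * (2 * mu l) ^ N) * ?h l" by (intro mult_right_mono) auto
   also have "... = D * 2 ^ N * (?h l * mu l ^ (N + 1)) * inverse (mu l)"
    using m(2) by (simp add: power_mult_distrib)
   also have "... <= D * 2 ^ N * C * inverse (mu l)"
    using hb D(1) m(2) by (intro mult_right_mono mult_left_mono) auto
   also have "... <= D * 2 ^ N * C * (4 * inverse ((1 + l)\<^sup>2))"
   proof (rule mult_left_mono)
    have "(1 + l)\<^sup>2 <= (2 * l)\<^sup>2" using 3 by (intro power_mono) auto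
    then have "(1 + l)\<^sup>2 <= 4 * mu l" using m by (simp add: power_mult_distrib)
    then show "inverse (mu l) <= 4 * inverse ((1 + l)\<^sup>2)" using m(2) 3 by (simp add: field_simps)
    show "0 <= D * 2 ^ N * C" using D(1) C by simp
   qed
   also have "... = D * C * 2 ^ N * 4 * (indicator {0..} l * inverse ((1 + l)\<^sup>2))"
    using 3 by (simp add: mult_ac)
   finally show ?thesis using w1(1,2)[of l] unfolding w_def by linarith
  qed
 qed
 then have "integrable lborel (%l. dd l * ?h l)"
  by (intro Bochner_Integration.integrable_bound[OF wi])
    (measurable, auto intro!: AE_I2 order_trans[OF _ abs_ge_self] simp: abs_mult dd_nonneg)
 then show ?thesis by (simp add: L1_def)
qed

text \<open>The Cauchy-Schwarz inequality on \<open>[0,\<Lambda>]\<close>, with the optimal constant \<open>S\<close> put into the pointwise inequality \<open>2 S m |h| <= S\<^sup>2 + m\<^sup>2 |h|\<^sup>2\<close>.\<close>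

lemma low_frequency_bound:
 assumes \<beta>: "\<beta> >= 0" and \<Lambda>: "\<Lambda> > 0"
 shows "\<exists>c\<ge>0. \<forall>h S. h \<in> borel_measurable borel \<longrightarrow> S > 0 \<longrightarrow> N2 \<beta> h = ennreal (S\<^sup>2) \<longrightarrow>
   (LINT l|lborel. indicator {0..\<Lambda>} l * (dd l * cmod (h l))) <= c * S"
proof -
 obtain D N where D: "D >= 0" "!!l. l >= 0 ==> dd l <= D * (1 + l) ^ N" using dd_growth by blast
 define d where "d = 4 powr \<beta> * (D * (1 + \<Lambda>) ^ N)"
 have d0: "d >= 0" using D(1) \<Lambda> by (simp add: d_def)
 have "(LINT l|lborel. indicator {0..\<Lambda>} l * (dd l * cmod (h l))) <= (d * \<Lambda> + 1) / 2 * S"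
  if h: "h \<in> borel_measurable borel" and S: "S > 0" and n: "N2 \<beta> h = ennreal (S\<^sup>2)" for h S
 proof -
  note [measurable] = h
  have wi: "integrable lborel (%l. w2 \<beta> l * (cmod (h l))\<^sup>2)" by (rule N2_integrable[OF h]) (simp add: n)
  have wI: "(LINT l|lborel. w2 \<beta> l * (cmod (h l))\<^sup>2) = S\<^sup>2"
   using n unfolding N2_def
   by (subst integral_eq_nn_integral) (auto simp: w2_nonneg)
  have ii: "integrable lborel (%l. S / 2 * (d * indicator {0..\<Lambda>} l))" using \<Lambda> by simp
  have pt: "indicator {0..\<Lambda>} l * (dd l * cmod (h l)) <= S / 2 * (d * indicator {0..\<Lambda>} l) + inverse (2 * S) * (w2 \<beta> l * (cmod (h l))\<^sup>2)" for l
  proof (cases "l \<in> {0..\<Lambda>}")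
   case False
   then show ?thesis using w2_nonneg[of \<beta> l] S by simp
  next
   case True
   define m where "m = mu l powr \<beta>"
   have m: "m > 0" using mu_pos[of l] by (simp add: m_def)
   have "0 <= (S - m * cmod (h l))\<^sup>2" by simp
   then have "2 * (S * m) * cmod (h l) <= S\<^sup>2 + m\<^sup>2 * (cmod (h l))\<^sup>2"
    by (simp add: power2_eq_square algebra_simps)
   then have "cmod (h l) <= S / 2 * inverse m + inverse (2 * S) * (m * (cmod (h l))\<^sup>2)"
    using S m by (simp add: field_simps power2_eq_square)
   then have "dd l * cmod (h l) <= dd l * (S / 2 * inverse m + inverse (2 * S) * (m * (cmod (h l))\<^sup>2))"
    by (intro mult_left_mono dd_nonneg)
   also have "... = S / 2 * (inverse m * dd l) + inverse (2 * S) * (w2 \<beta> l * (cmod (h l))\<^sup>2)"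
    unfolding w2_def m_def[symmetric] by (simp only: distrib_left mult_ac)
   also have "inverse m * dd l <= d"
   proof -
    have "inverse m <= 4 powr \<beta>" using mu_powr_ge[OF \<beta>, of l] m unfolding m_def[symmetric] by (simp add: field_simps)
    moreover have "dd l <= D * (1 + \<Lambda>) ^ N"
     using True D by (intro order_trans[OF D(2)] mult_left_mono power_mono) auto
    ultimately show ?thesis unfolding d_def using m dd_nonneg by (intro mult_mono) auto
   qed
   then have "S / 2 * (inverse m * dd l) <= S / 2 * d" using S by (intro mult_left_mono) auto
   finally show ?thesis using True \<open>S / 2 * (inverse m * dd l) <= S / 2 * d\<close> by simp
  qed
  have "(LINT l|lborel. indicator {0..\<Lambda>} l * (dd l * cmod (h l))) \<le>
    (LINT l|lborel. S / 2 * (d * indicator {0..\<Lambda>} l) + inverse (2 * S) * (w2 \<beta> l * (cmod (h l))\<^sup>2))"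
  proof (rule integral_mono[OF _ _ pt])
   show r: "integrable lborel (%l. S / 2 * (d * indicator {0..\<Lambda>} l) + inverse (2 * S) * (w2 \<beta> l * (cmod (h l))\<^sup>2))"
    by (intro Bochner_Integration.integrable_add ii integrable_mult_right wi)
   show "integrable lborel (%l. indicator {0..\<Lambda>} l * (dd l * cmod (h l)))"
   proof (rule Bochner_Integration.integrable_bound[OF r])
    show "(%l. indicator {0..\<Lambda>} l * (dd l * cmod (h l))) \<in> borel_measurable lborel" by measurable
    show "AE l in lborel. norm (indicator {0..\<Lambda>} l * (dd l * cmod (h l)))
      <= norm (S / 2 * (d * indicator {0..\<Lambda>} l) + inverse (2 * S) * (w2 \<beta> l * (cmod (h l))\<^sup>2))"
    proof (rule AE_I2)
     fix l :: real
     have "norm (indicator {0..\<Lambda>} l * (dd l * cmod (h l))) = indicator {0..\<Lambda>} l * (dd l * cmod (h l))"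
      using dd_nonneg[of l] by (simp add: abs_mult)
     also note pt
     also note abs_ge_self
     finally show "norm (indicator {0..\<Lambda>} l * (dd l * cmod (h l)))
      <= norm (S / 2 * (d * indicator {0..\<Lambda>} l) + inverse (2 * S) * (w2 \<beta> l * (cmod (h l))\<^sup>2))" by (simp only: real_norm_def)
    qed
   qed
  qed
  also have "... = S / 2 * (d * \<Lambda>) + inverse (2 * S) * S\<^sup>2"
   using \<Lambda> wI by (simp only: Bochner_Integration.integral_add[OF ii integrable_mult_right[OF wi]] integral_mult_right_zero) simp
  also have "... = (d * \<Lambda> + 1) / 2 * S" using S by (simp add: field_simps power2_eq_square)
  finally show ?thesis .
 qed
 then show ?thesis using d0 \<Lambda> by (intro exI[of _ "(d * \<Lambda> + 1) / 2"]) auto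
qed

text \<open>The datum with transform \<open>m tr F\<close> need not be a Schwartz function, but up to an error \<open>\<delta>\<close> in both norms it is one.\<close>

lemma rapid_multiplier:
 assumes F: "rapid F" and h: "L1 (tr F)" and S: "N2 \<beta> (tr F) = ennreal S2" "S2 >= 0"
  and m: "continuous_on UNIV m" "!!l. \<bar>m l\<bar> <= 1" and \<delta>: "\<delta> > 0"
 shows "\<exists>G. rapid G \<and> L1 (tr G) \<and> n1 (%l. tr G l - of_real (m l) * tr F l) <= \<delta> \<and> N2 \<beta> (tr G) <= ennreal (2 * S2 + 2 * \<delta>)"
proof -
 let ?q = "Q\<^sup>2 / 4" and ?h = "tr F"
 have q: "?q > 0" using hdim_pos by simp
 note [measurable] = tr_measurable[OF F] borel_measurable_continuous_onI[OF m(1)]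
 have w2i: "integrable lborel (%l. w2 \<beta> l * (cmod (?h l))\<^sup>2)" by (rule N2_integrable) (simp_all add: S)
 let ?P = "%a n. \<forall>g. (\<forall>l. g l = of_real (\<Sum>i\<le>n. a i * (1 / (l\<^sup>2 + ?q)) ^ i) * ?h l) \<longrightarrow>
   (\<integral>\<^sup>+l. ennreal (dd l * cmod (g l - of_real (m l) * ?h l)) \<partial>lborel) <= ennreal \<delta> \<and>
   (\<integral>\<^sup>+l. ennreal (w2 \<beta> l * (cmod (g l - of_real (m l) * ?h l))\<^sup>2) \<partial>lborel) <= ennreal \<delta>"
 have "\<exists>a n. ?P a n"
 by (rule multiplier_approx[OF q continuous_on_subset[OF m(1)] m(2) _ w2i])
    (use h dd_nonneg w2_nonneg dd_0 w2_0 \<delta> in \<open>auto simp: L1_def\<close>)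
 then obtain a where "\<exists>n. ?P a n" ..
 then obtain n where an: "?P a n" ..
 define P where "P l = (\<Sum>i\<le>n. a i * (1 / mu l) ^ i)" for l
 define g where "g l = of_real (P l) * ?h l" for l
 have gP: "(\<integral>\<^sup>+l. ennreal (dd l * cmod (g l - of_real (m l) * ?h l)) \<partial>lborel) <= ennreal \<delta> \<and>
   (\<integral>\<^sup>+l. ennreal (w2 \<beta> l * (cmod (g l - of_real (m l) * ?h l))\<^sup>2) \<partial>lborel) <= ennreal \<delta>"
  by (rule mp[OF spec[OF an]], rule allI) (simp only: g_def P_def mu_def)
 from rapid_resolvent_polynomial[OF F, of a n] obtain G where
  "rapid G \<and> (\<forall>lam>0. tr G lam = (\<Sum>i\<le>n. a i * (1 / mu lam) ^ i) *\<^sub>R ?h lam)" ..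
 then have G: "rapid G" and Gg: "!!l. l > 0 ==> tr G l = g l" by (simp_all add: g_def P_def scaleR_conv_of_real)
 note [measurable] = tr_measurable[OF G]
 have gd: "dd l * c (tr G l) = dd l * c (g l)" "w2 \<beta> l * c (tr G l) = w2 \<beta> l * c (g l)" for l and c :: "complex => real"
  by (cases "l > 0"; simp add: Gg dd_0 w2_0)+
 have gd3: "dd l * cmod (tr G l - z) = dd l * cmod (g l - z)" for l z
  using gd(1)[of l "%w. cmod (w - z)"] .
 have gd4: "w2 \<beta> l * (cmod (tr G l))\<^sup>2 = w2 \<beta> l * (cmod (g l))\<^sup>2" for l
  using gd(2)[of l "%w. (cmod w)\<^sup>2"] .
 have PL: "L1 g" unfolding g_def
 proof (rule L1_mult[OF h, of P "\<Sum>i\<le>n. \<bar>a i\<bar> * 4 ^ i"])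
  show "P \<in> borel_measurable borel" unfolding P_def[abs_def] by measurable
  fix l :: real
  have "1 / mu l <= 4" "0 <= 1 / mu l" using mu_ge(1)[of l] mu_pos[of l] by (simp_all add: field_simps)
  then have "\<bar>a i * (1 / mu l) ^ i\<bar> <= \<bar>a i\<bar> * 4 ^ i" for i
   unfolding abs_mult power_abs by (intro mult_left_mono power_mono) auto
  then show "\<bar>P l\<bar> <= (\<Sum>i\<le>n. \<bar>a i\<bar> * 4 ^ i)"
   unfolding P_def by (intro order_trans[OF sum_abs] sum_mono)
 qed
 then have LG: "L1 (tr G)" by (simp add: L1_def gd(1)[of _ cmod])
 have "n1 (%l. tr G l - of_real (m l) * ?h l) <= \<delta>"
 proof -
  have "n1 (%l. tr G l - of_real (m l) * ?h l) = (LINT l|lborel. dd l * cmod (g l - of_real (m l) * ?h l))"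
   unfolding n1_def gd3 ..
  also have "... = enn2real (\<integral>\<^sup>+l. ennreal (dd l * cmod (g l - of_real (m l) * ?h l)) \<partial>lborel)"
   using PL by (intro integral_eq_nn_integral) (auto simp: L1_def dd_nonneg)
  also have "... <= enn2real (ennreal \<delta>)" by (intro enn2real_mono conjunct1[OF gP]) simp
  finally show ?thesis using \<delta> by simp
 qed
 moreover have "N2 \<beta> (tr G) <= ennreal (2 * S2 + 2 * \<delta>)"
 proof -
  have [measurable]: "g \<in> borel_measurable borel" using PL by (simp add: L1_def)
  have pt: "w2 \<beta> l * (cmod (g l))\<^sup>2 <= 2 * (w2 \<beta> l * (cmod (?h l))\<^sup>2) + 2 * (w2 \<beta> l * (cmod (g l - of_real (m l) * ?h l))\<^sup>2)" for l
  proof -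
   define A B where "A = cmod (?h l)" and "B = cmod (g l - of_real (m l) * ?h l)"
   have "cmod (of_real (m l) * ?h l) <= 1 * A"
    unfolding norm_mult norm_of_real A_def by (intro mult_right_mono m(2)) simp
   then have "cmod (g l) <= A + B"
    using norm_triangle_sub[of "g l" "of_real (m l) * ?h l"] by (simp add: B_def)
   then have "(cmod (g l))\<^sup>2 <= (A + B)\<^sup>2" by (intro power_mono) auto
   also have "... <= 2 * A\<^sup>2 + 2 * B\<^sup>2"
    using zero_le_power2[of "A - B"] by (simp add: power2_eq_square algebra_simps)
   finally have "w2 \<beta> l * (cmod (g l))\<^sup>2 <= w2 \<beta> l * (2 * A\<^sup>2 + 2 * B\<^sup>2)" by (intro mult_left_mono w2_nonneg)
   then show ?thesis unfolding A_def B_def by (simp only: distrib_left mult.left_commute[of _ 2])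
  qed
  have "N2 \<beta> (tr G) = (\<integral>\<^sup>+l. ennreal (w2 \<beta> l * (cmod (g l))\<^sup>2) \<partial>lborel)"
   unfolding N2_def gd4 ..
  also have "... <= (\<integral>\<^sup>+l. ennreal 2 * ennreal (w2 \<beta> l * (cmod (?h l))\<^sup>2) + ennreal 2 * ennreal (w2 \<beta> l * (cmod (g l - of_real (m l) * ?h l))\<^sup>2) \<partial>lborel)"
   using w2_nonneg by (intro nn_integral_mono order_trans[OF ennreal_leI[OF pt]]) (simp add: ennreal_mult)
  also have "... = ennreal 2 * N2 \<beta> ?h + ennreal 2 * (\<integral>\<^sup>+l. ennreal (w2 \<beta> l * (cmod (g l - of_real (m l) * ?h l))\<^sup>2) \<partial>lborel)"
   unfolding N2_def by (subst nn_integral_add) (simp_all add: nn_integral_cmult)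
  also have "... <= ennreal 2 * ennreal S2 + ennreal 2 * ennreal \<delta>"
   unfolding S(1) by (intro add_left_mono mult_left_mono conjunct2[OF gP]) simp
  also have "... = ennreal (2 * S2 + 2 * \<delta>)" using S(2) \<delta> by (simp add: ennreal_mult)
  finally show ?thesis .
 qed
 ultimately show ?thesis using G LG by blast
qed

text \<open>Every Taylor term is a maximal function for \<open>\<psi>1\<close> whose datum has Sobolev norm at most \<open>2 S\<close>, where \<open>S\<close> is that of \<open>f\<close>. The errors of approximation, of the Taylor remainder and of the low frequencies are constants of size \<open>O(S)\<close>. The order \<open>K\<close> depends on \<open>f\<close>, the final constant does not.\<close>

lemma local_transfer:
 assumes \<psi>1: "continuous_on {0..} \<psi>1" and \<psi>2: "continuous_on {0..} \<psi>2"
  and \<Lambda>: "\<Lambda> > 0" and C: "C > 0" and cmp: "!!l. l > \<Lambda> ==> \<bar>\<psi>2 l - \<psi>1 l\<bar> <= C"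
  and p: "p >= 1" and \<beta>: "\<beta> >= 0" and C1: "C1 > 0"
  and bd: "!!f. f \<in> schwartz2 br ==> Lp_norm p (restrict_space (DR_measure br) (DR_ball br R)) (maximal_function br \<psi>1 f)
    <= ennreal C1 * sobolev_norm br \<beta> f"
 shows "\<exists>C2>0. \<forall>f\<in>schwartz2 br. Lp_norm p (restrict_space (DR_measure br) (DR_ball br R)) (maximal_function br \<psi>2 f)
    <= ennreal C2 * sobolev_norm br \<beta> f"
proof -
 define M where "M = restrict_space (DR_measure br) (DR_ball br R)"
 have spM: "space M = DR_ball br R" by (simp add: M_def space_restrict_space)
 have inDR: "x \<in> DR" if "x \<in> space M" for x using that by (simp add: spM DR_ball_def)
 have finM: "emeasure M (space M) < \<infinity>"
  using DR_ball_finite[of R] unfolding spM M_def by (simp add: emeasure_restrict_space)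
 have MMm: "(%x. MM \<psi> h (vv x)) \<in> borel_measurable M" if "continuous_on {0..} \<psi>" "L1 h" for \<psi> h
  unfolding M_def
 proof (rule measurable_restrict_space1)
  note [measurable] = MM_measurable[OF that]
  have "(%x. MM \<psi> h (vv x)) \<in> borel_measurable borel" by measurable
  then show "(%x. MM \<psi> h (vv x)) \<in> borel_measurable (DR_measure br)" by simp
 qed
 have max_eq: "Lp_norm p M (maximal_function br \<psi> f) = Lp_norm p M (%x. ennreal (MM \<psi> (tr F) (vv x)))"
  if "continuous_on {0..} \<psi>" "rapid F" "!!x. x \<in> DR ==> f x = F (vv x)" "L1 (tr F)" for \<psi> f F
  by (rule Lp_norm_cong) (rule maximal_function_eq[OF rapid_continuous[OF that(2)] that(3) inDR that(1) that(4)])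
 obtain c where c0: "c >= 0" and c: "!!h S. h \<in> borel_measurable borel ==> S > 0 ==> N2 \<beta> h = ennreal (S\<^sup>2) ==>
   (LINT l|lborel. indicator {0..\<Lambda>} l * (dd l * cmod (h l))) <= c * S"
  using low_frequency_bound[OF \<beta> \<Lambda>] by meson
 define B where "B = max 1 (measure M (space M))"
 have B: "B >= 1" by (simp add: B_def)
 define c1 where "c1 = exp C + 1 + 2 * c"
 have c1: "c1 > 0" using c0 exp_gt_zero[of C] by (simp add: c1_def add_pos_nonneg)
 define C2 where "C2 = (exp C + 1) * (2 * C1 + c1 * B)"
 have C2: "C2 > 0" unfolding C2_def using C1 c1 B by (intro mult_pos_pos add_pos_pos) auto
 \<comment> \<open>Clamping leaves the difference unchanged beyond \<open>\<Lambda>\<close> and bounds it everywhere.\<close>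
 define \<Delta> where "\<Delta> l = max (- C) (min C (\<psi>2 (max 0 l) - \<psi>1 (max 0 l)))" for l
 have cmax: "continuous_on UNIV (%l. \<psi> (max 0 l))" if "continuous_on {0..} \<psi>" for \<psi> :: "real => real"
  by (rule phase_continuous[OF that])
 have \<Delta>c: "continuous_on UNIV \<Delta>"
  unfolding \<Delta>_def[abs_def]
  by (intro continuous_on_max continuous_on_min continuous_on_const continuous_on_diff cmax \<psi>1 \<psi>2)
 have \<Delta>C: "\<bar>\<Delta> l\<bar> <= C" for l unfolding \<Delta>_def using C by linarith
 have \<Delta>e: "\<Delta> l = \<psi>2 l - \<psi>1 l" if "l > \<Lambda>" for l
  using cmp[OF that] that \<Lambda> unfolding \<Delta>_def by (simp add: max_absorb2)
 have \<Delta>m: "\<Delta> \<in> borel_measurable borel" by (rule borel_measurable_continuous_onI[OF \<Delta>c])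
 have "Lp_norm p M (maximal_function br \<psi>2 f) <= ennreal C2 * sobolev_norm br \<beta> f" if f: "f \<in> schwartz2 br" for f
 proof (rule schwartz2_rapid[OF f])
  fix F assume F: "rapid F" and fF: "!!x. x \<in> DR ==> f x = F (vv x)"
  let ?h = "tr F"
  have sob: "sobolev_norm br \<beta> f = ennreal_powr (N2 \<beta> ?h) (1 / 2)"
   by (rule sobolev_norm_eq[OF rapid_continuous[OF F] fF])
  show ?thesis
  proof (cases "N2 \<beta> ?h = \<infinity>")
   case True
   then have "ennreal C2 * sobolev_norm br \<beta> f = \<infinity>" unfolding sob using C2 by (simp add: ennreal_powr_def ennreal_mult_top)
   then show ?thesis by simp
  next
   case fin: False
   have h: "L1 ?h" by (rule L1_tr[OF F \<beta> fin])
   have hm: "?h \<in> borel_measurable borel" by (rule tr_measurable[OF F])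
   obtain S2 where S2: "N2 \<beta> ?h = ennreal S2" "S2 >= 0" using fin by (cases "N2 \<beta> ?h") auto
   define S where "S = sqrt S2"
   have S0: "S >= 0" and SS: "S\<^sup>2 = S2" using S2(2) by (simp_all add: S_def)
   have sobS: "sobolev_norm br \<beta> f = ennreal S"
    unfolding sob S2(1) S_def using S2(2) by (simp add: ennreal_powr_ennreal powr_half_sqrt)
   have mx: "Lp_norm p M (maximal_function br \<psi>2 f) = Lp_norm p M (%x. ennreal (MM \<psi>2 ?h (vv x)))"
    by (rule max_eq[OF \<psi>2 F fF h])
   have "Lp_norm p M (%x. ennreal (MM \<psi>2 ?h (vv x))) <= ennreal (C2 * S)"
   proof (cases "S = 0")
    case True
    then have "N2 \<beta> ?h = 0" using S2 SS by simp
    then have "AE l in lborel. ennreal (w2 \<beta> l * (cmod (?h l))\<^sup>2) = 0"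
     unfolding N2_def using hm by (subst (asm) nn_integral_0_iff_AE) (measurable, simp)
    then have "AE l in lborel. dd l * cmod (?h l) = 0"
    proof eventually_elim
     case (elim l)
     then have "w2 \<beta> l * (cmod (?h l))\<^sup>2 <= 0" by (simp only: ennreal_eq_0_iff)
     moreover have "0 <= w2 \<beta> l * (cmod (?h l))\<^sup>2" by (intro mult_nonneg_nonneg w2_nonneg) simp
     ultimately have "w2 \<beta> l * (cmod (?h l))\<^sup>2 = 0" by (rule antisym)
     then show ?case using mu_pos[of l] by (auto simp: w2_def)
    qed
    then have "n1 ?h = 0" unfolding n1_def by (rule integral_eq_zero_AE)
    then have "MM \<psi>2 ?h v = 0" for v
     using MM_nonneg[OF \<psi>2 h, of v] MM_least[of \<psi>2 ?h v 0] dp_bound[OF \<psi>2 h] by (metis antisym)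
    then show ?thesis using Lp_norm_const[OF p finM, of 0] by simp
   next
    case False
    then have S: "S > 0" using S0 by simp
    have S2p: "S2 > 0" using S SS[symmetric] by simp
    have cl: "(LINT l|lborel. indicator {0..\<Lambda>} l * (dd l * cmod (?h l))) <= c * S"
     by (rule c[OF hm S]) (simp add: S2(1) SS)
    have "(%n. C ^ n / fact n) \<longlonglongrightarrow> 0"
     using summable_LIMSEQ_zero[OF summable_exp[of C]] by (simp add: divide_inverse mult.commute)
    then have "(%n. C ^ Suc n / fact (Suc n) * n1 ?h) \<longlonglongrightarrow> 0 * n1 ?h"
     by (intro tendsto_mult_right LIMSEQ_Suc)
    then have "\<forall>\<^sub>F n in sequentially. C ^ Suc n / fact (Suc n) * n1 ?h < S"
     by (rule order_tendstoD(2)) (simp add: S)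
    then obtain K where K: "C ^ Suc K / fact (Suc K) * n1 ?h < S"
     using eventually_happens'[OF sequentially_bot] by blast
    \<comment> \<open>With \<open>\<delta> <= S2\<close> the Sobolev norms of the approximants are at most \<open>2 S\<close>; with \<open>\<delta> <= S\<close> the error is of size \<open>S\<close>.\<close>
    define \<delta> where "\<delta> = min S S2"
    have \<delta>: "\<delta> > 0" "\<delta> <= S" "\<delta> <= S2" using S S2p by (auto simp: \<delta>_def)
    let ?good = "%k G. rapid G \<and> L1 (tr G) \<and> n1 (%l. tr G l - of_real ((\<Delta> l / C) ^ k) * ?h l) <= \<delta> \<and> N2 \<beta> (tr G) <= ennreal (2 * S2 + 2 * \<delta>)"
    have "\<exists>G. ?good k G" for k
    proof (rule rapid_multiplier[OF F h S2 _ _ \<delta>(1)])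
     show "continuous_on UNIV (%l. (\<Delta> l / C) ^ k)" using C by (intro continuous_intros \<Delta>c) auto
     show "\<bar>(\<Delta> l / C) ^ k\<bar> <= 1" for l
      unfolding power_abs using \<Delta>C[of l] C by (intro power_le_one) auto
    qed
    then have "\<exists>G. \<forall>k. ?good k (G k)"
     by (intro choice allI)
    then obtain G where "\<forall>k. ?good k (G k)" ..
    then have G: "rapid (G k)" "L1 (tr (G k))" "n1 (%l. tr (G k) l - of_real ((\<Delta> l / C) ^ k) * ?h l) <= \<delta>"
     "N2 \<beta> (tr (G k)) <= ennreal (2 * S2 + 2 * \<delta>)" for k by simp_all
    define cS' where "cS' = c1 * S"
    have Lm: "L1 (%l. of_real ((\<Delta> l / C) ^ k) * ?h l)" for k
    proof (rule L1_mult[OF h, of _ 1])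
     show "(%l. (\<Delta> l / C) ^ k) \<in> borel_measurable borel" using \<Delta>m by measurable
     show "\<bar>(\<Delta> l / C) ^ k\<bar> <= 1" for l
      unfolding power_abs using \<Delta>C[of l] C by (intro power_le_one) auto
    qed
    have pt: "MM \<psi>2 ?h v <= (\<Sum>k\<le>K. C ^ k / fact k * MM \<psi>1 (tr (G k)) v) + cS'" for v
    proof (rule MM_least)
     fix t :: real assume t: "t \<in> {0<..<1}"
     have "cmod (dp \<psi>2 ?h t v) <= (\<Sum>k\<le>K. C ^ k / fact k * cmod (dp \<psi>1 (%l. of_real ((\<Delta> l / C) ^ k) * ?h l) t v))
       + C ^ Suc K / fact (Suc K) * n1 ?h + 2 * (LINT l|lborel. indicator {0..\<Lambda>} l * (dd l * cmod (?h l)))"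
      by (rule phase_taylor[OF \<psi>1 \<psi>2 h C \<Delta>e \<Delta>C \<Delta>m t])
     moreover have "(\<Sum>k\<le>K. C ^ k / fact k * cmod (dp \<psi>1 (%l. of_real ((\<Delta> l / C) ^ k) * ?h l) t v))
       <= (\<Sum>k\<le>K. C ^ k / fact k * (MM \<psi>1 (tr (G k)) v + \<delta>))"
     proof (rule sum_mono, rule mult_left_mono)
      fix k
      show "cmod (dp \<psi>1 (%l. of_real ((\<Delta> l / C) ^ k) * ?h l) t v) <= MM \<psi>1 (tr (G k)) v + \<delta>"
       using MM_diff[OF \<psi>1 Lm[of k] G(2)[of k] t, of v] G(3)[of k] by linarith
      show "0 <= C ^ k / fact k" using C by simp
     qed
     moreover have "(\<Sum>k\<le>K. C ^ k / fact k * (MM \<psi>1 (tr (G k)) v + \<delta>))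
       = (\<Sum>k\<le>K. C ^ k / fact k * MM \<psi>1 (tr (G k)) v) + (\<Sum>k\<le>K. C ^ k / fact k) * \<delta>"
      by (simp only: distrib_left sum.distrib sum_distrib_right)
     moreover have "(\<Sum>k\<le>K. C ^ k / fact k) * \<delta> <= exp C * S"
      using exp_partial_sum_le[of C K] C \<delta> by (intro mult_mono) auto
     moreover have "cS' = exp C * S + S + 2 * (c * S)" by (simp add: cS'_def c1_def algebra_simps)
     ultimately show "cmod (dp \<psi>2 ?h t v) <= (\<Sum>k\<le>K. C ^ k / fact k * MM \<psi>1 (tr (G k)) v) + cS'"
      using K cl by linarith
    qed
    define w where "w k = (if k <= K then C ^ k / fact k else 1)" for k
    \<comment> \<open>The index \<open>Suc K\<close> carries the constant error term.\<close>
    define fi where "fi k x = (if k <= K then MM \<psi>1 (tr (G k)) (vv x) else cS')" for k x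
    have cS0: "cS' >= 0" using c1 S by (simp add: cS'_def)
    have sw: "sum w {..Suc K} = (\<Sum>k\<le>K. C ^ k / fact k) + 1" by (simp add: w_def)
    have sw': "(\<Sum>k\<le>K. C ^ k / fact k) >= 0" using C by (intro sum_nonneg) auto
    define b where "b = 2 * C1 * S + cS' * B"
    have b0: "0 <= 2 * C1 * S" "0 <= cS' * B" using C1 S cS0 B by auto
    have "Lp_norm p M (%x. ennreal (MM \<psi>2 ?h (vv x))) <= ennreal (sum w {..Suc K} * b)"
    proof (rule Lp_norm_combination[OF p, where f = fi])
     show "finite {..Suc K}" by simp
     show "0 <= w i" for i using C by (simp add: w_def)
     show "0 < sum w {..Suc K}" unfolding sw using sw' by linarith
     show "fi i \<in> borel_measurable M" for i
      unfolding fi_def[abs_def] using MMm[OF \<psi>1 G(2)[of i]] by (cases "i <= K") auto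
     show "0 <= fi i x" for i x unfolding fi_def using MM_nonneg[OF \<psi>1 G(2)[of i]] cS0 by simp
     show "(%x. MM \<psi>2 ?h (vv x)) \<in> borel_measurable M" by (rule MMm[OF \<psi>2 h])
     show "0 <= MM \<psi>2 ?h (vv x)" for x by (rule MM_nonneg[OF \<psi>2 h])
     show "MM \<psi>2 ?h (vv x) <= (\<Sum>i\<le>Suc K. w i * fi i x)" for x
     proof -
      have "(\<Sum>i\<le>Suc K. w i * fi i x) = (\<Sum>k\<le>K. C ^ k / fact k * MM \<psi>1 (tr (G k)) (vv x)) + cS'"
       by (simp add: w_def fi_def)
      then show ?thesis using pt[of "vv x"] by simp
     qed
     show "0 <= b" unfolding b_def using b0 by linarith
     show "Lp_norm p M (%x. ennreal (fi i x)) <= ennreal b" for i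
     proof (cases "i <= K")
      case True
      have N: "N2 \<beta> (tr (G i)) <= ennreal (4 * S2)"
       using \<delta>(3) by (intro order_trans[OF G(4)] ennreal_leI) simp
      then obtain j where j: "N2 \<beta> (tr (G i)) = ennreal j" "j >= 0" by (cases "N2 \<beta> (tr (G i))") (auto simp: top_unique)
      have "j <= (2 * S)\<^sup>2" using N j S2(2) by (simp add: power_mult_distrib SS)
      then have "sqrt j <= 2 * S" using S0 by (intro real_le_lsqrt) auto
      have "sobolev_norm br \<beta> (%x. G i (vv x)) = ennreal (sqrt j)"
       using sobolev_norm_eq[OF rapid_continuous[OF G(1)[of i]], of "%x. G i (vv x)" \<beta>] j
       by (simp add: ennreal_powr_ennreal powr_half_sqrt)
      then have "Lp_norm p M (maximal_function br \<psi>1 (%x. G i (vv x))) <= ennreal C1 * ennreal (sqrt j)"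
       using bd[OF rapid_schwartz2[OF G(1)[of i]]] by (simp only: M_def)
      also have "... = ennreal (C1 * sqrt j)" using C1 j by (simp add: ennreal_mult)
      also have "... <= ennreal b"
      proof (rule ennreal_leI)
       have "C1 * sqrt j <= C1 * (2 * S)" using C1 \<open>sqrt j <= 2 * S\<close> by (intro mult_left_mono) auto
       then show "C1 * sqrt j <= b" unfolding b_def using b0 by (simp add: mult_ac)
      qed
      finally have "Lp_norm p M (maximal_function br \<psi>1 (%x. G i (vv x))) <= ennreal b" .
      moreover have "Lp_norm p M (maximal_function br \<psi>1 (%x. G i (vv x))) = Lp_norm p M (%x. ennreal (MM \<psi>1 (tr (G i)) (vv x)))"
       by (rule max_eq[OF \<psi>1 G(1) _ G(2)]) simp
      ultimately show ?thesis using True by (simp add: fi_def)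
     next
      case False
      have "Lp_norm p M (%x. ennreal cS') <= ennreal (cS' * B)" unfolding B_def by (rule Lp_norm_const[OF p finM cS0])
      also have "... <= ennreal b" unfolding b_def using b0 by (intro ennreal_leI) linarith
      finally show ?thesis using False by (simp add: fi_def)
     qed
    qed
    also have "... <= ennreal (C2 * S)"
    proof (rule ennreal_leI)
     have "b = (2 * C1 + c1 * B) * S" by (simp add: b_def cS'_def algebra_simps)
     moreover have "sum w {..Suc K} * b <= (exp C + 1) * b"
      unfolding sw using exp_partial_sum_le[of C K] C b0 by (intro mult_right_mono) (auto simp: b_def)
     ultimately show "sum w {..Suc K} * b <= C2 * S" by (simp add: C2_def mult.assoc)
    qed
    finally show ?thesis .
   qed
   also have "ennreal (C2 * S) = ennreal C2 * sobolev_norm br \<beta> f"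
    unfolding sobS using C2 S0 by (simp add: ennreal_mult)
   finally show ?thesis unfolding mx .
  qed
 qed
 then show ?thesis using C2 unfolding M_def by blast
qed

end

theorem theorem1p6:
  fixes br :: "'n::euclidean_space \<Rightarrow> 'n \<Rightarrow> 'n"
    and \<psi>1 \<psi>2 :: "real \<Rightarrow> real"
  assumes "H_type br"
    and "phase_function \<psi>1"
    and "phase_function \<psi>2"
    and "comparable_oscillation \<psi>1 \<psi>2"
  shows "locally_transferrable br \<psi>1 \<psi>2"
proof -
 interpret htype br by (rule htype.intro) (rule assms(1))
 have \<psi>: "continuous_on {0..} \<psi>1" "continuous_on {0..} \<psi>2"
  using assms(2,3) by (simp_all add: phase_function_def)
 obtain \<Lambda> C where C: "\<Lambda> > 0" "C > 0" "!!l. l > \<Lambda> ==> \<bar>\<psi>1 l - \<psi>2 l\<bar> <= C"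
  using assms(4) unfolding comparable_oscillation_def by blast
 then have C': "\<bar>\<psi>2 l - \<psi>1 l\<bar> <= C" if "l > \<Lambda>" for l using that by (simp add: abs_minus_commute)
 have transfer: "local_maximal_bound br \<phi>2 \<beta>\<^sub>0 p"
  if "continuous_on {0..} \<phi>1" "continuous_on {0..} \<phi>2" "!!l. l > \<Lambda> ==> \<bar>\<phi>2 l - \<phi>1 l\<bar> <= C"
   "\<beta>\<^sub>0 > 0" "p >= 1" and b: "local_maximal_bound br \<phi>1 \<beta>\<^sub>0 p" for \<phi>1 \<phi>2 \<beta>\<^sub>0 p
  unfolding local_maximal_bound_def
 proof (intro allI impI)
  fix R \<beta> :: real assume R: "R > 0" and \<beta>: "\<beta> > \<beta>\<^sub>0"
  from b[unfolded local_maximal_bound_def, rule_format, OF R \<beta>] obtain C1 where C1: "C1 > 0"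
   "!!f. f \<in> schwartz2 br ==> Lp_norm p (restrict_space (DR_measure br) (DR_ball br R)) (maximal_function br \<phi>1 f)
    <= ennreal C1 * sobolev_norm br \<beta> f" by blast
  have "\<beta> >= 0" using \<beta> that(4) by simp
  show "\<exists>C>0. \<forall>f\<in>schwartz2 br. Lp_norm p (restrict_space (DR_measure br) (DR_ball br R)) (maximal_function br \<phi>2 f)
    <= ennreal C * sobolev_norm br \<beta> f"
   by (rule local_transfer[OF that(1,2) C(1,2) that(3) that(5) \<open>\<beta> >= 0\<close> C1])
 qed
 show ?thesis
  unfolding locally_transferrable_def
 proof (intro allI impI conjI)
  fix \<beta>\<^sub>0 :: real and p :: ennreal assume b: "\<beta>\<^sub>0 > 0" "p >= 1"
  show "local_maximal_bound br \<psi>2 \<beta>\<^sub>0 p" if "local_maximal_bound br \<psi>1 \<beta>\<^sub>0 p"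
   by (rule transfer[OF \<psi>(1,2) C' b that])
  show "local_maximal_bound br \<psi>1 \<beta>\<^sub>0 p" if "local_maximal_bound br \<psi>2 \<beta>\<^sub>0 p"
   by (rule transfer[OF \<psi>(2,1) C(3) b that])
 qed
qed

end
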